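(* Let $M$ be a nonsingular irreducible algebraic variety, let $X$ be a (reduced) hypersurface in $M$, and let $Y$ be its singularity subscheme. Then $X$ satisfies the $\times$-condition if and only if $$\mathrm{Sym}^d_{\mathcal O_X}(\mathcal J_{Y,X})\cong\mathrm{qSym}^d_{\mathcal O_X}(\mathcal J_{Y,X})\quad\text{for } d\gg0$$ (via the canonical epimorphism $\mathrm{Sym}_{\mathcal O_X}(\mathcal J_{Y,X})\to\mathrm{qSym}_{\mathcal O_X}(\mathcal J_{Y,X})$, where the superscript $d$ denotes the degree-$d$ graded piece).
   Context: The base field is algebraically closed of characteristic $0$. $M$ is a nonsingular irreducible variety and $X$ is a hypersurface: the zero-scheme of a nonzero section $F$ of a line bundle $\mathcal L$ on $M$; $X$ is assumed reduced. The section $F$ determines a section $s$ of the bundle $\mathcal P^1_M\mathcal L$ of principal parts of $\mathcal L$; the singularity subscheme $Y$ of $X$ is the zero-scheme of $s$. Locally, with local parameters $x_1,\dots,x_n$ on $M$, the ideal $\mathcal J_{Y,M}$ of $Y$ in $M$ is $\left(F,\frac{\partial F}{\partial x_1},\dots,\frac{\partial F}{\partial x_n}\right)$. Dualizing $s$ gives a surjection $(\mathcal P^1_M\mathcal L)^\vee\to\mathcal J_{Y,M}$. $\mathcal J_{Y,X}$ is the ideal sheaf of $Y$ in $X$, and $\mathrm{Rees}(\mathcal J)=\bigoplus_{d\ge0}\mathcal J^d$. For closed embeddings $Y\subset X\subset N$, $$\mathrm{qSym}_{X\subset N}(\mathcal J_{Y,X}):=\mathrm{Sym}_{\mathcal O_X}(\mathcal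 J_{Y,X})\otimes_{\mathrm{Sym}_{\mathcal O_N}(\mathcal J_{Y,N})}\mathrm{Rees}_{\mathcal O_N}(\mathcal J_{Y,N}).$$ These form an inverse system of quotients of $\mathrm{Sym}_{\mathcal O_X}(\mathcal J_{Y,X})$ (for $X\subset N\subset N'$ there is an induced epimorphism from the $N'$-term to the $N$-term); $\mathrm{qSym}_{\mathcal O_X}(\mathcal J_{Y,X})$ is its inverse limit, which coincides with $\mathrm{qSym}_{X\subset N}(\mathcal J_{Y,X})$ for any nonsingular $N$. A homogeneous, degree $d$ differential operator satisfied by $F$ is a local section of $\mathrm{Sym}^d((\mathcal P^1_M\mathcal L)^\vee)$ mapping to $0$ in $\mathcal J_{Y,M}^d$. In terms of local parameters $x_1,\dots,x_n$ (and a local trivialization of $\mathcal L$), this is a homogeneous polynomial $P(T_0,\dots,T_n)$ of degree $d$ with coefficients local functions on $M$, such that $P\left(F,\frac{\partial F}{\partial x_1},\dots,\frac{\partial F}{\partial x_n}\right)\equiv0$. $X$ satisfies the $\times$-condition if there exists $d_0$ such that every homogeneous differential operator $P$ of degree $d\ge d_0$ satisfied by $F$ can be written (locally) as $P=P_0T_0+P_1T_1+\dots+P_nT_n$, where the $P_i$ are homogeneous polynomials of degree $d-1$ in $T_0,\dots,T_n$ (with coefficients local functions on $M$) and $P_1\frac{\partial F}{\partial x_1}+\dots+P_n\frac{\partial F}{\partial x_n}\in(F)$, i.e. lies in the ideal generated by $F$ in the ring of polynomials in $T_0,\dots,T_n$ over local functions on $M$. *)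

theory Defs
  imports "HOL-Algebra.Algebra" "HOL-Algebra.Algebraic_Closure_Type"
    "HOL-Analysis.Abstract_Topology" "HOL-Library.Multiset"
begin

section \<open>Commutative algebra\<close>

subsection \<open>Polynomials in a set of indeterminates\<close>

text \<open>The ring \<open>R[X_i : i \<in> I]\<close>, on the indexed polynomials of HOL-Algebra (which have no product):
  monomials are multisets of indices, polynomials are coefficient functions.\<close>

definition mpoly_ring ::
  "('r, 'm) ring_scheme \<Rightarrow> 'i set \<Rightarrow> ('i multiset \<Rightarrow> 'r) ring" where
  "mpoly_ring R I =
    \<lparr>carrier = ring.indexed_pset R I (carrier R),
     monoid.mult = (\<lambda>P Q m. \<Oplus>\<^bsub>R\<^esub>a\<in>{a. a \<subseteq># m}. P a \<otimes>\<^bsub>R\<^esub> Q (m - a)),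
     one = ring.indexed_const R \<one>\<^bsub>R\<^esub>,
     ring.zero = ring.indexed_const R \<zero>\<^bsub>R\<^esub>,
     add = ring.indexed_padd R\<rparr>"

definition homogeneous ::
  "('r, 'm) ring_scheme \<Rightarrow> 'i set \<Rightarrow> nat \<Rightarrow> ('i multiset \<Rightarrow> 'r) set" where
  "homogeneous R I d =
    {P \<in> carrier (mpoly_ring R I). \<forall>m. P m \<noteq> \<zero>\<^bsub>R\<^esub> \<longrightarrow> size m = d}"

text \<open>The value in \<open>S\<close> of a polynomial over \<open>R\<close>, where \<open>h\<close> maps the coefficients into \<open>S\<close> and
  \<open>v i\<close> is substituted for the \<open>i\<close>-th indeterminate.\<close>

definition mpoly_eval ::
  "('r, 'm) ring_scheme \<Rightarrow> ('s, 'n) ring_scheme \<Rightarrow> ('r \<Rightarrow> 's) \<Rightarrow> ('i \<Rightarrow> 's) \<Rightarrow>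
    ('i multiset \<Rightarrow> 'r) \<Rightarrow> 's" where
  "mpoly_eval R S h v P =
    (\<Oplus>\<^bsub>S\<^esub>m\<in>{m. P m \<noteq> \<zero>\<^bsub>R\<^esub>}.
      h (P m) \<otimes>\<^bsub>S\<^esub> (\<Otimes>\<^bsub>S\<^esub>i\<in>set_mset m. v i [^]\<^bsub>S\<^esub> count m i))"

subsection \<open>Symmetric algebra and Rees algebra of an ideal\<close>

definition sym_relations ::
  "('r, 'm) ring_scheme \<Rightarrow> 'r set \<Rightarrow> ('r multiset \<Rightarrow> 'r) set" where
  "sym_relations R J = (let P = mpoly_ring R J; x = ring.indexed_var R; c = ring.indexed_const R in
    Idl\<^bsub>P\<^esub> ({x (a \<oplus>\<^bsub>R\<^esub> b) \<ominus>\<^bsub>P\<^esub> (x a \<oplus>\<^bsub>P\<^esub> x b) | a b. a \<in> J \<and> b \<in> J} \<union>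
         {x (r \<otimes>\<^bsub>R\<^esub> a) \<ominus>\<^bsub>P\<^esub> (c r \<otimes>\<^bsub>P\<^esub> x a) | r a. r \<in> carrier R \<and> a \<in> J}))"

definition Sym :: "('r, 'm) ring_scheme \<Rightarrow> 'r set \<Rightarrow> ('r multiset \<Rightarrow> 'r) set ring" where
  "Sym R J = mpoly_ring R J Quot sym_relations R J"

definition Sym_deg ::
  "('r, 'm) ring_scheme \<Rightarrow> 'r set \<Rightarrow> nat \<Rightarrow> ('r multiset \<Rightarrow> 'r) set set" where
  "Sym_deg R J d = {sym_relations R J +>\<^bsub>mpoly_ring R J\<^esub> P | P. P \<in> homogeneous R J d}"

definition Sym_const ::
  "('r, 'm) ring_scheme \<Rightarrow> 'r set \<Rightarrow> 'r \<Rightarrow> ('r multiset \<Rightarrow> 'r) set" where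
  "Sym_const R J r = sym_relations R J +>\<^bsub>mpoly_ring R J\<^esub> ring.indexed_const R r"

definition Sym_gen ::
  "('r, 'm) ring_scheme \<Rightarrow> 'r set \<Rightarrow> 'r \<Rightarrow> ('r multiset \<Rightarrow> 'r) set" where
  "Sym_gen R J a = sym_relations R J +>\<^bsub>mpoly_ring R J\<^esub> ring.indexed_var R a"

text \<open>The ring homomorphism \<open>Sym R J \<rightarrow> S\<close> that is \<open>h\<close> on \<open>R\<close> and \<open>v\<close> on \<open>J\<close>
  (for \<open>h\<close> a ring homomorphism and \<open>v\<close> additive and \<open>h\<close>-semilinear).\<close>

definition Sym_lift ::
  "('r, 'm) ring_scheme \<Rightarrow> 'r set \<Rightarrow> ('s, 'n) ring_scheme \<Rightarrow> ('r \<Rightarrow> 's) \<Rightarrow> ('r \<Rightarrow> 's) \<Rightarrow>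
    ('r multiset \<Rightarrow> 'r) set \<Rightarrow> 's" where
  "Sym_lift R J S h v C = the_elem (mpoly_eval R S h v ` C)"

text \<open>The Rees algebra, as the subring \<open>\<Oplus>\<^sub>d J\<^sup>d t\<^sup>d\<close> of \<open>R[t]\<close>; the powers of \<open>J\<close> are taken in the
  monoid of ideals.\<close>

definition Rees :: "('r, 'm) ring_scheme \<Rightarrow> 'r set \<Rightarrow> ('r, nat \<Rightarrow> 'r) up_ring" where
  "Rees R J = (UP R)\<lparr>carrier := {f \<in> up R. \<forall>d. f d \<in> J [^]\<^bsub>ideals_set R\<^esub> d}\<rparr>"

definition Rees_deg :: "('r, 'm) ring_scheme \<Rightarrow> 'r set \<Rightarrow> nat \<Rightarrow> (nat \<Rightarrow> 'r) set" where
  "Rees_deg R J d = {up_ring.monom (UP R) a d | a. a \<in> J [^]\<^bsub>ideals_set R\<^esub> d}"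

definition Sym_to_Rees ::
  "('r, 'm) ring_scheme \<Rightarrow> 'r set \<Rightarrow> ('r multiset \<Rightarrow> 'r) set \<Rightarrow> (nat \<Rightarrow> 'r)" where
  "Sym_to_Rees R J = Sym_lift R J (Rees R J)
     (\<lambda>r. up_ring.monom (UP R) r 0) (\<lambda>a. up_ring.monom (UP R) a 1)"

subsection \<open>Tensor products of commutative algebras\<close>

text \<open>For ring homomorphisms \<open>f : R \<rightarrow> S\<close> and \<open>g : R \<rightarrow> T\<close>, the ring \<open>S \<otimes>\<^sub>R T\<close> is presented as an
  \<open>S\<close>-algebra: it has a generator \<open>x t = 1 \<otimes> t\<close> for each \<open>t\<close> in \<open>T\<close>, subject to the relations
  making \<open>x\<close> a ring homomorphism (\<open>x 1 = 1\<close> follows from the last family) with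
  \<open>x (g r) = f r\<close> for \<open>r\<close> in \<open>R\<close>.\<close>

definition tensor_relations ::
  "('r, 'm) ring_scheme \<Rightarrow> ('s, 'n) ring_scheme \<Rightarrow> ('t, 'o) ring_scheme \<Rightarrow>
    ('r \<Rightarrow> 's) \<Rightarrow> ('r \<Rightarrow> 't) \<Rightarrow> ('t multiset \<Rightarrow> 's) set" where
  "tensor_relations R S T f g =
    (let P = mpoly_ring S (carrier T); x = ring.indexed_var S; c = ring.indexed_const S in
    Idl\<^bsub>P\<^esub> ({x (t \<oplus>\<^bsub>T\<^esub> u) \<ominus>\<^bsub>P\<^esub> (x t \<oplus>\<^bsub>P\<^esub> x u) | t u. t \<in> carrier T \<and> u \<in> carrier T} \<union>
         {x (t \<otimes>\<^bsub>T\<^esub> u) \<ominus>\<^bsub>P\<^esub> (x t \<otimes>\<^bsub>P\<^esub> x u) | t u. t \<in> carrier T \<and> u \<in> carrier T} \<union>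
         {x (g r) \<ominus>\<^bsub>P\<^esub> c (f r) | r. r \<in> carrier R}))"

definition tensor ::
  "('r, 'm) ring_scheme \<Rightarrow> ('s, 'n) ring_scheme \<Rightarrow> ('t, 'o) ring_scheme \<Rightarrow>
    ('r \<Rightarrow> 's) \<Rightarrow> ('r \<Rightarrow> 't) \<Rightarrow> ('t multiset \<Rightarrow> 's) set ring" where
  "tensor R S T f g = mpoly_ring S (carrier T) Quot tensor_relations R S T f g"

definition pure_tensor ::
  "('r, 'm) ring_scheme \<Rightarrow> ('s, 'n) ring_scheme \<Rightarrow> ('t, 'o) ring_scheme \<Rightarrow>
    ('r \<Rightarrow> 's) \<Rightarrow> ('r \<Rightarrow> 't) \<Rightarrow> 's \<Rightarrow> 't \<Rightarrow> ('t multiset \<Rightarrow> 's) set" where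
  "pure_tensor R S T f g s t =
    (let P = mpoly_ring S (carrier T) in
     tensor_relations R S T f g +>\<^bsub>P\<^esub> (ring.indexed_const S s \<otimes>\<^bsub>P\<^esub> ring.indexed_var S t))"

subsection \<open>Algebras over a field, derivations, local rings\<close>

text \<open>A \<open>'k\<close>-algebra is a commutative ring \<open>A\<close> with a structure map \<open>\<iota>\<close> from the field \<open>'k\<close>.\<close>

definition base_field :: "'k::field ring" where
  "base_field = ring_of_type_algebra"

definition k_algebra :: "'r ring \<Rightarrow> ('k::field \<Rightarrow> 'r) \<Rightarrow> bool" where
  "k_algebra A \<iota> \<longleftrightarrow> cring A \<and> \<iota> \<in> ring_hom base_field A"

definition k_derivation :: "'r ring \<Rightarrow> ('k::field \<Rightarrow> 'r) \<Rightarrow> ('r \<Rightarrow> 'r) \<Rightarrow> bool" where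
  "k_derivation A \<iota> D \<longleftrightarrow> D \<in> carrier A \<rightarrow> carrier A \<and>
     (\<forall>a\<in>carrier A. \<forall>b\<in>carrier A. D (a \<oplus>\<^bsub>A\<^esub> b) = D a \<oplus>\<^bsub>A\<^esub> D b) \<and>
     (\<forall>a\<in>carrier A. \<forall>b\<in>carrier A. D (a \<otimes>\<^bsub>A\<^esub> b) = (a \<otimes>\<^bsub>A\<^esub> D b) \<oplus>\<^bsub>A\<^esub> (b \<otimes>\<^bsub>A\<^esub> D a)) \<and>
     (\<forall>c. D (\<iota> c) = \<zero>\<^bsub>A\<^esub>)"

definition alg_independent :: "'r ring \<Rightarrow> ('k::field \<Rightarrow> 'r) \<Rightarrow> nat \<Rightarrow> (nat \<Rightarrow> 'r) \<Rightarrow> bool" where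
  "alg_independent A \<iota> n a \<longleftrightarrow> a \<in> {..<n} \<rightarrow> carrier A \<and>
     (\<forall>P \<in> carrier (mpoly_ring (base_field :: 'k ring) {..<n}).
        mpoly_eval base_field A \<iota> a P = \<zero>\<^bsub>A\<^esub> \<longrightarrow> P = (\<lambda>_. 0))"

text \<open>For a domain this is the transcendence degree of its fraction field.\<close>

definition has_trdeg :: "'r ring \<Rightarrow> ('k::field \<Rightarrow> 'r) \<Rightarrow> nat \<Rightarrow> bool" where
  "has_trdeg A \<iota> n \<longleftrightarrow>
     (\<exists>a. alg_independent A \<iota> n a) \<and> \<not> (\<exists>a. alg_independent A \<iota> (Suc n) a)"

definition is_local_ring :: "'r ring \<Rightarrow> bool" where
  "is_local_ring A \<longleftrightarrow> cring A \<and> (\<exists>!\<mm>. maximalideal \<mm> A)"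

text \<open>Essentially of finite type: a localization of a finitely generated algebra.\<close>

definition ess_finite_type :: "'r ring \<Rightarrow> ('k::field \<Rightarrow> 'r) \<Rightarrow> bool" where
  "ess_finite_type A \<iota> \<longleftrightarrow> (\<exists>S \<subseteq> carrier A. finite S \<and>
     (\<forall>a \<in> carrier A. \<exists>u \<in> generate_ring A (range \<iota> \<union> S). \<exists>v \<in> generate_ring A (range \<iota> \<union> S).
        v \<in> Units A \<and> a \<otimes>\<^bsub>A\<^esub> v = u))"

section \<open>Quasi-symmetric algebras\<close>

text \<open>This section is local: \<open>B\<close> (with structure map \<open>\<kappa>\<close>) is the local ring of \<open>X\<close> at a point and
  \<open>J\<close> is the ideal of \<open>Y\<close> in it. A germ of a closed embedding of \<open>X\<close> into a scheme \<open>N\<close> of finite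
  type is a surjection \<open>\<pi> : A \<rightarrow> B\<close> from a local algebra essentially of finite type; the ideal of
  \<open>Y\<close> in \<open>N\<close> is then the preimage of \<open>J\<close>. An embedding is encoded as the triple \<open>(A, \<iota>, \<pi>)\<close>.
  The inverse system is constant above any nonsingular \<open>N\<close>, so its limit over germs is the stalk of
  the limit of sheaves.\<close>

type_synonym ('k, 'r, 'b) embedding = "'r ring \<times> ('k \<Rightarrow> 'r) \<times> ('r \<Rightarrow> 'b)"

definition embeddings :: "'b ring \<Rightarrow> ('k::field \<Rightarrow> 'b) \<Rightarrow> ('k, 'r, 'b) embedding set" where
  "embeddings B \<kappa> = {(A, \<iota>, \<pi>). k_algebra A \<iota> \<and> is_local_ring A \<and> ess_finite_type A \<iota> \<and>
     \<pi> \<in> ring_hom A B \<and> \<pi> ` carrier A = carrier B \<and> (\<forall>c. \<pi> (\<iota> c) = \<kappa> c)}"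

text \<open>The closed embeddings \<open>N \<subseteq> N'\<close> compatible with \<open>X\<close>, as surjections of local rings.\<close>

definition embedding_maps ::
  "('k, 'r, 'b) embedding \<Rightarrow> ('k, 'r, 'b) embedding \<Rightarrow> ('r \<Rightarrow> 'r) set" where
  "embedding_maps N N' = (case (N, N') of ((A, \<iota>, \<pi>), (A', \<iota>', \<pi>')) \<Rightarrow>
     {\<rho> \<in> ring_hom A' A. \<rho> ` carrier A' = carrier A \<and> (\<forall>c. \<rho> (\<iota>' c) = \<iota> c) \<and>
        (\<forall>a \<in> carrier A'. \<pi> (\<rho> a) = \<pi>' a)})"

definition ideal_in :: "'b set \<Rightarrow> ('k, 'r, 'b) embedding \<Rightarrow> 'r set" where
  "ideal_in J N = (case N of (A, \<iota>, \<pi>) \<Rightarrow> {a \<in> carrier A. \<pi> a \<in> J})"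

type_synonym ('r, 'b) qsym_elem = "((nat \<Rightarrow> 'r) multiset \<Rightarrow> ('b multiset \<Rightarrow> 'b) set) set"

definition qSym_in ::
  "'b ring \<Rightarrow> 'b set \<Rightarrow> ('k, 'r, 'b) embedding \<Rightarrow> ('r, 'b) qsym_elem ring" where
  "qSym_in B J N = (case N of (A, \<iota>, \<pi>) \<Rightarrow>
     tensor (Sym A (ideal_in J N)) (Sym B J) (Rees A (ideal_in J N))
       (Sym_lift A (ideal_in J N) (Sym B J) (\<lambda>r. Sym_const B J (\<pi> r)) (\<lambda>a. Sym_gen B J (\<pi> a)))
       (Sym_to_Rees A (ideal_in J N)))"

definition qSym_in_tensor ::
  "'b ring \<Rightarrow> 'b set \<Rightarrow> ('k, 'r, 'b) embedding \<Rightarrow>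
    ('b multiset \<Rightarrow> 'b) set \<Rightarrow> (nat \<Rightarrow> 'r) \<Rightarrow> ('r, 'b) qsym_elem" where
  "qSym_in_tensor B J N = (case N of (A, \<iota>, \<pi>) \<Rightarrow>
     pure_tensor (Sym A (ideal_in J N)) (Sym B J) (Rees A (ideal_in J N))
       (Sym_lift A (ideal_in J N) (Sym B J) (\<lambda>r. Sym_const B J (\<pi> r)) (\<lambda>a. Sym_gen B J (\<pi> a)))
       (Sym_to_Rees A (ideal_in J N)))"

definition qSym_in_deg ::
  "'b ring \<Rightarrow> 'b set \<Rightarrow> ('k, 'r, 'b) embedding \<Rightarrow> nat \<Rightarrow> ('r, 'b) qsym_elem set" where
  "qSym_in_deg B J N d = generate (add_monoid (qSym_in B J N))
     {qSym_in_tensor B J N s t | s t e e'. e + e' = d \<and> s \<in> Sym_deg B J e \<and>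
        t \<in> Rees_deg (fst N) (ideal_in J N) e'}"

text \<open>The map from the \<open>N'\<close>-term to the \<open>N\<close>-term induced by \<open>\<rho>\<close>, sending \<open>s \<otimes> t\<close> to
  \<open>s \<otimes> \<rho>(t)\<close>.\<close>

definition qSym_transition ::
  "'b ring \<Rightarrow> 'b set \<Rightarrow> ('k, 'r, 'b) embedding \<Rightarrow> ('r \<Rightarrow> 'r) \<Rightarrow>
    ('r, 'b) qsym_elem \<Rightarrow> ('r, 'b) qsym_elem" where
  "qSym_transition B J N \<rho> C = the_elem
     (mpoly_eval (Sym B J) (qSym_in B J N)
        (\<lambda>s. qSym_in_tensor B J N s \<one>\<^bsub>Rees (fst N) (ideal_in J N)\<^esub>)
        (\<lambda>t. qSym_in_tensor B J N \<one>\<^bsub>Sym B J\<^esub> (\<rho> \<circ> t)) ` C)"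

text \<open>The inverse limit, taken in each degree; its elements are the compatible families.\<close>

definition qSym_deg ::
  "'b ring \<Rightarrow> ('k::field \<Rightarrow> 'b) \<Rightarrow> 'b set \<Rightarrow> nat \<Rightarrow>
    (('k, 'r, 'b) embedding \<Rightarrow> ('r, 'b) qsym_elem) set" where
  "qSym_deg B \<kappa> J d = {x \<in> (\<Pi>\<^sub>E N\<in>embeddings B \<kappa>. qSym_in_deg B J N d).
     \<forall>N\<in>embeddings B \<kappa>. \<forall>N'\<in>embeddings B \<kappa>. \<forall>\<rho>\<in>embedding_maps N N'.
       qSym_transition B J N \<rho> (x N') = x N}"

definition Sym_to_qSym ::
  "'b ring \<Rightarrow> ('k::field \<Rightarrow> 'b) \<Rightarrow> 'b set \<Rightarrow> ('b multiset \<Rightarrow> 'b) set \<Rightarrow>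
    (('k, 'r, 'b) embedding \<Rightarrow> ('r, 'b) qsym_elem)" where
  "Sym_to_qSym B \<kappa> J s = (\<lambda>N\<in>embeddings B \<kappa>.
     qSym_in_tensor B J N s \<one>\<^bsub>Rees (fst N) (ideal_in J N)\<^esub>)"

section \<open>Varieties\<close>

text \<open>Varieties over the algebraically closed field \<open>'k\<close> are given by their closed points, with the
  Zariski topology and the sheaf of \<open>'k\<close>-valued regular functions. A function on \<open>U\<close> is represented
  by its extensional representative.\<close>

record ('a, 'k) fun_space =
  zariski :: "'a topology"
  regular :: "'a set \<Rightarrow> ('a \<Rightarrow> 'k) set"

abbreviation points :: "('a, 'k) fun_space \<Rightarrow> 'a set" where
  "points M \<equiv> topspace (zariski M)"

inductive_set poly_fun :: "nat \<Rightarrow> ((nat \<Rightarrow> 'k::field) \<Rightarrow> 'k) set" for n where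
  const: "(\<lambda>_. c) \<in> poly_fun n"
| coord: "i < n \<Longrightarrow> (\<lambda>v. v i) \<in> poly_fun n"
| add: "f \<in> poly_fun n \<Longrightarrow> g \<in> poly_fun n \<Longrightarrow> (\<lambda>v. f v + g v) \<in> poly_fun n"
| mult: "f \<in> poly_fun n \<Longrightarrow> g \<in> poly_fun n \<Longrightarrow> (\<lambda>v. f v * g v) \<in> poly_fun n"

definition sheaf_of_functions :: "('a, 'k) fun_space \<Rightarrow> bool" where
  "sheaf_of_functions M \<longleftrightarrow> (\<forall>U. openin (zariski M) U \<longrightarrow>
     regular M U \<subseteq> extensional U \<and>
     (\<forall>f\<in>regular M U. \<forall>V\<subseteq>U. openin (zariski M) V \<longrightarrow> restrict f V \<in> regular M V) \<and>
     (\<forall>f\<in>extensional U.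
        (\<forall>p\<in>U. \<exists>V\<subseteq>U. openin (zariski M) V \<and> p \<in> V \<and> restrict f V \<in> regular M V) \<longrightarrow>
        f \<in> regular M U))"

text \<open>\<open>U\<close> is isomorphic, via \<open>\<phi>\<close>, to an algebraic subset of affine \<open>n\<close>-space with its Zariski
  topology and its regular functions.\<close>

definition affine_open :: "('a, 'k::field) fun_space \<Rightarrow> 'a set \<Rightarrow> bool" where
  "affine_open M U \<longleftrightarrow> openin (zariski M) U \<and> (\<exists>n \<phi>. \<exists>S\<subseteq>poly_fun n.
     bij_betw \<phi> U {v \<in> {..<n} \<rightarrow>\<^sub>E UNIV. \<forall>s\<in>S. s v = 0} \<and>
     (\<forall>W\<subseteq>U. openin (zariski M) W \<longleftrightarrow>
        (\<exists>S'\<subseteq>poly_fun n. W = {q \<in> U. \<exists>s\<in>S'. s (\<phi> q) \<noteq> 0})) \<and>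
     (\<forall>W\<subseteq>U. openin (zariski M) W \<longrightarrow> regular M W = {f \<in> extensional W. \<forall>p\<in>W.
        \<exists>g\<in>poly_fun n. \<exists>h\<in>poly_fun n. \<exists>V\<subseteq>W. openin (zariski M) V \<and> p \<in> V \<and>
          (\<forall>q\<in>V. h (\<phi> q) \<noteq> 0 \<and> f q = g (\<phi> q) / h (\<phi> q))}))"

text \<open>Separatedness: for affine opens \<open>U\<close> and \<open>V\<close>, the diagonal is closed in \<open>U \<times> V\<close>, whose closed
  sets are cut out by functions \<open>\<Sum> a\<^sub>l \<otimes> b\<^sub>l\<close>.\<close>

definition separated :: "('a, 'k::field) fun_space \<Rightarrow> bool" where
  "separated M \<longleftrightarrow> (\<forall>U V. affine_open M U \<longrightarrow> affine_open M V \<longrightarrow>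
     (\<forall>u\<in>U. \<forall>v\<in>V. u \<noteq> v \<longrightarrow>
       (\<exists>(r::nat) a b. (\<forall>l<r. a l \<in> regular M U \<and> b l \<in> regular M V) \<and>
          (\<forall>q\<in>U \<inter> V. (\<Sum>l<r. a l q * b l q) = 0) \<and> (\<Sum>l<r. a l u * b l v) \<noteq> 0)))"

definition variety :: "('a, 'k::field) fun_space \<Rightarrow> bool" where
  "variety M \<longleftrightarrow> sheaf_of_functions M \<and> separated M \<and>
     (\<exists>\<U>. finite \<U> \<and> (\<forall>U\<in>\<U>. affine_open M U) \<and> \<Union>\<U> = points M)"

definition irreducible_space :: "'a topology \<Rightarrow> bool" where
  "irreducible_space T \<longleftrightarrow> topspace T \<noteq> {} \<and>
     (\<forall>U V. openin T U \<longrightarrow> openin T V \<longrightarrow> U \<noteq> {} \<longrightarrow> V \<noteq> {} \<longrightarrow> U \<inter> V \<noteq> {})"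

subsection \<open>Local rings of a variety\<close>

type_synonym ('a, 'k) germ = "('a set \<times> ('a \<Rightarrow> 'k)) set"

definition germ :: "('a, 'k) fun_space \<Rightarrow> 'a \<Rightarrow> 'a set \<Rightarrow> ('a \<Rightarrow> 'k) \<Rightarrow> ('a, 'k) germ" where
  "germ M p U f = {(V, g). openin (zariski M) V \<and> p \<in> V \<and> g \<in> regular M V \<and>
     (\<exists>W. openin (zariski M) W \<and> p \<in> W \<and> W \<subseteq> U \<inter> V \<and> (\<forall>q\<in>W. f q = g q))}"

definition germ_op ::
  "('a, 'k) fun_space \<Rightarrow> 'a \<Rightarrow> ('k \<Rightarrow> 'k \<Rightarrow> 'k) \<Rightarrow> ('a, 'k) germ \<Rightarrow> ('a, 'k) germ \<Rightarrow> ('a, 'k) germ" where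
  "germ_op M p op a b = (\<Union>(U, f)\<in>a. \<Union>(V, g)\<in>b. germ M p (U \<inter> V) (\<lambda>q\<in>U \<inter> V. op (f q) (g q)))"

definition stalk_const :: "('a, 'k) fun_space \<Rightarrow> 'a \<Rightarrow> 'k \<Rightarrow> ('a, 'k) germ" where
  "stalk_const M p c = germ M p (points M) (\<lambda>q\<in>points M. c)"

definition stalk :: "('a, 'k::field) fun_space \<Rightarrow> 'a \<Rightarrow> ('a, 'k) germ ring" where
  "stalk M p =
    \<lparr>carrier = {germ M p U f | U f. openin (zariski M) U \<and> p \<in> U \<and> f \<in> regular M U},
     monoid.mult = germ_op M p (*), one = stalk_const M p 1,
     ring.zero = stalk_const M p 0, add = germ_op M p (+)\<rparr>"

definition stalk_max :: "('a, 'k::field) fun_space \<Rightarrow> 'a \<Rightarrow> ('a, 'k) germ set" where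
  "stalk_max M p =
    {germ M p U f | U f. openin (zariski M) U \<and> p \<in> U \<and> f \<in> regular M U \<and> f p = 0}"

text \<open>\<open>x 1, \<dots>, x n\<close> is a regular system of parameters at \<open>p\<close>. On an irreducible variety the
  dimension of the local ring at a closed point is the transcendence degree.\<close>

definition regular_parameters ::
  "('a, 'k::field) fun_space \<Rightarrow> 'a \<Rightarrow> nat \<Rightarrow> (nat \<Rightarrow> ('a, 'k) germ) \<Rightarrow> bool" where
  "regular_parameters M p n x \<longleftrightarrow> has_trdeg (stalk M p) (stalk_const M p) n \<and>
     x \<in> {1..n} \<rightarrow> carrier (stalk M p) \<and> stalk_max M p = Idl\<^bsub>stalk M p\<^esub> (x ` {1..n})"

definition nonsingular :: "('a, 'k::field) fun_space \<Rightarrow> bool" where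
  "nonsingular M \<longleftrightarrow> (\<forall>p\<in>points M. \<exists>n x. regular_parameters M p n x)"

text \<open>Local parameters \<open>x\<close> together with the partial derivatives \<open>D j = \<partial>/\<partial>x\<^sub>j\<close>. At a point of
  a nonsingular variety these are the unique \<open>'k\<close>-derivations of the local ring with
  \<open>D j (x i) = \<delta>\<^sub>i\<^sub>j\<close>.\<close>

definition local_parameters ::
  "('a, 'k::field) fun_space \<Rightarrow> 'a \<Rightarrow> nat \<Rightarrow> (nat \<Rightarrow> ('a, 'k) germ) \<Rightarrow>
    (nat \<Rightarrow> ('a, 'k) germ \<Rightarrow> ('a, 'k) germ) \<Rightarrow> bool" where
  "local_parameters M p n x D \<longleftrightarrow> regular_parameters M p n x \<and>
     (\<forall>j\<in>{1..n}. k_derivation (stalk M p) (stalk_const M p) (D j) \<and>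
        (\<forall>i\<in>{1..n}. D j (x i) = (if i = j then \<one>\<^bsub>stalk M p\<^esub> else \<zero>\<^bsub>stalk M p\<^esub>)))"

section \<open>Hypersurfaces\<close>

text \<open>A line bundle is given by a trivializing open cover and transition functions; a section is
  given by its components in the trivializations.\<close>

record ('i, 'a, 'k) bundle_data =
  charts :: "'i set"
  chart :: "'i \<Rightarrow> 'a set"
  transition :: "'i \<Rightarrow> 'i \<Rightarrow> 'a \<Rightarrow> 'k"

definition line_bundle :: "('a, 'k::field) fun_space \<Rightarrow> ('i, 'a, 'k) bundle_data \<Rightarrow> bool" where
  "line_bundle M L \<longleftrightarrow>
     (\<forall>i\<in>charts L. openin (zariski M) (chart L i)) \<and> (\<Union>i\<in>charts L. chart L i) = points M \<and>
     (\<forall>i\<in>charts L. \<forall>j\<in>charts L. transition L i j \<in> regular M (chart L i \<inter> chart L j)) \<and>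
     (\<forall>i\<in>charts L. \<forall>q\<in>chart L i. transition L i i q = 1) \<and>
     (\<forall>i\<in>charts L. \<forall>j\<in>charts L. \<forall>l\<in>charts L. \<forall>q\<in>chart L i \<inter> chart L j \<inter> chart L l.
        transition L i j q * transition L j l q = transition L i l q)"

definition bundle_section ::
  "('a, 'k::field) fun_space \<Rightarrow> ('i, 'a, 'k) bundle_data \<Rightarrow> ('i \<Rightarrow> 'a \<Rightarrow> 'k) \<Rightarrow> bool" where
  "bundle_section M L F \<longleftrightarrow> (\<forall>i\<in>charts L. F i \<in> regular M (chart L i)) \<and>
     (\<forall>i\<in>charts L. \<forall>j\<in>charts L. \<forall>q\<in>chart L i \<inter> chart L j. F i q = transition L i j q * F j q)"

definition nonzero_section :: "('i, 'a, 'k::field) bundle_data \<Rightarrow> ('i \<Rightarrow> 'a \<Rightarrow> 'k) \<Rightarrow> bool" where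
  "nonzero_section L F \<longleftrightarrow> (\<exists>i\<in>charts L. \<exists>q\<in>chart L i. F i q \<noteq> 0)"

definition hypersurface_points ::
  "('i, 'a, 'k::field) bundle_data \<Rightarrow> ('i \<Rightarrow> 'a \<Rightarrow> 'k) \<Rightarrow> 'a set" where
  "hypersurface_points L F = {p. \<exists>i\<in>charts L. p \<in> chart L i \<and> F i p = 0}"

text \<open>The stalks at \<open>p\<close> of the ideals of \<open>X\<close> and of \<open>Y\<close> in \<open>M\<close>. The ideals \<open>(F)\<close> and
  \<open>(F, \<partial>F/\<partial>x\<^sub>1, \<dots>, \<partial>F/\<partial>x\<^sub>n)\<close> do not depend on the trivialization and on the local parameters, so
  taking the generators from all choices at once gives the same ideals.\<close>

definition ideal_X ::
  "('a, 'k::field) fun_space \<Rightarrow> ('i, 'a, 'k) bundle_data \<Rightarrow> ('i \<Rightarrow> 'a \<Rightarrow> 'k) \<Rightarrow> 'a \<Rightarrow> ('a, 'k) germ set" where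
  "ideal_X M L F p =
     Idl\<^bsub>stalk M p\<^esub> {germ M p (chart L i) (F i) | i. i \<in> charts L \<and> p \<in> chart L i}"

definition ideal_Y ::
  "('a, 'k::field) fun_space \<Rightarrow> ('i, 'a, 'k) bundle_data \<Rightarrow> ('i \<Rightarrow> 'a \<Rightarrow> 'k) \<Rightarrow> 'a \<Rightarrow> ('a, 'k) germ set" where
  "ideal_Y M L F p = Idl\<^bsub>stalk M p\<^esub>
     ({germ M p (chart L i) (F i) | i. i \<in> charts L \<and> p \<in> chart L i} \<union>
      {D j (germ M p (chart L i) (F i)) | i n x D j. i \<in> charts L \<and> p \<in> chart L i \<and>
         local_parameters M p n x D \<and> j \<in> {1..n}})"

definition reduced_hypersurface ::
  "('a, 'k::field) fun_space \<Rightarrow> ('i, 'a, 'k) bundle_data \<Rightarrow> ('i \<Rightarrow> 'a \<Rightarrow> 'k) \<Rightarrow> bool" where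
  "reduced_hypersurface M L F \<longleftrightarrow> (\<forall>p\<in>points M. \<forall>a\<in>carrier (stalk M p). \<forall>m::nat.
     a [^]\<^bsub>stalk M p\<^esub> m \<in> ideal_X M L F p \<longrightarrow> a \<in> ideal_X M L F p)"

text \<open>The local ring of \<open>X\<close> at \<open>p\<close>, its \<open>'k\<close>-algebra structure, and the stalk of the ideal of \<open>Y\<close>
  in \<open>X\<close>.\<close>

definition stalk_X ::
  "('a, 'k::field) fun_space \<Rightarrow> ('i, 'a, 'k) bundle_data \<Rightarrow> ('i \<Rightarrow> 'a \<Rightarrow> 'k) \<Rightarrow> 'a \<Rightarrow>
    ('a, 'k) germ set ring" where
  "stalk_X M L F p = stalk M p Quot ideal_X M L F p"

definition stalk_X_const ::
  "('a, 'k::field) fun_space \<Rightarrow> ('i, 'a, 'k) bundle_data \<Rightarrow> ('i \<Rightarrow> 'a \<Rightarrow> 'k) \<Rightarrow> 'a \<Rightarrow> 'k \<Rightarrow>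
    ('a, 'k) germ set" where
  "stalk_X_const M L F p c = ideal_X M L F p +>\<^bsub>stalk M p\<^esub> stalk_const M p c"

definition ideal_YX ::
  "('a, 'k::field) fun_space \<Rightarrow> ('i, 'a, 'k) bundle_data \<Rightarrow> ('i \<Rightarrow> 'a \<Rightarrow> 'k) \<Rightarrow> 'a \<Rightarrow>
    ('a, 'k) germ set set" where
  "ideal_YX M L F p = {ideal_X M L F p +>\<^bsub>stalk M p\<^esub> a | a. a \<in> ideal_Y M L F p}"

text \<open>The canonical map in degree \<open>d\<close> is an isomorphism of sheaves on \<open>X\<close>, tested on stalks. The
  inverse limit ranges over embeddings whose rings have elements of type \<open>('a, 'k) germ\<close>. This is
  no restriction: an algebra essentially of finite type has at most as many elements as \<open>'k\<close>, so
  up to isomorphism all of them occur.\<close>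

definition Sym_iso_qSym ::
  "('a, 'k::field) fun_space \<Rightarrow> ('i, 'a, 'k) bundle_data \<Rightarrow> ('i \<Rightarrow> 'a \<Rightarrow> 'k) \<Rightarrow> nat \<Rightarrow> bool" where
  "Sym_iso_qSym M L F d \<longleftrightarrow> (\<forall>p\<in>hypersurface_points L F.
     let B = stalk_X M L F p; \<kappa> = stalk_X_const M L F p; J = ideal_YX M L F p in
     bij_betw (Sym_to_qSym B \<kappa> J) (Sym_deg B J d)
       (qSym_deg B \<kappa> J d ::
         (('k, ('a, 'k) germ, ('a, 'k) germ set) embedding \<Rightarrow> _) set))"

subsection \<open>The \<open>\<times>\<close>-condition\<close>

text \<open>Differential operators satisfied by \<open>F\<close>, and the decompositions, are local sections, hence
  are taken with coefficients in the local rings of \<open>M\<close>. For \<open>d = 0\<close> the truncated \<open>d - 1\<close> is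
  harmless: the only operator of degree \<open>0\<close> satisfied by \<open>F\<close> is zero.\<close>

definition satisfied_operators ::
  "('a, 'k::field) fun_space \<Rightarrow> 'a \<Rightarrow> nat \<Rightarrow> (nat \<Rightarrow> ('a, 'k) germ \<Rightarrow> ('a, 'k) germ) \<Rightarrow>
    ('a, 'k) germ \<Rightarrow> nat \<Rightarrow> (nat multiset \<Rightarrow> ('a, 'k) germ) set" where
  "satisfied_operators M p n D f d = {P \<in> homogeneous (stalk M p) {0..n} d.
     mpoly_eval (stalk M p) (stalk M p) (\<lambda>a. a) (\<lambda>j. if j = 0 then f else D j f) P = \<zero>\<^bsub>stalk M p\<^esub>}"

definition times_condition ::
  "('a, 'k::field) fun_space \<Rightarrow> ('i, 'a, 'k) bundle_data \<Rightarrow> ('i \<Rightarrow> 'a \<Rightarrow> 'k) \<Rightarrow> bool" where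
  "times_condition M L F \<longleftrightarrow> (\<exists>d0. \<forall>d\<ge>d0. \<forall>p\<in>points M. \<forall>i\<in>charts L. \<forall>n x D.
     p \<in> chart L i \<longrightarrow> local_parameters M p n x D \<longrightarrow>
     (let R = stalk M p; T = mpoly_ring R {0..n}; f = germ M p (chart L i) (F i) in
      \<forall>P \<in> satisfied_operators M p n D f d.
        \<exists>Q. (\<forall>j\<in>{0..n}. Q j \<in> homogeneous R {0..n} (d - 1)) \<and>
            P = (\<Oplus>\<^bsub>T\<^esub>j\<in>{0..n}. Q j \<otimes>\<^bsub>T\<^esub> ring.indexed_var R j) \<and>
            (\<Oplus>\<^bsub>T\<^esub>j\<in>{1..n}. Q j \<otimes>\<^bsub>T\<^esub> ring.indexed_const R (D j f)) \<in>
              Idl\<^bsub>T\<^esub> {ring.indexed_const R f}))"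

end

theory Submission imports Defs begin

text \<open>Fix a point \<open>p\<close> of \<open>X\<close>. Let \<open>A\<close> be the local ring of \<open>M\<close> at \<open>p\<close>, \<open>f\<close> a local equation of \<open>X\<close> and
\<open>B = A/(f)\<close>. Let a further embedding of \<open>X\<close> at \<open>p\<close> be given by a surjection \<open>A' \<rightarrow> B\<close> with kernel \<open>K'\<close>,
and let \<open>I'\<close> be the ideal of \<open>Y\<close> in \<open>A'\<close>.

The proof compares two readings of one expression. A form of degree \<open>d\<close> in elements of \<open>I'\<close>, with
coefficients in \<open>A'\<close>, has a value in \<open>I'\<^sup>d\<close> and a class in \<open>Sym\<^sup>d\<close> of the ideal \<open>J\<close> of \<open>Y\<close> in \<open>B\<close>; the pairs of
value and class form the relation \<open>graph d\<close>. For such a pair \<open>(a, s)\<close> the tensor product satisfies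
\<open>s \<otimes> 1 = 1 \<otimes> a t\<^sup>d\<close>. Hence \<open>Sym\<^sup>d\<close> maps onto each term of the inverse system (\<open>generate_deg\<close>), and mapping the
tensor product to the Rees algebra modulo \<open>\<Oplus> K' I'\<^sup>d\<^sup>-\<^sup>1\<close> shows that \<open>s \<otimes> 1 = 0\<close> if and only if \<open>s\<close> is the
class of a form with value \<open>0\<close> (\<open>tensor_zero_iff\<close>).

For \<open>M\<close> itself the forms come from polynomials in \<open>T\<^sub>0, \<dots>, T\<^sub>n\<close> evaluated at the jet
\<open>F\<^sub>0 = f\<close>, \<open>F\<^sub>j = \<partial>f/\<partial>x\<^sub>j\<close>. The kernel of the map from polynomials to classes consists, in positive degree, of
the decomposable ones. So the \<open>\<times>\<close>-condition in degree \<open>d\<close> at \<open>p\<close> says that \<open>Sym\<^sup>d\<close> injects into the term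
of \<open>M\<close> (\<open>decomposes_iff_graph\<close>). Off \<open>X\<close> it holds since \<open>f\<close> is a unit there.

It remains to compare the term of \<open>M\<close> with the limit. If \<open>Sym\<^sup>d\<close> injects into the term of \<open>M\<close>, then it maps
bijectively to the limit, because each embedding is dominated together with \<open>M\<close> by a third one
(\<open>embeddings_directed\<close>), so that a compatible family is determined by its component at \<open>M\<close>
(\<open>limit_bij\<close>). Conversely, an element that dies at \<open>M\<close> has to die everywhere (\<open>graph_regular_transfer\<close>). Here
the regularity of \<open>M\<close> enters: elements of \<open>A\<close> have Taylor expansions in the parameters, which can be copied
into \<open>A'\<close> to any order, so a form over \<open>A\<close> with value \<open>0\<close> yields a form over \<open>A'\<close> of the same class with value
in an arbitrarily high power of the maximal ideal. Krull's intersection theorem makes the value lie in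
\<open>K' I'\<^sup>d\<^sup>-\<^sup>1\<close>, and then it can be removed.\<close>

section \<open>Polynomial rings in a set of indeterminates\<close>

definition mpoly_term :: "('r, 'm) ring_scheme \<Rightarrow> 'r \<Rightarrow> 'i multiset \<Rightarrow> ('i multiset \<Rightarrow> 'r)" where
  "mpoly_term R c m = (\<lambda>m'. if m' = m then c else \<zero>\<^bsub>R\<^esub>)"

lemma finite_submultisets: "finite {a. a \<subseteq># m}"
proof (induction m)
  case (add x m)
  have "{a. a \<subseteq># add_mset x m} \<subseteq> {a. a \<subseteq># m} \<union> add_mset x ` {a. a \<subseteq># m}"
  proof
    fix a assume "a \<in> {a. a \<subseteq># add_mset x m}"
    then have a: "a \<subseteq># add_mset x m" by simp
    show "a \<in> {a. a \<subseteq># m} \<union> add_mset x ` {a. a \<subseteq># m}"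
    proof (cases "x \<in># a")
      case True
      then have "a = add_mset x (a - {#x#})" "a - {#x#} \<subseteq># m"
        using a by (auto simp: subset_eq_diff_conv)
      then show ?thesis by blast
    next
      case False
      then have "a \<subseteq># m" using a
        by (metis diff_single_trivial add_mset_remove_trivial subset_eq_diff_conv add_mset_add_single)
      then show ?thesis by simp
    qed
  qed
  then show ?case using add finite_subset by blast
qed simp

context ring
begin

lemma finite_support_induct:
  assumes fin: "finite {m. P m \<noteq> \<zero>}" and cl: "\<And>m. P m \<in> carrier R"
    and zero: "\<Phi> (indexed_const \<zero>)"
    and step: "\<And>Q m. \<Phi> Q \<Longrightarrow> P m \<noteq> \<zero> \<Longrightarrow> \<Phi> (indexed_padd Q (mpoly_term R (P m) m))"
  shows "\<Phi> P"
proof -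
  have "S \<subseteq> {m. P m \<noteq> \<zero>} \<Longrightarrow> \<Phi> (\<lambda>m. if m \<in> S then P m else \<zero>)" if "finite S" for S
    using that
  proof induction
    case empty
    then show ?case using zero by (simp add: indexed_const_def)
  next
    case (insert x S)
    have "\<Phi> (indexed_padd (\<lambda>m. if m \<in> S then P m else \<zero>) (mpoly_term R (P x) x))"
      using insert by (intro step) auto
    moreover have "indexed_padd (\<lambda>m. if m \<in> S then P m else \<zero>) (mpoly_term R (P x) x)
        = (\<lambda>m. if m \<in> insert x S then P m else \<zero>)"
      using insert.hyps cl by (auto simp: indexed_padd_def mpoly_term_def)
    ultimately show ?case by (simp only:)
  qed
  from this[OF fin] have "\<Phi> (\<lambda>m. if m \<in> {m. P m \<noteq> \<zero>} then P m else \<zero>)" by blast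
  moreover have "(\<lambda>m. if m \<in> {m. P m \<noteq> \<zero>} then P m else \<zero>) = P" by auto
  ultimately show ?thesis by simp
qed

lemma mpoly_carrier_iff:
  "P \<in> carrier (mpoly_ring R I) \<longleftrightarrow>
     (\<forall>m. P m \<in> carrier R) \<and> finite {m. P m \<noteq> \<zero>} \<and> (\<forall>m. P m \<noteq> \<zero> \<longrightarrow> set_mset m \<subseteq> I)"
    (is "_ \<longleftrightarrow> ?good P")
proof
  have C: "carrier (mpoly_ring R I) = indexed_pset I (carrier R)"
    by (simp add: mpoly_ring_def)
  assume "P \<in> carrier (mpoly_ring R I)"
  then have "P \<in> indexed_pset I (carrier R)" by (simp add: C)
  then show "?good P"
  proof induction
    case (indexed_const k)
    have "{m. indexed_const k m \<noteq> \<zero>} \<subseteq> {{#}}" by (auto simp: indexed_const_def)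
    then have "finite {m. indexed_const k m \<noteq> \<zero>}" by (rule finite_subset) simp
    then show ?case using indexed_const by (auto simp: indexed_const_def)
  next
    case (indexed_padd P Q)
    have sub: "{m. indexed_padd P Q m \<noteq> \<zero>} \<subseteq> {m. P m \<noteq> \<zero>} \<union> {m. Q m \<noteq> \<zero>}"
      by (auto simp: indexed_padd_def)
    then have "finite {m. indexed_padd P Q m \<noteq> \<zero>}"
      using indexed_padd.IH finite_subset by blast
    moreover have "set_mset m \<subseteq> I" if "indexed_padd P Q m \<noteq> \<zero>" for m
      using indexed_padd.IH sub that by blast
    ultimately show ?case using indexed_padd.IH by (auto simp: indexed_padd_def)
  next
    case (indexed_pmult P i)
    have "{m. indexed_pmult P i m \<noteq> \<zero>} \<subseteq> add_mset i ` {m. P m \<noteq> \<zero>}"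
    proof
      fix m assume "m \<in> {m. indexed_pmult P i m \<noteq> \<zero>}"
      then have "i \<in># m" "P (m - {#i#}) \<noteq> \<zero>" by (auto simp: indexed_pmult_def split: if_splits)
      then show "m \<in> add_mset i ` {m. P m \<noteq> \<zero>}"
        by (intro image_eqI[of _ _ "m - {#i#}"]) auto
    qed
    then have "finite {m. indexed_pmult P i m \<noteq> \<zero>}"
      using indexed_pmult.IH finite_subset by blast
    moreover have "set_mset m \<subseteq> I" if "indexed_pmult P i m \<noteq> \<zero>" for m
    proof -
      from that have *: "i \<in># m" "P (m - {#i#}) \<noteq> \<zero>" by (auto simp: indexed_pmult_def split: if_splits)
      then have "set_mset (m - {#i#}) \<subseteq> I" using indexed_pmult.IH by blast
      then have "set_mset (add_mset i (m - {#i#})) \<subseteq> I" using indexed_pmult.hyps by simp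
      then show ?thesis using * by simp
    qed
    ultimately show ?case using indexed_pmult.IH by (auto simp: indexed_pmult_def)
  qed
next
  have C: "carrier (mpoly_ring R I) = indexed_pset I (carrier R)"
    by (simp add: mpoly_ring_def)
  have trm: "mpoly_term R c m \<in> indexed_pset I (carrier R)" if "c \<in> carrier R" "set_mset m \<subseteq> I" for c m
    using that(2)
  proof (induction m)
    case empty
    have "mpoly_term R c {#} = indexed_const c"
      by (auto simp: mpoly_term_def indexed_const_def)
    with indexed_pset.indexed_const[OF that(1), of I] show ?case by metis
  next
    case (add i m)
    have "mpoly_term R c (add_mset i m) = indexed_pmult (mpoly_term R c m) i"
      by (rule ext) (auto simp: mpoly_term_def indexed_pmult_def)
    then show ?case using add by (simp add: indexed_pset.indexed_pmult)
  qed
  assume g: "?good P"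
  from g have fin: "finite {m. P m \<noteq> \<zero>}" and cl: "\<And>m. P m \<in> carrier R"
    and sup: "\<And>m. P m \<noteq> \<zero> \<Longrightarrow> set_mset m \<subseteq> I" by auto
  from fin cl have "P \<in> indexed_pset I (carrier R)"
  proof (rule finite_support_induct)
    show "indexed_const \<zero> \<in> indexed_pset I (carrier R)" by (simp add: indexed_pset.indexed_const)
    fix Q m assume "Q \<in> indexed_pset I (carrier R)" "P m \<noteq> \<zero>"
    then show "indexed_padd Q (mpoly_term R (P m) m) \<in> indexed_pset I (carrier R)"
      by (intro indexed_pset.indexed_padd trm cl sup)
  qed
  then show "P \<in> carrier (mpoly_ring R I)" by (simp add: C)
qed

lemma mpoly_closed:
  "c \<in> carrier R \<Longrightarrow> indexed_const c \<in> carrier (mpoly_ring R I)"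
  "P \<in> carrier (mpoly_ring R I) \<Longrightarrow> Q \<in> carrier (mpoly_ring R I) \<Longrightarrow>
     indexed_padd P Q \<in> carrier (mpoly_ring R I)"
  "P \<in> carrier (mpoly_ring R I) \<Longrightarrow> i \<in> I \<Longrightarrow> indexed_pmult P i \<in> carrier (mpoly_ring R I)"
  by (auto simp: mpoly_ring_def indexed_pset.intros)

lemma mpoly_induct [consumes 1, case_names const add mult_var]:
  assumes "P \<in> carrier (mpoly_ring R I)"
    and "\<And>c. c \<in> carrier R \<Longrightarrow> \<Phi> (indexed_const c)"
    and "\<And>P Q. P \<in> carrier (mpoly_ring R I) \<Longrightarrow> Q \<in> carrier (mpoly_ring R I) \<Longrightarrow> \<Phi> P \<Longrightarrow> \<Phi> Q \<Longrightarrow>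
           \<Phi> (indexed_padd P Q)"
    and "\<And>P i. P \<in> carrier (mpoly_ring R I) \<Longrightarrow> i \<in> I \<Longrightarrow> \<Phi> P \<Longrightarrow> \<Phi> (indexed_pmult P i)"
  shows "\<Phi> P"
proof -
  have "P \<in> indexed_pset I (carrier R)" using assms(1) by (simp add: mpoly_ring_def)
  then show ?thesis
    by induction (use assms(2-) in \<open>auto simp: mpoly_ring_def\<close>)
qed

end

lemma mpoly_ring_simps:
  "ring.add (mpoly_ring R I) = ring.indexed_padd R"
  "ring.zero (mpoly_ring R I) = ring.indexed_const R \<zero>\<^bsub>R\<^esub>"
  "monoid.one (mpoly_ring R I) = ring.indexed_const R \<one>\<^bsub>R\<^esub>"
  by (simp_all add: mpoly_ring_def)

context cring
begin

abbreviation (input) pm where "pm I \<equiv> monoid.mult (mpoly_ring R I)"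

lemma mpoly_mult_eval: "pm I P Q m = (\<Oplus>a\<in>{a. a \<subseteq># m}. P a \<otimes> Q (m - a))"
  by (simp add: mpoly_ring_def)

lemma mpoly_coeff_closed: "P \<in> carrier (mpoly_ring R I) \<Longrightarrow> P m \<in> carrier R"
  by (simp add: mpoly_carrier_iff)

lemma mpoly_mult_const:
  assumes "c \<in> carrier R" "\<And>m. Q m \<in> carrier R"
  shows "pm I (indexed_const c) Q = (\<lambda>m. c \<otimes> Q m)"
proof
  fix m
  have "pm I (indexed_const c) Q m = (\<Oplus>a\<in>{a. a \<subseteq># m}. if {#} = a then c \<otimes> Q (m - a) else \<zero>)"
    unfolding mpoly_mult_eval using assms
    by (intro finsum_cong') (auto simp: indexed_const_def)
  also have "\<dots> = c \<otimes> Q m"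
    using finsum_singleton[of "{#}" "{a. a \<subseteq># m}" "\<lambda>a. c \<otimes> Q (m - a)"] assms
    by (simp add: finite_submultisets)
  finally show "pm I (indexed_const c) Q m = c \<otimes> Q m" .
qed

lemma mpoly_mult_padd:
  assumes "\<And>m. P m \<in> carrier R" "\<And>m. P' m \<in> carrier R" "\<And>m. Q m \<in> carrier R"
  shows "pm I (indexed_padd P P') Q = indexed_padd (pm I P Q) (pm I P' Q)"
proof
  fix m
  have "pm I (indexed_padd P P') Q m
      = (\<Oplus>a\<in>{a. a \<subseteq># m}. P a \<otimes> Q (m - a) \<oplus> P' a \<otimes> Q (m - a))"
    unfolding mpoly_mult_eval using assms
    by (intro finsum_cong') (auto simp: indexed_padd_def l_distr)
  also have "\<dots> = indexed_padd (pm I P Q) (pm I P' Q) m"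
    unfolding indexed_padd_def mpoly_mult_eval using assms by (intro finsum_addf) auto
  finally show "pm I (indexed_padd P P') Q m = indexed_padd (pm I P Q) (pm I P' Q) m" .
qed

text \<open>Multiplication by a variable is the only product that the indexed polynomials come with; together with
constants and sums it generates all polynomials, so identities are proved by induction along it.\<close>

lemma mpoly_mult_pmult:
  assumes "\<And>m. P m \<in> carrier R" "\<And>m. Q m \<in> carrier R"
  shows "pm I (indexed_pmult P i) Q = indexed_pmult (pm I P Q) i"
proof
  fix m
  let ?A = "{a. a \<subseteq># m \<and> i \<in># a}"
  have 1: "pm I (indexed_pmult P i) Q m = (\<Oplus>a\<in>?A. P (a - {#i#}) \<otimes> Q (m - a))"
    unfolding mpoly_mult_eval
    by (rule add.finprod_mono_neutral_cong_right)
      (use assms finite_submultisets in \<open>auto simp: indexed_pmult_def\<close>)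
  show "pm I (indexed_pmult P i) Q m = indexed_pmult (pm I P Q) i m"
  proof (cases "i \<in># m")
    case False
    then have "?A = {}" by (auto dest: mset_subset_eqD)
    then show ?thesis unfolding 1 by (simp only: finsum_empty) (simp add: indexed_pmult_def False)
  next
    case True
    have A: "?A = add_mset i ` {a. a \<subseteq># m - {#i#}}"
    proof (rule subset_antisym; rule subsetI)
      fix a assume "a \<in> ?A"
      then have "a = add_mset i (a - {#i#})" "a - {#i#} \<subseteq># m - {#i#}"
        by (auto intro: mset_subset_eq_mono_add_right_cancel subset_eq_diff_conv[THEN iffD2]
            simp: True subset_eq_diff_conv)
      then show "a \<in> add_mset i ` {a. a \<subseteq># m - {#i#}}" by blast
    next
      fix a assume "a \<in> add_mset i ` {a. a \<subseteq># m - {#i#}}"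
      then obtain b where "a = add_mset i b" "b \<subseteq># m - {#i#}" by blast
      then show "a \<in> ?A" using True
        by (simp add: insert_subset_eq_iff)
    qed
    have "(\<Oplus>a\<in>?A. P (a - {#i#}) \<otimes> Q (m - a))
        = (\<Oplus>b\<in>{a. a \<subseteq># m - {#i#}}. P (add_mset i b - {#i#}) \<otimes> Q (m - add_mset i b))"
      unfolding A using assms by (intro finsum_reindex) (auto simp: inj_on_def)
    also have "\<dots> = (\<Oplus>b\<in>{a. a \<subseteq># m - {#i#}}. P b \<otimes> Q ((m - {#i#}) - b))"
      using assms by (intro finsum_cong') (auto simp: add_mset_commute diff_diff_add_mset)
    finally show ?thesis unfolding 1 by (simp add: indexed_pmult_def True mpoly_mult_eval)
  qed
qed

lemma mpoly_mult_commute: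
  fixes P Q :: "'i multiset \<Rightarrow> 'a"
  assumes "\<And>m. P m \<in> carrier R" "\<And>m. Q m \<in> carrier R"
  shows "pm I P Q = pm I Q P"
proof
  fix m :: "'i multiset"
  have inv: "(\<lambda>a. m - a) ` {a. a \<subseteq># m} = {a. a \<subseteq># m}"
  proof (rule subset_antisym; rule subsetI)
    fix a assume "a \<in> {a. a \<subseteq># m}"
    then have "a = m - (m - a)" "m - a \<subseteq># m" by (auto simp: subset_mset.diff_diff_right)
    then show "a \<in> (\<lambda>a. m - a) ` {a. a \<subseteq># m}" by blast
  qed auto
  have "pm I P Q m = (\<Oplus>a\<in>(\<lambda>a. m - a) ` {a. a \<subseteq># m}. P a \<otimes> Q (m - a))"
    unfolding mpoly_mult_eval by (simp only: inv)
  also have "\<dots> = (\<Oplus>a\<in>{a. a \<subseteq># m}. P (m - a) \<otimes> Q (m - (m - a)))"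
    using assms by (intro finsum_reindex) (auto simp: inj_on_def, metis subset_mset.diff_diff_right add_diff_cancel_left' subset_mset.add_diff_inverse)
  also have "\<dots> = pm I Q P m"
    unfolding mpoly_mult_eval using assms
    by (intro finsum_cong') (auto simp: m_comm double_diff subset_mset.diff_diff_right)
  finally show "pm I P Q m = pm I Q P m" .
qed

lemma mpoly_mult_closed:
  assumes P: "P \<in> carrier (mpoly_ring R I)" and Q: "Q \<in> carrier (mpoly_ring R I)"
  shows "pm I P Q \<in> carrier (mpoly_ring R I)"
  using P
proof (induction rule: mpoly_induct)
  case (const c)
  have "{m. c \<otimes> Q m \<noteq> \<zero>} \<subseteq> {m. Q m \<noteq> \<zero>}" using const by auto
  then have "finite {m. c \<otimes> Q m \<noteq> \<zero>}" using Q finite_subset by (auto simp: mpoly_carrier_iff)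
  moreover have "set_mset m \<subseteq> I" if "c \<otimes> Q m \<noteq> \<zero>" for m
    using Q that const by (metis mpoly_carrier_iff r_null)
  ultimately show ?case using const Q
    by (subst mpoly_mult_const) (auto simp: mpoly_carrier_iff)
next
  case (add P P')
  then show ?case using Q by (simp add: mpoly_mult_padd mpoly_coeff_closed mpoly_closed)
next
  case (mult_var P i)
  then show ?case using Q by (simp add: mpoly_mult_pmult mpoly_coeff_closed mpoly_closed)
qed

lemma mpoly_mult_assoc:
  assumes P: "P \<in> carrier (mpoly_ring R I)" and Q: "Q \<in> carrier (mpoly_ring R I)"
    and S: "S \<in> carrier (mpoly_ring R I)"
  shows "pm I (pm I P Q) S = pm I P (pm I Q S)"
  using P
proof (induction rule: mpoly_induct)
  case (const c)
  have QS: "\<And>m. Q m \<in> carrier R" "\<And>m. S m \<in> carrier R"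
    using Q S by (auto intro: mpoly_coeff_closed)
  have "pm I (\<lambda>m. c \<otimes> Q m) S m = c \<otimes> pm I Q S m" for m
    unfolding mpoly_mult_eval using const QS
    by (subst finsum_rdistr) (auto simp: finite_submultisets m_assoc intro!: finsum_cong')
  moreover have "\<And>m. pm I Q S m \<in> carrier R"
    using mpoly_mult_closed[OF Q S] mpoly_coeff_closed by blast
  ultimately show ?case using const QS by (simp add: mpoly_mult_const fun_eq_iff)
next
  case (add P P')
  moreover have "\<And>P m. P \<in> carrier (mpoly_ring R I) \<Longrightarrow> pm I P Q m \<in> carrier R"
    using mpoly_mult_closed Q mpoly_coeff_closed by blast
  moreover have "\<And>m. pm I Q S m \<in> carrier R"
    using mpoly_mult_closed[OF Q S] mpoly_coeff_closed by blast
  ultimately show ?case using Q S by (simp add: mpoly_mult_padd mpoly_coeff_closed)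
next
  case (mult_var P i)
  moreover have "\<And>m. pm I P Q m \<in> carrier R"
    using mpoly_mult_closed[OF mult_var.hyps(1) Q] mpoly_coeff_closed by blast
  moreover have "\<And>m. pm I Q S m \<in> carrier R"
    using mpoly_mult_closed[OF Q S] mpoly_coeff_closed by blast
  ultimately show ?case using Q S by (simp add: mpoly_mult_pmult mpoly_coeff_closed)
qed

lemma mpoly_cring: "cring (mpoly_ring R I)"
proof (rule cringI)
  show "abelian_group (mpoly_ring R I)"
  proof (rule abelian_groupI)
    fix P assume P: "P \<in> carrier (mpoly_ring R I)"
    have "(\<lambda>m. \<ominus> P m) \<in> carrier (mpoly_ring R I)"
      using P by (auto simp: mpoly_carrier_iff)
    moreover have "indexed_padd (\<lambda>m. \<ominus> P m) P = indexed_const \<zero>"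
      using P by (auto simp: indexed_padd_def indexed_const_def mpoly_carrier_iff l_neg)
    ultimately show "\<exists>y\<in>carrier (mpoly_ring R I). y \<oplus>\<^bsub>mpoly_ring R I\<^esub> P = \<zero>\<^bsub>mpoly_ring R I\<^esub>"
      by (auto simp: mpoly_ring_simps)
    show "\<zero>\<^bsub>mpoly_ring R I\<^esub> \<oplus>\<^bsub>mpoly_ring R I\<^esub> P = P"
      using P by (auto simp: mpoly_ring_simps indexed_padd_def indexed_const_def mpoly_carrier_iff)
  qed (auto simp: mpoly_ring_simps mpoly_closed mpoly_coeff_closed a_ac,
      auto simp: indexed_padd_def mpoly_coeff_closed a_ac)
  show "Group.comm_monoid (mpoly_ring R I)"
  proof (rule comm_monoidI)
    fix P assume P: "P \<in> carrier (mpoly_ring R I)"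
    show "\<one>\<^bsub>mpoly_ring R I\<^esub> \<otimes>\<^bsub>mpoly_ring R I\<^esub> P = P"
      using P by (simp add: mpoly_ring_simps mpoly_mult_const mpoly_coeff_closed)
  qed (auto simp: mpoly_ring_simps mpoly_closed mpoly_mult_closed mpoly_mult_assoc
      mpoly_coeff_closed intro: mpoly_mult_commute)
qed (auto simp: mpoly_ring_simps mpoly_mult_padd mpoly_coeff_closed)

lemma indexed_var_closed: "i \<in> I \<Longrightarrow> indexed_var i \<in> carrier (mpoly_ring R I)"
  by (simp add: indexed_var_def mpoly_closed)

lemma mpoly_mult_var:
  assumes "P \<in> carrier (mpoly_ring R I)" "i \<in> I"
  shows "P \<otimes>\<^bsub>mpoly_ring R I\<^esub> indexed_var i = indexed_pmult P i"
proof -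
  have "pm I P (indexed_var i) = pm I (indexed_pmult (indexed_const \<one>) i) P"
    using assms by (subst mpoly_mult_commute) (auto simp: indexed_var_def[symmetric] intro: mpoly_coeff_closed indexed_var_closed)
  also have "\<dots> = indexed_pmult (pm I (indexed_const \<one>) P) i"
    using assms mpoly_closed(1) by (intro mpoly_mult_pmult) (auto intro: mpoly_coeff_closed simp: indexed_const_def)
  also have "pm I (indexed_const \<one>) P = P"
    using assms by (simp add: mpoly_mult_const mpoly_coeff_closed)
  finally show ?thesis .
qed

lemma indexed_const_hom: "indexed_const \<in> ring_hom R (mpoly_ring R I)"
  by (rule ring_hom_memI)
    (auto simp: mpoly_closed mpoly_ring_simps mpoly_mult_const mpoly_coeff_closed,
     auto simp: indexed_padd_def indexed_const_def)

end

section \<open>Forms\<close>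

text \<open>Expressions of degree \<open>d\<close> in elements of \<open>V\<close> with coefficients in \<open>C\<close>. Powers of an ideal, graded pieces of
polynomial rings and of symmetric algebras, and the relation between values and classes are all instances,
which makes a single induction principle serve for all of them.\<close>

inductive_set forms :: "('r, 'm) ring_scheme \<Rightarrow> 'r set \<Rightarrow> 'r set \<Rightarrow> (nat \<times> 'r) set" for R C V where
  const: "c \<in> C \<Longrightarrow> (0, c) \<in> forms R C V"
| zero: "(d, \<zero>\<^bsub>R\<^esub>) \<in> forms R C V"
| add: "(d, a) \<in> forms R C V \<Longrightarrow> (d, b) \<in> forms R C V \<Longrightarrow> (d, a \<oplus>\<^bsub>R\<^esub> b) \<in> forms R C V"
| mult: "(d, a) \<in> forms R C V \<Longrightarrow> v \<in> V \<Longrightarrow> (Suc d, a \<otimes>\<^bsub>R\<^esub> v) \<in> forms R C V"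

lemma forms_Suc_induct [consumes 1, case_names zero add mult]:
  assumes "(Suc d, a) \<in> forms R C V" and "\<Phi> \<zero>\<^bsub>R\<^esub>"
    and "\<And>a b. (Suc d, a) \<in> forms R C V \<Longrightarrow> (Suc d, b) \<in> forms R C V \<Longrightarrow> \<Phi> a \<Longrightarrow> \<Phi> b \<Longrightarrow> \<Phi> (a \<oplus>\<^bsub>R\<^esub> b)"
    and "\<And>a v. (d, a) \<in> forms R C V \<Longrightarrow> v \<in> V \<Longrightarrow> \<Phi> (a \<otimes>\<^bsub>R\<^esub> v)"
  shows "\<Phi> a"
proof -
  have "(n, a) \<in> forms R C V \<Longrightarrow> n = Suc d \<Longrightarrow> \<Phi> a" for n a
    by (induction n a rule: forms.induct) (use assms(2-) in auto)
  then show ?thesis using assms(1) by blast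
qed

context cring
begin

context
  fixes C V assumes C: "C \<subseteq> carrier R" and V: "V \<subseteq> carrier R"
begin

lemma forms_closed: "(d, a) \<in> forms R C V \<Longrightarrow> a \<in> carrier R"
  by (induction d a rule: forms.induct) (use C V in auto)

lemma forms_uminus:
  assumes "\<And>c. c \<in> C \<Longrightarrow> \<ominus> c \<in> C"
  shows "(d, a) \<in> forms R C V \<Longrightarrow> (d, \<ominus> a) \<in> forms R C V"
proof (induction d a rule: forms.induct)
  case (add d a b)
  then have "a \<in> carrier R" "b \<in> carrier R" by (auto intro: forms_closed)
  then show ?case using add by (simp add: minus_add forms.add)
next
  case (mult d a v)
  then have "a \<in> carrier R" "v \<in> carrier R" using V by (auto intro: forms_closed)
  then show ?case using mult by (simp add: forms.mult flip: l_minus)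
qed (use assms C in \<open>auto intro: forms.intros\<close>)

lemma forms_minus:
  assumes "\<And>c. c \<in> C \<Longrightarrow> \<ominus> c \<in> C" "(d, a) \<in> forms R C V" "(d, b) \<in> forms R C V"
  shows "(d, a \<ominus> b) \<in> forms R C V"
  unfolding a_minus_def using assms by (intro forms.add forms_uminus)

lemma forms_mult:
  assumes m: "\<And>c c'. c \<in> C \<Longrightarrow> c' \<in> C \<Longrightarrow> c \<otimes> c' \<in> C"
    and a: "(d, a) \<in> forms R C V" and b: "(e, b) \<in> forms R C V"
  shows "(d + e, a \<otimes> b) \<in> forms R C V"
  using b
proof (induction e b rule: forms.induct)
  case (const c)
  from a show ?case
  proof (induction d a rule: forms.induct)
    case (const c') then show ?case using m \<open>c \<in> C\<close> by (auto intro: forms.const)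
  next
    case (zero d)
    have "\<zero> \<otimes> c = \<zero>" using \<open>c \<in> C\<close> C by auto
    then show ?case by (simp add: forms.zero)
  next
    case (add d a b)
    then have "(a \<oplus> b) \<otimes> c = a \<otimes> c \<oplus> b \<otimes> c"
      using C \<open>c \<in> C\<close> by (intro l_distr) (auto intro: forms_closed)
    then show ?case using add.IH by (simp add: forms.add)
  next
    case (mult d a v)
    then have "a \<in> carrier R" "v \<in> carrier R" "c \<in> carrier R"
      using C V \<open>c \<in> C\<close> forms_closed[OF mult.hyps(1)] by auto
    then have "(a \<otimes> v) \<otimes> c = (a \<otimes> c) \<otimes> v" by (simp add: m_ac)
    then show ?case using mult by (simp add: forms.mult)
  qed
next
  case (zero e) then show ?case using forms_closed[OF a] by (auto intro: forms.zero)
next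
  case (add e b b')
  then have "a \<otimes> (b \<oplus> b') = a \<otimes> b \<oplus> a \<otimes> b'"
    using forms_closed[OF a] by (intro r_distr) (auto intro: forms_closed)
  then show ?case using add.IH by (simp add: forms.add)
next
  case (mult e b v)
  then have "a \<otimes> (b \<otimes> v) = a \<otimes> b \<otimes> v"
    using forms_closed[OF a] forms_closed[OF mult.hyps(1)] V by (auto simp: m_assoc)
  then show ?case using mult by (simp add: forms.mult)
qed

end

end

lemma ring_hom_zero': "h \<in> ring_hom R S \<Longrightarrow> cring R \<Longrightarrow> cring S \<Longrightarrow> h \<zero>\<^bsub>R\<^esub> = \<zero>\<^bsub>S\<^esub>"
  by (meson cring.axioms(1) ring_hom_zero)

lemma forms_hom:
  assumes "h \<in> ring_hom R S" "cring R" "cring S" "C \<subseteq> carrier R" "V \<subseteq> carrier R"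
    "h ` C \<subseteq> C'" "h ` V \<subseteq> V'"
  shows "(d, a) \<in> forms R C V \<Longrightarrow> (d, h a) \<in> forms S C' V'"
proof (induction d a rule: forms.induct)
  case (const c) then show ?case using assms by (auto intro: forms.const)
next
  case (zero d) then show ?case using assms by (simp add: ring_hom_zero' forms.zero)
next
  case (add d a b)
  then have "a \<in> carrier R" "b \<in> carrier R" using cring.forms_closed[OF assms(2,4,5)] by auto
  then show ?case using add assms(1) by (simp add: ring_hom_add forms.add)
next
  case (mult d a v)
  then have "a \<in> carrier R" "v \<in> carrier R" using cring.forms_closed[OF assms(2,4,5)] assms(5) by auto
  then show ?case using mult assms(1,7) by (auto simp: ring_hom_mult intro!: forms.mult)
qed

lemma forms_lift:
  assumes "h \<in> ring_hom R S" "cring R" "cring S" "C \<subseteq> carrier R" "V \<subseteq> carrier R"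
    "C' \<subseteq> h ` C" "V' \<subseteq> h ` V"
  shows "(d, b) \<in> forms S C' V' \<Longrightarrow> \<exists>a. (d, a) \<in> forms R C V \<and> h a = b"
proof (induction d b rule: forms.induct)
  case (const c)
  then obtain a where "a \<in> C" "h a = c" using assms(6) by blast
  then show ?case by (blast intro: forms.const)
next
  case (zero d) then show ?case using assms by (auto simp: ring_hom_zero' intro!: exI[of _ "\<zero>\<^bsub>R\<^esub>"] forms.zero)
next
  case (add d a b)
  then obtain a' b' where *: "(d, a') \<in> forms R C V" "h a' = a" "(d, b') \<in> forms R C V" "h b' = b" by blast
  then have "a' \<in> carrier R" "b' \<in> carrier R" using cring.forms_closed[OF assms(2,4,5)] by auto
  then show ?case using * assms(1) by (auto simp: ring_hom_add intro!: exI[of _ "a' \<oplus>\<^bsub>R\<^esub> b'"] forms.add)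
next
  case (mult d a v)
  then obtain a' where *: "(d, a') \<in> forms R C V" "h a' = a" by blast
  from mult obtain v' where v': "v' \<in> V" "h v' = v" using assms(7) by blast
  have "a' \<in> carrier R" "v' \<in> carrier R" using cring.forms_closed[OF assms(2,4,5)] * v' assms(5) by auto
  then show ?case using * v' assms(1)
    by (auto simp: ring_hom_mult intro!: exI[of _ "a' \<otimes>\<^bsub>R\<^esub> v'"] forms.mult)
qed

lemma (in cring) ideal_power_eq_forms:
  assumes J: "ideal J R"
  shows "J [^]\<^bsub>ideals_set R\<^esub> d = {a. (d, a) \<in> forms R (carrier R) J}" and "ideal (J [^]\<^bsub>ideals_set R\<^esub> d) R"
proof -
  interpret M: comm_monoid "ideals_set R" by (rule ideals_set_is_comm_monoid)
  have carr: "J \<in> carrier (ideals_set R)" using J by (simp add: ideals_set_def)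
  have idl: "ideal (J [^]\<^bsub>ideals_set R\<^esub> d) R" for d :: nat
    using M.nat_pow_closed[OF carr, of d] by (simp add: ideals_set_def)
  then show "ideal (J [^]\<^bsub>ideals_set R\<^esub> d) R" .
  have Js: "J \<subseteq> carrier R" by (rule additive_subgroup.a_subset[OF ideal.axioms(1)[OF J]])
  have S: "J [^]\<^bsub>ideals_set R\<^esub> Suc d = ideal_prod R (J [^]\<^bsub>ideals_set R\<^esub> d) J" for d :: nat
    by (simp add: ideals_set_def)
  have "a \<in> J [^]\<^bsub>ideals_set R\<^esub> d" if "(d, a) \<in> forms R (carrier R) J" for d a
    using that
  proof (induction d a rule: forms.induct)
    case (const c) then show ?case by (simp add: ideals_set_def)
  next
    case (zero d) then show ?case using idl[of d] by (simp add: additive_subgroup.zero_closed ideal.axioms(1))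
  next
    case (add d a b) then show ?case using idl[of d] by (simp add: additive_subgroup.a_closed ideal.axioms(1))
  next
    case (mult d a v) then show ?case unfolding S by (intro ideal_prod.prod)
  qed
  moreover have "a \<in> J [^]\<^bsub>ideals_set R\<^esub> d \<Longrightarrow> (d, a) \<in> forms R (carrier R) J" for a
  proof (induction d arbitrary: a)
    case 0 then show ?case by (auto simp: ideals_set_def intro: forms.const)
  next
    case (Suc d)
    from Suc.prems[unfolded S] show ?case
      by (induction) (auto intro: forms.intros Suc.IH)
  qed
  ultimately show "J [^]\<^bsub>ideals_set R\<^esub> d = {a. (d, a) \<in> forms R (carrier R) J}" by blast
qed

section \<open>Evaluation\<close>

definition mval :: "('s, 'n) ring_scheme \<Rightarrow> ('i \<Rightarrow> 's) \<Rightarrow> 'i multiset \<Rightarrow> 's" where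
  "mval S v m = (\<Otimes>\<^bsub>S\<^esub>i\<in>set_mset m. v i [^]\<^bsub>S\<^esub> count m i)"

context cring
begin

lemma mval_closed: "v \<in> set_mset m \<rightarrow> carrier R \<Longrightarrow> mval R v m \<in> carrier R"
  unfolding mval_def by (rule finprod_closed) auto

lemma mval_empty: "mval R v {#} = \<one>"
  by (simp add: mval_def)

lemma mval_add:
  assumes v: "v \<in> set_mset (add_mset i m) \<rightarrow> carrier R"
  shows "mval R v (add_mset i m) = mval R v m \<otimes> v i"
proof (cases "i \<in># m")
  case True
  then have set: "set_mset m = insert i (set_mset m - {i})" by auto
  have "mval R v (add_mset i m) = (\<Otimes>j\<in>insert i (set_mset m - {i}). v j [^] count (add_mset i m) j)"
    unfolding mval_def using set by simp
  also have "\<dots> = v i [^] Suc (count m i) \<otimes> (\<Otimes>j\<in>set_mset m - {i}. v j [^] count (add_mset i m) j)"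
    using v by (subst finprod_insert) auto
  also have "(\<Otimes>j\<in>set_mset m - {i}. v j [^] count (add_mset i m) j) = (\<Otimes>j\<in>set_mset m - {i}. v j [^] count m j)"
    using v by (intro finprod_cong') auto
  also have "v i [^] Suc (count m i) \<otimes> \<dots> = (v i [^] count m i \<otimes> \<dots>) \<otimes> v i"
  proof -
    have "(\<Otimes>j\<in>set_mset m - {i}. v j [^] count m j) \<in> carrier R"
      using v by (intro finprod_closed) auto
    then show ?thesis using v by (simp add: m_ac)
  qed
  also have "v i [^] count m i \<otimes> (\<Otimes>j\<in>set_mset m - {i}. v j [^] count m j)
      = (\<Otimes>j\<in>insert i (set_mset m - {i}). v j [^] count m j)"
    using v by (subst finprod_insert) auto
  also have "\<dots> = mval R v m" unfolding mval_def using set by simp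
  finally show ?thesis .
next
  case False
  then have "count (add_mset i m) i = 1" by (simp add: count_eq_zero_iff)
  moreover have "mval R v (add_mset i m)
      = v i [^] count (add_mset i m) i \<otimes> (\<Otimes>j\<in>set_mset m. v j [^] count (add_mset i m) j)"
    unfolding mval_def set_mset_add_mset_insert using v False
    by (subst finprod_insert) auto
  ultimately have "mval R v (add_mset i m) = v i [^] (1::nat) \<otimes> (\<Otimes>j\<in>set_mset m. v j [^] count (add_mset i m) j)"
    by simp
  also have "(\<Otimes>j\<in>set_mset m. v j [^] count (add_mset i m) j) = mval R v m"
    unfolding mval_def using v False by (intro finprod_cong') auto
  finally show ?thesis using v mval_closed[of v m] by (simp add: m_comm Pi_def)
qed

end

lemma mpoly_eval_mval: "mpoly_eval R S h v P = (\<Oplus>\<^bsub>S\<^esub>m\<in>{m. P m \<noteq> \<zero>\<^bsub>R\<^esub>}. h (P m) \<otimes>\<^bsub>S\<^esub> mval S v m)"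
  by (simp add: mpoly_eval_def mval_def)

locale mpoly_val = R: cring R + S: cring S for R (structure) and S (structure) +
  fixes I :: "'i set" and v assumes v: "v \<in> I \<rightarrow> carrier S"
begin

lemma mval_in: "set_mset m \<subseteq> I \<Longrightarrow> mval S v m \<in> carrier S"
  using v by (intro S.mval_closed) auto

lemma eval_superset:
  assumes "finite M" "\<And>m. P m \<noteq> \<zero>\<^bsub>R\<^esub> \<Longrightarrow> m \<in> M" "\<And>m. m \<in> M \<Longrightarrow> set_mset m \<subseteq> I"
    "h \<zero>\<^bsub>R\<^esub> = \<zero>\<^bsub>S\<^esub>" "\<And>m. h (P m) \<in> carrier S"
  shows "mpoly_eval R S h v P = (\<Oplus>\<^bsub>S\<^esub>m\<in>M. h (P m) \<otimes>\<^bsub>S\<^esub> mval S v m)"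
  unfolding mpoly_eval_mval
  by (rule S.add.finprod_mono_neutral_cong_left) (use assms mval_in in auto)

text \<open>The coefficient map is merely additive here, so that polynomials with coefficients in an ideal can be
evaluated with these coefficients sent to generators of the symmetric algebra (\<open>class_sum_zero\<close>).\<close>

lemma eval_padd:
  assumes P: "P \<in> carrier (mpoly_ring R I)" and Q: "Q \<in> carrier (mpoly_ring R I)"
    and D: "\<zero>\<^bsub>R\<^esub> \<in> D" "\<And>m. P m \<in> D" "\<And>m. Q m \<in> D" "h \<in> D \<rightarrow> carrier S"
    and h: "\<And>a b. a \<in> D \<Longrightarrow> b \<in> D \<Longrightarrow> h (a \<oplus>\<^bsub>R\<^esub> b) = h a \<oplus>\<^bsub>S\<^esub> h b"
  shows "mpoly_eval R S h v (ring.indexed_padd R P Q) = mpoly_eval R S h v P \<oplus>\<^bsub>S\<^esub> mpoly_eval R S h v Q"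
proof -
  have D': "\<And>m. h (P m) \<in> carrier S" "\<And>m. h (Q m) \<in> carrier S" "h \<zero>\<^bsub>R\<^esub> \<in> carrier S" using D by auto
  have h0: "h \<zero>\<^bsub>R\<^esub> = \<zero>\<^bsub>S\<^esub>"
    using h[OF D(1) D(1)] D' by (simp add: S.add.r_cancel_one')
  let ?M = "{m. P m \<noteq> \<zero>\<^bsub>R\<^esub>} \<union> {m. Q m \<noteq> \<zero>\<^bsub>R\<^esub>}"
  have M: "finite ?M" "\<And>m. m \<in> ?M \<Longrightarrow> set_mset m \<subseteq> I"
    using P Q by (auto simp: R.mpoly_carrier_iff)
  have PQ: "R.indexed_padd P Q m = P m \<oplus>\<^bsub>R\<^esub> Q m" for m by (simp add: R.indexed_padd_def)
  have "mpoly_eval R S h v (R.indexed_padd P Q) = (\<Oplus>\<^bsub>S\<^esub>m\<in>?M. h (R.indexed_padd P Q m) \<otimes>\<^bsub>S\<^esub> mval S v m)"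
    using M h0 D' by (intro eval_superset) (auto simp: PQ h D)
  also have "\<dots> = (\<Oplus>\<^bsub>S\<^esub>m\<in>?M. h (P m) \<otimes>\<^bsub>S\<^esub> mval S v m \<oplus>\<^bsub>S\<^esub> h (Q m) \<otimes>\<^bsub>S\<^esub> mval S v m)"
    using M D' mval_in by (intro S.finsum_cong') (auto simp: PQ h D S.l_distr)
  also have "\<dots> = (\<Oplus>\<^bsub>S\<^esub>m\<in>?M. h (P m) \<otimes>\<^bsub>S\<^esub> mval S v m) \<oplus>\<^bsub>S\<^esub> (\<Oplus>\<^bsub>S\<^esub>m\<in>?M. h (Q m) \<otimes>\<^bsub>S\<^esub> mval S v m)"
    using M D' mval_in by (intro S.finsum_addf) auto
  also have "(\<Oplus>\<^bsub>S\<^esub>m\<in>?M. h (P m) \<otimes>\<^bsub>S\<^esub> mval S v m) = mpoly_eval R S h v P"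
    using M h0 D' by (intro eval_superset[symmetric]) auto
  also have "(\<Oplus>\<^bsub>S\<^esub>m\<in>?M. h (Q m) \<otimes>\<^bsub>S\<^esub> mval S v m) = mpoly_eval R S h v Q"
    using M h0 D' by (intro eval_superset[symmetric]) auto
  finally show ?thesis .
qed

lemma eval_pmult:
  assumes P: "P \<in> carrier (mpoly_ring R I)" and i: "i \<in> I"
    and h: "h \<zero>\<^bsub>R\<^esub> = \<zero>\<^bsub>S\<^esub>" "\<And>m. h (P m) \<in> carrier S"
  shows "mpoly_eval R S h v (ring.indexed_pmult R P i) = mpoly_eval R S h v P \<otimes>\<^bsub>S\<^esub> v i"
proof -
  let ?M = "{m. P m \<noteq> \<zero>\<^bsub>R\<^esub>}"
  have M: "finite ?M" "\<And>m. m \<in> ?M \<Longrightarrow> set_mset m \<subseteq> I"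
    using P by (auto simp: R.mpoly_carrier_iff)
  have sup: "m \<in> add_mset i ` ?M" if "R.indexed_pmult P i m \<noteq> \<zero>\<^bsub>R\<^esub>" for m
    using that by (intro image_eqI[of _ _ "m - {#i#}"]) (auto simp: R.indexed_pmult_def split: if_splits)
  have iS: "v i \<in> carrier S" using v i by auto
  have mv: "m \<in> ?M \<Longrightarrow> mval S v (add_mset i m) = mval S v m \<otimes>\<^bsub>S\<^esub> v i" for m
    using M(2)[of m] v i by (intro S.mval_add) auto
  have "mpoly_eval R S h v (R.indexed_pmult P i)
      = (\<Oplus>\<^bsub>S\<^esub>m\<in>add_mset i ` ?M. h (R.indexed_pmult P i m) \<otimes>\<^bsub>S\<^esub> mval S v m)"
  proof (rule eval_superset)
    fix m assume "m \<in> add_mset i ` ?M"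
    then obtain m' where "m = add_mset i m'" "m' \<in> ?M" by blast
    then show "set_mset m \<subseteq> I" using M(2) i by simp
  qed (use M h sup in \<open>auto simp: R.indexed_pmult_def\<close>)
  also have "\<dots> = (\<Oplus>\<^bsub>S\<^esub>m\<in>?M. h (P m) \<otimes>\<^bsub>S\<^esub> mval S v (add_mset i m))"
    by (subst S.finsum_reindex)
      (use M h iS mv mval_in in \<open>auto simp: inj_on_def R.indexed_pmult_def\<close>)
  also have "\<dots> = (\<Oplus>\<^bsub>S\<^esub>m\<in>?M. (h (P m) \<otimes>\<^bsub>S\<^esub> mval S v m) \<otimes>\<^bsub>S\<^esub> v i)"
    using M h iS mv mval_in by (intro S.finsum_cong') (auto simp: S.m_assoc)
  also have "\<dots> = mpoly_eval R S h v P \<otimes>\<^bsub>S\<^esub> v i"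
    unfolding mpoly_eval_mval
    using M h iS mval_in by (intro S.finsum_ldistr[symmetric]) auto
  finally show ?thesis .
qed

lemma eval_const:
  assumes "h \<zero>\<^bsub>R\<^esub> = \<zero>\<^bsub>S\<^esub>" "h c \<in> carrier S"
  shows "mpoly_eval R S h v (ring.indexed_const R c) = h c"
proof -
  have "mpoly_eval R S h v (R.indexed_const c) = (\<Oplus>\<^bsub>S\<^esub>m\<in>{{#}}. h (R.indexed_const c m) \<otimes>\<^bsub>S\<^esub> mval S v m)"
    using assms by (intro eval_superset) (auto simp: R.indexed_const_def split: if_splits)
  also have "\<dots> = h c" using assms by (simp add: S.mval_empty R.indexed_const_def)
  finally show ?thesis .
qed

context
  fixes h assumes h: "h \<in> ring_hom R S"
begin

lemma h0: "h \<zero>\<^bsub>R\<^esub> = \<zero>\<^bsub>S\<^esub>" using h by (intro ring_hom_zero') unfold_locales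

lemma eval_hom_const: "c \<in> carrier R \<Longrightarrow> mpoly_eval R S h v (ring.indexed_const R c) = h c"
  using h h0 ring_hom_closed by (intro eval_const) fast+

lemma eval_hom_padd:
  assumes "P \<in> carrier (mpoly_ring R I)" "Q \<in> carrier (mpoly_ring R I)"
  shows "mpoly_eval R S h v (ring.indexed_padd R P Q) = mpoly_eval R S h v P \<oplus>\<^bsub>S\<^esub> mpoly_eval R S h v Q"
  using assms h
  by (intro eval_padd[where D = "carrier R"]) (auto simp: R.mpoly_coeff_closed ring_hom_add intro: ring_hom_closed)

lemma eval_hom_pmult:
  assumes "P \<in> carrier (mpoly_ring R I)" "i \<in> I"
  shows "mpoly_eval R S h v (ring.indexed_pmult R P i) = mpoly_eval R S h v P \<otimes>\<^bsub>S\<^esub> v i"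
  using assms h h0 by (intro eval_pmult) (auto simp: R.mpoly_coeff_closed intro: ring_hom_closed)

lemma eval_closed: "P \<in> carrier (mpoly_ring R I) \<Longrightarrow> mpoly_eval R S h v P \<in> carrier S"
  by (induction rule: R.mpoly_induct)
    (use v h in \<open>auto simp: eval_hom_const eval_hom_padd eval_hom_pmult intro: ring_hom_closed\<close>)

lemma eval_mult:
  assumes P: "P \<in> carrier (mpoly_ring R I)" and Q: "Q \<in> carrier (mpoly_ring R I)"
  shows "mpoly_eval R S h v (P \<otimes>\<^bsub>mpoly_ring R I\<^esub> Q) = mpoly_eval R S h v P \<otimes>\<^bsub>S\<^esub> mpoly_eval R S h v Q"
proof -
  interpret T: cring "mpoly_ring R I" by (rule R.mpoly_cring)
  show ?thesis using P
  proof (induction rule: R.mpoly_induct)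
    case (const c)
    note c = \<open>c \<in> carrier R\<close>
    have cc: "R.indexed_const c \<in> carrier (mpoly_ring R I)" using c by (rule R.mpoly_closed)
    show ?case using Q
    proof (induction rule: R.mpoly_induct)
      case (const c')
      have "R.indexed_const c \<otimes>\<^bsub>mpoly_ring R I\<^esub> R.indexed_const c' = R.indexed_const (c \<otimes>\<^bsub>R\<^esub> c')"
        using ring_hom_mult[OF R.indexed_const_hom[of I] c const] by (rule sym)
      then show ?case using c const h by (simp add: eval_hom_const ring_hom_mult)
    next
      case (add P Q)
      have "R.indexed_const c \<otimes>\<^bsub>mpoly_ring R I\<^esub> R.indexed_padd P Q
          = R.indexed_padd (R.indexed_const c \<otimes>\<^bsub>mpoly_ring R I\<^esub> P) (R.indexed_const c \<otimes>\<^bsub>mpoly_ring R I\<^esub> Q)"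
        using T.r_distr[of P Q "R.indexed_const c"] add cc by (simp add: mpoly_ring_simps)
      then show ?case using add cc c h
        by (simp add: eval_hom_padd R.mpoly_mult_closed eval_hom_const S.r_distr eval_closed ring_hom_closed)
    next
      case (mult_var P i)
      have "R.indexed_const c \<otimes>\<^bsub>mpoly_ring R I\<^esub> R.indexed_pmult P i
          = R.indexed_pmult (R.indexed_const c \<otimes>\<^bsub>mpoly_ring R I\<^esub> P) i"
        using T.m_assoc[of "R.indexed_const c" P "R.indexed_var i"] mult_var cc
        by (simp add: R.mpoly_mult_var R.indexed_var_closed R.mpoly_mult_closed)
      then show ?case using mult_var cc c h v
        by (simp add: eval_hom_pmult R.mpoly_mult_closed eval_hom_const S.m_assoc eval_closed ring_hom_closed Pi_def)
    qed
  next
    case (add P P')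
    then show ?case using Q
      by (simp add: R.mpoly_mult_padd R.mpoly_coeff_closed eval_hom_padd R.mpoly_mult_closed S.l_distr eval_closed)
  next
    case (mult_var P i)
    then show ?case using Q v
      by (simp add: R.mpoly_mult_pmult R.mpoly_coeff_closed eval_hom_pmult R.mpoly_mult_closed S.m_ac eval_closed Pi_def)
  qed
qed

lemma eval_ring_hom: "mpoly_eval R S h v \<in> ring_hom (mpoly_ring R I) S"
proof (rule ring_hom_memI)
  show "mpoly_eval R S h v \<one>\<^bsub>mpoly_ring R I\<^esub> = \<one>\<^bsub>S\<^esub>"
    using h by (simp add: mpoly_ring_simps eval_hom_const ring_hom_one)
qed (auto simp: eval_closed eval_mult mpoly_ring_simps eval_hom_padd)

lemma eval_var:
  assumes i: "i \<in> I" shows "mpoly_eval R S h v (ring.indexed_var R i) = v i"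
proof -
  have "v i \<in> carrier S" using v i by auto
  then show ?thesis using i h
    by (simp add: R.indexed_var_def eval_hom_pmult R.mpoly_closed eval_hom_const ring_hom_one)
qed

end

end

text \<open>A polynomial ring is generated by its constants and variables.\<close>

lemma mpoly_hom_eqI:
  assumes R: "cring R" and S: "cring S" and f: "f \<in> ring_hom (mpoly_ring R I) S" and g: "g \<in> ring_hom (mpoly_ring R I) S"
    and c: "\<And>c. c \<in> carrier R \<Longrightarrow> f (ring.indexed_const R c) = g (ring.indexed_const R c)"
    and x: "\<And>i. i \<in> I \<Longrightarrow> f (ring.indexed_var R i) = g (ring.indexed_var R i)"
    and P: "P \<in> carrier (mpoly_ring R I)"
  shows "f P = g P"
proof -
  interpret R: cring R by fact
  show ?thesis using P
  proof (induction rule: R.mpoly_induct)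
    case (add P Q)
    then show ?case using ring_hom_add[OF f, of P Q] ring_hom_add[OF g, of P Q] by (simp add: mpoly_ring_simps)
  next
    case (mult_var P i)
    have "R.indexed_pmult P i = P \<otimes>\<^bsub>mpoly_ring R I\<^esub> R.indexed_var i"
      using mult_var by (simp add: R.mpoly_mult_var)
    then show ?case using mult_var R.indexed_var_closed[of i I] by (simp add: ring_hom_mult[OF f] ring_hom_mult[OF g] x)
  qed (use c in auto)
qed

section \<open>Homogeneous polynomials\<close>

lemma (in ring) mpoly_term_empty: "mpoly_term R c {#} = indexed_const c"
  by (auto simp: mpoly_term_def indexed_const_def)

text \<open>A term is built up from its coefficient by multiplying with one variable at a time.\<close>

lemma (in cring) mpoly_term_forms:
  assumes "c \<in> carrier R" "set_mset m \<subseteq> I"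
  shows "(size m, mpoly_term R c m) \<in> forms (mpoly_ring R I) (indexed_const ` carrier R) (indexed_var ` I)"
  using assms(2)
proof (induction m)
  case empty
have "(0, indexed_const c) \<in> forms (mpoly_ring R I) (indexed_const ` carrier R) (indexed_var ` I)"
    using assms(1) by (intro forms.const) auto
  then show ?case by (simp add: mpoly_term_empty)
next
  case (add i m)
  have cl: "mpoly_term R c m \<in> carrier (mpoly_ring R I)"
    using add.IH add.prems cring.forms_closed[OF mpoly_cring] mpoly_closed(1) indexed_var_closed
    by (metis (no_types, lifting) image_subset_iff insert_subset set_mset_add_mset_insert)
  have "mpoly_term R c (add_mset i m) = indexed_pmult (mpoly_term R c m) i"
    by (rule ext) (auto simp: mpoly_term_def indexed_pmult_def)
  also have "\<dots> = mpoly_term R c m \<otimes>\<^bsub>mpoly_ring R I\<^esub> indexed_var i"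
    using add.prems cl by (simp add: mpoly_mult_var)
  finally show ?case using add by (auto intro!: forms.mult)
qed

lemma (in cring) homogeneous_eq_forms:
  "homogeneous R I d = {P. (d, P) \<in> forms (mpoly_ring R I) (indexed_const ` carrier R) (indexed_var ` I)}"
proof (intro subset_antisym subsetI; clarify)
  fix P assume "P \<in> homogeneous R I d"
  then have P: "P \<in> carrier (mpoly_ring R I)" "\<And>m. P m \<noteq> \<zero> \<Longrightarrow> size m = d" by (auto simp: homogeneous_def)
  let ?F = "forms (mpoly_ring R I) (indexed_const ` carrier R) (indexed_var ` I)"
  have "finite {m. P m \<noteq> \<zero>}" "\<And>m. P m \<in> carrier R" using P by (auto simp: mpoly_carrier_iff)
  then show "(d, P) \<in> ?F"
  proof (rule finite_support_induct)
    show "(d, indexed_const \<zero>) \<in> ?F" using forms.zero[of d "mpoly_ring R I"] by (simp add: mpoly_ring_simps)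
    fix Q m assume "(d, Q) \<in> ?F" "P m \<noteq> \<zero>"
    moreover from this have "(size m, mpoly_term R (P m) m) \<in> ?F"
      using P by (intro mpoly_term_forms) (auto simp: mpoly_carrier_iff)
    ultimately show "(d, indexed_padd Q (mpoly_term R (P m) m)) \<in> ?F"
      using P forms.add[of d Q "mpoly_ring R I"] by (auto simp: mpoly_ring_simps)
  qed
next
  fix P assume "(d, P) \<in> forms (mpoly_ring R I) (indexed_const ` carrier R) (indexed_var ` I)"
  then show "P \<in> homogeneous R I d"
  proof (induction d P rule: forms.induct)
    case (const c)
    then obtain r where "r \<in> carrier R" "c = indexed_const r" by blast
    moreover have "m = {#}" if "indexed_const r m \<noteq> \<zero>" for r and m :: "'c multiset"
      using that by (auto simp: indexed_const_def split: if_splits)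
    ultimately show ?case by (auto simp: homogeneous_def mpoly_closed)
  next
    case (zero d)
    have "indexed_const \<zero> \<in> carrier (mpoly_ring R I)" by (rule mpoly_closed) simp
    then show ?case unfolding homogeneous_def mpoly_ring_simps
      by (intro CollectI conjI) (simp_all add: indexed_const_def)
  next
    case (add d P Q)
    have "P m \<noteq> \<zero> \<or> Q m \<noteq> \<zero>" if "indexed_padd P Q m \<noteq> \<zero>" for m using that by (auto simp: indexed_padd_def)
    then show ?case using add by (auto simp: homogeneous_def mpoly_closed mpoly_ring_simps)
  next
    case (mult d P x)
    then obtain i where i: "i \<in> I" "x = indexed_var i" by auto
    have "size m = Suc d" if "indexed_pmult P i m \<noteq> \<zero>" for m
    proof -
      have "i \<in># m" "P (m - {#i#}) \<noteq> \<zero>" using that by (auto simp: indexed_pmult_def split: if_splits)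
      then have "size (m - {#i#}) = d" "i \<in># m" using mult by (auto simp: homogeneous_def)
      then show ?thesis by (metis size_Suc_Diff1)
    qed
    then show ?case using mult i by (auto simp: homogeneous_def mpoly_mult_var mpoly_closed)
  qed
qed

section \<open>Quotients, symmetric algebras, Rees algebras, tensor products\<close>

subsection \<open>Ideals\<close>

lemmas ideal_add = additive_subgroup.a_closed[OF ideal.axioms(1)]
  and ideal_zero = additive_subgroup.zero_closed[OF ideal.axioms(1)]
  and ideal_uminus = additive_subgroup.a_inv_closed[OF ideal.axioms(1)]

lemma (in cring) ideal_closedI:
  assumes sub: "L \<subseteq> carrier R" and ne: "L \<noteq> {}" and add: "\<And>a b. a \<in> L \<Longrightarrow> b \<in> L \<Longrightarrow> a \<oplus> b \<in> L"
    and mult: "\<And>r a. r \<in> carrier R \<Longrightarrow> a \<in> L \<Longrightarrow> r \<otimes> a \<in> L"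
  shows "ideal L R"
proof (rule idealI[OF ring_axioms])
  show "subgroup L (add_monoid R)"
  proof (rule group.subgroupI[OF a_group])
    show "L \<subseteq> carrier (add_monoid R)" using sub by simp
    fix a assume a: "a \<in> L"
    have "(\<ominus> \<one>) \<otimes> a \<in> L" by (rule mult[OF _ a]) simp
    then show "inv\<^bsub>add_monoid R\<^esub> a \<in> L" using a sub by (simp add: l_minus subset_iff flip: a_inv_def)
  qed (use ne add in simp_all)
  fix a r assume a: "a \<in> L" and r: "r \<in> carrier R"
  show "r \<otimes> a \<in> L" by (rule mult[OF r a])
  then show "a \<otimes> r \<in> L" using m_comm[of a r] r a sub by auto
qed

lemma (in cring) genideal_induct [consumes 2, case_names gen zero add mult]:
  assumes x: "x \<in> Idl G" and G: "G \<subseteq> carrier R"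
    and gen: "\<And>g. g \<in> G \<Longrightarrow> \<Phi> g" and zero: "\<Phi> \<zero>"
    and add: "\<And>a b. a \<in> carrier R \<Longrightarrow> b \<in> carrier R \<Longrightarrow> \<Phi> a \<Longrightarrow> \<Phi> b \<Longrightarrow> \<Phi> (a \<oplus> b)"
    and mult: "\<And>r a. r \<in> carrier R \<Longrightarrow> a \<in> Idl G \<Longrightarrow> \<Phi> a \<Longrightarrow> \<Phi> (r \<otimes> a)"
  shows "\<Phi> x"
proof -
  interpret I: ideal "Idl G" R by (rule genideal_ideal[OF G])
  have "ideal {a \<in> Idl G. \<Phi> a} R"
  proof (rule ideal_closedI)
    show "{a \<in> Idl G. \<Phi> a} \<noteq> {}" using zero I.zero_closed by blast
  qed (use add mult I.Icarr I.I_l_closed in auto)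
  then have "Idl G \<subseteq> {a \<in> Idl G. \<Phi> a}" by (rule genideal_minimal) (use gen genideal_self[OF G] in blast)
  then show ?thesis using x by blast
qed

subsection \<open>Homomorphisms from quotients\<close>

lemma quot_lift_eval:
  assumes I: "ideal I R" and S: "ring S" and h: "h \<in> ring_hom R S" and z: "\<And>i. i \<in> I \<Longrightarrow> h i = \<zero>\<^bsub>S\<^esub>"
    and a: "a \<in> carrier R"
  shows "the_elem (h ` (I +>\<^bsub>R\<^esub> a)) = h a"
proof -
  interpret I: ideal I R by fact
  interpret S: ring S by fact
  have "h ` (I +>\<^bsub>R\<^esub> a) = {h a}"
  proof -
    have "h (i \<oplus>\<^bsub>R\<^esub> a) = h a" if "i \<in> I" for i
      using that a h z I.Icarr ring_hom_closed[OF h a] by (simp add: ring_hom_add)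
    moreover have "I \<noteq> {}" using additive_subgroup.zero_closed[OF I.additive_subgroup_axioms] by blast
    moreover have "h ` (I +>\<^bsub>R\<^esub> a) = (\<lambda>i. h (i \<oplus>\<^bsub>R\<^esub> a)) ` I" unfolding a_r_coset_def' by auto
    ultimately show ?thesis by (auto simp: image_constant_conv cong: image_cong)
  qed
  then show ?thesis by simp
qed

lemma quot_elem:
  assumes "C \<in> carrier (R Quot I)" obtains a where "a \<in> carrier R" "C = I +>\<^bsub>R\<^esub> a"
  using assms unfolding FactRing_def A_RCOSETS_def RCOSETS_def a_r_coset_def by auto

lemma quot_lift_hom:
  assumes I: "ideal I R" and S: "ring S" and h: "h \<in> ring_hom R S" and z: "\<And>i. i \<in> I \<Longrightarrow> h i = \<zero>\<^bsub>S\<^esub>"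
  shows "(\<lambda>C. the_elem (h ` C)) \<in> ring_hom (R Quot I) S"
proof -
  interpret I: ideal I R by fact
  interpret S: ring S by fact
  note p = I.rcos_ring_hom
  note ev = quot_lift_eval[OF assms]
  show ?thesis
  proof (rule ring_hom_memI)
    fix C assume "C \<in> carrier (R Quot I)"
    then obtain a where a: "a \<in> carrier R" "C = I +>\<^bsub>R\<^esub> a" by (rule quot_elem)
    then show "the_elem (h ` C) \<in> carrier S" using ev h by (simp add: ring_hom_closed)
    fix D assume "D \<in> carrier (R Quot I)"
    then obtain b where b: "b \<in> carrier R" "D = I +>\<^bsub>R\<^esub> b" by (rule quot_elem)
    show "the_elem (h ` (C \<otimes>\<^bsub>R Quot I\<^esub> D)) = the_elem (h ` C) \<otimes>\<^bsub>S\<^esub> the_elem (h ` D)"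
      using a b ring_hom_mult[OF p a(1) b(1)] ev[of "a \<otimes>\<^bsub>R\<^esub> b"] ev h by (simp add: ring_hom_mult)
    show "the_elem (h ` (C \<oplus>\<^bsub>R Quot I\<^esub> D)) = the_elem (h ` C) \<oplus>\<^bsub>S\<^esub> the_elem (h ` D)"
      using a b ring_hom_add[OF p a(1) b(1)] ev[of "a \<oplus>\<^bsub>R\<^esub> b"] ev h by (simp add: ring_hom_add)
  next
    show "the_elem (h ` \<one>\<^bsub>R Quot I\<^esub>) = \<one>\<^bsub>S\<^esub>"
      using ring_hom_one[OF p] ev[of "\<one>\<^bsub>R\<^esub>"] h by (simp add: ring_hom_one)
  qed
qed

lemma hom_zero_Idl:
  assumes R: "ring R" and S: "ring S" and h: "h \<in> ring_hom R S" and G: "G \<subseteq> carrier R"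
    and z: "\<And>x. x \<in> G \<Longrightarrow> h x = \<zero>\<^bsub>S\<^esub>" and x: "x \<in> Idl\<^bsub>R\<^esub> G"
  shows "h x = \<zero>\<^bsub>S\<^esub>"
proof -
  interpret h: ring_hom_ring R S h using R S h by (rule ring_hom_ringI2)
  have "x \<in> a_kernel R S h" if "x \<in> G" for x
    using G z[OF that] that unfolding a_kernel_def' by blast
  then have "Idl\<^bsub>R\<^esub> G \<subseteq> a_kernel R S h"
    using h.R.genideal_minimal[OF h.kernel_is_ideal] by blast
  then show ?thesis using x unfolding a_kernel_def' by blast
qed

lemma ring_hom_minus:
  assumes "ring R" "ring S" "h \<in> ring_hom R S" "a \<in> carrier R" "b \<in> carrier R"
  shows "h (a \<ominus>\<^bsub>R\<^esub> b) = h a \<ominus>\<^bsub>S\<^esub> h b"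
proof -
  interpret h: ring_hom_ring R S h using assms(1-3) by (rule ring_hom_ringI2)
  show ?thesis using assms by (simp add: a_minus_def)
qed

subsection \<open>The symmetric algebra of an ideal\<close>

locale ring_with_ideal = cring R + J: ideal J R for R (structure) and J
begin

abbreviation "T \<equiv> mpoly_ring R J"
abbreviation "sym_gens \<equiv> {indexed_var (a \<oplus> b) \<ominus>\<^bsub>T\<^esub> (indexed_var a \<oplus>\<^bsub>T\<^esub> indexed_var b) | a b. a \<in> J \<and> b \<in> J} \<union>
         {indexed_var (r \<otimes> a) \<ominus>\<^bsub>T\<^esub> (indexed_const r \<otimes>\<^bsub>T\<^esub> indexed_var a) | r a. r \<in> carrier R \<and> a \<in> J}"

sublocale T: cring T by (rule mpoly_cring)

lemma sym_relations_eq: "sym_relations R J = Idl\<^bsub>T\<^esub> sym_gens"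
  by (simp add: sym_relations_def Let_def)

lemma sym_gens_closed: "sym_gens \<subseteq> carrier T"
  by (auto intro!: T.minus_closed T.a_closed T.m_closed indexed_var_closed mpoly_closed J.I_l_closed
      additive_subgroup.a_closed[OF J.additive_subgroup_axioms])

sublocale rel: ideal "sym_relations R J" T
  unfolding sym_relations_eq by (rule T.genideal_ideal[OF sym_gens_closed])

sublocale S: cring "Sym R J"
  unfolding Sym_def by (rule rel.quotient_is_cring) (rule mpoly_cring)

lemma proj_hom: "(+>\<^bsub>T\<^esub>) (sym_relations R J) \<in> ring_hom T (Sym R J)"
  unfolding Sym_def by (rule rel.rcos_ring_hom)

lemma Sym_const_hom: "Sym_const R J \<in> ring_hom R (Sym R J)"
proof -
  have "Sym_const R J = (+>\<^bsub>T\<^esub>) (sym_relations R J) \<circ> indexed_const"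
    by (auto simp: Sym_const_def)
  then show ?thesis using ring_hom_trans[OF indexed_const_hom proj_hom] by simp
qed

lemma Sym_const_closed: "r \<in> carrier R \<Longrightarrow> Sym_const R J r \<in> carrier (Sym R J)"
  using Sym_const_hom by (rule ring_hom_closed)

lemma Sym_gen_closed: "a \<in> J \<Longrightarrow> Sym_gen R J a \<in> carrier (Sym R J)"
  unfolding Sym_gen_def using proj_hom by (rule ring_hom_closed) (rule indexed_var_closed)

lemma Sym_gen_add:
  assumes "a \<in> J" "b \<in> J"
  shows "Sym_gen R J (a \<oplus> b) = Sym_gen R J a \<oplus>\<^bsub>Sym R J\<^esub> Sym_gen R J b"
proof -
  have ab: "a \<oplus> b \<in> J" using assms by (rule additive_subgroup.a_closed[OF J.additive_subgroup_axioms])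
  have "indexed_var (a \<oplus> b) \<ominus>\<^bsub>T\<^esub> (indexed_var a \<oplus>\<^bsub>T\<^esub> indexed_var b) \<in> sym_relations R J"
    unfolding sym_relations_eq using assms T.genideal_self[OF sym_gens_closed] by blast
  then have "Sym_gen R J (a \<oplus> b) = sym_relations R J +>\<^bsub>T\<^esub> (indexed_var a \<oplus>\<^bsub>T\<^esub> indexed_var b)"
    unfolding Sym_gen_def using assms ab
    by (subst (asm) T.quotient_eq_iff_same_a_r_cos[OF rel.is_ideal]) (auto intro: indexed_var_closed)
  also have "\<dots> = Sym_gen R J a \<oplus>\<^bsub>Sym R J\<^esub> Sym_gen R J b"
    unfolding Sym_gen_def using assms by (intro ring_hom_add[OF proj_hom]) (auto intro: indexed_var_closed)
  finally show ?thesis .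
qed

lemma Sym_gen_smult:
  assumes "r \<in> carrier R" "a \<in> J"
  shows "Sym_gen R J (r \<otimes> a) = Sym_const R J r \<otimes>\<^bsub>Sym R J\<^esub> Sym_gen R J a"
proof -
  have ab: "r \<otimes> a \<in> J" using assms by (intro J.I_l_closed)
  have "indexed_var (r \<otimes> a) \<ominus>\<^bsub>T\<^esub> (indexed_const r \<otimes>\<^bsub>T\<^esub> indexed_var a) \<in> sym_relations R J"
    unfolding sym_relations_eq using assms T.genideal_self[OF sym_gens_closed] by blast
  then have "Sym_gen R J (r \<otimes> a) = sym_relations R J +>\<^bsub>T\<^esub> (indexed_const r \<otimes>\<^bsub>T\<^esub> indexed_var a)"
    unfolding Sym_gen_def using assms ab
    by (subst (asm) T.quotient_eq_iff_same_a_r_cos[OF rel.is_ideal]) (auto intro: indexed_var_closed mpoly_closed)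
  also have "\<dots> = Sym_const R J r \<otimes>\<^bsub>Sym R J\<^esub> Sym_gen R J a"
    unfolding Sym_gen_def Sym_const_def using assms
    by (intro ring_hom_mult[OF proj_hom]) (auto intro: indexed_var_closed mpoly_closed)
  finally show ?thesis .
qed

lemma Sym_gen_zero: "Sym_gen R J \<zero> = \<zero>\<^bsub>Sym R J\<^esub>"
proof -
  have z: "\<zero> \<in> J" by (rule additive_subgroup.zero_closed[OF J.additive_subgroup_axioms])
  have "Sym_gen R J \<zero> = Sym_const R J \<zero> \<otimes>\<^bsub>Sym R J\<^esub> Sym_gen R J \<zero>"
    using Sym_gen_smult[OF zero_closed z] by simp
  also have "Sym_const R J \<zero> = \<zero>\<^bsub>Sym R J\<^esub>"
    by (rule ring_hom_zero'[OF Sym_const_hom]) unfold_locales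
  finally show ?thesis using Sym_gen_closed[OF z] by simp
qed

lemma const_gen_subset:
  "Sym_const R J ` carrier R \<subseteq> carrier (Sym R J)" "Sym_gen R J ` J \<subseteq> carrier (Sym R J)"
  using Sym_const_closed Sym_gen_closed by auto

text \<open>Passing to the quotient commutes with forming expressions of given degree.\<close>

lemma Sym_deg_eq_forms:
  "Sym_deg R J d = {s. (d, s) \<in> forms (Sym R J) (Sym_const R J ` carrier R) (Sym_gen R J ` J)}"
proof -
  have im: "(+>\<^bsub>T\<^esub>) (sym_relations R J) ` (indexed_const ` carrier R) = Sym_const R J ` carrier R"
    "(+>\<^bsub>T\<^esub>) (sym_relations R J) ` (indexed_var ` J) = Sym_gen R J ` J"
    by (auto simp: Sym_const_def Sym_gen_def)
  have cl: "indexed_const ` carrier R \<subseteq> carrier T" "indexed_var ` J \<subseteq> carrier T"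
    by (auto intro: mpoly_closed indexed_var_closed)
  show ?thesis
  proof (intro subset_antisym subsetI)
    fix s assume "s \<in> Sym_deg R J d"
    then obtain P where "(d, P) \<in> forms T (indexed_const ` carrier R) (indexed_var ` J)"
        "s = sym_relations R J +>\<^bsub>T\<^esub> P"
      by (auto simp: Sym_deg_def homogeneous_eq_forms)
    then show "s \<in> {s. (d, s) \<in> forms (Sym R J) (Sym_const R J ` carrier R) (Sym_gen R J ` J)}"
      using forms_hom[OF proj_hom T.cring_axioms S.cring_axioms cl] im by auto
  next
    fix s assume "s \<in> {s. (d, s) \<in> forms (Sym R J) (Sym_const R J ` carrier R) (Sym_gen R J ` J)}"
    then have s: "(d, s) \<in> forms (Sym R J) (Sym_const R J ` carrier R) (Sym_gen R J ` J)" by simp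
    obtain P where "(d, P) \<in> forms T (indexed_const ` carrier R) (indexed_var ` J)"
        "sym_relations R J +>\<^bsub>T\<^esub> P = s"
      using forms_lift[OF proj_hom T.cring_axioms S.cring_axioms cl equalityD2[OF im(1)] equalityD2[OF im(2)] s]
      by (elim exE conjE)
    then show "s \<in> Sym_deg R J d" by (auto simp: Sym_deg_def homogeneous_eq_forms)
  qed
qed

lemma Sym_hom_eqI:
  assumes Q: "cring Q" and f: "f \<in> ring_hom (Sym R J) Q" and g: "g \<in> ring_hom (Sym R J) Q"
    and c: "\<And>r. r \<in> carrier R \<Longrightarrow> f (Sym_const R J r) = g (Sym_const R J r)"
    and x: "\<And>a. a \<in> J \<Longrightarrow> f (Sym_gen R J a) = g (Sym_gen R J a)"
    and s: "s \<in> carrier (Sym R J)"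
  shows "f s = g s"
proof -
  from s obtain P where P: "P \<in> carrier T" "s = sym_relations R J +>\<^bsub>T\<^esub> P"
    unfolding Sym_def by (rule quot_elem)
  have "(f \<circ> (+>\<^bsub>T\<^esub>) (sym_relations R J)) P = (g \<circ> (+>\<^bsub>T\<^esub>) (sym_relations R J)) P"
    using cring_axioms Q ring_hom_trans[OF proj_hom f] ring_hom_trans[OF proj_hom g]
    by (rule mpoly_hom_eqI) (use c x P in \<open>auto simp: Sym_const_def Sym_gen_def\<close>)
  then show ?thesis using P by simp
qed

context
  fixes Q h v
  assumes Q: "cring Q" and h: "h \<in> ring_hom R Q" and v: "v \<in> J \<rightarrow> carrier Q"
    and va: "\<And>a b. a \<in> J \<Longrightarrow> b \<in> J \<Longrightarrow> v (a \<oplus> b) = v a \<oplus>\<^bsub>Q\<^esub> v b"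
    and vm: "\<And>r a. r \<in> carrier R \<Longrightarrow> a \<in> J \<Longrightarrow> v (r \<otimes> a) = h r \<otimes>\<^bsub>Q\<^esub> v a"
begin

interpretation Q: cring Q by (rule Q)
interpretation E: mpoly_val R Q J v by unfold_locales (rule v)

lemma eval_relation_zero: "P \<in> sym_relations R J \<Longrightarrow> mpoly_eval R Q h v P = \<zero>\<^bsub>Q\<^esub>"
proof (rule hom_zero_Idl[OF T.ring_axioms Q.ring_axioms E.eval_ring_hom[OF h] sym_gens_closed])
  note vs = indexed_var_closed additive_subgroup.a_closed[OF J.additive_subgroup_axioms] J.I_l_closed
    mpoly_closed T.a_closed T.m_closed
  note mh = ring_hom_minus[OF T.ring_axioms Q.ring_axioms E.eval_ring_hom[OF h]]
    ring_hom_add[OF E.eval_ring_hom[OF h]] ring_hom_mult[OF E.eval_ring_hom[OF h]]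
  fix x assume "x \<in> sym_gens"
  then show "mpoly_eval R Q h v x = \<zero>\<^bsub>Q\<^esub>"
  proof
    assume "x \<in> {indexed_var (a \<oplus> b) \<ominus>\<^bsub>T\<^esub> (indexed_var a \<oplus>\<^bsub>T\<^esub> indexed_var b) | a b. a \<in> J \<and> b \<in> J}"
    then obtain a b where ab: "a \<in> J" "b \<in> J"
      "x = indexed_var (a \<oplus> b) \<ominus>\<^bsub>T\<^esub> (indexed_var a \<oplus>\<^bsub>T\<^esub> indexed_var b)" by blast
    then show ?thesis using v by (simp add: vs mh E.eval_var[OF h] va Pi_def)
  next
    assume "x \<in> {indexed_var (r \<otimes> a) \<ominus>\<^bsub>T\<^esub> (indexed_const r \<otimes>\<^bsub>T\<^esub> indexed_var a) | r a. r \<in> carrier R \<and> a \<in> J}"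
    then obtain r a where ra: "r \<in> carrier R" "a \<in> J"
      "x = indexed_var (r \<otimes> a) \<ominus>\<^bsub>T\<^esub> (indexed_const r \<otimes>\<^bsub>T\<^esub> indexed_var a)" by blast
    then show ?thesis using v h
      by (simp add: vs mh E.eval_var[OF h] E.eval_hom_const[OF h] vm Pi_def ring_hom_closed)
  qed
qed (simp add: sym_relations_eq)

lemma Sym_lift_hom: "Sym_lift R J Q h v \<in> ring_hom (Sym R J) Q"
proof -
  have "Sym_lift R J Q h v = (\<lambda>C. the_elem (mpoly_eval R Q h v ` C))"
    by (auto simp: Sym_lift_def)
  then show ?thesis unfolding Sym_def
    using quot_lift_hom[OF rel.is_ideal Q.ring_axioms E.eval_ring_hom[OF h] eval_relation_zero] by simp
qed

lemma Sym_lift_const: "r \<in> carrier R \<Longrightarrow> Sym_lift R J Q h v (Sym_const R J r) = h r"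
  unfolding Sym_lift_def Sym_const_def
  using quot_lift_eval[OF rel.is_ideal Q.ring_axioms E.eval_ring_hom[OF h] eval_relation_zero]
  by (simp add: mpoly_closed E.eval_hom_const[OF h])

lemma Sym_lift_gen: "a \<in> J \<Longrightarrow> Sym_lift R J Q h v (Sym_gen R J a) = v a"
  unfolding Sym_lift_def Sym_gen_def
  using quot_lift_eval[OF rel.is_ideal Q.ring_axioms E.eval_ring_hom[OF h] eval_relation_zero]
  by (simp add: indexed_var_closed E.eval_var[OF h])

end

subsection \<open>The Rees algebra\<close>

abbreviation "JP d \<equiv> {a. (d, a) \<in> forms R (carrier R) J}"

lemma J_sub: "J \<subseteq> carrier R" by (rule J.a_subset)

lemma JP_ideal: "ideal (JP d) R"
  using ideal_power_eq_forms[OF J.is_ideal, of d] by simp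

lemma JP_mult: "a \<in> JP d \<Longrightarrow> b \<in> JP e \<Longrightarrow> a \<otimes> b \<in> JP (d + e)"
  using forms_mult[of "carrier R" J d a e b] J_sub by auto

lemma ideal_finsum:
  assumes "ideal K R" "finite A" "\<And>i. i \<in> A \<Longrightarrow> f i \<in> K"
  shows "finsum R f A \<in> K"
proof -
  interpret K: ideal K R by fact
  from assms(2,3) show ?thesis
  proof induction
    case empty then show ?case by simp
  next
    case (insert x F)
    then have "f \<in> F \<rightarrow> carrier R" "f x \<in> carrier R" using K.Icarr by auto
    then show ?case using insert by simp
  qed
qed

lemma UP_ring: "UP_ring R" by (intro UP_ring.intro ring_axioms)

lemma UP_cr: "UP_cring R" by (rule UP_cring.intro[OF cring_axioms])

lemma UP_is_cring: "cring (UP R)" by (rule UP_cring.UP_cring[OF UP_cr])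

lemma UP_mult_at:
  "p \<in> up R \<Longrightarrow> q \<in> up R \<Longrightarrow> (p \<otimes>\<^bsub>UP R\<^esub> q) n = (\<Oplus>i\<in>{..n}. p i \<otimes> q (n - i))"
  "p \<in> up R \<Longrightarrow> q \<in> up R \<Longrightarrow> (p \<oplus>\<^bsub>UP R\<^esub> q) n = p n \<oplus> q n"
  by (simp_all add: UP_def)

lemma UP_uminus_at: "p \<in> up R \<Longrightarrow> (\<ominus>\<^bsub>UP R\<^esub> p) n = \<ominus> p n"
  using UP_ring.coeff_a_inv[OF UP_ring, of p n] UP_ring.UP_a_inv_closed[OF UP_ring, of p] by (simp add: UP_def)

lemma carrier_Rees: "carrier (Rees R J) = {f \<in> up R. \<forall>d. f d \<in> JP d}"
  using ideal_power_eq_forms(1)[OF J.is_ideal] by (simp add: Rees_def)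

lemma carrier_UP: "carrier (UP R) = up R" by (simp add: UP_def)

text \<open>Closure under products is \<open>J\<^sup>i J\<^sup>d\<^sup>-\<^sup>i \<subseteq> J\<^sup>d\<close>, applied in each summand of the convolution.\<close>

lemma Rees_subring: "subring (carrier (Rees R J)) (UP R)"
proof -
  interpret UP: cring "UP R" by (rule UP_is_cring)
  show ?thesis
  proof (rule UP.subringI)
  show "carrier (Rees R J) \<subseteq> carrier (UP R)" by (auto simp: carrier_Rees carrier_UP)
  show "\<one>\<^bsub>UP R\<^esub> \<in> carrier (Rees R J)"
  proof -
    have "(d, if d = 0 then \<one> else \<zero>) \<in> forms R (carrier R) J" for d
      by (cases "d = 0") (simp_all add: forms.const forms.zero)
    then show ?thesis by (simp add: carrier_Rees UP_def up_one_closed)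
  qed
  fix p assume p: "p \<in> carrier (Rees R J)"
  then have pu: "p \<in> up R" "\<And>d. p d \<in> JP d" by (auto simp: carrier_Rees)
  have "(d, \<ominus> p d) \<in> forms R (carrier R) J" for d
    using ideal_uminus[OF JP_ideal[of d]] pu by blast
  moreover have "\<ominus>\<^bsub>UP R\<^esub> p \<in> up R" using UP_ring.UP_a_inv_closed[OF UP_ring, of p] pu(1) by (simp add: carrier_UP)
  ultimately show "\<ominus>\<^bsub>UP R\<^esub> p \<in> carrier (Rees R J)"
    using pu(1) \<open>\<And>d. (d, \<ominus> p d) \<in> forms R (carrier R) J\<close> by (simp add: carrier_Rees UP_uminus_at)
  fix q assume q: "q \<in> carrier (Rees R J)"
  then have qu: "q \<in> up R" "\<And>d. q d \<in> JP d" by (auto simp: carrier_Rees)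
  have "(\<Oplus>i\<in>{..n}. p i \<otimes> q (n - i)) \<in> JP n" for n
  proof (rule ideal_finsum[OF JP_ideal])
    fix i assume "i \<in> {..n}"
    then show "p i \<otimes> q (n - i) \<in> JP n" using JP_mult[OF pu(2)[of i] qu(2)[of "n - i"]] by simp
  qed simp
  moreover have "p \<otimes>\<^bsub>UP R\<^esub> q \<in> up R" using UP_ring.UP_mult_closed[OF UP_ring, of p q] pu(1) qu(1) by (simp add: carrier_UP)
  ultimately show "p \<otimes>\<^bsub>UP R\<^esub> q \<in> carrier (Rees R J)"
    using pu(1) qu(1) by (simp add: carrier_Rees UP_mult_at)
  have "p \<oplus>\<^bsub>UP R\<^esub> q \<in> up R" using UP_ring.UP_a_closed[OF UP_ring, of p q] pu(1) qu(1) by (simp add: carrier_UP)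
  then show "p \<oplus>\<^bsub>UP R\<^esub> q \<in> carrier (Rees R J)"
    using pu qu by (simp add: carrier_Rees UP_mult_at forms.add)
qed
qed

lemma Rees_simps:
  "monoid.mult (Rees R J) = monoid.mult (UP R)" "monoid.one (Rees R J) = monoid.one (UP R)"
  "ring.zero (Rees R J) = ring.zero (UP R)" "ring.add (Rees R J) = ring.add (UP R)"
  by (simp_all add: Rees_def)

lemma Rees_eq: "Rees R J = UP R\<lparr>carrier := carrier (Rees R J)\<rparr>"
  by (simp add: Rees_def)

lemma Rees_cring: "cring (Rees R J)"
proof -
  interpret UP: cring "UP R" by (rule UP_is_cring)
  have "subcring (carrier (Rees R J)) (UP R)" by (rule UP.subcringI'[OF Rees_subring])
  then have "cring (UP R\<lparr>carrier := carrier (Rees R J)\<rparr>)"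
    using UP.subcring_iff[OF subringE(1)[OF Rees_subring]] by blast
  then show ?thesis using Rees_eq by metis
qed

lemma monom_at: "a \<in> carrier R \<Longrightarrow> up_ring.monom (UP R) a d = (\<lambda>i. if i = d then a else \<zero>)"
  by (simp add: UP_def)

lemma monom_Rees: "a \<in> JP d \<Longrightarrow> up_ring.monom (UP R) a d \<in> carrier (Rees R J)"
proof -
  assume a: "a \<in> JP d"
  then have aR: "a \<in> carrier R" using J_sub by (auto intro: forms_closed[of "carrier R" J])
  have "up_ring.monom (UP R) a d \<in> up R" using UP_ring.monom_closed[OF UP_ring aR, of d] by (simp add: carrier_UP)
  then show ?thesis using a aR by (simp add: carrier_Rees monom_at forms.zero)
qed

lemma JP_carrier: "(d, a) \<in> forms R (carrier R) J \<Longrightarrow> a \<in> carrier R"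
  using J_sub by (auto intro: forms_closed[of "carrier R" J])

lemma monom0_hom: "(\<lambda>r. up_ring.monom (UP R) r 0) \<in> ring_hom R (Rees R J)"
proof (rule ring_hom_memI)
  fix a b assume ab: "a \<in> carrier R" "b \<in> carrier R"
  show "up_ring.monom (UP R) (a \<otimes> b) 0 = up_ring.monom (UP R) a 0 \<otimes>\<^bsub>Rees R J\<^esub> up_ring.monom (UP R) b 0"
    using UP_ring.monom_mult[OF UP_ring, of a b 0 0] ab by (simp add: Rees_simps)
qed (auto intro!: monom_Rees forms.const
    simp: Rees_simps UP_ring.monom_add[OF UP_ring] UP_ring.monom_one[OF UP_ring])

lemma J_JP1: "J \<subseteq> JP 1"
proof
  fix a assume a: "a \<in> J"
  then have "(Suc 0, \<one> \<otimes> a) \<in> forms R (carrier R) J" by (intro forms.mult forms.const) auto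
  then show "a \<in> JP 1" using a J_sub by auto
qed

lemma monom1_Rees: "a \<in> J \<Longrightarrow> up_ring.monom (UP R) a 1 \<in> carrier (Rees R J)"
  using J_JP1 by (intro monom_Rees) auto

lemma monom_mult_Rees:
  "a \<in> carrier R \<Longrightarrow> b \<in> carrier R \<Longrightarrow> up_ring.monom (UP R) a d \<otimes>\<^bsub>Rees R J\<^esub> up_ring.monom (UP R) b e
     = up_ring.monom (UP R) (a \<otimes> b) (d + e)"
  "a \<in> carrier R \<Longrightarrow> b \<in> carrier R \<Longrightarrow> up_ring.monom (UP R) a d \<oplus>\<^bsub>Rees R J\<^esub> up_ring.monom (UP R) b d
     = up_ring.monom (UP R) (a \<oplus> b) d"
  by (simp_all add: Rees_simps UP_ring.monom_mult[OF UP_ring]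
      UP_ring.monom_add[OF UP_ring])

lemma Sym_to_Rees_hom: "Sym_to_Rees R J \<in> ring_hom (Sym R J) (Rees R J)"
  and Sym_to_Rees_const: "r \<in> carrier R \<Longrightarrow> Sym_to_Rees R J (Sym_const R J r) = up_ring.monom (UP R) r 0"
  and Sym_to_Rees_gen: "a \<in> J \<Longrightarrow> Sym_to_Rees R J (Sym_gen R J a) = up_ring.monom (UP R) a 1"
proof -
  have 1: "(\<lambda>a. up_ring.monom (UP R) a 1) \<in> J \<rightarrow> carrier (Rees R J)" using monom1_Rees by auto
  have 2: "up_ring.monom (UP R) (a \<oplus> b) 1 = up_ring.monom (UP R) a 1 \<oplus>\<^bsub>Rees R J\<^esub> up_ring.monom (UP R) b 1"
    if "a \<in> J" "b \<in> J" for a b using that J_sub by (auto simp: monom_mult_Rees)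
  have 3: "up_ring.monom (UP R) (r \<otimes> a) 1 = up_ring.monom (UP R) r 0 \<otimes>\<^bsub>Rees R J\<^esub> up_ring.monom (UP R) a 1"
    if "r \<in> carrier R" "a \<in> J" for a r using that J_sub monom_mult_Rees(1)[of r a 0 1] by auto
  note * = Rees_cring monom0_hom 1 2 3
  show "Sym_to_Rees R J \<in> ring_hom (Sym R J) (Rees R J)"
    unfolding Sym_to_Rees_def by (rule Sym_lift_hom[OF *])
  show "r \<in> carrier R \<Longrightarrow> Sym_to_Rees R J (Sym_const R J r) = up_ring.monom (UP R) r 0"
    unfolding Sym_to_Rees_def by (rule Sym_lift_const[OF *])
  show "a \<in> J \<Longrightarrow> Sym_to_Rees R J (Sym_gen R J a) = up_ring.monom (UP R) a 1"
    unfolding Sym_to_Rees_def by (rule Sym_lift_gen[OF *])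
qed

end

subsection \<open>Tensor products\<close>

locale tensor_data = R: cring R + S: cring S + T: cring T
  for R (structure) and S (structure) and T (structure) +
  fixes f g
  assumes f: "f \<in> ring_hom R S" and g: "g \<in> ring_hom R T"
begin

abbreviation "P \<equiv> mpoly_ring S (carrier T)"
abbreviation "TX \<equiv> tensor R S T f g"
abbreviation "rels \<equiv> tensor_relations R S T f g"
definition inl where "inl s = rels +>\<^bsub>P\<^esub> (ring.indexed_const S s)"
definition inr where "inr t = rels +>\<^bsub>P\<^esub> (ring.indexed_var S t)"
abbreviation "gens \<equiv> {S.indexed_var (t \<oplus>\<^bsub>T\<^esub> u) \<ominus>\<^bsub>P\<^esub> (S.indexed_var t \<oplus>\<^bsub>P\<^esub> S.indexed_var u) | t u. t \<in> carrier T \<and> u \<in> carrier T} \<union>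
         {S.indexed_var (t \<otimes>\<^bsub>T\<^esub> u) \<ominus>\<^bsub>P\<^esub> (S.indexed_var t \<otimes>\<^bsub>P\<^esub> S.indexed_var u) | t u. t \<in> carrier T \<and> u \<in> carrier T} \<union>
         {S.indexed_var (g r) \<ominus>\<^bsub>P\<^esub> S.indexed_const (f r) | r. r \<in> carrier R}"

sublocale P: cring P by (rule S.mpoly_cring)

lemma rels_eq: "rels = Idl\<^bsub>P\<^esub> gens"
  by (simp add: tensor_relations_def Let_def)

lemma gens_closed: "gens \<subseteq> carrier P"
  using f g by (auto intro!: P.minus_closed P.a_closed P.m_closed S.indexed_var_closed S.mpoly_closed intro: ring_hom_closed)

sublocale rel: ideal rels P
  unfolding rels_eq by (rule P.genideal_ideal[OF gens_closed])

sublocale TX: cring TX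
  unfolding tensor_def by (rule rel.quotient_is_cring) (rule S.mpoly_cring)

lemma proj: "(+>\<^bsub>P\<^esub>) rels \<in> ring_hom P TX"
  unfolding tensor_def by (rule rel.rcos_ring_hom)

lemma gens_eq: "a \<ominus>\<^bsub>P\<^esub> b \<in> gens \<Longrightarrow> a \<in> carrier P \<Longrightarrow> b \<in> carrier P \<Longrightarrow> rels +>\<^bsub>P\<^esub> a = rels +>\<^bsub>P\<^esub> b"
  using P.quotient_eq_iff_same_a_r_cos[OF rel.is_ideal, of a b] P.genideal_self[OF gens_closed] rels_eq by blast

lemma inl_hom: "inl \<in> ring_hom S TX"
proof -
  have "inl = (+>\<^bsub>P\<^esub>) rels \<circ> S.indexed_const" by (auto simp: inl_def)
  then show ?thesis using ring_hom_trans[OF S.indexed_const_hom proj] by simp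
qed

lemma inr_inl: "r \<in> carrier R \<Longrightarrow> inr (g r) = inl (f r)"
  unfolding inr_def inl_def
  by (rule gens_eq) (use f g in \<open>auto intro!: S.indexed_var_closed S.mpoly_closed intro: ring_hom_closed\<close>)

lemma inr_hom: "inr \<in> ring_hom T TX"
proof (rule ring_hom_memI)
  show "inr \<one>\<^bsub>T\<^esub> = \<one>\<^bsub>TX\<^esub>"
    using inr_inl[of "\<one>\<^bsub>R\<^esub>"] f g inl_hom by (simp add: ring_hom_one)
  fix t assume t: "t \<in> carrier T"
  then show "inr t \<in> carrier TX" unfolding inr_def by (intro ring_hom_closed[OF proj] S.indexed_var_closed)
  fix u assume u: "u \<in> carrier T"
  have "inr (t \<otimes>\<^bsub>T\<^esub> u) = rels +>\<^bsub>P\<^esub> (S.indexed_var t \<otimes>\<^bsub>P\<^esub> S.indexed_var u)"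
    unfolding inr_def by (rule gens_eq) (use t u in \<open>auto intro!: S.indexed_var_closed P.m_closed\<close>)
  then show "inr (t \<otimes>\<^bsub>T\<^esub> u) = inr t \<otimes>\<^bsub>TX\<^esub> inr u"
    unfolding inr_def using t u by (simp add: ring_hom_mult[OF proj] S.indexed_var_closed)
  have "inr (t \<oplus>\<^bsub>T\<^esub> u) = rels +>\<^bsub>P\<^esub> (S.indexed_var t \<oplus>\<^bsub>P\<^esub> S.indexed_var u)"
    unfolding inr_def by (rule gens_eq) (use t u in \<open>auto intro!: S.indexed_var_closed P.a_closed\<close>)
  then show "inr (t \<oplus>\<^bsub>T\<^esub> u) = inr t \<oplus>\<^bsub>TX\<^esub> inr u"
    unfolding inr_def using t u by (simp add: ring_hom_add[OF proj] S.indexed_var_closed)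
qed

lemma pure_tensor_eq:
  "s \<in> carrier S \<Longrightarrow> t \<in> carrier T \<Longrightarrow> pure_tensor R S T f g s t = inl s \<otimes>\<^bsub>TX\<^esub> inr t"
  unfolding pure_tensor_def Let_def inl_def inr_def
  by (simp add: ring_hom_mult[OF proj] S.indexed_var_closed S.mpoly_closed)

lemma pure_tensor_one:
  "s \<in> carrier S \<Longrightarrow> pure_tensor R S T f g s \<one>\<^bsub>T\<^esub> = inl s"
  "t \<in> carrier T \<Longrightarrow> pure_tensor R S T f g \<one>\<^bsub>S\<^esub> t = inr t"
  using ring_hom_closed[OF inl_hom] ring_hom_closed[OF inr_hom]
  by (simp_all add: pure_tensor_eq ring_hom_one[OF inl_hom] ring_hom_one[OF inr_hom])

context
  fixes Q h v
  assumes Q: "cring Q" and h: "h \<in> ring_hom S Q" and v: "v \<in> ring_hom T Q"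
    and hv: "\<And>r. r \<in> carrier R \<Longrightarrow> v (g r) = h (f r)"
begin

interpretation Q: cring Q by (rule Q)
interpretation E: mpoly_val S Q "carrier T" v
  by unfold_locales (use v in \<open>auto intro: ring_hom_closed\<close>)

lemma tensor_eval_zero: "x \<in> rels \<Longrightarrow> mpoly_eval S Q h v x = \<zero>\<^bsub>Q\<^esub>"
proof (rule hom_zero_Idl[OF P.ring_axioms Q.ring_axioms E.eval_ring_hom[OF h] gens_closed])
  note vs = S.indexed_var_closed S.mpoly_closed ring_hom_closed[OF f] ring_hom_closed[OF g]
    ring_hom_closed[OF v] ring_hom_closed[OF h]
  note mh = ring_hom_minus[OF P.ring_axioms Q.ring_axioms E.eval_ring_hom[OF h]]
    ring_hom_add[OF E.eval_ring_hom[OF h]] ring_hom_mult[OF E.eval_ring_hom[OF h]]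
    E.eval_var[OF h] E.eval_hom_const[OF h] ring_hom_add[OF v] ring_hom_mult[OF v]
  fix x assume "x \<in> gens"
  then consider t u where "t \<in> carrier T" "u \<in> carrier T"
      "x = S.indexed_var (t \<oplus>\<^bsub>T\<^esub> u) \<ominus>\<^bsub>P\<^esub> (S.indexed_var t \<oplus>\<^bsub>P\<^esub> S.indexed_var u)"
    | t u where "t \<in> carrier T" "u \<in> carrier T"
      "x = S.indexed_var (t \<otimes>\<^bsub>T\<^esub> u) \<ominus>\<^bsub>P\<^esub> (S.indexed_var t \<otimes>\<^bsub>P\<^esub> S.indexed_var u)"
    | r where "r \<in> carrier R" "x = S.indexed_var (g r) \<ominus>\<^bsub>P\<^esub> S.indexed_const (f r)"
    by blast
  then show "mpoly_eval S Q h v x = \<zero>\<^bsub>Q\<^esub>"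
    by cases (simp_all add: vs mh hv)
qed (simp add: rels_eq)

lemma tensor_lift_hom: "(\<lambda>C. the_elem (mpoly_eval S Q h v ` C)) \<in> ring_hom TX Q"
  unfolding tensor_def
  by (rule quot_lift_hom[OF rel.is_ideal Q.ring_axioms E.eval_ring_hom[OF h] tensor_eval_zero])

lemma tensor_lift_inl: "s \<in> carrier S \<Longrightarrow> the_elem (mpoly_eval S Q h v ` inl s) = h s"
  unfolding inl_def
  using quot_lift_eval[OF rel.is_ideal Q.ring_axioms E.eval_ring_hom[OF h] tensor_eval_zero]
  by (simp add: S.mpoly_closed E.eval_hom_const[OF h])

lemma tensor_lift_inr: "t \<in> carrier T \<Longrightarrow> the_elem (mpoly_eval S Q h v ` inr t) = v t"
  unfolding inr_def
  using quot_lift_eval[OF rel.is_ideal Q.ring_axioms E.eval_ring_hom[OF h] tensor_eval_zero]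
  by (simp add: S.indexed_var_closed E.eval_var[OF h])

end

end

section \<open>The degree-wise kernel of the map to the quasi-symmetric algebra\<close>

lemma RDirProd_simps:
  "carrier (RDirProd R S) = carrier R \<times> carrier S"
  "monoid.mult (RDirProd R S) p q = (fst p \<otimes>\<^bsub>R\<^esub> fst q, snd p \<otimes>\<^bsub>S\<^esub> snd q)"
  "ring.add (RDirProd R S) p q = (fst p \<oplus>\<^bsub>R\<^esub> fst q, snd p \<oplus>\<^bsub>S\<^esub> snd q)"
  "monoid.one (RDirProd R S) = (\<one>\<^bsub>R\<^esub>, \<one>\<^bsub>S\<^esub>)"
  "ring.zero (RDirProd R S) = (\<zero>\<^bsub>R\<^esub>, \<zero>\<^bsub>S\<^esub>)"
  by (auto simp: RDirProd_def DirProd_def monoid.defs split: prod.splits)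

lemma RDirProd_cring:
  assumes "cring R" "cring S" shows "cring (RDirProd R S)"
proof -
  interpret R: cring R by fact
  interpret S: cring S by fact
  interpret ring "RDirProd R S" by (rule RDirProd_ring) unfold_locales
  show ?thesis
    by unfold_locales (auto simp: RDirProd_simps R.m_comm S.m_comm)
qed

lemma fst_hom: "fst \<in> ring_hom (RDirProd R S) R"
  and snd_hom: "snd \<in> ring_hom (RDirProd R S) S"
  by (auto intro!: ring_hom_memI simp: RDirProd_simps)

lemma RDirProd_minus:
  assumes "cring R" "cring S" "p \<in> carrier (RDirProd R S)" "q \<in> carrier (RDirProd R S)"
  shows "p \<ominus>\<^bsub>RDirProd R S\<^esub> q = (fst p \<ominus>\<^bsub>R\<^esub> fst q, snd p \<ominus>\<^bsub>S\<^esub> snd q)"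
proof -
  note c = RDirProd_cring[OF assms(1,2)]
  note r = cring.axioms(1)[OF assms(1)] cring.axioms(1)[OF assms(2)] cring.axioms(1)[OF c]
  show ?thesis
    using ring_hom_minus[OF r(3,1) fst_hom assms(3,4)] ring_hom_minus[OF r(3,2) snd_hom assms(3,4)]
    by (metis prod.collapse)
qed

context ring_with_ideal
begin

text \<open>The graded ideal \<open>\<Oplus>\<^sub>d K J\<^sup>d\<^sup>-\<^sup>1 t\<^sup>d\<close>. In degree \<open>0\<close> the truncated exponent gives \<open>K\<close>.\<close>

definition shifted :: "'a set \<Rightarrow> (nat \<Rightarrow> 'a) set" where
  "shifted K = {u \<in> carrier (Rees R J). \<forall>d. u d \<in> ideal_prod R K (JP (d - 1))}"

context
  fixes K assumes K: "ideal K R"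
begin

lemma KJ_ideal: "ideal (ideal_prod R K (JP d)) R"
  by (rule ideal_prod_is_ideal[OF K JP_ideal])

lemma JP_decreasing: "JP (Suc d) \<subseteq> JP d"
proof
  fix a assume "a \<in> JP (Suc d)"
  then have "(Suc d, a) \<in> forms R (carrier R) J" by simp
  then have "(d, a) \<in> forms R (carrier R) J"
  proof (induction rule: forms_Suc_induct)
    case (mult a v)
    then have "a \<otimes> v \<in> JP d" using ideal.I_r_closed[OF JP_ideal, of a d v] J_sub by blast
    then show ?case by simp
  qed (rule forms.zero forms.add; assumption)+
  then show "a \<in> JP d" by simp
qed

lemma JP_mult_KJ:
  assumes a: "a \<in> JP i" and b: "b \<in> ideal_prod R K (JP (e - 1))"
  shows "a \<otimes> b \<in> ideal_prod R K (JP (i + e - 1))"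
  using b
proof induction
  case (prod k y)
  have y: "a \<otimes> y \<in> JP (i + (e - 1))" using JP_mult[OF a prod(2)] .
  have "a \<otimes> y \<in> JP (i + e - 1)"
  proof (cases "e = 0 \<and> i \<noteq> 0")
    case True
    then show ?thesis using y JP_decreasing[of "i - 1"] by auto
  next
    case False
    then have "i + (e - 1) = i + e - 1" by auto
    then show ?thesis using y by simp
  qed
  moreover have "a \<otimes> (k \<otimes> y) = k \<otimes> (a \<otimes> y)"
    using JP_carrier[of i a] JP_carrier[of "e - 1" y] a prod ideal.Icarr[OF K, of k] by (simp add: m_lcomm)
  ultimately show ?case using prod(1) by (simp add: ideal_prod.prod)
next
  case (sum s1 s2)
  have "s1 \<in> carrier R" "s2 \<in> carrier R" "a \<in> carrier R"
    using sum ideal.Icarr[OF KJ_ideal] JP_carrier[of i a] a by auto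
  then show ?case using sum by (simp add: r_distr ideal_prod.sum)
qed

lemma shifted_ideal: "ideal (shifted K) (Rees R J)"
proof -
  interpret Rs: cring "Rees R J" by (rule Rees_cring)
  have up: "u \<in> up R" if "u \<in> carrier (Rees R J)" for u using that by (simp add: carrier_Rees)
  have z: "\<zero>\<^bsub>Rees R J\<^esub> = (\<lambda>_. \<zero>)" by (simp add: Rees_simps UP_def)
  have neg: "(\<ominus>\<^bsub>Rees R J\<^esub> u) d = \<ominus> u d" if u: "u \<in> carrier (Rees R J)" for u d
  proof -
    have "(u \<oplus>\<^bsub>Rees R J\<^esub> (\<ominus>\<^bsub>Rees R J\<^esub> u)) d = \<zero>" using Rs.r_neg[OF u] z by simp
    then have "u d \<oplus> (\<ominus>\<^bsub>Rees R J\<^esub> u) d = \<zero>"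
      using up[OF u] up[OF Rs.a_inv_closed[OF u]] by (simp add: Rees_simps UP_mult_at)
    then show ?thesis
      using mem_upD[OF up[OF u]] mem_upD[OF up[OF Rs.a_inv_closed[OF u]]]
      by (metis minus_equality a_comm)
  qed
  show ?thesis
  proof (rule idealI)
    show "ring (Rees R J)" by unfold_locales
    show "subgroup (shifted K) (add_monoid (Rees R J))"
    proof
      show "shifted K \<subseteq> carrier (add_monoid (Rees R J))" by (auto simp: shifted_def)
      fix u w assume uw: "u \<in> shifted K" "w \<in> shifted K"
      then have cl: "u \<in> carrier (Rees R J)" "w \<in> carrier (Rees R J)" by (auto simp: shifted_def)
      have "(u \<oplus>\<^bsub>Rees R J\<^esub> w) d = u d \<oplus> w d" for d
        using up[OF cl(1)] up[OF cl(2)] by (simp add: Rees_simps UP_mult_at)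
      then show "u \<otimes>\<^bsub>add_monoid (Rees R J)\<^esub> w \<in> shifted K"
        using uw Rs.a_closed[OF cl] by (auto simp: shifted_def intro: ideal_prod.sum)
    next
      have "\<zero> \<in> ideal_prod R K (JP (d - 1))" for d
        using ideal_zero[OF KJ_ideal] .
      then show "\<one>\<^bsub>add_monoid (Rees R J)\<^esub> \<in> shifted K"
        using Rs.zero_closed by (simp add: shifted_def z)
    next
      fix u assume u: "u \<in> shifted K"
      then have cl: "u \<in> carrier (Rees R J)" by (simp add: shifted_def)
      have "\<ominus> u d \<in> ideal_prod R K (JP (d - 1))" for d
        using u ideal_uminus[OF KJ_ideal] unfolding shifted_def by blast
      then have "\<ominus>\<^bsub>Rees R J\<^esub> u \<in> shifted K"
        using Rs.a_inv_closed[OF cl] by (simp add: shifted_def neg[OF cl])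
      then show "inv\<^bsub>add_monoid (Rees R J)\<^esub> u \<in> shifted K" by (simp add: a_inv_def)
    qed
    fix u w assume u: "u \<in> shifted K" and w: "w \<in> carrier (Rees R J)"
    then have cl: "u \<in> carrier (Rees R J)" by (simp add: shifted_def)
    have wJ: "w i \<in> JP i" for i using w by (simp add: carrier_Rees)
    have uK: "u i \<in> ideal_prod R K (JP (i - 1))" for i using u by (simp add: shifted_def)
    have "(w \<otimes>\<^bsub>Rees R J\<^esub> u) n \<in> ideal_prod R K (JP (n - 1))" for n
    proof -
      have "(w \<otimes>\<^bsub>Rees R J\<^esub> u) n = (\<Oplus>i\<in>{..n}. w i \<otimes> u (n - i))"
        using up[OF cl] up[OF w] by (simp add: Rees_simps UP_mult_at)
      also have "\<dots> \<in> ideal_prod R K (JP (n - 1))"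
      proof (rule ideal_finsum[OF KJ_ideal])
        fix i assume "i \<in> {..n}"
        then show "w i \<otimes> u (n - i) \<in> ideal_prod R K (JP (n - 1))"
          using JP_mult_KJ[OF wJ uK, of i "n - i"] by simp
      qed simp
      finally show ?thesis .
    qed
    then show "w \<otimes>\<^bsub>Rees R J\<^esub> u \<in> shifted K" using Rs.m_closed[OF w cl] by (simp add: shifted_def)
    then show "u \<otimes>\<^bsub>Rees R J\<^esub> w \<in> shifted K" using Rs.m_comm[OF w cl] by simp
  qed
qed

end

end

text \<open>A closed embedding, locally: \<open>A\<close> is the local ring of the ambient scheme, \<open>B\<close> that of \<open>X\<close>.\<close>

locale embedded = A: ring_with_ideal A I + B: ring_with_ideal B J
  for A (structure) and I and B (structure) and J +
  fixes \<pi> assumes \<pi>: "\<pi> \<in> ring_hom A B" and surj: "\<pi> ` carrier A = carrier B"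
    and I_eq: "I = {a \<in> carrier A. \<pi> a \<in> J}"
begin

abbreviation "SB \<equiv> Sym B J"
abbreviation "K \<equiv> {a \<in> carrier A. \<pi> a = \<zero>\<^bsub>B\<^esub>}"
abbreviation "AS \<equiv> RDirProd A SB"
abbreviation "Wc \<equiv> (\<lambda>c. (c, Sym_const B J (\<pi> c))) ` carrier A"
abbreviation "Wv \<equiv> (\<lambda>b. (b, Sym_gen B J (\<pi> b))) ` I"

text \<open>The values of forms and their classes are recorded together, as forms over the product ring. This relation
is not a map in either direction: a class has several values, and a value several classes.\<close>

definition graph :: "nat \<Rightarrow> ('a \<times> ('c multiset \<Rightarrow> 'c) set) set" where
  "graph d = {p. (d, p) \<in> forms AS Wc Wv}"

abbreviation "gen b \<equiv> Sym_gen B J (\<pi> b)"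
abbreviation "lift_map \<equiv> Sym_lift A I SB (\<lambda>r. Sym_const B J (\<pi> r)) (\<lambda>a. gen a)"

lemma I_sub: "I \<subseteq> carrier A" by (rule A.J_sub)

lemma \<pi>I: "b \<in> I \<Longrightarrow> \<pi> b \<in> J"
  using equalityD1[OF I_eq] by blast

lemma in_I: "b \<in> carrier A \<Longrightarrow> \<pi> b \<in> J \<Longrightarrow> b \<in> I"
  using equalityD2[OF I_eq] by blast

lemma B_lift:
  assumes "x \<in> carrier B" obtains a where "a \<in> carrier A" "x = \<pi> a"
proof -
  have "x \<in> \<pi> ` carrier A" using assms surj by simp
  then show ?thesis using that by (elim imageE)
qed

lemma J_lift:
  assumes x: "x \<in> J" obtains a where "a \<in> I" "x = \<pi> a"
proof -
  obtain a where "a \<in> carrier A" "x = \<pi> a" using B_lift[OF subsetD[OF B.J_sub x]] .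
  then show ?thesis using that[of a] in_I[of a] x by simp
qed

lemma \<pi>_closed: "a \<in> carrier A \<Longrightarrow> \<pi> a \<in> carrier B"
  using \<pi> by (rule ring_hom_closed)

text \<open>The prescription is read off at arbitrary lifts along \<open>\<pi>\<close>. Both maps out of \<open>Sym B J\<close> constructed below, to
the Rees algebra modulo \<open>\<Oplus> K I\<^sup>d\<^sup>-\<^sup>1 t\<^sup>d\<close> and to the polynomial ring modulo the kernel ideal, arise in this way.\<close>

lemma Sym_descend:
  assumes N: "cring N" and h: "h \<in> ring_hom A N" and h_eq: "\<And>a b. a \<in> carrier A \<Longrightarrow> b \<in> carrier A \<Longrightarrow> \<pi> a = \<pi> b \<Longrightarrow> h a = h b"
    and v: "v \<in> I \<rightarrow> carrier N" and v_eq: "\<And>a b. a \<in> I \<Longrightarrow> b \<in> I \<Longrightarrow> \<pi> a = \<pi> b \<Longrightarrow> v a = v b"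
    and va: "\<And>a b. a \<in> I \<Longrightarrow> b \<in> I \<Longrightarrow> v (a \<oplus> b) = v a \<oplus>\<^bsub>N\<^esub> v b"
    and vm: "\<And>r a. r \<in> carrier A \<Longrightarrow> a \<in> I \<Longrightarrow> v (r \<otimes> a) = h r \<otimes>\<^bsub>N\<^esub> v a"
  obtains G where "G \<in> ring_hom SB N" "\<And>a. a \<in> carrier A \<Longrightarrow> G (Sym_const B J (\<pi> a)) = h a"
    "\<And>a. a \<in> I \<Longrightarrow> G (gen a) = v a"
proof -
  define lf where "lf b = (SOME a. a \<in> carrier A \<and> \<pi> a = b)" for b
  have lf: "lf b \<in> carrier A \<and> \<pi> (lf b) = b" if b: "b \<in> carrier B" for b
    unfolding lf_def by (rule someI_ex, rule B_lift[OF b]) metis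
  let ?h = "\<lambda>b. h (lf b)" and ?v = "\<lambda>b. v (lf b)"
  have hh: "?h (\<pi> a) = h a" if a: "a \<in> carrier A" for a
    using lf[OF \<pi>_closed[OF a]] by (intro h_eq a) auto
  have vv: "?v (\<pi> a) = v a" if a: "a \<in> I" for a
  proof -
    have "a \<in> carrier A" using a I_sub by blast
    then have "lf (\<pi> a) \<in> I" "\<pi> (lf (\<pi> a)) = \<pi> a" using lf[OF \<pi>_closed] \<pi>I[OF a] by (simp_all add: in_I)
    then show ?thesis using a by (intro v_eq)
  qed
  have H: "?h \<in> ring_hom B N"
  proof (rule ring_hom_memI)
    fix x y assume x: "x \<in> carrier B" and y: "y \<in> carrier B"
    obtain a where a: "a \<in> carrier A" "x = \<pi> a" using B_lift[OF x] .
    obtain b where b: "b \<in> carrier A" "y = \<pi> b" using B_lift[OF y] .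
    show "?h x \<in> carrier N" using a hh ring_hom_closed[OF h] by simp
    show "?h (x \<otimes>\<^bsub>B\<^esub> y) = ?h x \<otimes>\<^bsub>N\<^esub> ?h y"
      using a b hh[of "a \<otimes> b"] hh[of a] hh[of b] ring_hom_mult[OF h a(1) b(1)] ring_hom_mult[OF \<pi> a(1) b(1)] by simp
    show "?h (x \<oplus>\<^bsub>B\<^esub> y) = ?h x \<oplus>\<^bsub>N\<^esub> ?h y"
      using a b hh[of "a \<oplus> b"] hh[of a] hh[of b] ring_hom_add[OF h a(1) b(1)] ring_hom_add[OF \<pi> a(1) b(1)] by simp
  next
    show "?h \<one>\<^bsub>B\<^esub> = \<one>\<^bsub>N\<^esub>" using hh[of \<one>] ring_hom_one[OF h] ring_hom_one[OF \<pi>] by simp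
  qed
  have V0: "?v \<in> J \<rightarrow> carrier N"
  proof
    fix x assume "x \<in> J"
    then obtain a where "a \<in> I" "x = \<pi> a" by (rule J_lift)
    then show "?v x \<in> carrier N" using vv Pi_mem[OF v] by simp
  qed
  have V1: "?v (x \<oplus>\<^bsub>B\<^esub> y) = ?v x \<oplus>\<^bsub>N\<^esub> ?v y" if x: "x \<in> J" and y: "y \<in> J" for x y
  proof -
    obtain a where a: "a \<in> I" "x = \<pi> a" using J_lift[OF x] .
    obtain b where b: "b \<in> I" "y = \<pi> b" using J_lift[OF y] .
    have "a \<oplus> b \<in> I" by (rule additive_subgroup.a_closed[OF A.J.additive_subgroup_axioms a(1) b(1)])
    then show ?thesis
      using a b vv[of "a \<oplus> b"] vv[of a] vv[of b] va[of a b] ring_hom_add[OF \<pi> subsetD[OF I_sub a(1)] subsetD[OF I_sub b(1)]] by simp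
  qed
  have V2: "?v (x \<otimes>\<^bsub>B\<^esub> y) = ?h x \<otimes>\<^bsub>N\<^esub> ?v y" if x: "x \<in> carrier B" and y: "y \<in> J" for x y
  proof -
    obtain a where a: "a \<in> carrier A" "x = \<pi> a" using B_lift[OF x] .
    obtain b where b: "b \<in> I" "y = \<pi> b" using J_lift[OF y] .
    have "a \<otimes> b \<in> I" by (rule A.J.I_l_closed[OF b(1) a(1)])
    then show ?thesis
      using a b vv[of "a \<otimes> b"] hh[of a] vv[of b] vm[of a b] ring_hom_mult[OF \<pi> a(1) subsetD[OF I_sub b(1)]] by simp
  qed
  note L = N H V0 V1 V2
  show thesis
  proof (rule that[of "Sym_lift B J N ?h ?v"])
    show "Sym_lift B J N ?h ?v \<in> ring_hom SB N" by (rule B.Sym_lift_hom[OF L])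
    show "Sym_lift B J N ?h ?v (Sym_const B J (\<pi> a)) = h a" if "a \<in> carrier A" for a
      using B.Sym_lift_const[OF L \<pi>_closed[OF that]] hh[OF that] by simp
    show "Sym_lift B J N ?h ?v (gen a) = v a" if "a \<in> I" for a
      using B.Sym_lift_gen[OF L \<pi>I[OF that]] vv[OF that] by simp
  qed
qed

lemma lift_map_facts:
  "lift_map \<in> ring_hom (Sym A I) SB"
  "c \<in> carrier A \<Longrightarrow> lift_map (Sym_const A I c) = Sym_const B J (\<pi> c)"
  "b \<in> I \<Longrightarrow> lift_map (Sym_gen A I b) = gen b"
proof -
  have 1: "(\<lambda>r. Sym_const B J (\<pi> r)) \<in> ring_hom A SB"
    using ring_hom_trans[OF \<pi> B.Sym_const_hom] by (simp add: comp_def)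
  have 2: "(\<lambda>a. gen a) \<in> I \<rightarrow> carrier SB" using \<pi>I B.Sym_gen_closed by auto
  have 3: "Sym_gen B J (\<pi> (a \<oplus> b)) = gen a \<oplus>\<^bsub>SB\<^esub> gen b"
    if "a \<in> I" "b \<in> I" for a b
    using that \<pi> I_sub \<pi>I B.Sym_gen_add[of "\<pi> a" "\<pi> b"] by (simp add: ring_hom_add[OF \<pi>] subset_iff)
  have 4: "Sym_gen B J (\<pi> (r \<otimes> a)) = Sym_const B J (\<pi> r) \<otimes>\<^bsub>SB\<^esub> gen a"
    if "r \<in> carrier A" "a \<in> I" for a r
    using that I_sub \<pi>I B.Sym_gen_smult[of "\<pi> r" "\<pi> a"] by (simp add: ring_hom_mult[OF \<pi>] subset_iff \<pi>_closed)
  note * = B.S.cring_axioms 1 2 3 4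
  show "lift_map \<in> ring_hom (Sym A I) SB" by (rule A.Sym_lift_hom[OF *])
  show "c \<in> carrier A \<Longrightarrow> lift_map (Sym_const A I c) = Sym_const B J (\<pi> c)" by (rule A.Sym_lift_const[OF *])
  show "b \<in> I \<Longrightarrow> lift_map (Sym_gen A I b) = gen b" by (rule A.Sym_lift_gen[OF *])
qed

lemma tensor: "tensor_data (Sym A I) SB (Rees A I) lift_map (Sym_to_Rees A I)"
  by (intro tensor_data.intro tensor_data_axioms.intro A.S.cring_axioms B.S.cring_axioms A.Rees_cring
      lift_map_facts A.Sym_to_Rees_hom)

abbreviation "Q \<equiv> tensor (Sym A I) SB (Rees A I) lift_map (Sym_to_Rees A I)"
abbreviation "inl \<equiv> tensor_data.inl (Sym A I) SB (Rees A I) lift_map (Sym_to_Rees A I)"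
abbreviation "inr \<equiv> tensor_data.inr (Sym A I) SB (Rees A I) lift_map (Sym_to_Rees A I)"
abbreviation "tmon \<equiv> up_ring.monom (UP A)"

lemma Q_cring: "cring Q" and inl_hom: "inl \<in> ring_hom SB Q" and inr_hom: "inr \<in> ring_hom (Rees A I) Q"
  and inr_inl: "r \<in> carrier (Sym A I) \<Longrightarrow> inr (Sym_to_Rees A I r) = inl (lift_map r)"
proof -
  interpret X: tensor_data "Sym A I" SB "Rees A I" lift_map "Sym_to_Rees A I" by (rule tensor)
  show "cring Q" by (rule X.TX.cring_axioms)
  show "inl \<in> ring_hom SB Q" by (rule X.inl_hom)
  show "inr \<in> ring_hom (Rees A I) Q" by (rule X.inr_hom)
  show "r \<in> carrier (Sym A I) \<Longrightarrow> inr (Sym_to_Rees A I r) = inl (lift_map r)" by (rule X.inr_inl)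
qed

lemma AS_cring: "cring AS"
  by (rule RDirProd_cring[OF A.cring_axioms B.S.cring_axioms])

lemma W_sub: "Wc \<subseteq> carrier AS" "Wv \<subseteq> carrier AS"
  using \<pi>_closed I_sub \<pi>I B.Sym_const_closed B.Sym_gen_closed by (auto simp: RDirProd_simps)

lemma graph_carrier: "(a, s) \<in> graph d \<Longrightarrow> a \<in> carrier A \<and> s \<in> carrier SB"
  using cring.forms_closed[OF AS_cring W_sub, of d "(a, s)"] by (simp add: graph_def RDirProd_simps)

lemma graph_induct [consumes 1, case_names const zero add mult]:
  assumes "(a, s) \<in> graph d"
    and "\<And>c. c \<in> carrier A \<Longrightarrow> \<Phi> 0 c (Sym_const B J (\<pi> c))"
    and "\<And>d. \<Phi> d \<zero> \<zero>\<^bsub>SB\<^esub>"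
    and "\<And>d a s a' s'. (a, s) \<in> graph d \<Longrightarrow> (a', s') \<in> graph d \<Longrightarrow> \<Phi> d a s \<Longrightarrow> \<Phi> d a' s' \<Longrightarrow>
           \<Phi> d (a \<oplus> a') (s \<oplus>\<^bsub>SB\<^esub> s')"
    and "\<And>d a s b. (a, s) \<in> graph d \<Longrightarrow> b \<in> I \<Longrightarrow> \<Phi> d a s \<Longrightarrow>
           \<Phi> (Suc d) (a \<otimes> b) (s \<otimes>\<^bsub>SB\<^esub> gen b)"
  shows "\<Phi> d a s"
proof -
  have "(d, p) \<in> forms AS Wc Wv \<Longrightarrow> \<Phi> d (fst p) (snd p)" for d p
  proof (induction d p rule: forms.induct)
    case (add d a b)
    then show ?case using assms(4)[of "fst a" "snd a" d "fst b" "snd b"] by (simp add: RDirProd_simps graph_def)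
  next
    case (mult d a v)
    then obtain b where "b \<in> I" "v = (b, gen b)" by blast
    then show ?case using assms(5)[of "fst a" "snd a" d b] mult by (simp add: RDirProd_simps graph_def)
  qed (use assms(2,3) in \<open>auto simp: RDirProd_simps\<close>)
  from this[of d "(a, s)"] show ?thesis using assms(1) by (simp add: graph_def)
qed

lemma graph_const: "c \<in> carrier A \<Longrightarrow> (c, Sym_const B J (\<pi> c)) \<in> graph 0"
  by (simp add: graph_def forms.const)

lemma graph_zero: "(\<zero>, \<zero>\<^bsub>SB\<^esub>) \<in> graph d"
  using forms.zero[of d AS] by (simp add: graph_def RDirProd_simps)

lemma graph_add: "(a, s) \<in> graph d \<Longrightarrow> (a', s') \<in> graph d \<Longrightarrow> (a \<oplus> a', s \<oplus>\<^bsub>SB\<^esub> s') \<in> graph d"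
  using forms.add[of d "(a, s)" AS Wc Wv "(a', s')"] by (simp add: graph_def RDirProd_simps)

lemma graph_mult_gen: "(a, s) \<in> graph d \<Longrightarrow> b \<in> I \<Longrightarrow> (a \<otimes> b, s \<otimes>\<^bsub>SB\<^esub> gen b) \<in> graph (Suc d)"
  using forms.mult[of d "(a, s)" AS Wc Wv "(b, gen b)"] by (simp add: graph_def RDirProd_simps)

lemma Wc_uminus: "p \<in> Wc \<Longrightarrow> \<ominus>\<^bsub>AS\<^esub> p \<in> Wc"
proof -
  assume "p \<in> Wc"
  then obtain c where c: "c \<in> carrier A" "p = (c, Sym_const B J (\<pi> c))" by blast
  interpret AS: cring AS by (rule AS_cring)
  interpret h: ring_hom_ring A SB "\<lambda>c. Sym_const B J (\<pi> c)"
    using ring_hom_trans[OF \<pi> B.Sym_const_hom] by unfold_locales (simp add: comp_def)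
  have "\<ominus>\<^bsub>AS\<^esub> p = (\<ominus> c, \<ominus>\<^bsub>SB\<^esub> Sym_const B J (\<pi> c))"
  proof (rule AS.minus_equality)
    show "(\<ominus> c, \<ominus>\<^bsub>SB\<^esub> Sym_const B J (\<pi> c)) \<oplus>\<^bsub>AS\<^esub> p = \<zero>\<^bsub>AS\<^esub>"
      using c by (simp add: RDirProd_simps A.l_neg B.S.l_neg B.Sym_const_closed \<pi>_closed)
  qed (use c in \<open>auto simp: RDirProd_simps B.Sym_const_closed \<pi>_closed\<close>)
  also have "\<dots> = (\<ominus> c, Sym_const B J (\<pi> (\<ominus> c)))" using c by simp
  finally show ?thesis by (rule image_eqI) (rule A.a_inv_closed[OF c(1)])
qed

lemma graph_minus:
  assumes "(a, s) \<in> graph d" "(a', s') \<in> graph d"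
  shows "(a \<ominus> a', s \<ominus>\<^bsub>SB\<^esub> s') \<in> graph d"
  using cring.forms_minus[OF AS_cring W_sub Wc_uminus, of d "(a, s)" "(a', s')"] assms
    RDirProd_minus[OF A.cring_axioms B.S.cring_axioms, of "(a, s)" "(a', s')"]
    graph_carrier[OF assms(1)] graph_carrier[OF assms(2)]
  by (simp add: graph_def RDirProd_simps)

lemma graph_fst: "(a, s) \<in> graph d \<Longrightarrow> a \<in> A.JP d"
proof (induction rule: graph_induct)
  case (mult d a s b)
  then have "(d, a) \<in> forms A (carrier A) I" by simp
  from forms.mult[OF this \<open>b \<in> I\<close>] show ?case by simp
qed (simp_all add: forms.const forms.zero forms.add)

lemma graph_snd: "(a, s) \<in> graph d \<Longrightarrow> s \<in> Sym_deg B J d"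
  unfolding B.Sym_deg_eq_forms
proof (induction rule: graph_induct)
  case (mult d a s b)
  then have "(d, s) \<in> forms SB (Sym_const B J ` carrier B) (Sym_gen B J ` J)" by simp
  from forms.mult[OF this imageI[OF \<pi>I[OF \<open>b \<in> I\<close>]]] show ?case by simp
qed (simp_all add: forms.const forms.zero forms.add \<pi>_closed)

lemma graph_total_fst: "a \<in> A.JP d \<Longrightarrow> \<exists>s. (a, s) \<in> graph d"
proof -
  assume "a \<in> A.JP d"
  then have a: "(d, a) \<in> forms A (carrier A) I" by simp
  have 1: "carrier A \<subseteq> fst ` Wc" and 2: "I \<subseteq> fst ` Wv" by (simp_all add: image_image)
  show ?thesis
    using forms_lift[OF fst_hom AS_cring A.cring_axioms W_sub 1 2 a] unfolding graph_def by force
qed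

lemma graph_total_snd: "s \<in> Sym_deg B J d \<Longrightarrow> \<exists>a. (a, s) \<in> graph d"
proof -
  assume "s \<in> Sym_deg B J d"
  then have s: "(d, s) \<in> forms SB (Sym_const B J ` carrier B) (Sym_gen B J ` J)" by (simp add: B.Sym_deg_eq_forms)
  have "J \<subseteq> \<pi> ` I" by (rule subsetI, erule J_lift) simp
  then have 1: "Sym_const B J ` carrier B \<subseteq> snd ` Wc" and 2: "Sym_gen B J ` J \<subseteq> snd ` Wv"
    by (auto simp: image_image simp flip: surj)
  show ?thesis
    using forms_lift[OF snd_hom AS_cring B.S.cring_axioms W_sub 1 2 s] unfolding graph_def by force
qed

lemma Sym_deg_carrier: "s \<in> Sym_deg B J d \<Longrightarrow> s \<in> carrier SB"
  using graph_total_snd graph_carrier by blast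

lemma Sym_deg_minus: "s \<in> Sym_deg B J d \<Longrightarrow> t \<in> Sym_deg B J d \<Longrightarrow> s \<ominus>\<^bsub>SB\<^esub> t \<in> Sym_deg B J d"
  using graph_total_snd graph_minus graph_snd by meson

text \<open>In the tensor product a generator at \<open>\<pi> b\<close> can be moved to the other side as \<open>b t\<close>, one factor at a time.\<close>

lemma graph_tensor: "(a, s) \<in> graph d \<Longrightarrow> inl s = inr (tmon a d)"
proof (induction rule: graph_induct)
  case (const c)
  then show ?case using inr_inl[of "Sym_const A I c"] A.Sym_const_closed
    by (simp add: A.Sym_to_Rees_const lift_map_facts)
next
  case (zero d)
  have "tmon \<zero> d = \<zero>\<^bsub>Rees A I\<^esub>" by (simp add: A.Rees_simps UP_ring.monom_zero[OF A.UP_ring])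
  then show ?case using ring_hom_zero'[OF inl_hom B.S.cring_axioms Q_cring] ring_hom_zero'[OF inr_hom A.Rees_cring Q_cring]
    by simp
next
  case (add d a s a' s')
  note c = graph_carrier[OF add(1)] graph_carrier[OF add(2)]
  note m = A.monom_Rees[OF graph_fst[OF add(1)]] A.monom_Rees[OF graph_fst[OF add(2)]]
  have "inl (s \<oplus>\<^bsub>SB\<^esub> s') = inr (tmon a d) \<oplus>\<^bsub>Q\<^esub> inr (tmon a' d)"
    using c add by (simp add: ring_hom_add[OF inl_hom])
  also have "\<dots> = inr (tmon a d \<oplus>\<^bsub>Rees A I\<^esub> tmon a' d)"
    using ring_hom_add[OF inr_hom m] by simp
  finally show ?case using c by (simp add: A.monom_mult_Rees)
next
  case (mult d a s b)
  note c = graph_carrier[OF mult(1)]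
  have bA: "b \<in> carrier A" using mult(2) I_sub by blast
  note m = A.monom_Rees[OF graph_fst[OF mult(1)]] A.monom1_Rees[OF mult(2)]
  have "inr (tmon b 1) = inl (gen b)"
    using inr_inl[OF A.Sym_gen_closed[OF mult(2)]] mult(2)
    by (simp add: A.Sym_to_Rees_gen lift_map_facts)
  then have "inl (s \<otimes>\<^bsub>SB\<^esub> gen b) = inr (tmon a d) \<otimes>\<^bsub>Q\<^esub> inr (tmon b 1)"
    using c mult \<pi>I by (simp add: ring_hom_mult[OF inl_hom] B.Sym_gen_closed)
  also have "\<dots> = inr (tmon a d \<otimes>\<^bsub>Rees A I\<^esub> tmon b 1)"
    using ring_hom_mult[OF inr_hom m] by simp
  finally show ?case using c bA by (simp add: A.monom_mult_Rees)
qed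

lemma K_ideal: "ideal K A"
proof -
  interpret h: ring_hom_ring A B \<pi> using \<pi> by unfold_locales
  show ?thesis by (rule h.kernel_is_ideal[unfolded a_kernel_def'])
qed

lemma K_sub_I: "K \<subseteq> I"
  using in_I additive_subgroup.zero_closed[OF B.J.additive_subgroup_axioms] by force

text \<open>In a product \<open>k y\<close> with \<open>k\<close> in the kernel of \<open>\<pi>\<close> the factor \<open>k\<close> is an element of \<open>I\<close> whose generator is the one at \<open>0\<close>.\<close>

lemma graph_kernel:
  assumes "a \<in> ideal_prod A K (A.JP d)" shows "(a, \<zero>\<^bsub>SB\<^esub>) \<in> graph (Suc d)"
  using assms
proof induction
  case (prod k y)
  then obtain s where s: "(y, s) \<in> graph d" using graph_total_fst by blast
  have "k \<in> I" using prod K_sub_I by blast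
  from graph_mult_gen[OF s this] show ?case
    using prod graph_carrier[OF s] by (simp add: B.Sym_gen_zero A.m_comm)
next
  case (sum a b)
  then show ?case using graph_add[of a "\<zero>\<^bsub>SB\<^esub>" "Suc d" b "\<zero>\<^bsub>SB\<^esub>"] by simp
qed

text \<open>Both factors of the tensor product map to the Rees algebra modulo the ideal with components
  \<open>K I\<^sup>d\<^sup>-\<^sup>1\<close>; hence an element of the graph whose class dies in the tensor product has its value there.\<close>

lemma tensor_kernel_value:
  assumes W: "(a, s) \<in> graph d" and 0: "inl s = \<zero>\<^bsub>Q\<^esub>"
  shows "a \<in> ideal_prod A K (A.JP (d - 1))"
proof -
  interpret Rs: cring "Rees A I" by (rule A.Rees_cring)
  have n: "ideal (A.shifted K) (Rees A I)" by (rule A.shifted_ideal[OF K_ideal])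
  define N where "N = Rees A I Quot A.shifted K"
  define cl where "cl u = A.shifted K +>\<^bsub>Rees A I\<^esub> u" for u
  have Nc: "cring N" unfolding N_def by (rule ideal.quotient_is_cring[OF n A.Rees_cring])
  have clh: "cl \<in> ring_hom (Rees A I) N" unfolding cl_def[abs_def] N_def by (rule ideal.rcos_ring_hom[OF n])
  have cl0: "cl u = cl w \<longleftrightarrow> u \<ominus>\<^bsub>Rees A I\<^esub> w \<in> A.shifted K"
    if "u \<in> carrier (Rees A I)" "w \<in> carrier (Rees A I)" for u w
    unfolding cl_def by (rule Rs.quotient_eq_iff_same_a_r_cos[OF n that, symmetric])
  have Kmon: "tmon k e \<in> A.shifted K" if "k \<in> ideal_prod A K (A.JP (e - 1))" "tmon k e \<in> carrier (Rees A I)" for k e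
  proof -
    have kA: "k \<in> carrier A" using that(1) ideal.Icarr[OF A.KJ_ideal[OF K_ideal]] by blast
    have "\<zero> \<in> ideal_prod A K (A.JP (d - 1))" for d
      using ideal_zero[OF A.KJ_ideal[OF K_ideal]] .
    then have "tmon k e i \<in> ideal_prod A K (A.JP (i - 1))" for i
      using that(1) by (cases "i = e") (simp_all add: A.monom_at[OF kA])
    then show ?thesis unfolding A.shifted_def using that(2) by blast
  qed
  have K1: "k \<in> K \<Longrightarrow> k \<in> ideal_prod A K (A.JP 0)" for k
    using ideal_prod.prod[of k K "\<one>" "A.JP 0" A] by (simp add: forms.const)
  have mminus: "tmon a e \<ominus>\<^bsub>Rees A I\<^esub> tmon b e = tmon (a \<ominus> b) e"
    if "a \<in> A.JP e" "b \<in> A.JP e" for a b e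
  proof -
    have ab: "a \<in> carrier A" "b \<in> carrier A" using that A.JP_carrier by auto
    have mb: "\<ominus> b \<in> A.JP e"
      by (rule ideal_uminus[OF A.JP_ideal that(2)])
    have "tmon (\<ominus> b) e \<oplus>\<^bsub>Rees A I\<^esub> tmon b e = \<zero>\<^bsub>Rees A I\<^esub>"
      using ab by (simp add: A.monom_mult_Rees A.l_neg) (simp add: A.Rees_simps UP_ring.monom_zero[OF A.UP_ring])
    then have "\<ominus>\<^bsub>Rees A I\<^esub> tmon b e = tmon (\<ominus> b) e"
      by (rule Rs.minus_equality) (rule A.monom_Rees[OF that(2)], rule A.monom_Rees[OF mb])
    then show ?thesis using ab by (simp add: a_minus_def A.monom_mult_Rees)
  qed
  have K0: "cl (tmon a e) = cl (tmon b e)"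
    if "a \<in> A.JP e" "b \<in> A.JP e" "\<pi> a = \<pi> b" "e = 0 \<or> e = 1" for a b e
  proof -
    have ab: "a \<in> carrier A" "b \<in> carrier A" using that A.JP_carrier by auto
    interpret h: ring_hom_ring A B \<pi> using \<pi> by unfold_locales
    have "a \<ominus> b \<in> K" using ab that \<pi>_closed[of b] by (simp add: a_minus_def B.r_neg)
    then have "a \<ominus> b \<in> ideal_prod A K (A.JP (e - 1))" using K1 that(4) by auto
    moreover have ms: "tmon a e \<in> carrier (Rees A I)" "tmon b e \<in> carrier (Rees A I)"
      using that(1,2) by (auto intro!: A.monom_Rees)
    ultimately show ?thesis using Kmon[of "a \<ominus> b" e] mminus[OF that(1,2)] cl0[OF ms] Rs.minus_closed[OF ms]
      by simp
  qed
  have cA: "a \<in> carrier A \<Longrightarrow> a \<in> A.JP 0" for a by (simp add: forms.const)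
  have cI: "a \<in> I \<Longrightarrow> a \<in> A.JP 1" for a using A.J_JP1 by blast
  have ms: "tmon a 0 \<in> carrier (Rees A I)" if "a \<in> carrier A" for a by (rule A.monom_Rees[OF cA[OF that]])
  obtain H' where H': "H' \<in> ring_hom SB N" and Hc: "\<And>a. a \<in> carrier A \<Longrightarrow> H' (Sym_const B J (\<pi> a)) = cl (tmon a 0)"
    and Hg: "\<And>a. a \<in> I \<Longrightarrow> H' (gen a) = cl (tmon a 1)"
  proof (rule Sym_descend[OF Nc])
    show "(\<lambda>a. cl (tmon a 0)) \<in> ring_hom A N" using ring_hom_trans[OF A.monom0_hom clh] by (simp add: comp_def)
    show "cl (tmon a 0) = cl (tmon b 0)" if "a \<in> carrier A" "b \<in> carrier A" "\<pi> a = \<pi> b" for a b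
      using that by (intro K0 cA) auto
    show "(\<lambda>a. cl (tmon a 1)) \<in> I \<rightarrow> carrier N" by (rule funcsetI) (rule ring_hom_closed[OF clh A.monom1_Rees])
    show "cl (tmon a 1) = cl (tmon b 1)" if "a \<in> I" "b \<in> I" "\<pi> a = \<pi> b" for a b
      using that by (intro K0 cI) auto
    show "cl (tmon (a \<oplus> b) 1) = cl (tmon a 1) \<oplus>\<^bsub>N\<^esub> cl (tmon b 1)" if ab: "a \<in> I" "b \<in> I" for a b
      using ring_hom_add[OF clh A.monom1_Rees[OF ab(1)] A.monom1_Rees[OF ab(2)]] ab I_sub by (simp add: A.monom_mult_Rees subset_iff)
    show "cl (tmon (r \<otimes> a) 1) = cl (tmon r 0) \<otimes>\<^bsub>N\<^esub> cl (tmon a 1)" if ra: "r \<in> carrier A" "a \<in> I" for r a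
      using ring_hom_mult[OF clh ms[OF ra(1)] A.monom1_Rees[OF ra(2)]] ra I_sub A.monom_mult_Rees(1)[of r a 0 1] by (simp add: subset_iff)
  qed metis
  have comp: "cl (Sym_to_Rees A I r) = H' (lift_map r)" if r: "r \<in> carrier (Sym A I)" for r
  proof -
    have "(cl \<circ> Sym_to_Rees A I) r = (H' \<circ> lift_map) r"
    proof (rule A.Sym_hom_eqI[OF Nc ring_hom_trans[OF A.Sym_to_Rees_hom clh] ring_hom_trans[OF lift_map_facts(1) H'] _ _ r])
      fix c assume "c \<in> carrier A"
      then show "(cl \<circ> Sym_to_Rees A I) (Sym_const A I c) = (H' \<circ> lift_map) (Sym_const A I c)"
        by (simp add: A.Sym_to_Rees_const lift_map_facts Hc)
    next
      fix c assume "c \<in> I"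
      then show "(cl \<circ> Sym_to_Rees A I) (Sym_gen A I c) = (H' \<circ> lift_map) (Sym_gen A I c)"
        using Hg[of c] by (simp add: A.Sym_to_Rees_gen lift_map_facts)
    qed
    then show ?thesis by simp
  qed
  define TL where "TL C = the_elem (mpoly_eval SB N H' cl ` C)" for C
  have TLh: "TL \<in> ring_hom Q N" unfolding TL_def[abs_def] by (rule tensor_data.tensor_lift_hom[OF tensor Nc H' clh, OF comp])
  have ma: "tmon a d \<in> carrier (Rees A I)" by (rule A.monom_Rees[OF graph_fst[OF W]])
  have "cl (tmon a d) = TL (inr (tmon a d))"
    unfolding TL_def by (rule tensor_data.tensor_lift_inr[OF tensor Nc H' clh, OF comp ma, symmetric])
  also have "\<dots> = TL \<zero>\<^bsub>Q\<^esub>" using graph_tensor[OF W] 0 by simp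
  also have "\<dots> = \<zero>\<^bsub>N\<^esub>" by (rule ring_hom_zero'[OF TLh Q_cring Nc])
  also have "\<dots> = cl \<zero>\<^bsub>Rees A I\<^esub>" by (rule ring_hom_zero'[OF clh A.Rees_cring Nc, symmetric])
  finally have "tmon a d \<ominus>\<^bsub>Rees A I\<^esub> \<zero>\<^bsub>Rees A I\<^esub> \<in> A.shifted K" using cl0[OF ma Rs.zero_closed] by simp
  then have "tmon a d \<in> A.shifted K" using ma by (simp add: a_minus_def)
  then have "tmon a d d \<in> ideal_prod A K (A.JP (d - 1))" by (simp add: A.shifted_def)
  then show ?thesis using graph_carrier[OF W] by (simp add: A.monom_at)
qed

text \<open>Two values of one class differ by a value of the class zero.\<close>

lemma graph_unique:
  assumes "(a, s) \<in> graph d" "(a', s) \<in> graph d"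
  shows "a \<ominus> a' \<in> ideal_prod A K (A.JP (d - 1))"
proof -
  have "(a \<ominus> a', s \<ominus>\<^bsub>SB\<^esub> s) \<in> graph d" by (rule graph_minus[OF assms])
  moreover have "s \<ominus>\<^bsub>SB\<^esub> s = \<zero>\<^bsub>SB\<^esub>" using graph_carrier[OF assms(1)] by (simp add: a_minus_def B.S.r_neg)
  ultimately show ?thesis
    using tensor_kernel_value ring_hom_zero'[OF inl_hom B.S.cring_axioms Q_cring] by simp
qed

text \<open>If \<open>s \<otimes> 1 = 0\<close>, then any value of \<open>s\<close> lies in \<open>K I\<^sup>d\<^sup>-\<^sup>1\<close>, hence is also a value of \<open>0\<close>, and subtracting gives the
value \<open>0\<close>.\<close>

lemma tensor_zero_iff:
  assumes d: "0 < d" and s: "s \<in> Sym_deg B J d"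
  shows "inl s = \<zero>\<^bsub>Q\<^esub> \<longleftrightarrow> (\<zero>, s) \<in> graph d"
proof
  assume 0: "inl s = \<zero>\<^bsub>Q\<^esub>"
  obtain a where a: "(a, s) \<in> graph d" using graph_total_snd[OF s] by blast
  have "a \<in> ideal_prod A K (A.JP (d - 1))" by (rule tensor_kernel_value[OF a 0])
  then have "(a, \<zero>\<^bsub>SB\<^esub>) \<in> graph d" using graph_kernel[of a "d - 1"] d by simp
  from graph_minus[OF a this] show "(\<zero>, s) \<in> graph d"
    using graph_carrier[OF a] by (simp add: a_minus_def A.r_neg)
next
  assume "(\<zero>, s) \<in> graph d"
  then have "inl s = inr (tmon \<zero> d)" by (rule graph_tensor)
  also have "tmon \<zero> d = \<zero>\<^bsub>Rees A I\<^esub>" by (simp add: A.Rees_simps UP_ring.monom_zero[OF A.UP_ring])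
  finally show "inl s = \<zero>\<^bsub>Q\<^esub>" using ring_hom_zero'[OF inr_hom A.Rees_cring Q_cring] by simp
qed

end

section \<open>The inverse system and its limit\<close>

context embedded
begin

abbreviation "pure \<equiv> pure_tensor (Sym A I) SB (Rees A I) lift_map (Sym_to_Rees A I)"

lemma pure_eq:
  "s \<in> carrier SB \<Longrightarrow> t \<in> carrier (Rees A I) \<Longrightarrow> pure s t = inl s \<otimes>\<^bsub>Q\<^esub> inr t"
  "s \<in> carrier SB \<Longrightarrow> pure s \<one>\<^bsub>Rees A I\<^esub> = inl s"
  "t \<in> carrier (Rees A I) \<Longrightarrow> pure \<one>\<^bsub>SB\<^esub> t = inr t"
  by (rule tensor_data.pure_tensor_eq[OF tensor] tensor_data.pure_tensor_one[OF tensor]; assumption)+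

lemma inr_gen: "b \<in> I \<Longrightarrow> inr (tmon b 1) = inl (Sym_gen B J (\<pi> b))"
  using inr_inl[OF A.Sym_gen_closed, of b] A.Sym_to_Rees_gen[of b] lift_map_facts(3)[of b] by metis

lemma inl_closed: "s \<in> carrier SB \<Longrightarrow> inl s \<in> carrier Q"
  by (rule ring_hom_closed[OF inl_hom])

lemma inl_inj_zero:
  assumes "s \<in> carrier SB" "t \<in> carrier SB" "inl s = inl t" shows "inl (s \<ominus>\<^bsub>SB\<^esub> t) = \<zero>\<^bsub>Q\<^esub>"
proof -
  interpret Q: cring Q by (rule Q_cring)
  have "inl (s \<ominus>\<^bsub>SB\<^esub> t) = inl s \<ominus>\<^bsub>Q\<^esub> inl t"
    by (rule ring_hom_minus[OF B.S.ring_axioms Q.ring_axioms inl_hom assms(1,2)])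
  then show ?thesis using assms inl_closed[OF assms(2)] by (simp add: a_minus_def Q.r_neg)
qed

lemma Sym_deg_add: "s \<in> Sym_deg B J d \<Longrightarrow> t \<in> Sym_deg B J d \<Longrightarrow> s \<oplus>\<^bsub>SB\<^esub> t \<in> Sym_deg B J d"
  using graph_total_snd graph_add graph_snd by meson

lemma Sym_deg_zero: "\<zero>\<^bsub>SB\<^esub> \<in> Sym_deg B J d"
  using graph_zero graph_snd by meson

lemma Sym_deg_mult: "s \<in> Sym_deg B J d \<Longrightarrow> t \<in> Sym_deg B J e \<Longrightarrow> s \<otimes>\<^bsub>SB\<^esub> t \<in> Sym_deg B J (d + e)"
proof -
  assume st: "s \<in> Sym_deg B J d" "t \<in> Sym_deg B J e"
  have "c \<otimes>\<^bsub>SB\<^esub> c' \<in> Sym_const B J ` carrier B"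
    if c: "c \<in> Sym_const B J ` carrier B" and c': "c' \<in> Sym_const B J ` carrier B" for c c'
  proof -
    obtain a where a: "a \<in> carrier B" "c = Sym_const B J a" using c by (elim imageE)
    obtain b where b: "b \<in> carrier B" "c' = Sym_const B J b" using c' by (elim imageE)
    have "c \<otimes>\<^bsub>SB\<^esub> c' = Sym_const B J (a \<otimes>\<^bsub>B\<^esub> b)"
      using ring_hom_mult[OF B.Sym_const_hom a(1) b(1)] a b by simp
    then show ?thesis using B.m_closed[OF a(1) b(1)] by (rule image_eqI)
  qed
  from B.S.forms_mult[OF B.const_gen_subset this, of d s e t] show ?thesis
    using st unfolding B.Sym_deg_eq_forms by blast
qed

text \<open>In each degree the quasi-symmetric algebra is the image of the symmetric algebra, because
  every element of a power of \<open>I\<close> is the value of a form.\<close>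

lemma generate_deg:
  "generate (add_monoid Q) {pure s t | s t e e'. e + e' = d \<and> s \<in> Sym_deg B J e \<and> t \<in> Rees_deg A I e'}
     = inl ` Sym_deg B J d" (is "generate _ ?G = _")
proof (rule subset_antisym; rule subsetI)
  interpret Q: cring Q by (rule Q_cring)
  have G: "x \<in> inl ` Sym_deg B J d" if x: "x \<in> ?G" for x
  proof -
    obtain s t e e' where st: "x = pure s t" "e + e' = d" "s \<in> Sym_deg B J e" "t \<in> Rees_deg A I e'"
      using x by blast
    obtain a where a: "a \<in> A.JP e'" "t = tmon a e'"
      using st(4) A.ideal_power_eq_forms(1)[OF A.J.is_ideal] unfolding Rees_deg_def by blast
    obtain s' where s': "(a, s') \<in> graph e'" using graph_total_fst[OF a(1)] by (elim exE)
    have sc: "s \<in> carrier SB" "s' \<in> carrier SB" using Sym_deg_carrier[OF st(3)] graph_carrier[OF s'] by simp_all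
    have "x = inl s \<otimes>\<^bsub>Q\<^esub> inr t" unfolding st(1)
      by (rule pure_eq(1)[OF sc(1)]) (simp only: a(2) A.monom_Rees[OF a(1)])
    also have "inr t = inl s'" using graph_tensor[OF s'] a(2) by simp
    also have "inl s \<otimes>\<^bsub>Q\<^esub> inl s' = inl (s \<otimes>\<^bsub>SB\<^esub> s')" by (rule ring_hom_mult[OF inl_hom sc, symmetric])
    finally show ?thesis
      using Sym_deg_mult[OF st(3) graph_snd[OF s']] st(2) by (simp only: imageI)
  qed
  fix x assume "x \<in> generate (add_monoid Q) ?G"
  then show "x \<in> inl ` Sym_deg B J d"
  proof (induction rule: generate.induct)
    case one
    have "inl \<zero>\<^bsub>SB\<^esub> = \<one>\<^bsub>add_monoid Q\<^esub>" using ring_hom_zero'[OF inl_hom B.S.cring_axioms Q_cring] by simp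
    then show ?case using imageI[OF Sym_deg_zero, of inl d] by simp
  next
    case (incl h) then show ?case by (rule G)
  next
    case (inv h)
    obtain s where s: "s \<in> Sym_deg B J d" "h = inl s" using G[OF inv] by (elim imageE)
    have sc: "s \<in> carrier SB" by (rule Sym_deg_carrier[OF s(1)])
    have "inl (\<zero>\<^bsub>SB\<^esub> \<ominus>\<^bsub>SB\<^esub> s) = inl \<zero>\<^bsub>SB\<^esub> \<ominus>\<^bsub>Q\<^esub> inl s"
      by (rule ring_hom_minus[OF B.S.ring_axioms Q.ring_axioms inl_hom B.S.zero_closed sc])
    also have "\<dots> = \<ominus>\<^bsub>Q\<^esub> h"
      using ring_hom_zero'[OF inl_hom B.S.cring_axioms Q_cring] inl_closed[OF sc] s(2) by (simp add: a_minus_def)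
    finally have "inv\<^bsub>add_monoid Q\<^esub> h = inl (\<zero>\<^bsub>SB\<^esub> \<ominus>\<^bsub>SB\<^esub> s)" by (simp add: a_inv_def)
    then show ?case using Sym_deg_minus[OF Sym_deg_zero s(1)] by (rule image_eqI)
  next
    case (eng g h)
    obtain s where s: "s \<in> Sym_deg B J d" "g = inl s" using eng(3) by (elim imageE)
    obtain t where t: "t \<in> Sym_deg B J d" "h = inl t" using eng(4) by (elim imageE)
    have "g \<otimes>\<^bsub>add_monoid Q\<^esub> h = inl (s \<oplus>\<^bsub>SB\<^esub> t)"
      using ring_hom_add[OF inl_hom Sym_deg_carrier[OF s(1)] Sym_deg_carrier[OF t(1)]] s(2) t(2) by simp
    then show ?case using Sym_deg_add[OF s(1) t(1)] by (rule image_eqI)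
  qed
next
  fix x assume "x \<in> inl ` Sym_deg B J d"
  then obtain s where s: "s \<in> Sym_deg B J d" "x = inl s" by (elim imageE)
  have "\<one>\<^bsub>A\<^esub> \<in> I [^]\<^bsub>ideals_set A\<^esub> (0::nat)" by (simp add: ideals_set_def)
  moreover have "tmon \<one>\<^bsub>A\<^esub> 0 = \<one>\<^bsub>Rees A I\<^esub>" using ring_hom_one[OF A.monom0_hom] by simp
  ultimately have 1: "\<one>\<^bsub>Rees A I\<^esub> \<in> Rees_deg A I 0" unfolding Rees_deg_def by (metis (mono_tags, lifting) mem_Collect_eq)
  have "x = pure s \<one>\<^bsub>Rees A I\<^esub>" unfolding s(2) by (rule pure_eq(2)[OF Sym_deg_carrier[OF s(1)], symmetric])
  then have "x \<in> ?G" using s(1) 1 add_0_right[of d] by blast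
  then show "x \<in> generate (add_monoid Q) ?G" by (rule generate.incl)
qed

end

lemma embedding_embedded:
  assumes B: "cring B" and J: "ideal J B" and N: "(A, \<iota>, \<pi>) \<in> embeddings B \<kappa>"
  shows "embedded A (ideal_in J (A, \<iota>, \<pi>)) B J \<pi>"
proof -
  from N have A: "cring A" and \<pi>: "\<pi> \<in> ring_hom A B" "\<pi> ` carrier A = carrier B"
    by (auto simp: embeddings_def k_algebra_def)
  interpret h: ring_hom_ring A B \<pi> by (rule ring_hom_ringI2) (use A B \<pi> cring.axioms(1) in auto)
  have I: "ideal_in J (A, \<iota>, \<pi>) = {a \<in> carrier A. \<pi> a \<in> J}" by (simp add: ideal_in_def)
  then have "ideal (ideal_in J (A, \<iota>, \<pi>)) A"
    using h.ideal_vimage[OF J] by simp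
  then show ?thesis
    by (intro embedded.intro ring_with_ideal.intro embedded_axioms.intro A B J \<pi> I)
qed

locale embedded_morphism = N: embedded A I B J \<pi> + N': embedded A' I' B J \<pi>'
  for A (structure) and I and B (structure) and J and \<pi> and A' (structure) and I' and \<pi>' +
  fixes \<rho>
  assumes \<rho>: "\<rho> \<in> ring_hom A' A" and \<pi>\<rho>: "\<And>a. a \<in> carrier A' \<Longrightarrow> \<pi> (\<rho> a) = \<pi>' a"
begin

lemma \<rho>_ideal: "b \<in> I' \<Longrightarrow> \<rho> b \<in> I"
  using N'.I_sub N'.\<pi>I[of b] ring_hom_closed[OF \<rho>, of b] \<pi>\<rho>[of b] N.in_I[of "\<rho> b"] by force

lemma \<rho>_zero: "\<rho> \<zero>\<^bsub>A'\<^esub> = \<zero>\<^bsub>A\<^esub>"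
  by (rule ring_hom_zero'[OF \<rho> N'.A.cring_axioms N.A.cring_axioms])

lemma \<rho>_Rees: assumes t: "t \<in> carrier (Rees A' I')" shows "\<rho> \<circ> t \<in> carrier (Rees A I)"
proof -
  have tu: "t \<in> up A'" and tJ: "\<And>d. t d \<in> N'.A.JP d" using t unfolding N'.A.carrier_Rees by blast+
  obtain n where n: "bound \<zero>\<^bsub>A'\<^esub> n t" using tu by (auto simp: up_def)
  have "bound \<zero>\<^bsub>A\<^esub> n (\<rho> \<circ> t)"
    using n \<rho>_zero by (simp add: bound_def)
  moreover have "(\<rho> \<circ> t) d \<in> carrier A" for d
    using ring_hom_closed[OF \<rho> mem_upD[OF tu]] by simp
  ultimately have 1: "\<rho> \<circ> t \<in> up A" by (intro mem_upI exI)
  have 2: "(\<rho> \<circ> t) d \<in> N.A.JP d" for d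
  proof -
    have s: "\<rho> ` carrier A' \<subseteq> carrier A" "\<rho> ` I' \<subseteq> I"
      using ring_hom_closed[OF \<rho>] \<rho>_ideal by blast+
    have "(d, t d) \<in> forms A' (carrier A') I'" using tJ[of d] by blast
    from forms_hom[OF \<rho> N'.A.cring_axioms N.A.cring_axioms subset_refl N'.I_sub s this]
    show ?thesis by simp
  qed
  show ?thesis unfolding N.A.carrier_Rees using 1 2 by blast
qed

lemma \<rho>_monom: "a \<in> carrier A' \<Longrightarrow> \<rho> \<circ> up_ring.monom (UP A') a d = up_ring.monom (UP A) (\<rho> a) d"
  by (rule ext) (simp add: N'.A.monom_at N.A.monom_at ring_hom_closed[OF \<rho>] \<rho>_zero)

lemma \<rho>_Rees_hom: "(\<lambda>t. \<rho> \<circ> t) \<in> ring_hom (Rees A' I') (Rees A I)"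
proof (rule ring_hom_memI)
  interpret h: ring_hom_ring A' A \<rho>
    by (rule ring_hom_ringI2[OF N'.A.ring_axioms N.A.ring_axioms \<rho>])
  have u: "t \<in> up A'" if "t \<in> carrier (Rees A' I')" for t using that unfolding N'.A.carrier_Rees by blast
  have v: "\<rho> \<circ> t \<in> up A" if "t \<in> carrier (Rees A' I')" for t using \<rho>_Rees[OF that] unfolding N.A.carrier_Rees by blast
  fix s t assume s: "s \<in> carrier (Rees A' I')" and t: "t \<in> carrier (Rees A' I')"
  show "\<rho> \<circ> s \<in> carrier (Rees A I)" by (rule \<rho>_Rees[OF s])
  show "\<rho> \<circ> (s \<oplus>\<^bsub>Rees A' I'\<^esub> t) = (\<rho> \<circ> s) \<oplus>\<^bsub>Rees A I\<^esub> (\<rho> \<circ> t)"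
  proof (rule ext)
    fix n
    show "(\<rho> \<circ> (s \<oplus>\<^bsub>Rees A' I'\<^esub> t)) n = ((\<rho> \<circ> s) \<oplus>\<^bsub>Rees A I\<^esub> (\<rho> \<circ> t)) n"
      unfolding N'.A.Rees_simps N.A.Rees_simps comp_apply N'.A.UP_mult_at(2)[OF u[OF s] u[OF t]] N.A.UP_mult_at(2)[OF v[OF s] v[OF t]]
      by (rule ring_hom_add[OF \<rho> mem_upD[OF u[OF s]] mem_upD[OF u[OF t]]])
  qed
  show "\<rho> \<circ> (s \<otimes>\<^bsub>Rees A' I'\<^esub> t) = (\<rho> \<circ> s) \<otimes>\<^bsub>Rees A I\<^esub> (\<rho> \<circ> t)"
  proof (rule ext)
    fix n
    have cl: "s i \<in> carrier A'" "t i \<in> carrier A'" for i using mem_upD[OF u[OF s]] mem_upD[OF u[OF t]] by blast+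
    have F: "(\<lambda>i. s i \<otimes>\<^bsub>A'\<^esub> t (n - i)) \<in> {..n} \<rightarrow> carrier A'"
      by (rule funcsetI) (rule N'.A.m_closed[OF cl])
    have "\<rho> (\<Oplus>\<^bsub>A'\<^esub>i\<in>{..n}. s i \<otimes>\<^bsub>A'\<^esub> t (n - i)) = (\<Oplus>\<^bsub>A\<^esub>i\<in>{..n}. (\<rho> \<circ> (\<lambda>i. s i \<otimes>\<^bsub>A'\<^esub> t (n - i))) i)"
      by (rule h.hom_finsum[OF F])
    also have "\<dots> = (\<Oplus>\<^bsub>A\<^esub>i\<in>{..n}. (\<rho> \<circ> s) i \<otimes>\<^bsub>A\<^esub> (\<rho> \<circ> t) (n - i))"
      by (simp add: comp_def ring_hom_mult[OF \<rho> cl])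
    finally show "(\<rho> \<circ> (s \<otimes>\<^bsub>Rees A' I'\<^esub> t)) n = ((\<rho> \<circ> s) \<otimes>\<^bsub>Rees A I\<^esub> (\<rho> \<circ> t)) n"
      unfolding N'.A.Rees_simps N.A.Rees_simps comp_apply[of \<rho> "_ \<otimes>\<^bsub>_\<^esub> _"] N'.A.UP_mult_at(1)[OF u[OF s] u[OF t]] N.A.UP_mult_at(1)[OF v[OF s] v[OF t]] .
  qed
next
  have "\<rho> \<circ> \<one>\<^bsub>Rees A' I'\<^esub> = \<rho> \<circ> up_ring.monom (UP A') \<one>\<^bsub>A'\<^esub> 0"
    using ring_hom_one[OF N'.A.monom0_hom] by simp
  also have "\<dots> = up_ring.monom (UP A) \<one>\<^bsub>A\<^esub> 0"
    using \<rho>_monom[OF N'.A.one_closed] ring_hom_one[OF \<rho>] by simp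
  finally show "\<rho> \<circ> \<one>\<^bsub>Rees A' I'\<^esub> = \<one>\<^bsub>Rees A I\<^esub>"
    using ring_hom_one[OF N.A.monom0_hom] by simp
qed

text \<open>The transition map is induced by homomorphisms on both factors that agree on \<open>Sym A' I'\<close>; it suffices to
check the agreement on constants and generators.\<close>

lemma transition_inl:
  assumes s: "s \<in> carrier (Sym B J)"
  shows "the_elem (mpoly_eval (Sym B J) N.Q (\<lambda>s. N.pure s \<one>\<^bsub>Rees A I\<^esub>) (\<lambda>t. N.pure \<one>\<^bsub>Sym B J\<^esub> (\<rho> \<circ> t)) ` N'.inl s)
    = N.inl s"
proof -
  let ?h = "\<lambda>s. N.pure s \<one>\<^bsub>Rees A I\<^esub>" and ?v = "\<lambda>t. N.pure \<one>\<^bsub>Sym B J\<^esub> (\<rho> \<circ> t)"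
  have he: "?h s = N.inl s" if "s \<in> carrier (Sym B J)" for s by (rule N.pure_eq(2)[OF that])
  have ve: "?v t = N.inr (\<rho> \<circ> t)" if "t \<in> carrier (Rees A' I')" for t by (rule N.pure_eq(3)[OF \<rho>_Rees[OF that]])
  have "?h \<in> ring_hom (Sym B J) N.Q"
    by (rule ring_hom_memI)
      (simp_all only: he N.B.S.m_closed N.B.S.a_closed N.B.S.one_closed N.inl_closed
        ring_hom_mult[OF N.inl_hom] ring_hom_add[OF N.inl_hom] ring_hom_one[OF N.inl_hom])
  moreover have v: "?v \<in> ring_hom (Rees A' I') N.Q"
  proof -
    have c: "(N.inr \<circ> (\<lambda>t. \<rho> \<circ> t)) \<in> ring_hom (Rees A' I') N.Q"
      by (rule ring_hom_trans[OF \<rho>_Rees_hom N.inr_hom])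
    interpret Rs: cring "Rees A' I'" by (rule N'.A.Rees_cring)
    have ve': "?v t = (N.inr \<circ> (\<lambda>t. \<rho> \<circ> t)) t" if "t \<in> carrier (Rees A' I')" for t using ve[OF that] by simp
    show ?thesis
      by (rule ring_hom_memI)
        (simp_all only: ve' Rs.m_closed Rs.a_closed Rs.one_closed ring_hom_closed[OF c]
          ring_hom_mult[OF c] ring_hom_add[OF c] ring_hom_one[OF c])
  qed
  moreover have "?v (Sym_to_Rees A' I' r) = ?h (N'.lift_map r)" if r: "r \<in> carrier (Sym A' I')" for r
  proof -
    have "((N.inr \<circ> (\<lambda>t. \<rho> \<circ> t)) \<circ> Sym_to_Rees A' I') r = (N.inl \<circ> N'.lift_map) r"
    proof (rule N'.A.Sym_hom_eqI[OF N.Q_cring ring_hom_trans[OF N'.A.Sym_to_Rees_hom ring_hom_trans[OF \<rho>_Rees_hom N.inr_hom]]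
          ring_hom_trans[OF N'.lift_map_facts(1) N.inl_hom] _ _ r])
      fix c assume c: "c \<in> carrier A'"
      have "N.inl (Sym_const B J (\<pi> (\<rho> c))) = N.inr (up_ring.monom (UP A) (\<rho> c) 0)"
        by (rule N.graph_tensor[OF N.graph_const[OF ring_hom_closed[OF \<rho> c]]])
      then show "((N.inr \<circ> (\<lambda>t. \<rho> \<circ> t)) \<circ> Sym_to_Rees A' I') (Sym_const A' I' c) = (N.inl \<circ> N'.lift_map) (Sym_const A' I' c)"
        by (simp only: comp_apply N'.A.Sym_to_Rees_const[OF c] \<rho>_monom[OF c] N'.lift_map_facts(2)[OF c] \<pi>\<rho>[OF c])
    next
      fix c assume c: "c \<in> I'"
      have cA: "c \<in> carrier A'" using c N'.I_sub by blast
      show "((N.inr \<circ> (\<lambda>t. \<rho> \<circ> t)) \<circ> Sym_to_Rees A' I') (Sym_gen A' I' c) = (N.inl \<circ> N'.lift_map) (Sym_gen A' I' c)"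
        unfolding comp_apply N'.A.Sym_to_Rees_gen[OF c] \<rho>_monom[OF cA] N'.lift_map_facts(3)[OF c] N.inr_gen[OF \<rho>_ideal[OF c]] \<pi>\<rho>[OF cA] ..
    qed
    then show ?thesis
      using he[OF ring_hom_closed[OF N'.lift_map_facts(1) r]] ve[OF ring_hom_closed[OF N'.A.Sym_to_Rees_hom r]] by simp
  qed
  ultimately show ?thesis
    using tensor_data.tensor_lift_inl[OF N'.tensor N.Q_cring, of ?h ?v s] he[OF s] s by simp
qed

end

subsection \<open>The limit\<close>

context
  fixes B :: "'b ring" and \<kappa> :: "'k::field \<Rightarrow> 'b" and J :: "'b set"
  assumes B: "cring B" and J: "ideal J B"
begin

interpretation BJ: ring_with_ideal B J by (rule ring_with_ideal.intro[OF B J])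

definition qclass :: "('k, 'r, 'b) embedding \<Rightarrow> ('b multiset \<Rightarrow> 'b) set \<Rightarrow> ('r, 'b) qsym_elem" where
  "qclass N s = qSym_in_tensor B J N s \<one>\<^bsub>Rees (fst N) (ideal_in J N)\<^esub>"

lemma qclass_facts:
  fixes N :: "('k, 'r, 'b) embedding"
  assumes N: "N \<in> embeddings B \<kappa>"
  shows "qSym_in_deg B J N d = qclass N ` Sym_deg B J d"
    "s \<in> carrier (Sym B J) \<Longrightarrow> t \<in> carrier (Sym B J) \<Longrightarrow> qclass N s = qclass N t \<Longrightarrow>
       qclass N (s \<ominus>\<^bsub>Sym B J\<^esub> t) = qclass N \<zero>\<^bsub>Sym B J\<^esub>"
    "s \<in> Sym_deg B J d \<Longrightarrow> t \<in> Sym_deg B J d \<Longrightarrow> s \<ominus>\<^bsub>Sym B J\<^esub> t \<in> Sym_deg B J d"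
    "s \<in> Sym_deg B J d \<Longrightarrow> s \<in> carrier (Sym B J)"
    "\<zero>\<^bsub>Sym B J\<^esub> \<in> Sym_deg B J d"
proof -
  obtain A \<iota> \<pi> where NA: "N = (A, \<iota>, \<pi>)" by (metis prod_cases3)
  interpret E: embedded A "ideal_in J (A, \<iota>, \<pi>)" B J \<pi>
    by (rule embedding_embedded[OF B J]) (use N NA in blast)
  have q: "qclass N s = E.inl s" if "s \<in> carrier (Sym B J)" for s
    unfolding qclass_def NA qSym_in_tensor_def fst_conv prod.case by (rule E.pure_eq(2)[OF that])
  have "qSym_in_deg B J N d = E.inl ` Sym_deg B J d"
    unfolding NA qSym_in_deg_def qSym_in_tensor_def qSym_in_def fst_conv prod.case by (rule E.generate_deg)
  also have "\<dots> = qclass N ` Sym_deg B J d"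
    by (rule image_cong[OF refl]) (rule q[OF E.Sym_deg_carrier, symmetric])
  finally show "qSym_in_deg B J N d = qclass N ` Sym_deg B J d" .
  show "qclass N (s \<ominus>\<^bsub>Sym B J\<^esub> t) = qclass N \<zero>\<^bsub>Sym B J\<^esub>"
    if st: "s \<in> carrier (Sym B J)" "t \<in> carrier (Sym B J)" "qclass N s = qclass N t"
  proof -
    have "E.inl s = E.inl t" using st q by metis
    then have "E.inl (s \<ominus>\<^bsub>Sym B J\<^esub> t) = E.inl \<zero>\<^bsub>Sym B J\<^esub>"
      using E.inl_inj_zero[OF st(1,2)] ring_hom_zero'[OF E.inl_hom BJ.S.cring_axioms E.Q_cring] by metis
    then show ?thesis using q[OF BJ.S.minus_closed[OF st(1,2)]] q[OF BJ.S.zero_closed] by metis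
  qed
  show "s \<in> Sym_deg B J d \<Longrightarrow> t \<in> Sym_deg B J d \<Longrightarrow> s \<ominus>\<^bsub>Sym B J\<^esub> t \<in> Sym_deg B J d" by (rule E.Sym_deg_minus)
  show "s \<in> Sym_deg B J d \<Longrightarrow> s \<in> carrier (Sym B J)" by (rule E.Sym_deg_carrier)
  show "\<zero>\<^bsub>Sym B J\<^esub> \<in> Sym_deg B J d" by (rule E.Sym_deg_zero)
qed

lemma qclass_zero_iff:
  assumes N: "(A, \<iota>, \<pi>) \<in> embeddings B \<kappa>" and d: "0 < d" and s: "s \<in> Sym_deg B J d"
  shows "qclass (A, \<iota>, \<pi>) s = qclass (A, \<iota>, \<pi>) \<zero>\<^bsub>Sym B J\<^esub> \<longleftrightarrow>
    (\<zero>\<^bsub>A\<^esub>, s) \<in> embedded.graph A (ideal_in J (A, \<iota>, \<pi>)) B J \<pi> d"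
proof -
  interpret E: embedded A "ideal_in J (A, \<iota>, \<pi>)" B J \<pi> by (rule embedding_embedded[OF B J N])
  have q: "qclass (A, \<iota>, \<pi>) s = E.inl s" if "s \<in> carrier (Sym B J)" for s
    unfolding qclass_def qSym_in_tensor_def fst_conv prod.case by (rule E.pure_eq(2)[OF that])
  show ?thesis
    unfolding q[OF E.Sym_deg_carrier[OF s]] q[OF BJ.S.zero_closed] ring_hom_zero'[OF E.inl_hom BJ.S.cring_axioms E.Q_cring]
    by (rule E.tensor_zero_iff[OF d s])
qed

lemma transition_qclass:
  assumes N: "N \<in> embeddings B \<kappa>" and N': "N' \<in> embeddings B \<kappa>" and \<rho>: "\<rho> \<in> embedding_maps N N'"
    and s: "s \<in> carrier (Sym B J)"
  shows "qSym_transition B J N \<rho> (qclass N' s) = qclass N s"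
proof -
  obtain A \<iota> \<pi> where NA: "N = (A, \<iota>, \<pi>)" by (metis prod_cases3)
  obtain A' \<iota>' \<pi>' where NA': "N' = (A', \<iota>', \<pi>')" by (metis prod_cases3)
  interpret E: embedded_morphism A "ideal_in J (A, \<iota>, \<pi>)" B J \<pi> A' "ideal_in J (A', \<iota>', \<pi>')" \<pi>' \<rho>
    by (intro embedded_morphism.intro embedded_morphism_axioms.intro embedding_embedded[OF B J, where \<kappa> = \<kappa>])
      (use N N' \<rho> NA NA' in \<open>auto simp: embedding_maps_def\<close>)
  have q: "qclass N s = E.N.inl s"
    unfolding qclass_def NA qSym_in_tensor_def fst_conv prod.case by (rule E.N.pure_eq(2)[OF s])
  have q': "qclass N' s = E.N'.inl s"
    unfolding qclass_def NA' qSym_in_tensor_def fst_conv prod.case by (rule E.N'.pure_eq(2)[OF s])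
  show ?thesis
    unfolding q q' unfolding NA qSym_transition_def qSym_in_tensor_def qSym_in_def fst_conv prod.case
    by (rule E.transition_inl[OF s])
qed

text \<open>A compatible family \<open>x\<close> has the component of some \<open>s\<close> at \<open>M\<close>. For any other \<open>N\<close> choose a common bound \<open>N'\<close>; the
component at \<open>N'\<close> comes from some \<open>s'\<close>, which equals \<open>s\<close> because both have the same image at \<open>M\<close>. Hence the
component at \<open>N\<close> comes from \<open>s\<close> as well.\<close>

lemma limit_bij:
  fixes M :: "('k, 'r, 'b) embedding"
  assumes M: "M \<in> embeddings B \<kappa>"
    and dom: "\<And>N :: ('k, 'r, 'b) embedding. N \<in> embeddings B \<kappa> \<Longrightarrow>
       \<exists>N'\<in>embeddings B \<kappa>. embedding_maps M N' \<noteq> {} \<and> embedding_maps N N' \<noteq> {}"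
    and inj: "\<And>s. s \<in> Sym_deg B J d \<Longrightarrow> qclass M s = qclass M \<zero>\<^bsub>Sym B J\<^esub> \<Longrightarrow> s = \<zero>\<^bsub>Sym B J\<^esub>"
  shows "bij_betw (Sym_to_qSym B \<kappa> J) (Sym_deg B J d)
    (qSym_deg B \<kappa> J d :: (('k, 'r, 'b) embedding \<Rightarrow> _) set)"
proof -
  note F = qclass_facts[OF M]
  have at: "Sym_to_qSym B \<kappa> J s N = qclass N s" if "N \<in> embeddings B \<kappa>" for s and N :: "('k, 'r, 'b) embedding"
    using that by (simp add: Sym_to_qSym_def qclass_def)
  have inj': "s = t" if st: "s \<in> Sym_deg B J d" "t \<in> Sym_deg B J d" "qclass M s = qclass M t" for s t
  proof -
    have "s \<ominus>\<^bsub>Sym B J\<^esub> t = \<zero>\<^bsub>Sym B J\<^esub>"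
      by (rule inj[OF F(3)[OF st(1,2)] F(2)[OF F(4)[OF st(1)] F(4)[OF st(2)] st(3)]])
    then show ?thesis using F(4)[OF st(1)] F(4)[OF st(2)] by (metis BJ.S.r_right_minus_eq)
  qed
  show ?thesis unfolding bij_betw_def
  proof (intro conjI subset_antisym)
    show "inj_on (Sym_to_qSym B \<kappa> J :: _ \<Rightarrow> (('k, 'r, 'b) embedding \<Rightarrow> _)) (Sym_deg B J d)"
    proof (rule inj_onI)
      fix s t assume st: "s \<in> Sym_deg B J d" "t \<in> Sym_deg B J d"
        and "(Sym_to_qSym B \<kappa> J s :: ('k, 'r, 'b) embedding \<Rightarrow> _) = Sym_to_qSym B \<kappa> J t"
      then have "qclass M s = qclass M t" using at[OF M] by metis
      then show "s = t" by (rule inj'[OF st])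
    qed
    show "Sym_to_qSym B \<kappa> J ` Sym_deg B J d \<subseteq> (qSym_deg B \<kappa> J d :: (('k, 'r, 'b) embedding \<Rightarrow> _) set)"
    proof (rule image_subsetI)
      fix s assume s: "s \<in> Sym_deg B J d"
      show "Sym_to_qSym B \<kappa> J s \<in> (qSym_deg B \<kappa> J d :: (('k, 'r, 'b) embedding \<Rightarrow> _) set)"
        unfolding qSym_deg_def
      proof (intro CollectI conjI ballI)
        show "(Sym_to_qSym B \<kappa> J s :: ('k, 'r, 'b) embedding \<Rightarrow> _) \<in> (\<Pi>\<^sub>E N\<in>embeddings B \<kappa>. qSym_in_deg B J N d)"
        proof (rule PiE_I)
          fix N :: "('k, 'r, 'b) embedding" assume N: "N \<in> embeddings B \<kappa>"
          show "Sym_to_qSym B \<kappa> J s N \<in> qSym_in_deg B J N d"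
            unfolding at[OF N] qclass_facts(1)[OF N] by (rule imageI[OF s])
        qed (simp add: Sym_to_qSym_def)
        fix N N' :: "('k, 'r, 'b) embedding" and \<rho>
        assume N: "N \<in> embeddings B \<kappa>" and N': "N' \<in> embeddings B \<kappa>" and \<rho>: "\<rho> \<in> embedding_maps N N'"
        show "qSym_transition B J N \<rho> (Sym_to_qSym B \<kappa> J s N') = Sym_to_qSym B \<kappa> J s N"
          unfolding at[OF N] at[OF N'] by (rule transition_qclass[OF N N' \<rho> F(4)[OF s]])
      qed
    qed
    show "(qSym_deg B \<kappa> J d :: (('k, 'r, 'b) embedding \<Rightarrow> _) set) \<subseteq> Sym_to_qSym B \<kappa> J ` Sym_deg B J d"
    proof (rule subsetI)
      fix x :: "('k, 'r, 'b) embedding \<Rightarrow> _" assume "x \<in> qSym_deg B \<kappa> J d"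
      then have xN: "x \<in> (\<Pi>\<^sub>E N\<in>embeddings B \<kappa>. qSym_in_deg B J N d)"
        and xc: "\<And>(N :: ('k, 'r, 'b) embedding) N' \<rho>. N \<in> embeddings B \<kappa> \<Longrightarrow> N' \<in> embeddings B \<kappa> \<Longrightarrow> \<rho> \<in> embedding_maps N N' \<Longrightarrow>
           qSym_transition B J N \<rho> (x N') = x N"
        unfolding qSym_deg_def by blast+
      have xd: "\<exists>s\<in>Sym_deg B J d. x N = qclass N s" if N: "N \<in> embeddings B \<kappa>" for N :: "('k, 'r, 'b) embedding"
        using PiE_mem[OF xN N] unfolding qclass_facts(1)[OF N] by (elim imageE) (rule bexI)
      obtain s where s: "s \<in> Sym_deg B J d" "x M = qclass M s" using xd[OF M] by (elim bexE)
      have "x N = Sym_to_qSym B \<kappa> J s N" for N :: "('k, 'r, 'b) embedding"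
      proof (cases "N \<in> embeddings B \<kappa>")
        case N: True
        obtain N' \<rho> \<rho>' where N': "N' \<in> embeddings B \<kappa>" "\<rho> \<in> embedding_maps M N'" "\<rho>' \<in> embedding_maps N N'"
          using dom[OF N] by (elim bexE conjE) (meson ex_in_conv)
        obtain t where t: "t \<in> Sym_deg B J d" "x N' = qclass N' t" using xd[OF N'(1)] by (elim bexE)
        have "qclass M t = qclass M s"
          using xc[OF M N'(1,2)] transition_qclass[OF M N'(1,2) F(4)[OF t(1)]] t(2) s(2) by simp
        then have "t = s" by (rule inj'[OF t(1) s(1)])
        then show ?thesis
          using xc[OF N N'(1,3)] transition_qclass[OF N N'(1,3) F(4)[OF t(1)]] t(2) at[OF N, of s] by simp
      next
        case False
        then show ?thesis using PiE_arb[OF xN False] by (simp add: Sym_to_qSym_def)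
      qed
      then show "x \<in> Sym_to_qSym B \<kappa> J ` Sym_deg B J d" using s(1) by (intro image_eqI[of _ _ s]) auto
    qed
  qed
qed

lemma limit_inj:
  assumes bij: "bij_betw (Sym_to_qSym B \<kappa> J) (Sym_deg B J d)
      (qSym_deg B \<kappa> J d :: (('k, 'r, 'b) embedding \<Rightarrow> _) set)"
    and s: "s \<in> Sym_deg B J d" and z: "\<zero>\<^bsub>Sym B J\<^esub> \<in> Sym_deg B J d"
    and all: "\<And>N :: ('k, 'r, 'b) embedding. N \<in> embeddings B \<kappa> \<Longrightarrow> qclass N s = qclass N \<zero>\<^bsub>Sym B J\<^esub>"
  shows "s = \<zero>\<^bsub>Sym B J\<^esub>"
proof (rule inj_onD[OF bij_betw_imp_inj_on[OF bij] _ s z])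
  show "(Sym_to_qSym B \<kappa> J s :: ('k, 'r, 'b) embedding \<Rightarrow> _) = Sym_to_qSym B \<kappa> J \<zero>\<^bsub>Sym B J\<^esub>"
    unfolding Sym_to_qSym_def by (rule restrict_ext) (use all in \<open>simp add: qclass_def\<close>)
qed

end

section \<open>The \<open>\<times>\<close>-condition as vanishing of a kernel\<close>

definition component :: "('r, 'm) ring_scheme \<Rightarrow> nat \<Rightarrow> ('i multiset \<Rightarrow> 'r) \<Rightarrow> ('i multiset \<Rightarrow> 'r)" where
  "component R d P = (\<lambda>m. if size m = d then P m else \<zero>\<^bsub>R\<^esub>)"

context cring
begin

abbreviation (input) "MP I \<equiv> mpoly_ring R I"

lemma component_homogeneous: "P \<in> carrier (MP I) \<Longrightarrow> component R d P \<in> homogeneous R I d"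
proof -
  assume P: "P \<in> carrier (MP I)"
  have "finite {m. component R d P m \<noteq> \<zero>}"
    by (rule finite_subset[of _ "{m. P m \<noteq> \<zero>}"]) (use P in \<open>auto simp: component_def mpoly_carrier_iff\<close>)
  then show ?thesis using P by (auto simp: homogeneous_def mpoly_carrier_iff component_def)
qed

lemma component_id: "P \<in> homogeneous R I d \<Longrightarrow> component R d P = P"
  unfolding component_def homogeneous_def by (rule ext) (metis (mono_tags, lifting) mem_Collect_eq)

lemma component_add: "component R d (P \<oplus>\<^bsub>MP I\<^esub> Q) = component R d P \<oplus>\<^bsub>MP I\<^esub> component R d Q"
  by (rule ext) (simp add: component_def mpoly_ring_simps indexed_padd_def)

lemma component_const:
  assumes "P \<in> carrier (MP I)" "c \<in> carrier R"
  shows "component R d (P \<otimes>\<^bsub>MP I\<^esub> indexed_const c) = component R d P \<otimes>\<^bsub>MP I\<^esub> indexed_const c"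
proof -
  have *: "Y \<otimes>\<^bsub>MP I\<^esub> indexed_const c = (\<lambda>m. c \<otimes> Y m)" if Y: "Y \<in> carrier (MP I)" for Y
    using mpoly_mult_commute[of Y "indexed_const c" I] mpoly_mult_const[OF assms(2), of Y I]
      mpoly_coeff_closed[OF Y] mpoly_coeff_closed[OF mpoly_closed(1)[OF assms(2), of I]] by simp
  have "component R d P \<in> carrier (MP I)" using component_homogeneous[OF assms(1)] by (simp add: homogeneous_def)
  then show ?thesis using assms by (simp add: * component_def fun_eq_iff)
qed

lemma component_var:
  assumes P: "P \<in> carrier (MP I)" and i: "i \<in> I"
  shows "component R (Suc d) (P \<otimes>\<^bsub>MP I\<^esub> indexed_var i) = component R d P \<otimes>\<^bsub>MP I\<^esub> indexed_var i"
proof -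
  have "component R d P \<in> carrier (MP I)" using component_homogeneous[OF P] by (simp add: homogeneous_def)
  moreover have "(size m = Suc d) = (size (m - {#i#}) = d)" if "i \<in># m" for m
    using that by (metis size_Suc_Diff1 nat.inject)
  ultimately show ?thesis using P i
    by (auto simp: mpoly_mult_var component_def indexed_pmult_def fun_eq_iff)
qed

lemma component_finsum:
  assumes "finite A" "f \<in> A \<rightarrow> carrier (MP I)"
  shows "component R d (finsum (MP I) f A) = (\<Oplus>\<^bsub>MP I\<^esub>i\<in>A. component R d (f i))"
proof -
  interpret T: cring "MP I" by (rule mpoly_cring)
  have cc: "P \<in> carrier (MP I) \<Longrightarrow> component R d P \<in> carrier (MP I)" for P
    using component_homogeneous[of P I d] by (simp add: homogeneous_def)
  have "component R d \<zero>\<^bsub>MP I\<^esub> = \<zero>\<^bsub>MP I\<^esub>"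
    by (rule ext) (simp add: component_def mpoly_ring_simps indexed_const_def)
  with assms show ?thesis
    by (induction A rule: finite_induct) (simp_all add: component_add cc Pi_def)
qed

lemma homogeneous_carrier: "P \<in> homogeneous R I d \<Longrightarrow> P \<in> carrier (MP I)"
  by (simp add: homogeneous_def)

lemma forms_T_sub: "indexed_const ` carrier R \<subseteq> carrier (MP I)" "indexed_var ` I \<subseteq> carrier (MP I)"
  by (auto intro: mpoly_closed indexed_var_closed)

lemma homogeneous_add: "P \<in> homogeneous R I d \<Longrightarrow> Q \<in> homogeneous R I d \<Longrightarrow> P \<oplus>\<^bsub>MP I\<^esub> Q \<in> homogeneous R I d"
  unfolding homogeneous_eq_forms by (simp add: forms.add)

lemma homogeneous_zero: "\<zero>\<^bsub>MP I\<^esub> \<in> homogeneous R I d"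
  unfolding homogeneous_eq_forms by (simp add: forms.zero)

lemma homogeneous_const: "c \<in> carrier R \<Longrightarrow> indexed_const c \<in> homogeneous R I 0"
  unfolding homogeneous_eq_forms by (simp add: forms.const)

lemma homogeneous_mult_var: "P \<in> homogeneous R I d \<Longrightarrow> i \<in> I \<Longrightarrow> P \<otimes>\<^bsub>MP I\<^esub> indexed_var i \<in> homogeneous R I (Suc d)"
  unfolding homogeneous_eq_forms by (simp add: forms.mult)

lemma homogeneous_mult:
  assumes "P \<in> homogeneous R I d" "Q \<in> homogeneous R I e"
  shows "P \<otimes>\<^bsub>MP I\<^esub> Q \<in> homogeneous R I (d + e)"
proof -
  interpret T: cring "MP I" by (rule mpoly_cring)
  have "c \<otimes>\<^bsub>MP I\<^esub> c' \<in> indexed_const ` carrier R"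
    if c: "c \<in> indexed_const ` carrier R" and c': "c' \<in> indexed_const ` carrier R" for c c' :: "'c multiset \<Rightarrow> 'a"
  proof -
    obtain a where a: "a \<in> carrier R" "c = indexed_const a" using c by (elim imageE)
    obtain b where b: "b \<in> carrier R" "c' = indexed_const b" using c' by (elim imageE)
    have "c \<otimes>\<^bsub>MP I\<^esub> c' = indexed_const (a \<otimes> b)"
      unfolding a(2) b(2) by (rule ring_hom_mult[OF indexed_const_hom a(1) b(1), symmetric])
    then show ?thesis by (rule image_eqI) (rule m_closed[OF a(1) b(1)])
  qed
  from T.forms_mult[OF forms_T_sub this, of d P e Q] assms show ?thesis
    unfolding homogeneous_eq_forms by (simp only: mem_Collect_eq)
qed

text \<open>In an expression of positive degree the last factor of each summand is a variable.\<close>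

lemma homogeneous_Suc_decomp:
  assumes P: "P \<in> homogeneous R I (Suc d)" and fin: "finite I"
  shows "\<exists>Q. (\<forall>j\<in>I. Q j \<in> homogeneous R I d) \<and> P = (\<Oplus>\<^bsub>MP I\<^esub>j\<in>I. Q j \<otimes>\<^bsub>MP I\<^esub> indexed_var j)"
proof -
  interpret T: cring "MP I" by (rule mpoly_cring)
  let ?C = "indexed_const ` carrier R" and ?V = "indexed_var ` I"
  note hc = homogeneous_carrier indexed_var_closed
  have "(Suc d, P) \<in> forms (MP I) ?C ?V" using P unfolding homogeneous_eq_forms by blast
  then show ?thesis
  proof (induction rule: forms_Suc_induct)
    case zero
    have "\<zero>\<^bsub>MP I\<^esub> = (\<Oplus>\<^bsub>MP I\<^esub>j\<in>I. \<zero>\<^bsub>MP I\<^esub> \<otimes>\<^bsub>MP I\<^esub> indexed_var j)"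
      by (rule T.add.finprod_one_eqI[symmetric]) (simp add: hc)
    then show ?case using homogeneous_zero by (intro exI[of _ "\<lambda>_. \<zero>\<^bsub>MP I\<^esub>"]) blast
  next
    case (add a b)
    obtain Q where Q: "\<forall>j\<in>I. Q j \<in> homogeneous R I d" "a = (\<Oplus>\<^bsub>MP I\<^esub>j\<in>I. Q j \<otimes>\<^bsub>MP I\<^esub> indexed_var j)"
      using add.IH(1) by (elim exE conjE)
    obtain Q' where Q': "\<forall>j\<in>I. Q' j \<in> homogeneous R I d" "b = (\<Oplus>\<^bsub>MP I\<^esub>j\<in>I. Q' j \<otimes>\<^bsub>MP I\<^esub> indexed_var j)"
      using add.IH(2) by (elim exE conjE)
    have cl: "Q j \<in> carrier (MP I)" "Q' j \<in> carrier (MP I)" if "j \<in> I" for j using Q Q' that hc(1) by blast+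
    have "a \<oplus>\<^bsub>MP I\<^esub> b = (\<Oplus>\<^bsub>MP I\<^esub>j\<in>I. Q j \<otimes>\<^bsub>MP I\<^esub> indexed_var j \<oplus>\<^bsub>MP I\<^esub> Q' j \<otimes>\<^bsub>MP I\<^esub> indexed_var j)"
      unfolding Q(2) Q'(2) by (rule T.finsum_addf[symmetric]) (simp_all add: cl hc Pi_def)
    also have "\<dots> = (\<Oplus>\<^bsub>MP I\<^esub>j\<in>I. (Q j \<oplus>\<^bsub>MP I\<^esub> Q' j) \<otimes>\<^bsub>MP I\<^esub> indexed_var j)"
      by (rule T.finsum_cong') (simp_all add: cl hc T.l_distr)
    finally show ?case using Q(1) Q'(1) homogeneous_add
      by (intro exI[of _ "\<lambda>j. Q j \<oplus>\<^bsub>MP I\<^esub> Q' j"]) blast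
  next
    case (mult a v)
    then obtain i where i: "i \<in> I" "v = indexed_var i" by blast
    have a: "a \<in> homogeneous R I d" using mult unfolding homogeneous_eq_forms by blast
    have "(\<Oplus>\<^bsub>MP I\<^esub>j\<in>I. (if i = j then a \<otimes>\<^bsub>MP I\<^esub> indexed_var j else \<zero>\<^bsub>MP I\<^esub>)) = a \<otimes>\<^bsub>MP I\<^esub> indexed_var i"
      using T.finsum_singleton[OF i(1) fin, of "\<lambda>j. a \<otimes>\<^bsub>MP I\<^esub> indexed_var j"] hc(1)[OF a] by (simp add: hc Pi_def)
    moreover have "(\<Oplus>\<^bsub>MP I\<^esub>j\<in>I. (if i = j then a \<otimes>\<^bsub>MP I\<^esub> indexed_var j else \<zero>\<^bsub>MP I\<^esub>))
        = (\<Oplus>\<^bsub>MP I\<^esub>j\<in>I. (if i = j then a else \<zero>\<^bsub>MP I\<^esub>) \<otimes>\<^bsub>MP I\<^esub> indexed_var j)"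
      by (rule T.finsum_cong') (simp_all add: hc(2) hc(1)[OF a])
    ultimately show ?case using a homogeneous_zero i
      by (intro exI[of _ "\<lambda>j. if i = j then a else \<zero>\<^bsub>MP I\<^esub>"]) auto
  qed
qed

end

text \<open>The sequence \<open>F\<close> stands for the jet \<open>(f, \<partial>f/\<partial>x\<^sub>1, \<dots>, \<partial>f/\<partial>x\<^sub>n)\<close>; its entry with index \<open>0\<close> generates the ideal of \<open>X\<close>
and all entries together generate the ideal of \<open>Y\<close>.\<close>

locale jets = embedded A I B J \<pi>
  for A (structure) and I and B (structure) and J and \<pi> +
  fixes n :: nat and F :: "nat \<Rightarrow> 'a"
  assumes F_closed: "F \<in> {0..n} \<rightarrow> carrier A" and I_gen: "I = Idl\<^bsub>A\<^esub> (F ` {0..n})"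
    and K_gen: "K = {F 0 \<otimes>\<^bsub>A\<^esub> c | c. c \<in> carrier A}"
begin

abbreviation "TT \<equiv> mpoly_ring A {0..n}"
abbreviation "tc \<equiv> ring.indexed_const A"
abbreviation "tv \<equiv> ring.indexed_var A"
abbreviation "HH \<equiv> homogeneous A {0..n}"
abbreviation tmult (infixl "\<star>" 70) where "P \<star> P' \<equiv> P \<otimes>\<^bsub>TT\<^esub> P'"
abbreviation tplus (infixl "\<uplus>" 65) where "P \<uplus> P' \<equiv> P \<oplus>\<^bsub>TT\<^esub> P'"
abbreviation "comb q g \<equiv> (\<Oplus>\<^bsub>TT\<^esub>j\<in>{0..n}. q j \<otimes>\<^bsub>TT\<^esub> g j)"
abbreviation "F0I \<equiv> Idl\<^bsub>TT\<^esub> {tc (F 0)}"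
abbreviation "TTs \<equiv> {0..n} \<rightarrow> carrier TT"
abbreviation "TF \<equiv> (\<lambda>j. tc (F j))"
abbreviation "value \<equiv> mpoly_eval A A (\<lambda>a. a) F"
abbreviation "cls \<equiv> mpoly_eval A SB (\<lambda>c. Sym_const B J (\<pi> c)) (\<lambda>j. gen (F j))"

definition decomposes :: "nat \<Rightarrow> (nat multiset \<Rightarrow> 'a) \<Rightarrow> bool" where
  "decomposes d P \<longleftrightarrow> (\<exists>Q. (\<forall>j\<in>{0..n}. Q j \<in> HH (d - 1)) \<and>
     P = comb Q tv \<and>
     (\<Oplus>\<^bsub>TT\<^esub>j\<in>{1..n}. Q j \<star> tc (F j)) \<in> Idl\<^bsub>TT\<^esub> {tc (F 0)})"

lemma Fc: "j \<in> {0..n} \<Longrightarrow> F j \<in> carrier A" using F_closed by (rule Pi_mem)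

lemma F_I: "j \<in> {0..n} \<Longrightarrow> F j \<in> I"
  unfolding I_gen by (rule subsetD[OF A.genideal_self]) (use F_closed in auto)

lemma F0K: "\<pi> (F 0) = \<zero>\<^bsub>B\<^esub>"
proof -
  have "F 0 = F 0 \<otimes> \<one>" using Fc[of 0] by simp
  then have "F 0 \<in> K" unfolding K_gen using A.one_closed by blast
  then show ?thesis by blast
qed

lemma TT_cring: "cring TT" by (rule A.mpoly_cring)

lemma const_hom: "(\<lambda>c. Sym_const B J (\<pi> c)) \<in> ring_hom A SB"
  using ring_hom_trans[OF \<pi> B.Sym_const_hom] by (simp add: comp_def)

lemma gen_closed: "b \<in> I \<Longrightarrow> gen b \<in> carrier SB"
  by (rule B.Sym_gen_closed[OF \<pi>I])

lemma id_hom: "(\<lambda>a. a) \<in> ring_hom A A"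
  by (rule ring_hom_memI) auto

lemma ev_val: "mpoly_val A A {0..n} F" and cls_val: "mpoly_val A SB {0..n} (\<lambda>j. gen (F j))"
  using F_closed F_I gen_closed
  by (auto intro!: mpoly_val.intro mpoly_val_axioms.intro A.cring_axioms B.S.cring_axioms)

lemma value_hom: "value \<in> ring_hom TT A" and cls_hom: "cls \<in> ring_hom TT SB"
  by (rule mpoly_val.eval_ring_hom[OF ev_val id_hom]) (rule mpoly_val.eval_ring_hom[OF cls_val const_hom])

lemma value_simps: "c \<in> carrier A \<Longrightarrow> value (tc c) = c" "j \<in> {0..n} \<Longrightarrow> value (tv j) = F j"
  by (rule mpoly_val.eval_hom_const[OF ev_val id_hom], assumption)
    (rule mpoly_val.eval_var[OF ev_val id_hom], assumption)

lemma cls_simps: "c \<in> carrier A \<Longrightarrow> cls (tc c) = Sym_const B J (\<pi> c)"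
  "j \<in> {0..n} \<Longrightarrow> cls (tv j) = gen (F j)"
  by (rule mpoly_val.eval_hom_const[OF cls_val const_hom], assumption)
    (rule mpoly_val.eval_var[OF cls_val const_hom], assumption)

lemma homogeneous_graph: "P \<in> HH d \<Longrightarrow> (value P, cls P) \<in> graph d"
proof -
  assume "P \<in> HH d"
  then have P: "(d, P) \<in> forms TT (tc ` carrier A) (tv ` {0..n})" unfolding A.homogeneous_eq_forms by blast
  have h: "(\<lambda>P. (value P, cls P)) \<in> ring_hom TT AS"
    by (rule ring_hom_memI)
      (simp_all add: RDirProd_simps ring_hom_closed[OF value_hom] ring_hom_closed[OF cls_hom]
        ring_hom_mult[OF value_hom] ring_hom_mult[OF cls_hom] ring_hom_add[OF value_hom] ring_hom_add[OF cls_hom]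
        ring_hom_one[OF value_hom] ring_hom_one[OF cls_hom])
  have 1: "(\<lambda>P. (value P, cls P)) ` (tc ` carrier A) \<subseteq> Wc"
    by (rule image_subsetI, erule imageE) (simp add: value_simps cls_simps)
  have 2: "(\<lambda>P. (value P, cls P)) ` (tv ` {0..n}) \<subseteq> Wv"
    by (rule image_subsetI, erule imageE) (simp add: value_simps cls_simps F_I)
  show ?thesis using forms_hom[OF h TT_cring AS_cring A.forms_T_sub 1 2 P] unfolding graph_def by blast
qed

text \<open>The elements with this property form an ideal that contains the generators of \<open>I\<close>.\<close>

lemma linear_form: "b \<in> I \<Longrightarrow> \<exists>l\<in>HH 1. value l = b \<and> cls l = gen b"
proof -
  let ?L = "{b \<in> I. \<exists>l\<in>HH 1. value l = b \<and> cls l = gen b}"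
  have L_add: "a \<oplus> b \<in> ?L" if ab: "a \<in> ?L" "b \<in> ?L" for a b
  proof -
    obtain l where l: "l \<in> HH 1" "value l = a" "cls l = gen a" and aI: "a \<in> I" using ab(1) by blast
    obtain m where m: "m \<in> HH 1" "value m = b" "cls m = gen b" and bI: "b \<in> I" using ab(2) by blast
    note c = A.homogeneous_carrier[OF l(1)] A.homogeneous_carrier[OF m(1)]
    have "\<pi> (a \<oplus> b) = \<pi> a \<oplus>\<^bsub>B\<^esub> \<pi> b" using aI bI I_sub by (intro ring_hom_add[OF \<pi>]) auto
    then have "cls (l \<uplus> m) = Sym_gen B J (\<pi> (a \<oplus> b))"
      using ring_hom_add[OF cls_hom c] l(3) m(3) B.Sym_gen_add[OF \<pi>I[OF aI] \<pi>I[OF bI]] by metis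
    moreover have "value (l \<uplus> m) = a \<oplus> b" using ring_hom_add[OF value_hom c] l(2) m(2) by metis
    ultimately show ?thesis
      using A.homogeneous_add[OF l(1) m(1)] additive_subgroup.a_closed[OF A.J.additive_subgroup_axioms aI bI] by blast
  qed
  have L_mult: "r \<otimes> a \<in> ?L" if a: "a \<in> ?L" and r: "r \<in> carrier A" for a r
  proof -
    obtain l where l: "l \<in> HH 1" "value l = a" "cls l = gen a" and aI: "a \<in> I" using a by blast
    note c = A.mpoly_closed(1)[OF r, of "{0..n}"] A.homogeneous_carrier[OF l(1)]
    have "\<pi> (r \<otimes> a) = \<pi> r \<otimes>\<^bsub>B\<^esub> \<pi> a" using aI I_sub r by (intro ring_hom_mult[OF \<pi>]) auto
    then have "cls (tc r \<star> l) = Sym_gen B J (\<pi> (r \<otimes> a))"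
      using ring_hom_mult[OF cls_hom c] l(3) B.Sym_gen_smult[OF \<pi>_closed[OF r] \<pi>I[OF aI]] cls_simps(1)[OF r] by metis
    moreover have "value (tc r \<star> l) = r \<otimes> a" using ring_hom_mult[OF value_hom c] l(2) value_simps(1)[OF r] by metis
    moreover have "tc r \<star> l \<in> HH 1"
      using A.homogeneous_mult[OF A.homogeneous_const[OF r] l(1)] by simp
    ultimately show ?thesis using A.J.I_l_closed[OF aI r] by blast
  qed
  have L_F: "F j \<in> ?L" if j: "j \<in> {0..n}" for j
  proof -
    have "tv j = tc \<one> \<star> tv j"
      using cring.cring_simprules(12)[OF TT_cring A.indexed_var_closed[OF j]] by (simp add: mpoly_ring_simps)
    then have "tv j \<in> HH 1"
      using A.homogeneous_mult_var[OF A.homogeneous_const[OF A.one_closed] j] by simp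
    then show ?thesis using value_simps(2)[OF j] cls_simps(2)[OF j] F_I[OF j] by blast
  qed
  have "ideal ?L A"
  proof (rule A.ideal_closedI)
    show "?L \<subseteq> carrier A" using I_sub by blast
    show "?L \<noteq> {}" using L_F[of 0] by auto
  qed (rule L_add, assumption+, rule L_mult, assumption+)
  then have "Idl (F ` {0..n}) \<subseteq> ?L" by (rule A.genideal_minimal) (use L_F in blast)
  then show "b \<in> I \<Longrightarrow> \<exists>l\<in>HH 1. value l = b \<and> cls l = gen b" unfolding I_gen[symmetric] by blast
qed

lemma graph_homogeneous: "(a, s) \<in> graph d \<Longrightarrow> \<exists>P\<in>HH d. value P = a \<and> cls P = s"
proof (induction rule: graph_induct)
  case (const c)
  then show ?case using A.homogeneous_const value_simps cls_simps by blast
next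
  case (zero d)
  then show ?case using A.homogeneous_zero ring_hom_zero'[OF value_hom TT_cring A.cring_axioms]
      ring_hom_zero'[OF cls_hom TT_cring B.S.cring_axioms] by blast
next
  case (add d a s a' s')
  obtain P where P: "P \<in> HH d" "value P = a" "cls P = s" using add(3) by blast
  obtain P' where P': "P' \<in> HH d" "value P' = a'" "cls P' = s'" using add(4) by blast
  note c = A.homogeneous_carrier[OF P(1)] A.homogeneous_carrier[OF P'(1)]
  show ?case using ring_hom_add[OF value_hom c] ring_hom_add[OF cls_hom c] A.homogeneous_add[OF P(1) P'(1)] P P' by blast
next
  case (mult d a s b)
  obtain P where P: "P \<in> HH d" "value P = a" "cls P = s" using mult(3) by blast
  obtain l where l: "l \<in> HH 1" "value l = b" "cls l = gen b" using linear_form[OF mult(2)] by blast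
  note c = A.homogeneous_carrier[OF P(1)] A.homogeneous_carrier[OF l(1)]
  have h: "P \<star> l \<in> HH (Suc d)" using A.homogeneous_mult[OF P(1) l(1)] by simp
  show ?case
    by (rule bexI[OF _ h]) (simp add: ring_hom_mult[OF value_hom c] ring_hom_mult[OF cls_hom c] P(2,3) l(2,3))
qed

text \<open>Evaluate \<open>\<Sum> Q\<^sub>j F\<^sub>j\<close>, a polynomial with coefficients in \<open>I\<close>, by sending each coefficient \<open>a\<close> to the generator at
\<open>\<pi> a\<close>. Summand by summand this is the sum in question; computed from \<open>G F\<^sub>0\<close> it is a multiple of the generator
at \<open>\<pi> F\<^sub>0 = 0\<close>.\<close>

lemma class_sum_zero:
  fixes Q :: "nat \<Rightarrow> nat multiset \<Rightarrow> 'a"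
  assumes Q: "\<And>j. j \<in> {0..n} \<Longrightarrow> Q j \<in> carrier TT" and G: "G \<in> carrier TT"
    and eq: "comb Q TF = G \<star> tc (F 0)"
  shows "(\<Oplus>\<^bsub>SB\<^esub>j\<in>{0..n}. cls (Q j) \<otimes>\<^bsub>SB\<^esub> gen (F j)) = \<zero>\<^bsub>SB\<^esub>"
proof -
  interpret T: cring TT by (rule TT_cring)
  let ?E = "mpoly_eval A SB (\<lambda>c. gen c) (\<lambda>j. gen (F j))"
  have I0: "\<zero> \<in> I" by (rule additive_subgroup.zero_closed[OF A.J.additive_subgroup_axioms])
  have g0: "Sym_gen B J (\<pi> \<zero>) = \<zero>\<^bsub>SB\<^esub>"
    using ring_hom_zero'[OF \<pi> A.cring_axioms B.cring_axioms] B.Sym_gen_zero by simp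
  have gadd: "Sym_gen B J (\<pi> (a \<oplus> b)) = gen a \<oplus>\<^bsub>SB\<^esub> gen b" if "a \<in> I" "b \<in> I" for a b
    using that I_sub B.Sym_gen_add[OF \<pi>I \<pi>I] ring_hom_add[OF \<pi>, of a b] by (metis subsetD)
  have coef: "(P \<star> tc y) m \<in> I" if P: "P \<in> carrier TT" and y: "y \<in> I" for P y m
  proof -
    have yA: "y \<in> carrier A" using y I_sub by blast
    have "P \<star> tc y = tc y \<star> P" by (rule T.m_comm[OF P A.mpoly_closed(1)[OF yA]])
    also have "\<dots> = (\<lambda>m. y \<otimes> P m)" by (rule A.mpoly_mult_const[OF yA A.mpoly_coeff_closed[OF P]])
    finally show ?thesis using A.J.I_r_closed[OF y A.mpoly_coeff_closed[OF P]] by simp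
  qed
  have Eadd: "?E (P \<uplus> P') = ?E P \<oplus>\<^bsub>SB\<^esub> ?E P'"
    if "P \<in> carrier TT" "P' \<in> carrier TT" "\<And>m. P m \<in> I" "\<And>m. P' m \<in> I" for P P'
    unfolding mpoly_ring_simps
    by (rule mpoly_val.eval_padd[OF cls_val that(1,2) I0 that(3,4)]) (use gen_closed gadd in auto)
  have Econst: "?E (P \<star> tc y) = cls P \<otimes>\<^bsub>SB\<^esub> gen y" if P: "P \<in> carrier TT" and y: "y \<in> I" for P y
    using P
  proof (induction rule: A.mpoly_induct)
    case (const c)
    have yA: "y \<in> carrier A" using y I_sub by blast
    have "tc c \<star> tc y = tc (c \<otimes> y)" by (rule ring_hom_mult[OF A.indexed_const_hom const yA, symmetric])
    then have "?E (tc c \<star> tc y) = Sym_gen B J (\<pi> (c \<otimes> y))"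
      using mpoly_val.eval_const[OF cls_val, of "\<lambda>c. gen c" "c \<otimes> y"] g0 gen_closed[OF A.J.I_l_closed[OF y const]] by simp
    also have "\<dots> = Sym_const B J (\<pi> c) \<otimes>\<^bsub>SB\<^esub> gen y"
      using B.Sym_gen_smult[OF \<pi>_closed[OF const] \<pi>I[OF y]] ring_hom_mult[OF \<pi> const yA] by simp
    finally show ?case using cls_simps(1)[OF const] by simp
  next
    case (add P P')
    have yT: "tc y \<in> carrier TT" using y I_sub A.mpoly_closed(1) by blast
    have cl: "cls P \<in> carrier SB" "cls P' \<in> carrier SB"
      using ring_hom_closed[OF cls_hom] add(1,2) by blast+
    have "(P \<uplus> P') \<star> tc y = P \<star> tc y \<uplus> P' \<star> tc y"
      by (rule T.l_distr[OF add(1,2) yT])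
    then have "?E ((P \<uplus> P') \<star> tc y) = cls P \<otimes>\<^bsub>SB\<^esub> gen y \<oplus>\<^bsub>SB\<^esub> cls P' \<otimes>\<^bsub>SB\<^esub> gen y"
      using Eadd[OF T.m_closed[OF add(1) yT] T.m_closed[OF add(2) yT] coef[OF add(1) y] coef[OF add(2) y]] add.IH by simp
    also have "\<dots> = cls (P \<uplus> P') \<otimes>\<^bsub>SB\<^esub> gen y"
      using B.S.l_distr[OF cl gen_closed[OF y]] ring_hom_add[OF cls_hom add(1,2)] by simp
    finally show ?case by (simp add: mpoly_ring_simps)
  next
    case (mult_var P i)
    have yT: "tc y \<in> carrier TT" using y I_sub A.mpoly_closed(1) by blast
    have iT: "tv i \<in> carrier TT" by (rule A.indexed_var_closed[OF mult_var(2)])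
    have cl: "cls P \<in> carrier SB" "gen (F i) \<in> carrier SB"
      using ring_hom_closed[OF cls_hom mult_var(1)] gen_closed[OF F_I[OF mult_var(2)]] by blast+
    have pv: "A.indexed_pmult P i = P \<star> tv i" by (rule A.mpoly_mult_var[OF mult_var(1,2), symmetric])
    have "(P \<star> tv i) \<star> tc y = (P \<star> tc y) \<star> tv i"
      using T.m_assoc[OF mult_var(1) iT yT] T.m_assoc[OF mult_var(1) yT iT] T.m_comm[OF iT yT] by simp
    also have "\<dots> = A.indexed_pmult (P \<star> tc y) i"
      by (rule A.mpoly_mult_var[OF T.m_closed[OF mult_var(1) yT] mult_var(2)])
    finally have "?E ((P \<star> tv i) \<star> tc y) = ?E (P \<star> tc y) \<otimes>\<^bsub>SB\<^esub> gen (F i)"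
      using mpoly_val.eval_pmult[OF cls_val T.m_closed[OF mult_var(1) yT] mult_var(2), of "\<lambda>c. gen c"]
        g0 gen_closed[OF coef[OF mult_var(1) y]] by simp
    also have "\<dots> = (cls P \<otimes>\<^bsub>SB\<^esub> gen y) \<otimes>\<^bsub>SB\<^esub> gen (F i)" using mult_var(3) by simp
    also have "\<dots> = (cls P \<otimes>\<^bsub>SB\<^esub> gen (F i)) \<otimes>\<^bsub>SB\<^esub> gen y"
      using cl gen_closed[OF y] by (simp add: B.S.m_ac)
    also have "cls P \<otimes>\<^bsub>SB\<^esub> gen (F i) = cls (P \<star> tv i)"
      using ring_hom_mult[OF cls_hom mult_var(1) iT] cls_simps(2)[OF mult_var(2)] by simp
    finally show ?case unfolding pv .
  qed
  have "?E (\<Oplus>\<^bsub>TT\<^esub>j\<in>S. Q j \<star> tc (F j)) = (\<Oplus>\<^bsub>SB\<^esub>j\<in>S. cls (Q j) \<otimes>\<^bsub>SB\<^esub> gen (F j)) \<and>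
     (\<forall>m. (\<Oplus>\<^bsub>TT\<^esub>j\<in>S. Q j \<star> tc (F j)) m \<in> I)" if "finite S" "S \<subseteq> {0..n}" for S
    using that
  proof (induction S rule: finite_induct)
    case empty
    have z: "(\<Oplus>\<^bsub>TT\<^esub>j\<in>{}. Q j \<star> tc (F j)) = tc \<zero>" by (simp add: mpoly_ring_simps)
    show ?case unfolding z using mpoly_val.eval_const[OF cls_val, of "\<lambda>c. gen c" "\<zero>"] g0 I0
      by (simp add: A.indexed_const_def)
  next
    case (insert x S)
    have cl: "Q j \<star> tc (F j) \<in> carrier TT" if "j \<in> {0..n}" for j
      using Q[OF that] A.mpoly_closed(1)[OF Fc[OF that], of "{0..n}"] by simp
    have cl': "cls (Q j) \<otimes>\<^bsub>SB\<^esub> gen (F j) \<in> carrier SB" if "j \<in> {0..n}" for j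
      using ring_hom_closed[OF cls_hom Q[OF that]] gen_closed[OF F_I[OF that]] by simp
    have xS: "x \<in> {0..n}" "S \<subseteq> {0..n}" using insert.prems by auto
    have s1: "(\<Oplus>\<^bsub>TT\<^esub>j\<in>insert x S. Q j \<star> tc (F j)) = Q x \<star> tc (F x) \<uplus> (\<Oplus>\<^bsub>TT\<^esub>j\<in>S. Q j \<star> tc (F j))"
      by (rule T.finsum_insert[OF insert.hyps]) (use cl xS in auto)
    have s2: "(\<Oplus>\<^bsub>SB\<^esub>j\<in>insert x S. cls (Q j) \<otimes>\<^bsub>SB\<^esub> gen (F j)) =
        cls (Q x) \<otimes>\<^bsub>SB\<^esub> gen (F x) \<oplus>\<^bsub>SB\<^esub> (\<Oplus>\<^bsub>SB\<^esub>j\<in>S. cls (Q j) \<otimes>\<^bsub>SB\<^esub> gen (F j))"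
      by (rule B.S.finsum_insert[OF insert.hyps]) (use cl' xS in auto)
    have fs: "(\<Oplus>\<^bsub>TT\<^esub>j\<in>S. Q j \<star> tc (F j)) \<in> carrier TT" by (rule T.finsum_closed) (use cl xS in auto)
    have IH: "?E (\<Oplus>\<^bsub>TT\<^esub>j\<in>S. Q j \<star> tc (F j)) = (\<Oplus>\<^bsub>SB\<^esub>j\<in>S. cls (Q j) \<otimes>\<^bsub>SB\<^esub> gen (F j))"
      "\<And>m. (\<Oplus>\<^bsub>TT\<^esub>j\<in>S. Q j \<star> tc (F j)) m \<in> I" using insert.IH[OF xS(2)] by blast+
    have "(Q x \<star> tc (F x) \<uplus> (\<Oplus>\<^bsub>TT\<^esub>j\<in>S. Q j \<star> tc (F j))) m \<in> I" for m
      unfolding mpoly_ring_simps A.indexed_padd_def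
      using additive_subgroup.a_closed[OF A.J.additive_subgroup_axioms coef[OF Q[OF xS(1)] F_I[OF xS(1)]] IH(2)] .
    then show ?case unfolding s1 s2
      using Eadd[OF cl[OF xS(1)] fs coef[OF Q[OF xS(1)] F_I[OF xS(1)]] IH(2)] Econst[OF Q[OF xS(1)] F_I[OF xS(1)]] IH(1) by simp
  qed
  from this[of "{0..n}"] have "(\<Oplus>\<^bsub>SB\<^esub>j\<in>{0..n}. cls (Q j) \<otimes>\<^bsub>SB\<^esub> gen (F j)) = ?E (G \<star> tc (F 0))"
    unfolding eq by simp
  also have "\<dots> = cls G \<otimes>\<^bsub>SB\<^esub> gen (F 0)" by (rule Econst[OF G F_I]) simp
  also have "\<dots> = \<zero>\<^bsub>SB\<^esub>" using F0K B.Sym_gen_zero ring_hom_closed[OF cls_hom G] by simp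
  finally show ?thesis .
qed

lemma Idl_F0: "x \<in> F0I \<longleftrightarrow> (\<exists>G\<in>carrier TT. x = G \<star> tc (F 0))"
proof -
  have "tc (F 0) \<in> carrier TT" by (rule A.mpoly_closed(1)[OF Fc]) simp
  then have "F0I = PIdl\<^bsub>TT\<^esub> (tc (F 0))" by (rule cring.cgenideal_eq_genideal[OF TT_cring, symmetric])
  then show ?thesis by (auto simp: cgenideal_def)
qed

lemma split_first:
  assumes R: "cring R" and f: "\<And>j. j \<in> {0..n} \<Longrightarrow> f j \<in> carrier R"
  shows "(\<Oplus>\<^bsub>R\<^esub>j\<in>{0..n}. f j) = f 0 \<oplus>\<^bsub>R\<^esub> (\<Oplus>\<^bsub>R\<^esub>j\<in>{1..n}. f j)"
proof -
  interpret R: cring R by fact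
  have "{0..n} = insert 0 {1..n}" by auto
  then show ?thesis using f R.finsum_insert[of "{1..n}" 0 f] by auto
qed

lemma decomposes_imp_class_zero:
  assumes "decomposes d P"
  shows "cls P = \<zero>\<^bsub>SB\<^esub>"
proof -
  interpret T: cring TT by (rule TT_cring)
  obtain Q where Q: "\<forall>j\<in>{0..n}. Q j \<in> HH (d - 1)" "P = comb Q tv"
     "(\<Oplus>\<^bsub>TT\<^esub>j\<in>{1..n}. Q j \<star> tc (F j)) \<in> F0I"
    using assms unfolding decomposes_def by (elim exE conjE)
  have Qc: "Q j \<in> carrier TT" if "j \<in> {0..n}" for j using Q(1) that A.homogeneous_carrier by blast
  obtain G where G: "G \<in> carrier TT" "(\<Oplus>\<^bsub>TT\<^esub>j\<in>{1..n}. Q j \<star> tc (F j)) = G \<star> tc (F 0)"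
    using Q(3) unfolding Idl_F0 by (elim bexE)
  have F0: "tc (F 0) \<in> carrier TT" by (rule A.mpoly_closed(1)[OF Fc]) simp
  have Q0: "Q 0 \<in> carrier TT" by (rule Qc) simp
  have "comb Q TF = Q 0 \<star> tc (F 0) \<uplus> (\<Oplus>\<^bsub>TT\<^esub>j\<in>{1..n}. Q j \<star> tc (F j))"
    by (rule split_first[OF TT_cring T.m_closed[OF Qc A.mpoly_closed(1)[OF Fc]]])
  also have "\<dots> = (Q 0 \<uplus> G) \<star> tc (F 0)" unfolding G(2) by (rule T.l_distr[OF Q0 G(1) F0, symmetric])
  finally have e: "comb Q TF = (Q 0 \<uplus> G) \<star> tc (F 0)" .
  have z: "(\<Oplus>\<^bsub>SB\<^esub>j\<in>{0..n}. cls (Q j) \<otimes>\<^bsub>SB\<^esub> gen (F j)) = \<zero>\<^bsub>SB\<^esub>"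
    by (rule class_sum_zero[OF Qc T.a_closed[OF Q0 G(1)] e])
  interpret h: ring_hom_ring TT SB cls by (rule ring_hom_ringI2[OF T.ring_axioms B.S.ring_axioms cls_hom])
  have "cls P = (\<Oplus>\<^bsub>SB\<^esub>j\<in>{0..n}. (cls \<circ> (\<lambda>j. Q j \<star> tv j)) j)"
    unfolding Q(2) by (rule h.hom_finsum) (rule funcsetI, rule T.m_closed[OF Qc A.indexed_var_closed])
  also have "\<dots> = (\<Oplus>\<^bsub>SB\<^esub>j\<in>{0..n}. cls (Q j) \<otimes>\<^bsub>SB\<^esub> gen (F j))"
  proof (rule B.S.finsum_cong'[OF refl])
    show "(\<lambda>j. cls (Q j) \<otimes>\<^bsub>SB\<^esub> gen (F j)) \<in> {0..n} \<rightarrow> carrier SB"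
      by (rule funcsetI) (rule B.S.m_closed[OF ring_hom_closed[OF cls_hom Qc] gen_closed[OF F_I]])
    fix j assume j: "j \<in> {0..n}"
    show "(cls \<circ> (\<lambda>j. Q j \<star> tv j)) j = cls (Q j) \<otimes>\<^bsub>SB\<^esub> gen (F j)"
      using ring_hom_mult[OF cls_hom Qc[OF j] A.indexed_var_closed[OF j]] cls_simps(2)[OF j] by simp
  qed
  finally show ?thesis using z by simp
qed

text \<open>The elements \<open>\<Sum> Q\<^sub>j T\<^sub>j + H F\<^sub>0\<close> with \<open>\<Sum> Q\<^sub>j F\<^sub>j \<in> (F\<^sub>0)\<close> form an ideal: the kernel of
  the map from the polynomial ring to \<open>Sym B J\<close>.\<close>

definition kernel_ideal :: "(nat multiset \<Rightarrow> 'a) set" where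
  "kernel_ideal = {comb Q tv \<uplus> H \<star> tc (F 0) | Q H.
     Q \<in> TTs \<and> H \<in> carrier TT \<and>
     comb Q TF \<in> F0I}"

lemma kernel_idealI:
  fixes Q :: "nat \<Rightarrow> nat multiset \<Rightarrow> 'a"
  assumes "Q \<in> TTs" "H \<in> carrier TT"
    "comb Q TF \<in> F0I"
    "P = comb Q tv \<uplus> H \<star> tc (F 0)"
  shows "P \<in> kernel_ideal"
  using assms unfolding kernel_ideal_def by blast

lemma tcF: "j \<in> {0..n} \<Longrightarrow> tc (F j) \<in> carrier TT"
  by (rule A.mpoly_closed(1)[OF Fc])

lemma tvT: "j \<in> {0..n} \<Longrightarrow> tv j \<in> carrier TT"
  by (rule A.indexed_var_closed)

lemma tcFp: "(\<lambda>j. tc (F j)) \<in> TTs"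
  by (rule funcsetI[OF tcF])

lemma tvTp: "tv \<in> TTs"
  by (rule funcsetI[OF tvT])

lemma sum_zero:
  assumes "g \<in> TTs"
  shows "comb (\<lambda>j. \<zero>\<^bsub>TT\<^esub>) g = \<zero>\<^bsub>TT\<^esub>"
proof -
  interpret T: cring TT by (rule TT_cring)
  show ?thesis by (rule T.add.finprod_one_eqI) (rule T.l_null[OF Pi_mem[OF assms]])
qed

lemma F0_ideal: "ideal (F0I) TT"
proof -
  interpret T: cring TT by (rule TT_cring)
  show ?thesis by (rule T.genideal_ideal) (use tcF[of 0] in auto)
qed

lemma F0_in: "H \<in> carrier TT \<Longrightarrow> H \<star> tc (F 0) \<in> F0I"
  unfolding Idl_F0 by blast

lemma sum_add:
  fixes Q Q' :: "nat \<Rightarrow> nat multiset \<Rightarrow> 'a"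
  assumes "Q \<in> TTs" "Q' \<in> TTs" "g \<in> TTs"
  shows "comb (\<lambda>j. (Q j \<uplus> Q' j)) g =
    comb Q g \<uplus> comb Q' g"
proof -
  interpret T: cring TT by (rule TT_cring)
  have c: "Q j \<in> carrier TT" "Q' j \<in> carrier TT" "g j \<in> carrier TT" if "j \<in> {0..n}" for j
    using Pi_mem[OF assms(1) that] Pi_mem[OF assms(2) that] Pi_mem[OF assms(3) that] by simp_all
  have "comb (\<lambda>j. (Q j \<uplus> Q' j)) g = (\<Oplus>\<^bsub>TT\<^esub>j\<in>{0..n}. Q j \<star> g j \<uplus> Q' j \<star> g j)"
    by (rule T.finsum_cong'[OF refl]) (rule funcsetI, intro T.a_closed T.m_closed c, assumption+, rule T.l_distr[OF c], assumption+)
  also have "\<dots> = comb Q g \<uplus> comb Q' g"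
    by (rule T.finsum_addf) (rule funcsetI, intro T.m_closed c, assumption+)+
  finally show ?thesis .
qed

lemma sum_scale:
  fixes Q :: "nat \<Rightarrow> nat multiset \<Rightarrow> 'a"
  assumes "Q \<in> TTs" "g \<in> TTs" "R \<in> carrier TT"
  shows "comb (\<lambda>j. (R \<star> Q j)) g = R \<star> comb Q g"
proof -
  interpret T: cring TT by (rule TT_cring)
  have c: "Q j \<in> carrier TT" "g j \<in> carrier TT" if "j \<in> {0..n}" for j
    using Pi_mem[OF assms(1) that] Pi_mem[OF assms(2) that] by simp_all
  have "R \<star> comb Q g = (\<Oplus>\<^bsub>TT\<^esub>j\<in>{0..n}. R \<star> (Q j \<star> g j))"
    by (rule T.finsum_rdistr[OF _ assms(3)]) (simp, rule funcsetI, intro T.m_closed c, assumption+)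
  also have "\<dots> = comb (\<lambda>j. (R \<star> Q j)) g"
    by (rule T.finsum_cong'[OF refl]) (rule funcsetI, intro T.m_closed c assms(3), assumption+, rule T.m_assoc[OF assms(3) c, symmetric], assumption+)
  finally show ?thesis by simp
qed

lemma kernel_ideal_carrier: "P \<in> kernel_ideal \<Longrightarrow> P \<in> carrier TT"
proof -
  interpret T: cring TT by (rule TT_cring)
  assume "P \<in> kernel_ideal"
  then obtain Q H where Q: "Q \<in> TTs" and H: "H \<in> carrier TT"
    and P: "P = comb Q tv \<uplus> H \<star> tc (F 0)"
    unfolding kernel_ideal_def by blast
  show ?thesis unfolding P
    by (intro T.a_closed T.finsum_closed funcsetI T.m_closed Pi_mem[OF Q] H tcF tvT) simp_all
qed

lemma const_F0_kernel: "tc (F 0) \<in> kernel_ideal"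
proof -
  interpret T: cring TT by (rule TT_cring)
  show ?thesis
  proof (rule kernel_idealI[where Q = "\<lambda>_. \<zero>\<^bsub>TT\<^esub>" and H = "\<one>\<^bsub>TT\<^esub>"])
    show "comb (\<lambda>j. \<zero>\<^bsub>TT\<^esub>) TF \<in> F0I"
      unfolding sum_zero[OF tcFp] by (rule ideal_zero[OF F0_ideal])
    show "tc (F 0) = comb (\<lambda>j. \<zero>\<^bsub>TT\<^esub>) tv \<uplus> \<one>\<^bsub>TT\<^esub> \<star> tc (F 0)"
      unfolding sum_zero[OF tvTp] using tcF[of 0] by simp
  qed simp_all
qed

lemma kernel_ideal_ideal: "ideal kernel_ideal TT"
proof -
  interpret T: cring TT by (rule TT_cring)
  have tot: "H \<star> tc (F 0) \<in> carrier TT" if "H \<in> carrier TT" for H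
    using that tcF[of 0] by simp
  have S: "comb Q tv \<in> carrier TT" if "Q \<in> TTs" for Q
    by (intro T.finsum_closed funcsetI T.m_closed Pi_mem[OF that] tvT)
  have add: "P \<uplus> P' \<in> kernel_ideal" if P: "P \<in> kernel_ideal" and P': "P' \<in> kernel_ideal" for P P'
  proof -
    obtain Q H where Q: "Q \<in> TTs" "H \<in> carrier TT"
      "comb Q TF \<in> F0I"
      "P = comb Q tv \<uplus> H \<star> tc (F 0)"
      using P unfolding kernel_ideal_def by blast
    obtain Q' H' where Q': "Q' \<in> TTs" "H' \<in> carrier TT"
      "comb Q' TF \<in> F0I"
      "P' = comb Q' tv \<uplus> H' \<star> tc (F 0)"
      using P' unfolding kernel_ideal_def by blast
    show ?thesis
    proof (rule kernel_idealI)
      show "(\<lambda>j. Q j \<uplus> Q' j) \<in> TTs"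
        by (rule funcsetI) (rule T.a_closed[OF Pi_mem[OF Q(1)] Pi_mem[OF Q'(1)]])
      show "H \<uplus> H' \<in> carrier TT" by (rule T.a_closed[OF Q(2) Q'(2)])
      show "comb (\<lambda>j. (Q j \<uplus> Q' j)) TF \<in> F0I"
        unfolding sum_add[OF Q(1) Q'(1) tcFp]
        by (rule ideal_add[OF F0_ideal Q(3) Q'(3)])
      show "P \<uplus> P' = comb (\<lambda>j. (Q j \<uplus> Q' j)) tv \<uplus> (H \<uplus> H') \<star> tc (F 0)"
        unfolding sum_add[OF Q(1) Q'(1) tvTp] Q(4) Q'(4)
        using S[OF Q(1)] S[OF Q'(1)] tot[OF Q(2)] tot[OF Q'(2)] T.l_distr[OF Q(2) Q'(2) tcF[of 0]]
        by (simp add: T.a_ac)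
    qed
  qed
  have mult: "R \<star> P \<in> kernel_ideal" if P: "P \<in> kernel_ideal" and R: "R \<in> carrier TT" for P R
  proof -
    obtain Q H where Q: "Q \<in> TTs" "H \<in> carrier TT"
      "comb Q TF \<in> F0I"
      "P = comb Q tv \<uplus> H \<star> tc (F 0)"
      using P unfolding kernel_ideal_def by blast
    show ?thesis
    proof (rule kernel_idealI)
      show "(\<lambda>j. R \<star> Q j) \<in> TTs"
        by (rule funcsetI) (rule T.m_closed[OF R Pi_mem[OF Q(1)]])
      show "R \<star> H \<in> carrier TT" by (rule T.m_closed[OF R Q(2)])
      show "comb (\<lambda>j. (R \<star> Q j)) TF \<in> F0I"
        unfolding sum_scale[OF Q(1) tcFp R] by (rule ideal.I_l_closed[OF F0_ideal Q(3) R])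
      show "R \<star> P = comb (\<lambda>j. (R \<star> Q j)) tv \<uplus> (R \<star> H) \<star> tc (F 0)"
        unfolding sum_scale[OF Q(1) tvTp R] Q(4) T.m_assoc[OF R Q(2) tcF[of 0], simplified]
        by (rule T.r_distr[OF S[OF Q(1)] tot[OF Q(2)] R])
    qed
  qed
  show ?thesis
    by (rule T.ideal_closedI) (use kernel_ideal_carrier const_F0_kernel add mult in blast)+
qed

text \<open>A linear form has constant coefficients, so that its value is itself the polynomial \<open>\<Sum> Q\<^sub>j F\<^sub>j\<close>.\<close>

lemma linear_kernel:
  assumes l: "l \<in> HH 1" and v: "value l \<in> K"
  shows "l \<in> kernel_ideal"
proof -
  interpret T: cring TT by (rule TT_cring)
  obtain Q where Q: "\<forall>j\<in>{0..n}. Q j \<in> HH 0" "l = comb Q tv"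
    using A.homogeneous_Suc_decomp[of l "{0..n}" 0] l by auto
  have H0: "P \<in> HH 0 \<Longrightarrow> tc (value P) = P \<and> value P \<in> carrier A" for P
  proof -
    assume P: "P \<in> HH 0"
    have "P = tc (P {#})"
      using P by (auto simp: homogeneous_def A.indexed_const_def fun_eq_iff)
    moreover have "P {#} \<in> carrier A" by (rule A.mpoly_coeff_closed[OF A.homogeneous_carrier[OF P]])
    ultimately show ?thesis using value_simps(1)[of "P {#}"] by metis
  qed
  have Qc: "Q j \<in> carrier TT" if "j \<in> {0..n}" for j using Q(1) that A.homogeneous_carrier by blast
  interpret v: ring_hom_ring TT A "value" by (rule ring_hom_ringI2[OF T.ring_axioms A.ring_axioms value_hom])
  interpret c: ring_hom_ring A TT tc by (rule ring_hom_ringI2[OF A.ring_axioms T.ring_axioms A.indexed_const_hom])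
  have "value l = (\<Oplus>j\<in>{0..n}. (value \<circ> (\<lambda>j. Q j \<star> tv j)) j)"
    unfolding Q(2) by (rule v.hom_finsum) (rule funcsetI, rule T.m_closed[OF Qc tvT])
  moreover have "value \<circ> (\<lambda>j. Q j \<star> tv j) \<in> {0..n} \<rightarrow> carrier A"
    by (rule funcsetI, unfold comp_apply, rule ring_hom_closed[OF value_hom T.m_closed[OF Qc tvT]])
  ultimately have "tc (value l) = (\<Oplus>\<^bsub>TT\<^esub>j\<in>{0..n}. (tc \<circ> (value \<circ> (\<lambda>j. Q j \<star> tv j))) j)"
    by (simp only: c.hom_finsum)
  also have "\<dots> = comb Q TF"
  proof (rule T.finsum_cong'[OF refl])
    show "(\<lambda>j. Q j \<star> tc (F j)) \<in> TTs" by (rule funcsetI) (rule T.m_closed[OF Qc tcF])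
    fix j assume j: "j \<in> {0..n}"
    have "value (Q j \<star> tv j) = value (Q j) \<otimes> F j"
      using ring_hom_mult[OF value_hom Qc[OF j] tvT[OF j]] value_simps(2)[OF j] by simp
    then show "(tc \<circ> (value \<circ> (\<lambda>j. Q j \<star> tv j))) j = Q j \<star> tc (F j)"
      using ring_hom_mult[OF A.indexed_const_hom, of "value (Q j)" "F j" "{0..n}"] H0[of "Q j"] Q(1) j Fc[OF j] by simp
  qed
  finally have e: "comb Q TF = tc (value l)" by simp
  obtain c where cA: "c \<in> carrier A" and vl: "value l = F 0 \<otimes> c" using v unfolding K_gen by blast
  have "tc (value l) = tc c \<star> tc (F 0)"
    unfolding vl using ring_hom_mult[OF A.indexed_const_hom cA Fc[of 0], of "{0..n}"] A.m_comm[OF cA Fc[of 0]] by simp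
  then have "comb Q TF \<in> F0I"
    unfolding e using F0_in[OF A.mpoly_closed(1)[OF cA]] by simp
  then show ?thesis
  proof (rule kernel_idealI[rotated 2])
    show "Q \<in> TTs" by (rule funcsetI[OF Qc])
    show "l = comb Q tv \<uplus> \<zero>\<^bsub>TT\<^esub> \<star> tc (F 0)"
      using tcF[of 0] A.homogeneous_carrier[OF l] Q(2) by simp
  qed simp
qed

text \<open>The quotient by the kernel ideal receives a map from \<open>Sym B J\<close> that inverts the map of classes: send the
generator at \<open>\<pi> a\<close> to any linear form with value \<open>a\<close>. Two linear forms whose values agree in \<open>B\<close> differ by an
element of the kernel ideal (\<open>linear_kernel\<close>), so this is well defined and additive.\<close>

lemma class_zero_imp_kernel:
  assumes P: "P \<in> carrier TT" and z: "cls P = \<zero>\<^bsub>SB\<^esub>"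
  shows "P \<in> kernel_ideal"
proof -
  have Tc: "cring TT" by (rule TT_cring)
  interpret T: cring TT by (rule TT_cring)
  note n = kernel_ideal_ideal
  define N where "N = TT Quot kernel_ideal"
  define cl where "cl u = kernel_ideal +>\<^bsub>TT\<^esub> u" for u
  have Nc: "cring N" unfolding N_def by (rule ideal.quotient_is_cring[OF n Tc])
  have clh: "cl \<in> ring_hom TT N" unfolding cl_def[abs_def] N_def by (rule ideal.rcos_ring_hom[OF n])
  have cl_eq: "cl u = cl w" if "u \<in> carrier TT" "w \<in> carrier TT" "u \<ominus>\<^bsub>TT\<^esub> w \<in> kernel_ideal" for u w
    unfolding cl_def using T.quotient_eq_iff_same_a_r_cos[OF n that(1,2)] that(3) by blast
  define ll where "ll a = (SOME l. l \<in> HH 1 \<and> value l = a)" for a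
  have ll: "ll a \<in> HH 1 \<and> value (ll a) = a" if a: "a \<in> I" for a
    unfolding ll_def by (rule someI_ex[of "\<lambda>l. l \<in> HH 1 \<and> value l = a"]) (use linear_form[OF a] in blast)
  interpret p: ring_hom_ring A B \<pi> by (rule ring_hom_ringI2[OF A.ring_axioms B.ring_axioms \<pi>])
  have diffK: "a \<ominus> b \<in> K" if ab: "a \<in> carrier A" "b \<in> carrier A" "\<pi> a = \<pi> b" for a b
    using ab ring_hom_minus[OF A.ring_axioms B.ring_axioms \<pi> ab(1,2)] \<pi>_closed[OF ab(2)]
    by (simp add: a_minus_def B.r_neg)
  have c_eq: "cl (tc a) = cl (tc b)" if ab: "a \<in> carrier A" "b \<in> carrier A" "\<pi> a = \<pi> b" for a b
  proof (rule cl_eq[OF A.mpoly_closed(1)[OF ab(1)] A.mpoly_closed(1)[OF ab(2)]])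
    obtain c where c: "c \<in> carrier A" "a \<ominus> b = F 0 \<otimes> c" using diffK[OF ab] unfolding K_gen by blast
    have "tc a \<ominus>\<^bsub>TT\<^esub> tc b = tc (F 0 \<otimes> c)"
      using ring_hom_minus[OF A.ring_axioms T.ring_axioms A.indexed_const_hom ab(1,2)] c(2) by simp
    also have "\<dots> = tc (F 0) \<star> tc c" by (rule ring_hom_mult[OF A.indexed_const_hom Fc c(1)]) simp
    finally show "tc a \<ominus>\<^bsub>TT\<^esub> tc b \<in> kernel_ideal"
      using ideal.I_r_closed[OF n const_F0_kernel A.mpoly_closed(1)[OF c(1)]] by simp
  qed
  have l_eq: "cl l = cl m" if lm: "l \<in> HH 1" "m \<in> HH 1" "\<pi> (value l) = \<pi> (value m)" for l m
  proof (rule cl_eq[OF A.homogeneous_carrier[OF lm(1)] A.homogeneous_carrier[OF lm(2)]])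
    note c = A.homogeneous_carrier[OF lm(1)] A.homogeneous_carrier[OF lm(2)]
    have "(\<ominus>\<^bsub>TT\<^esub> \<one>\<^bsub>TT\<^esub>) \<star> m \<in> HH 1"
    proof -
      interpret h: ring_hom_ring A TT tc by (rule ring_hom_ringI2[OF A.ring_axioms T.ring_axioms A.indexed_const_hom])
      have "\<ominus>\<^bsub>TT\<^esub> \<one>\<^bsub>TT\<^esub> = tc (\<ominus> \<one>)" by simp
      then show ?thesis using A.homogeneous_mult[OF A.homogeneous_const[of "\<ominus> \<one>"] lm(2)] by simp
    qed
    then have "\<ominus>\<^bsub>TT\<^esub> m \<in> HH 1" using c(2) by (simp add: T.l_minus)
    then have d: "l \<ominus>\<^bsub>TT\<^esub> m \<in> HH 1" unfolding a_minus_def by (rule A.homogeneous_add[OF lm(1)])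
    have "value (l \<ominus>\<^bsub>TT\<^esub> m) \<in> K"
      unfolding ring_hom_minus[OF T.ring_axioms A.ring_axioms value_hom c]
      by (rule diffK[OF ring_hom_closed[OF value_hom c(1)] ring_hom_closed[OF value_hom c(2)] lm(3)])
    then show "l \<ominus>\<^bsub>TT\<^esub> m \<in> kernel_ideal" by (rule linear_kernel[OF d])
  qed
  obtain G where Gh: "G \<in> ring_hom SB N" and Gc: "\<And>a. a \<in> carrier A \<Longrightarrow> G (Sym_const B J (\<pi> a)) = cl (tc a)"
    and Gg: "\<And>a. a \<in> I \<Longrightarrow> G (gen a) = cl (ll a)"
  proof (rule Sym_descend[OF Nc])
    show "(\<lambda>a. cl (tc a)) \<in> ring_hom A N" using ring_hom_trans[OF A.indexed_const_hom clh] by (simp add: comp_def)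
    show "cl (tc a) = cl (tc b)" if "a \<in> carrier A" "b \<in> carrier A" "\<pi> a = \<pi> b" for a b by (rule c_eq[OF that])
    show "(\<lambda>a. cl (ll a)) \<in> I \<rightarrow> carrier N"
      by (rule funcsetI) (use ll A.homogeneous_carrier ring_hom_closed[OF clh] in blast)
    show "cl (ll a) = cl (ll b)" if "a \<in> I" "b \<in> I" "\<pi> a = \<pi> b" for a b
      by (rule l_eq) (use ll that in simp_all)
    show "cl (ll (a \<oplus> b)) = cl (ll a) \<oplus>\<^bsub>N\<^esub> cl (ll b)" if ab: "a \<in> I" "b \<in> I" for a b
    proof -
      have s: "a \<oplus> b \<in> I" by (rule additive_subgroup.a_closed[OF A.J.additive_subgroup_axioms ab])
      have h: "ll a \<in> HH 1" "ll b \<in> HH 1" "ll (a \<oplus> b) \<in> HH 1" using ll ab s by blast+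
      note c = A.homogeneous_carrier[OF h(1)] A.homogeneous_carrier[OF h(2)]
      have "cl (ll (a \<oplus> b)) = cl (ll a \<uplus> ll b)"
        by (rule l_eq[OF h(3) A.homogeneous_add[OF h(1,2)]]) (simp add: ring_hom_add[OF value_hom c] ll ab s)
      then show ?thesis using ring_hom_add[OF clh c] by simp
    qed
    show "cl (ll (r \<otimes> a)) = cl (tc r) \<otimes>\<^bsub>N\<^esub> cl (ll a)" if r: "r \<in> carrier A" and a: "a \<in> I" for r a
    proof -
      have s: "r \<otimes> a \<in> I" by (rule A.J.I_l_closed[OF a r])
      have h: "ll a \<in> HH 1" "ll (r \<otimes> a) \<in> HH 1" using ll a s by blast+
      note c = A.mpoly_closed(1)[OF r] A.homogeneous_carrier[OF h(1)]
      have m: "tc r \<star> ll a \<in> HH 1" using A.homogeneous_mult[OF A.homogeneous_const[OF r] h(1)] by simp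
      have "cl (ll (r \<otimes> a)) = cl (tc r \<star> ll a)"
        by (rule l_eq[OF h(2) m]) (simp add: ring_hom_mult[OF value_hom c] ll a s value_simps(1)[OF r])
      then show ?thesis using ring_hom_mult[OF clh c] by simp
    qed
  qed metis
  have "(G \<circ> cls) P = cl P"
  proof (rule mpoly_hom_eqI[OF A.cring_axioms Nc ring_hom_trans[OF cls_hom Gh] clh _ _ P])
    fix c assume c: "c \<in> carrier A"
    show "(G \<circ> cls) (tc c) = cl (tc c)" using cls_simps(1)[OF c] Gc[OF c] by simp
  next
    fix j assume j: "j \<in> {0..n}"
    have "tv j = tc \<one> \<star> tv j" using tvT[OF j] T.l_one[OF tvT[OF j]] by (simp add: mpoly_ring_simps)
    then have "tv j \<in> HH 1" using A.homogeneous_mult_var[OF A.homogeneous_const[OF A.one_closed] j] by simp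
    then have "cl (ll (F j)) = cl (tv j)"
      using ll[OF F_I[OF j]] value_simps(2)[OF j] by (intro l_eq) auto
    then show "(G \<circ> cls) (tv j) = cl (tv j)" using cls_simps(2)[OF j] Gg[OF F_I[OF j]] by simp
  qed
  then have "cl P = cl \<zero>\<^bsub>TT\<^esub>"
    using z ring_hom_zero'[OF Gh B.S.cring_axioms Nc] ring_hom_zero'[OF clh Tc Nc] by simp
  then have "P \<ominus>\<^bsub>TT\<^esub> \<zero>\<^bsub>TT\<^esub> \<in> kernel_ideal"
    unfolding cl_def using T.quotient_eq_iff_same_a_r_cos[OF n P T.zero_closed] by blast
  then show ?thesis using P by (simp add: a_minus_def)
qed

text \<open>Take components of degree \<open>d\<close> of the representation as an element of the kernel ideal. The summand \<open>H F\<^sub>0\<close>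
is absorbed: the component of \<open>H\<close> has positive degree, hence is \<open>\<Sum> Y\<^sub>j T\<^sub>j\<close>, and \<open>Q\<^sub>j\<close> is replaced by \<open>Q\<^sub>j + F\<^sub>0 Y\<^sub>j\<close>.
Finally the term with \<open>j = 0\<close> can be dropped from \<open>\<Sum> Q\<^sub>j F\<^sub>j\<close>, as it is a multiple of \<open>F\<^sub>0\<close>.\<close>

lemma class_zero_imp_decomposes:
  assumes P: "P \<in> HH d" and d: "0 < d" and z: "cls P = \<zero>\<^bsub>SB\<^esub>"
  shows "decomposes d P"
proof -
  interpret T: cring TT by (rule TT_cring)
  obtain Q H where Q: "Q \<in> TTs" "H \<in> carrier TT"
      "comb Q TF \<in> F0I"
      "P = comb Q tv \<uplus> H \<star> tc (F 0)"
    using class_zero_imp_kernel[OF A.homogeneous_carrier[OF P] z] unfolding kernel_ideal_def by blast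
  obtain e where e: "d = Suc e" using d by (cases d) auto
  let ?c = "component A"
  have Qc: "Q j \<in> carrier TT" if "j \<in> {0..n}" for j by (rule Pi_mem[OF Q(1) that])
  obtain Y where Y: "\<forall>j\<in>{0..n}. Y j \<in> HH e" "?c d H = comb Y tv"
    using A.homogeneous_Suc_decomp[OF A.component_homogeneous[OF Q(2), of "Suc e"]] e by auto
  have Yc: "Y j \<in> carrier TT" if "j \<in> {0..n}" for j using Y(1) that A.homogeneous_carrier by blast
  have cQ: "?c e (Q j) \<in> HH e" if "j \<in> {0..n}" for j by (rule A.component_homogeneous[OF Qc[OF that]])
  define S where "S j = ?c e (Q j) \<uplus> tc (F 0) \<star> Y j" for j
  have c1: "(\<lambda>j. ?c e (Q j)) \<in> TTs" by (rule funcsetI) (rule A.homogeneous_carrier[OF cQ])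
  have c2: "(\<lambda>j. tc (F 0) \<star> Y j) \<in> TTs" by (rule funcsetI) (rule T.m_closed[OF tcF Yc], simp)
  have Yp: "Y \<in> TTs" by (rule funcsetI[OF Yc])
  have F0: "tc (F 0) \<in> carrier TT" by (rule tcF) simp
  have SH: "S j \<in> HH e" if j: "j \<in> {0..n}" for j
    unfolding S_def using A.homogeneous_add[OF cQ[OF j]] A.homogeneous_mult[OF A.homogeneous_const[OF Fc[of 0]], of "Y j" "{0..n}" e] Y(1) j by simp
  have f1: "(\<lambda>j. Q j \<star> tv j) \<in> TTs" by (rule funcsetI) (rule T.m_closed[OF Qc tvT])
  have f2: "(\<lambda>j. Q j \<star> tc (F j)) \<in> TTs" by (rule funcsetI) (rule T.m_closed[OF Qc tcF])
  have "P = ?c d P" by (rule A.component_id[OF P, symmetric])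
  also have "\<dots> = ?c d (comb Q tv) \<uplus> ?c d (H \<star> tc (F 0))"
    unfolding Q(4) by (rule A.component_add)
  also have "?c d (comb Q tv) = (\<Oplus>\<^bsub>TT\<^esub>j\<in>{0..n}. ?c d (Q j \<star> tv j))"
    by (rule A.component_finsum[OF _ f1]) simp
  also have "\<dots> = comb (\<lambda>j. ?c e (Q j)) tv"
    unfolding e
    by (rule T.finsum_cong'[OF refl])
      (rule funcsetI, rule T.m_closed[OF Pi_mem[OF c1] tvT], assumption+, rule A.component_var[OF Qc], assumption+)
  also have "?c d (H \<star> tc (F 0)) = ?c d H \<star> tc (F 0)" by (rule A.component_const[OF Q(2) Fc]) simp
  also have "\<dots> = tc (F 0) \<star> comb Y tv"
    using T.m_comm[OF A.homogeneous_carrier[OF A.component_homogeneous[OF Q(2)]] F0, of d] Y(2) by simp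
  also have "\<dots> = comb (\<lambda>j. (tc (F 0) \<star> Y j)) tv" by (rule sum_scale[OF Yp tvTp F0, symmetric])
  also have "comb (\<lambda>j. ?c e (Q j)) tv \<uplus> \<dots> = comb S tv"
    unfolding S_def by (rule sum_add[OF c1 c2 tvTp, symmetric])
  finally have PS: "P = comb S tv" .
  obtain G where G: "G \<in> carrier TT" "comb Q TF = G \<star> tc (F 0)"
    using Q(3) unfolding Idl_F0 by (elim bexE)
  have "comb (\<lambda>j. ?c e (Q j)) TF = (\<Oplus>\<^bsub>TT\<^esub>j\<in>{0..n}. ?c e (Q j \<star> tc (F j)))"
    by (rule T.finsum_cong'[OF refl])
      (rule funcsetI, rule A.homogeneous_carrier[OF A.component_homogeneous[OF Pi_mem[OF f2]]], assumption+,
       rule A.component_const[OF Qc Fc, symmetric], assumption+)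
  also have "\<dots> = ?c e (G \<star> tc (F 0))" unfolding G(2)[symmetric] by (rule A.component_finsum[OF _ f2, symmetric]) simp
  also have "\<dots> = ?c e G \<star> tc (F 0)" by (rule A.component_const[OF G(1) Fc]) simp
  finally have m1: "comb (\<lambda>j. ?c e (Q j)) TF \<in> F0I"
    using F0_in[OF A.homogeneous_carrier[OF A.component_homogeneous[OF G(1), of e]]] by simp
  have yt: "comb Y TF \<in> carrier TT"
    by (rule T.finsum_closed) (rule funcsetI, rule T.m_closed[OF Yc tcF])
  have m2: "comb (\<lambda>j. (tc (F 0) \<star> Y j)) TF \<in> F0I"
    unfolding sum_scale[OF Yp tcFp F0] T.m_comm[OF F0 yt] by (rule F0_in[OF yt])
  have m3: "comb S TF \<in> F0I"
    unfolding S_def sum_add[OF c1 c2 tcFp]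
    by (rule ideal_add[OF F0_ideal m1 m2])
  have Sc: "S j \<in> carrier TT" if "j \<in> {0..n}" for j by (rule A.homogeneous_carrier[OF SH[OF that]])
  have S0: "S 0 \<star> tc (F 0) \<in> F0I" by (rule F0_in[OF Sc]) simp
  have r: "(\<Oplus>\<^bsub>TT\<^esub>j\<in>{1..n}. S j \<star> tc (F j)) \<in> carrier TT"
    by (rule T.finsum_closed) (use Sc tcF in auto)
  have "comb S TF = S 0 \<star> tc (F 0) \<uplus> (\<Oplus>\<^bsub>TT\<^esub>j\<in>{1..n}. S j \<star> tc (F j))"
    by (rule split_first[OF TT_cring T.m_closed[OF Sc tcF]])
  then have "(\<Oplus>\<^bsub>TT\<^esub>j\<in>{1..n}. S j \<star> tc (F j)) = (\<ominus>\<^bsub>TT\<^esub> (S 0 \<star> tc (F 0))) \<uplus> comb S TF"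
    using T.r_neg1[OF T.m_closed[OF Sc[of 0] F0] r] by simp
  also have "\<dots> \<in> F0I"
    by (rule ideal_add[OF F0_ideal
        ideal_uminus[OF F0_ideal S0] m3])
  finally show ?thesis unfolding decomposes_def using PS SH e by (intro exI[of _ S]) simp
qed

text \<open>Forms with value \<open>a\<close> and class \<open>s\<close> over \<open>A\<close> come from homogeneous polynomials with value \<open>a\<close> and class \<open>s\<close>, and a
polynomial of positive degree decomposes if and only if its class is zero.\<close>

theorem decomposes_iff_graph:
  assumes d: "0 < d"
  shows "(\<forall>P\<in>HH d. value P = \<zero> \<longrightarrow> decomposes d P) \<longleftrightarrow> (\<forall>s. (\<zero>, s) \<in> graph d \<longrightarrow> s = \<zero>\<^bsub>SB\<^esub>)"
proof (intro iffI allI impI ballI)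
  fix s assume D: "\<forall>P\<in>HH d. value P = \<zero> \<longrightarrow> decomposes d P" and "(\<zero>, s) \<in> graph d"
  then obtain P where "P \<in> HH d" "value P = \<zero>" "cls P = s" using graph_homogeneous by blast
  then show "s = \<zero>\<^bsub>SB\<^esub>" using D decomposes_imp_class_zero by blast
next
  fix P assume G: "\<forall>s. (\<zero>, s) \<in> graph d \<longrightarrow> s = \<zero>\<^bsub>SB\<^esub>" and P: "P \<in> HH d" "value P = \<zero>"
  have "cls P = \<zero>\<^bsub>SB\<^esub>" using homogeneous_graph[OF P(1)] P(2) G by simp
  then show "decomposes d P" by (rule class_zero_imp_decomposes[OF P(1) d])
qed

end

section \<open>Noetherian rings and Krull's intersection theorem\<close>

context cring
begin

text \<open>Ideals of a subring \<open>C\<close>, inside a fixed ambient ring, and the Noetherian property for \<open>C\<close> (each ideal \<open>L\<close> is the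
least one containing some finite subset). Working with subsets lets a subring grow by one generator at a time.\<close>

definition submod :: "'a set \<Rightarrow> 'a set \<Rightarrow> bool" where
  "submod C L \<longleftrightarrow> L \<subseteq> C \<and> \<zero> \<in> L \<and> (\<forall>x\<in>L. \<forall>y\<in>L. x \<oplus> y \<in> L) \<and> (\<forall>c\<in>C. \<forall>x\<in>L. c \<otimes> x \<in> L)"

definition noeth :: "'a set \<Rightarrow> bool" where
  "noeth C \<longleftrightarrow> (\<forall>L. submod C L \<longrightarrow> (\<exists>G. finite G \<and> G \<subseteq> L \<and> (\<forall>M. submod C M \<longrightarrow> G \<subseteq> M \<longrightarrow> L \<subseteq> M)))"

lemma submodI:
  "L \<subseteq> C \<Longrightarrow> \<zero> \<in> L \<Longrightarrow> (\<And>x y. x \<in> L \<Longrightarrow> y \<in> L \<Longrightarrow> x \<oplus> y \<in> L) \<Longrightarrow>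
   (\<And>c x. c \<in> C \<Longrightarrow> x \<in> L \<Longrightarrow> c \<otimes> x \<in> L) \<Longrightarrow> submod C L"
  by (simp add: submod_def)

lemma submodD:
  assumes "submod C L"
  shows "L \<subseteq> C" "\<zero> \<in> L" "x \<in> L \<Longrightarrow> y \<in> L \<Longrightarrow> x \<oplus> y \<in> L" "c \<in> C \<Longrightarrow> x \<in> L \<Longrightarrow> c \<otimes> x \<in> L"
  using assms by (auto simp: submod_def)

lemma noethE:
  assumes "noeth C" "submod C L"
  obtains G where "finite G" "G \<subseteq> L" "\<And>M. submod C M \<Longrightarrow> G \<subseteq> M \<Longrightarrow> L \<subseteq> M"
  using assms unfolding noeth_def by meson

lemma submod_minus:
  assumes C: "subring C R" and L: "submod C L" and x: "x \<in> L" and y: "y \<in> L"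
  shows "x \<ominus> y \<in> L"
proof -
  have sub: "C \<subseteq> carrier R" by (rule subringE(1)[OF C])
  have yR: "y \<in> carrier R" using submodD(1)[OF L] sub y by blast
  have "(\<ominus> \<one>) \<otimes> y \<in> L" by (rule submodD(4)[OF L subringE(5)[OF C subringE(3)[OF C]] y])
  then have "\<ominus> y \<in> L" using yR by (simp add: l_minus)
  then show ?thesis unfolding a_minus_def by (rule submodD(3)[OF L x])
qed

lemma submod_inter: "submod C L \<Longrightarrow> submod C M \<Longrightarrow> submod C (L \<inter> M)"
  unfolding submod_def by blast

subsection \<open>Hilbert's basis theorem\<close>

text \<open>The polynomial expressions of degree less than \<open>n\<close> in \<open>a\<close>. The element \<open>a\<close> may be algebraic over \<open>C\<close>, so these
expressions need not be unique; the proof of the basis theorem tolerates this.\<close>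

fun poly_in :: "'a set \<Rightarrow> 'a \<Rightarrow> nat \<Rightarrow> 'a set" where
  "poly_in C a 0 = {\<zero>}"
| "poly_in C a (Suc n) = {p \<oplus> c \<otimes> a [^] n | p c. p \<in> poly_in C a n \<and> c \<in> C}"

context
  fixes C a assumes C: "subring C R" and a: "a \<in> carrier R"
begin

private lemma sub: "C \<subseteq> carrier R" by (rule subringE(1)[OF C])

private lemma Cc: "c \<in> C \<Longrightarrow> c \<in> carrier R" using sub by blast

private lemma C0: "\<zero> \<in> C" by (rule subringE(2)[OF C])

lemma poly_in_carrier: "p \<in> poly_in C a n \<Longrightarrow> p \<in> carrier R"
proof (induction n arbitrary: p)
  case (Suc n)
  then obtain q c where "q \<in> poly_in C a n" "c \<in> C" "p = q \<oplus> c \<otimes> a [^] n" by auto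
  then show ?case using Suc.IH[of q] Cc[of c] a by simp
qed simp

lemma poly_in_SucI: "p \<in> poly_in C a n \<Longrightarrow> c \<in> C \<Longrightarrow> p \<oplus> c \<otimes> a [^] n \<in> poly_in C a (Suc n)"
  by auto

lemma poly_in_Suc: "p \<in> poly_in C a n \<Longrightarrow> p \<in> poly_in C a (Suc n)"
  using poly_in_SucI[of p n \<zero>] C0 poly_in_carrier[of p n] a by simp

lemma poly_in_mono: "p \<in> poly_in C a n \<Longrightarrow> n \<le> m \<Longrightarrow> p \<in> poly_in C a m"
  by (induction m) (use poly_in_Suc le_Suc_eq in \<open>auto simp del: poly_in.simps(2)\<close>)

lemma poly_in_zero: "\<zero> \<in> poly_in C a n"
  using poly_in_mono[of \<zero> 0 n] by simp

lemma poly_in_add: "p \<in> poly_in C a n \<Longrightarrow> q \<in> poly_in C a n \<Longrightarrow> p \<oplus> q \<in> poly_in C a n"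
proof (induction n arbitrary: p q)
  case (Suc n)
  obtain p' c where p: "p' \<in> poly_in C a n" "c \<in> C" "p = p' \<oplus> c \<otimes> a [^] n" using Suc.prems(1) by auto
  obtain q' d where q: "q' \<in> poly_in C a n" "d \<in> C" "q = q' \<oplus> d \<otimes> a [^] n" using Suc.prems(2) by auto
  note cl = poly_in_carrier[OF p(1)] poly_in_carrier[OF q(1)] Cc[OF p(2)] Cc[OF q(2)] nat_pow_closed[OF a, of n]
  have "p \<oplus> q = (p' \<oplus> q') \<oplus> (c \<oplus> d) \<otimes> a [^] n" unfolding p(3) q(3) using cl by (simp add: a_ac l_distr)
  then show ?case using poly_in_SucI[OF Suc.IH[OF p(1) q(1)] subringE(7)[OF C p(2) q(2)]] by simp
qed simp

lemma poly_in_smult: "p \<in> poly_in C a n \<Longrightarrow> c \<in> C \<Longrightarrow> c \<otimes> p \<in> poly_in C a n"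
proof (induction n arbitrary: p)
  case 0 then show ?case using Cc by simp
next
  case (Suc n)
  obtain p' d where p: "p' \<in> poly_in C a n" "d \<in> C" "p = p' \<oplus> d \<otimes> a [^] n" using Suc.prems(1) by auto
  note cl = poly_in_carrier[OF p(1)] Cc[OF p(2)] Cc[OF Suc.prems(2)] nat_pow_closed[OF a, of n]
  have "c \<otimes> p = c \<otimes> p' \<oplus> (c \<otimes> d) \<otimes> a [^] n" unfolding p(3) using cl by (simp add: r_distr m_assoc)
  then show ?case using poly_in_SucI[OF Suc.IH[OF p(1) Suc.prems(2)] subringE(6)[OF C Suc.prems(2) p(2)]] by simp
qed

lemma poly_in_shift: "p \<in> poly_in C a n \<Longrightarrow> a \<otimes> p \<in> poly_in C a (Suc n)"
proof (induction n arbitrary: p)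
  case 0 then show ?case using a poly_in_zero[of "Suc 0"] by (simp del: poly_in.simps(2))
next
  case (Suc n)
  obtain p' d where p: "p' \<in> poly_in C a n" "d \<in> C" "p = p' \<oplus> d \<otimes> a [^] n" using Suc.prems(1) by auto
  note cl = poly_in_carrier[OF p(1)] Cc[OF p(2)] nat_pow_closed[OF a, of n] a
  have "a \<otimes> p = a \<otimes> p' \<oplus> d \<otimes> a [^] Suc n" unfolding p(3) using cl by (simp add: r_distr m_ac)
  then show ?case using poly_in_SucI[OF Suc.IH[OF p(1)] p(2)] by (simp del: poly_in.simps(2))
qed

lemma poly_in_shifts: "p \<in> poly_in C a n \<Longrightarrow> a [^] k \<otimes> p \<in> poly_in C a (n + k)"
proof (induction k)
  case 0 then show ?case using poly_in_carrier by simp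
next
  case (Suc k)
  have pc: "p \<in> carrier R" by (rule poly_in_carrier[OF Suc.prems])
  have "a [^] Suc k \<otimes> p = a \<otimes> (a [^] k \<otimes> p)" using a pc by (simp add: m_ac)
  then show ?case using poly_in_shift[OF Suc.IH[OF Suc.prems]] by (simp del: poly_in.simps(2))
qed

lemma poly_in_mult: "p \<in> poly_in C a n \<Longrightarrow> q \<in> poly_in C a m \<Longrightarrow> p \<otimes> q \<in> poly_in C a (n + m)"
proof (induction n arbitrary: p)
  case 0 then show ?case using poly_in_carrier[of q] poly_in_zero by simp
next
  case (Suc n)
  obtain p' d where p: "p' \<in> poly_in C a n" "d \<in> C" "p = p' \<oplus> d \<otimes> a [^] n" using Suc.prems(1) by auto
  note cl = poly_in_carrier[OF p(1)] poly_in_carrier[OF Suc.prems(2)] Cc[OF p(2)] nat_pow_closed[OF a, of n]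
  have "p \<otimes> q = p' \<otimes> q \<oplus> d \<otimes> (a [^] n \<otimes> q)" unfolding p(3) using cl by (simp add: l_distr m_assoc)
  moreover have "p' \<otimes> q \<in> poly_in C a (Suc n + m)"
    by (rule poly_in_mono[OF Suc.IH[OF p(1) Suc.prems(2)]]) simp
  moreover have "d \<otimes> (a [^] n \<otimes> q) \<in> poly_in C a (Suc n + m)"
    by (rule poly_in_mono[OF poly_in_smult[OF poly_in_shifts[OF Suc.prems(2)] p(2)]]) simp
  ultimately show ?case using poly_in_add by (simp del: poly_in.simps(2))
qed

definition adjoin :: "'a set" where "adjoin = (\<Union>n. poly_in C a n)"

lemma adjoin_common:
  assumes "x \<in> adjoin" "y \<in> adjoin" obtains n where "x \<in> poly_in C a n" "y \<in> poly_in C a n"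
proof -
  obtain i j where "x \<in> poly_in C a i" "y \<in> poly_in C a j" using assms by (auto simp: adjoin_def)
  then have "x \<in> poly_in C a (max i j)" "y \<in> poly_in C a (max i j)" by (auto intro: poly_in_mono)
  then show ?thesis by (rule that)
qed

lemma C_adjoin: "c \<in> C \<Longrightarrow> c \<in> adjoin"
  using poly_in_SucI[of \<zero> 0 c] Cc[of c] unfolding adjoin_def by (auto simp del: poly_in.simps(2))

lemma a_adjoin: "a \<in> adjoin"
proof -
  have "\<one> \<in> poly_in C a 1" using poly_in_SucI[of \<zero> 0 \<one>] subringE(3)[OF C] by simp
  from poly_in_shift[OF this] show ?thesis using a unfolding adjoin_def by (auto simp del: poly_in.simps(2))
qed

lemma adjoin_subring: "subring adjoin R"
proof (rule subringI)
  show "adjoin \<subseteq> carrier R" using poly_in_carrier by (auto simp: adjoin_def)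
  show "\<one> \<in> adjoin" by (rule C_adjoin[OF subringE(3)[OF C]])
  fix x assume x: "x \<in> adjoin"
  then obtain i where i: "x \<in> poly_in C a i" by (auto simp: adjoin_def)
  have "(\<ominus> \<one>) \<otimes> x \<in> poly_in C a i" by (rule poly_in_smult[OF i subringE(5)[OF C subringE(3)[OF C]]])
  then have "\<ominus> x \<in> poly_in C a i" using poly_in_carrier[OF i] by (simp add: l_minus)
  then show "\<ominus> x \<in> adjoin" by (auto simp: adjoin_def)
  fix y assume y: "y \<in> adjoin"
  obtain n where n: "x \<in> poly_in C a n" "y \<in> poly_in C a n" by (rule adjoin_common[OF x y])
  show "x \<oplus> y \<in> adjoin" using poly_in_add[OF n] by (auto simp: adjoin_def)
  show "x \<otimes> y \<in> adjoin" using poly_in_mult[OF n] by (auto simp: adjoin_def)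
qed

text \<open>The possible leading coefficients of elements of \<open>L\<close> written with formal degree \<open>n\<close>.\<close>

definition lead :: "'a set \<Rightarrow> nat \<Rightarrow> 'a set" where
  "lead L n = {c \<in> C. \<exists>p\<in>poly_in C a n. p \<oplus> c \<otimes> a [^] n \<in> L}"

lemma lead_submod: assumes L: "submod adjoin L" shows "submod C (lead L n)"
proof (rule submodI)
  show "lead L n \<subseteq> C" by (auto simp: lead_def)
  have "\<zero> \<oplus> \<zero> \<otimes> a [^] n \<in> L" using submodD(2)[OF L] a by simp
  then show "\<zero> \<in> lead L n" unfolding lead_def using C0 poly_in_zero by blast
next
  fix c d assume "c \<in> lead L n" "d \<in> lead L n"
  then obtain p q where p: "c \<in> C" "p \<in> poly_in C a n" "p \<oplus> c \<otimes> a [^] n \<in> L"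
    and q: "d \<in> C" "q \<in> poly_in C a n" "q \<oplus> d \<otimes> a [^] n \<in> L" by (auto simp: lead_def)
  note cl = poly_in_carrier[OF p(2)] poly_in_carrier[OF q(2)] Cc[OF p(1)] Cc[OF q(1)] nat_pow_closed[OF a, of n]
  have "(p \<oplus> q) \<oplus> (c \<oplus> d) \<otimes> a [^] n = (p \<oplus> c \<otimes> a [^] n) \<oplus> (q \<oplus> d \<otimes> a [^] n)"
    using cl by (simp add: a_ac l_distr)
  also have "\<dots> \<in> L" by (rule submodD(3)[OF L p(3) q(3)])
  finally show "c \<oplus> d \<in> lead L n" unfolding lead_def using poly_in_add[OF p(2) q(2)] subringE(7)[OF C p(1) q(1)] by blast
next
  fix c d assume c: "c \<in> C" and "d \<in> lead L n"
  then obtain q where q: "d \<in> C" "q \<in> poly_in C a n" "q \<oplus> d \<otimes> a [^] n \<in> L" by (auto simp: lead_def)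
  note cl = poly_in_carrier[OF q(2)] Cc[OF c] Cc[OF q(1)] nat_pow_closed[OF a, of n]
  have "c \<otimes> q \<oplus> (c \<otimes> d) \<otimes> a [^] n = c \<otimes> (q \<oplus> d \<otimes> a [^] n)" using cl by (simp add: r_distr m_assoc)
  also have "\<dots> \<in> L" by (rule submodD(4)[OF L C_adjoin[OF c] q(3)])
  finally show "c \<otimes> d \<in> lead L n" unfolding lead_def using poly_in_smult[OF q(2) c] subringE(6)[OF C c q(1)] by blast
qed

lemma lead_Suc: assumes L: "submod adjoin L" shows "lead L n \<subseteq> lead L (Suc n)"
proof
  fix d assume "d \<in> lead L n"
  then obtain q where q: "d \<in> C" "q \<in> poly_in C a n" "q \<oplus> d \<otimes> a [^] n \<in> L" by (auto simp: lead_def)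
  note cl = poly_in_carrier[OF q(2)] Cc[OF q(1)] nat_pow_closed[OF a, of n] a
  have "a \<otimes> q \<oplus> d \<otimes> a [^] Suc n = a \<otimes> (q \<oplus> d \<otimes> a [^] n)" using cl by (simp add: r_distr m_ac)
  also have "\<dots> \<in> L" by (rule submodD(4)[OF L a_adjoin q(3)])
  finally show "d \<in> lead L (Suc n)" unfolding lead_def using poly_in_shift[OF q(2)] q(1) by blast
qed

lemma lead_mono: "submod adjoin L \<Longrightarrow> n \<le> m \<Longrightarrow> lead L n \<subseteq> lead L m"
  by (rule lift_Suc_mono_le[of "lead L"]) (rule lead_Suc)

text \<open>Subtract an element of \<open>M \<inter> L\<close> with the same leading coefficient; the difference has smaller formal degree.\<close>

lemma lead_determines:
  assumes L: "submod adjoin L" and M: "submod adjoin M" and le: "\<And>n. lead L n \<subseteq> lead (M \<inter> L) n"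
  shows "L \<subseteq> M"
proof -
  have "x \<in> L \<Longrightarrow> x \<in> poly_in C a m \<Longrightarrow> x \<in> M" for x m
  proof (induction m arbitrary: x)
    case 0 then show ?case using submodD(2)[OF M] by simp
  next
    case (Suc m)
    obtain p c where p: "p \<in> poly_in C a m" "c \<in> C" "x = p \<oplus> c \<otimes> a [^] m" using Suc.prems(2) by auto
    have "c \<in> lead L m" unfolding lead_def using p Suc.prems(1) by blast
    then obtain p' where p': "p' \<in> poly_in C a m" "p' \<oplus> c \<otimes> a [^] m \<in> M \<inter> L"
      using le[of m] unfolding lead_def by blast
    define y where "y = p' \<oplus> c \<otimes> a [^] m"
    note cl = poly_in_carrier[OF p(1)] poly_in_carrier[OF p'(1)] Cc[OF p(2)] nat_pow_closed[OF a, of m]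
    have yc: "y \<in> carrier R" unfolding y_def using cl by simp
    have "x \<ominus> y = p \<oplus> (\<ominus> \<one>) \<otimes> p'"
      unfolding p(3) y_def a_minus_def using cl by (simp add: l_minus minus_add a_ac r_neg1 r_neg)
    then have "x \<ominus> y \<in> poly_in C a m"
      using poly_in_add[OF p(1) poly_in_smult[OF p'(1) subringE(5)[OF C subringE(3)[OF C]]]] by simp
    moreover have "x \<ominus> y \<in> L"
      by (rule submod_minus[OF adjoin_subring L Suc.prems(1)]) (use p' y_def in blast)
    ultimately have "x \<ominus> y \<in> M" using Suc.IH by blast
    then have "(x \<ominus> y) \<oplus> y \<in> M" by (rule submodD(3)[OF M]) (use p' y_def in blast)
    moreover have "(x \<ominus> y) \<oplus> y = x"
      using poly_in_carrier[OF Suc.prems(2)] yc by (simp add: a_minus_def a_assoc l_neg)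
    ultimately show ?case by simp
  qed
  then show ?thesis using submodD(1)[OF L] unfolding adjoin_def by blast
qed

text \<open>Hilbert's argument: the ideals of leading coefficients increase with the degree, so they stabilize, and finitely
many elements of \<open>L\<close> realize generators of all of them.\<close>

lemma adjoin_noeth: assumes N: "noeth C" shows "noeth adjoin"
  unfolding noeth_def
proof (intro allI impI)
  fix L assume L: "submod adjoin L"
  define U where "U = (\<Union>n. lead L n)"
  have U: "submod C U"
  proof (rule submodI)
    show "U \<subseteq> C" by (auto simp: U_def lead_def)
    show "\<zero> \<in> U" using submodD(2)[OF lead_submod[OF L, of 0]] by (auto simp: U_def)
    fix x assume "x \<in> U"
    then obtain i where i: "x \<in> lead L i" by (auto simp: U_def)
    show "c \<otimes> x \<in> U" if "c \<in> C" for c using submodD(4)[OF lead_submod[OF L] that i] by (auto simp: U_def)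
    fix y assume "y \<in> U"
    then obtain j where j: "y \<in> lead L j" by (auto simp: U_def)
    have "x \<in> lead L (max i j)" "y \<in> lead L (max i j)"
      using i j lead_mono[OF L, of i "max i j"] lead_mono[OF L, of j "max i j"] by auto
    from submodD(3)[OF lead_submod[OF L] this] show "x \<oplus> y \<in> U" by (auto simp: U_def)
  qed
  obtain G where G: "finite G" "G \<subseteq> U" "\<And>M. submod C M \<Longrightarrow> G \<subseteq> M \<Longrightarrow> U \<subseteq> M" by (rule noethE[OF N U]) blast
  have "\<exists>n. G' \<subseteq> lead L n" if "finite G'" "G' \<subseteq> U" for G'
    using that
  proof (induction G' rule: finite_induct)
    case (insert g F)
    then obtain n m where "F \<subseteq> lead L n" "g \<in> lead L m" by (auto simp: U_def)
    then have "insert g F \<subseteq> lead L (max n m)"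
      using lead_mono[OF L, of n "max n m"] lead_mono[OF L, of m "max n m"] by auto
    then show ?case by blast
  qed simp
  then obtain b where b: "G \<subseteq> lead L b" using G by blast
  have Ub: "U \<subseteq> lead L b" by (rule G(3)[OF lead_submod[OF L] b])
  have "\<exists>G. finite G \<and> G \<subseteq> lead L n \<and> (\<forall>M. submod C M \<longrightarrow> G \<subseteq> M \<longrightarrow> lead L n \<subseteq> M)" for n
    using N lead_submod[OF L, of n] unfolding noeth_def by blast
  then obtain g where g: "\<And>n. finite (g n)" "\<And>n. g n \<subseteq> lead L n"
    "\<And>n M. submod C M \<Longrightarrow> g n \<subseteq> M \<Longrightarrow> lead L n \<subseteq> M" by metis
  define q where "q n c = (SOME p. p \<in> poly_in C a n \<and> p \<oplus> c \<otimes> a [^] n \<in> L)" for n c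
  have q: "q n c \<in> poly_in C a n \<and> q n c \<oplus> c \<otimes> a [^] n \<in> L" if "c \<in> g n" for n c
    unfolding q_def by (rule someI_ex) (use g(2)[of n] that in \<open>unfold lead_def, blast\<close>)
  define E where "E = (\<Union>n\<in>{..b}. (\<lambda>c. q n c \<oplus> c \<otimes> a [^] n) ` g n)"
  have "finite E" unfolding E_def using g(1) by simp
  moreover have "E \<subseteq> L" unfolding E_def using q by blast
  moreover have "L \<subseteq> M" if M: "submod adjoin M" and EM: "E \<subseteq> M" for M
  proof (rule lead_determines[OF L M])
    have MiL: "submod adjoin (M \<inter> L)" by (rule submod_inter[OF M L])
    have low: "lead L n \<subseteq> lead (M \<inter> L) n" if n: "n \<le> b" for n
    proof (rule g(3)[OF lead_submod[OF MiL]], rule subsetI)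
      fix c assume c: "c \<in> g n"
      then have "q n c \<oplus> c \<otimes> a [^] n \<in> M" using EM n unfolding E_def by blast
      then show "c \<in> lead (M \<inter> L) n" unfolding lead_def using q[OF c] g(2)[of n] c unfolding lead_def by blast
    qed
    fix n show "lead L n \<subseteq> lead (M \<inter> L) n"
    proof (cases "n \<le> b")
      case False
      have "lead L n \<subseteq> U" by (auto simp: U_def)
      also have "\<dots> \<subseteq> lead L b" by (rule Ub)
      also have "\<dots> \<subseteq> lead (M \<inter> L) b" by (rule low) simp
      also have "\<dots> \<subseteq> lead (M \<inter> L) n" by (rule lead_mono[OF MiL]) (use False in simp)
      finally show ?thesis .
    qed (rule low)
  qed
  ultimately show "\<exists>G. finite G \<and> G \<subseteq> L \<and> (\<forall>M. submod adjoin M \<longrightarrow> G \<subseteq> M \<longrightarrow> L \<subseteq> M)" by blast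
qed

end

lemma generate_ring_noeth:
  assumes S: "finite S" "S \<subseteq> carrier R" and C: "subring C R" and N: "noeth C"
  shows "noeth (generate_ring R (C \<union> S))"
  using S
proof (induction S rule: finite_induct)
  case empty
  have "generate_ring R C = C"
    using generate_ring_min_subring1[OF subringE(1)[OF C] C subset_refl] generate_ring.incl[of _ C R] by blast
  then show ?case using N by simp
next
  case (insert x S)
  have CS: "C \<union> S \<subseteq> carrier R" using subringE(1)[OF C] insert.prems by blast
  have D: "subring (generate_ring R (C \<union> S)) R" by (rule generate_ring_is_subring[OF CS])
  have x: "x \<in> carrier R" using insert.prems by blast
  have "generate_ring R (C \<union> insert x S) = adjoin (generate_ring R (C \<union> S)) x"
  proof
    show "generate_ring R (C \<union> insert x S) \<subseteq> adjoin (generate_ring R (C \<union> S)) x"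
    proof (rule generate_ring_min_subring1[OF _ adjoin_subring[OF D x]])
      show "C \<union> insert x S \<subseteq> carrier R" using CS x by blast
      show "C \<union> insert x S \<subseteq> adjoin (generate_ring R (C \<union> S)) x"
        using a_adjoin[OF D x] C_adjoin[OF D x] generate_ring.incl[of _ "C \<union> S" R] by blast
    qed
    let ?H = "generate_ring R (C \<union> insert x S)"
    have H: "subring ?H R" by (rule generate_ring_is_subring) (use CS x in blast)
    have CH: "generate_ring R (C \<union> S) \<subseteq> ?H"
      by (rule generate_ring_min_subring1[OF CS H]) (auto intro: generate_ring.incl)
    have xH: "x \<in> ?H" by (auto intro: generate_ring.incl)
    have xn: "x [^] n \<in> ?H" for n :: nat
      by (induction n) (use subringE(3)[OF H] subringE(6)[OF H _ xH] in auto)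
    have "p \<in> ?H" if "p \<in> poly_in (generate_ring R (C \<union> S)) x n" for p n
      using that
    proof (induction n arbitrary: p)
      case 0 then show ?case using subringE(2)[OF H] by simp
    next
      case (Suc n)
      then obtain q c where q: "q \<in> poly_in (generate_ring R (C \<union> S)) x n" "c \<in> generate_ring R (C \<union> S)"
        "p = q \<oplus> c \<otimes> x [^] n" by auto
      show ?case unfolding q(3)
        by (rule subringE(7)[OF H Suc.IH[OF q(1)] subringE(6)[OF H subsetD[OF CH q(2)] xn]])
    qed
    then show "adjoin (generate_ring R (C \<union> S)) x \<subseteq> ?H" unfolding adjoin_def[OF D x] by blast
  qed
  then show ?case using adjoin_noeth[OF D x insert.IH] insert.prems by simp
qed

text \<open>An ideal is generated by its intersection with \<open>C\<close>, since denominators are units.\<close>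

lemma localization_noeth:
  assumes C: "subring C R" and N: "noeth C"
    and loc: "\<And>r. r \<in> carrier R \<Longrightarrow> \<exists>u\<in>C. \<exists>v\<in>C. v \<in> Units R \<and> r \<otimes> v = u"
  shows "noeth (carrier R)"
  unfolding noeth_def
proof (intro allI impI)
  have sub: "C \<subseteq> carrier R" by (rule subringE(1)[OF C])
  fix L assume L: "submod (carrier R) L"
  have int: "submod C (M \<inter> C)" if M: "submod (carrier R) M" for M
    by (rule submodI)
      (use submodD[OF M] sub subringE(2,6,7)[OF C] in auto)
  obtain G where G: "finite G" "G \<subseteq> L \<inter> C" "\<And>M. submod C M \<Longrightarrow> G \<subseteq> M \<Longrightarrow> L \<inter> C \<subseteq> M"
    by (rule noethE[OF N int[OF L]]) blast
  have "L \<subseteq> M" if M: "submod (carrier R) M" and GM: "G \<subseteq> M" for M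
  proof
    fix x assume x: "x \<in> L"
    then have xR: "x \<in> carrier R" using submodD(1)[OF L] by blast
    obtain u v where uv: "u \<in> C" "v \<in> C" "v \<in> Units R" "x \<otimes> v = u" using loc[OF xR] by blast
    have "v \<otimes> x \<in> L" by (rule submodD(4)[OF L Units_closed[OF uv(3)] x])
    then have "u \<in> L \<inter> C" using uv xR m_comm[OF xR Units_closed[OF uv(3)]] by simp
    then have uM: "u \<in> M" using G(3)[OF int[OF M]] GM G(2) by blast
    have "inv v \<otimes> u = x"
      using uv xR by (metis Units_closed Units_inv_closed Units_r_inv m_assoc m_comm r_one)
    then show "x \<in> M" using submodD(4)[OF M Units_inv_closed[OF uv(3)] uM] by simp
  qed
  then show "\<exists>G. finite G \<and> G \<subseteq> L \<and> (\<forall>M. submod (carrier R) M \<longrightarrow> G \<subseteq> M \<longrightarrow> L \<subseteq> M)" using G by blast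
qed

subsection \<open>Krull's intersection theorem\<close>

lemma submod_ideal: "ideal L R \<Longrightarrow> submod (carrier R) L"
  by (rule submodI)
    (auto intro: ideal.Icarr additive_subgroup.zero_closed[OF ideal.axioms(1)] additive_subgroup.a_closed[OF ideal.axioms(1)] ideal.I_l_closed)

lemma submod_maximal_avoiding:
  assumes L: "submod (carrier R) L" and x: "x \<notin> L"
  shows "\<exists>M. submod (carrier R) M \<and> L \<subseteq> M \<and> x \<notin> M \<and> (\<forall>M'. submod (carrier R) M' \<longrightarrow> M \<subseteq> M' \<longrightarrow> x \<notin> M' \<longrightarrow> M' = M)"
proof -
  let ?A = "{M. submod (carrier R) M \<and> L \<subseteq> M \<and> x \<notin> M}"
  have "\<exists>M\<in>?A. \<forall>V\<in>?A. M \<subseteq> V \<longrightarrow> V = M"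
  proof (rule subset_Zorn_nonempty)
    show "?A \<noteq> {}" using L x by blast
    fix c assume c: "c \<noteq> {}" "subset.chain ?A c"
    then have cA: "c \<subseteq> ?A" and ch: "\<And>V W. V \<in> c \<Longrightarrow> W \<in> c \<Longrightarrow> V \<subseteq> W \<or> W \<subseteq> V"
      by (auto simp: subset_chain_def)
    have "submod (carrier R) (\<Union>c)"
    proof (rule submodI)
      show "\<Union>c \<subseteq> carrier R" using cA submodD(1) by blast
      show "\<zero> \<in> \<Union>c" using c(1) cA submodD(2) by blast
      show "x \<oplus> y \<in> \<Union>c" if xy: "x \<in> \<Union>c" "y \<in> \<Union>c" for x y
      proof -
        obtain V W where XY: "V \<in> c" "x \<in> V" "W \<in> c" "y \<in> W" using xy by blast
        then obtain Z where Z: "Z \<in> c" "x \<in> Z" "y \<in> Z" using ch[of V W] by blast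
        then have "submod (carrier R) Z" using cA by blast
        from submodD(3)[OF this Z(2,3)] show ?thesis using Z(1) by blast
      qed
      show "d \<otimes> x \<in> \<Union>c" if "d \<in> carrier R" "x \<in> \<Union>c" for d x
        using that cA submodD(4) by blast
    qed
    then show "\<Union>c \<in> ?A" using c(1) cA by blast
  qed
  then obtain M where "M \<in> ?A" and max: "\<forall>V\<in>?A. M \<subseteq> V \<longrightarrow> V = M" by (elim bexE)
  then have M: "submod (carrier R) M" "L \<subseteq> M" "x \<notin> M" by simp_all
  have "M' = M" if "submod (carrier R) M'" "M \<subseteq> M'" "x \<notin> M'" for M'
    using max that M(2) by simp
  then show ?thesis using M by (intro exI[of _ M]) simp
qed

lemma noeth_chain:
  assumes N: "noeth (carrier R)" and L: "\<And>n::nat. submod (carrier R) (L n)" and mono: "\<And>n. L n \<subseteq> L (Suc n)"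
  shows "\<exists>n. L (Suc n) \<subseteq> L n"
proof -
  have le: "L i \<subseteq> L j" if "i \<le> j" for i j using mono that by (rule lift_Suc_mono_le)
  have U: "submod (carrier R) (\<Union>n. L n)"
  proof (rule submodI)
    show "(\<Union>n. L n) \<subseteq> carrier R" using submodD(1)[OF L] by blast
    show "\<zero> \<in> (\<Union>n. L n)" using submodD(2)[OF L] by blast
    show "x \<oplus> y \<in> (\<Union>n. L n)" if xy: "x \<in> (\<Union>n. L n)" "y \<in> (\<Union>n. L n)" for x y
    proof -
      obtain i j where "x \<in> L i" "y \<in> L j" using xy by blast
      then have "x \<in> L (max i j)" "y \<in> L (max i j)" using le[of i "max i j"] le[of j "max i j"] by auto
      from submodD(3)[OF L this] show ?thesis by blast
    qed
    show "d \<otimes> x \<in> (\<Union>n. L n)" if "d \<in> carrier R" "x \<in> (\<Union>n. L n)" for d x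
      using that submodD(4)[OF L] by blast
  qed
  obtain G where G: "finite G" "G \<subseteq> (\<Union>n. L n)" "\<And>M. submod (carrier R) M \<Longrightarrow> G \<subseteq> M \<Longrightarrow> (\<Union>n. L n) \<subseteq> M"
    by (rule noethE[OF N U]) blast
  have "\<exists>n. G' \<subseteq> L n" if "finite G'" "G' \<subseteq> (\<Union>n. L n)" for G'
    using that
  proof (induction G' rule: finite_induct)
    case (insert g F)
    then obtain n m where "F \<subseteq> L n" "g \<in> L m" by auto
    then have "insert g F \<subseteq> L (max n m)" using le[of n "max n m"] le[of m "max n m"] by auto
    then show ?case by blast
  qed simp
  from this[OF G(1,2)] obtain n where "G \<subseteq> L n" by (elim exE)
  from G(3)[OF L this] show ?thesis by blast
qed

abbreviation "rforms \<equiv> forms R (carrier R)"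

lemma forms_carrier_mult:
  assumes "V \<subseteq> carrier R" "(d, a) \<in> rforms V" "c \<in> carrier R"
  shows "(d, a \<otimes> c) \<in> rforms V"
  using forms_mult[of "carrier R" V d a 0 c] assms by (simp add: forms.const)

lemma forms_decreasing:
  assumes V: "V \<subseteq> carrier R" and a: "(e, a) \<in> rforms V" and le: "d \<le> e"
  shows "(d, a) \<in> rforms V"
proof -
  have step: "(n, a) \<in> rforms V" if "(Suc n, a) \<in> rforms V" for n a
    using that
  proof (induction rule: forms_Suc_induct)
    case (mult a v)
    then show ?case using forms_carrier_mult[OF V] V by blast
  qed (rule forms.zero forms.add; assumption)+
  show ?thesis using le a
    by (induction rule: inc_induct) (use step in blast)+
qed

text \<open>Each summand either avoids the generator \<open>y\<close> or contains it as a factor.\<close>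

lemma forms_split_var:
  assumes V: "insert y Y \<subseteq> carrier R"
  shows "(d, a) \<in> rforms (insert y Y) \<Longrightarrow>
    \<exists>b c. a = b \<oplus> y \<otimes> c \<and> (d, b) \<in> rforms Y \<and> (d - 1, c) \<in> rforms (insert y Y) \<and> (d = 0 \<longrightarrow> c = \<zero>)"
proof (induction d a rule: forms.induct)
  case (const c)
  have "c = c \<oplus> y \<otimes> \<zero>" using const V by simp
  then show ?case using forms.const[OF const] forms.zero by (metis diff_0_eq_0)
next
  case (zero d)
  have "\<zero> = \<zero> \<oplus> y \<otimes> \<zero>" using V by simp
  then show ?case using forms.zero by metis
next
  case (add d a a')
  obtain b c where b: "a = b \<oplus> y \<otimes> c" "(d, b) \<in> rforms Y" "(d - 1, c) \<in> rforms (insert y Y)" "d = 0 \<longrightarrow> c = \<zero>"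
    using add.IH(1) by (elim exE conjE)
  obtain b' c' where b': "a' = b' \<oplus> y \<otimes> c'" "(d, b') \<in> rforms Y" "(d - 1, c') \<in> rforms (insert y Y)" "d = 0 \<longrightarrow> c' = \<zero>"
    using add.IH(2) by (elim exE conjE)
  have cl: "b \<in> carrier R" "b' \<in> carrier R" "c \<in> carrier R" "c' \<in> carrier R" "y \<in> carrier R"
    using forms_closed[of "carrier R" Y d] forms_closed[OF _ V] b(2,3) b'(2,3) V by auto
  have "a \<oplus> a' = (b \<oplus> b') \<oplus> y \<otimes> (c \<oplus> c')" unfolding b(1) b'(1) using cl by (simp add: r_distr a_ac)
  moreover have "d = 0 \<longrightarrow> c \<oplus> c' = \<zero>" using b(4) b'(4) by simp
  ultimately show ?case using forms.add[OF b(2) b'(2)] forms.add[OF b(3) b'(3)] by blast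
next
  case (mult d a v)
  obtain b c where b: "a = b \<oplus> y \<otimes> c" "(d, b) \<in> rforms Y" "(d - 1, c) \<in> rforms (insert y Y)" "d = 0 \<longrightarrow> c = \<zero>"
    using mult.IH by (elim exE conjE)
  have cl: "b \<in> carrier R" "c \<in> carrier R" "y \<in> carrier R" "v \<in> carrier R" "a \<in> carrier R"
    using forms_closed[of "carrier R" Y d] forms_closed[OF _ V] b(2,3) V mult by auto
  show ?case
  proof (cases "v = y")
    case True
    have "a \<otimes> v = \<zero> \<oplus> y \<otimes> a" using True cl by (simp add: m_comm)
    then show ?thesis using mult(1) forms.zero[of "Suc d" R "carrier R" Y] by (metis diff_Suc_1 nat.distinct(1))
  next
    case False
    then have vY: "v \<in> Y" using mult(2) by blast
    have "a \<otimes> v = b \<otimes> v \<oplus> y \<otimes> (c \<otimes> v)" unfolding b(1) using cl by (simp add: l_distr m_assoc)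
    moreover have "(d, c \<otimes> v) \<in> rforms (insert y Y)"
    proof (cases d)
      case 0 then show ?thesis using b(4) cl forms.zero by simp
    next
      case (Suc e) then show ?thesis using forms.mult[OF b(3) mult(2)] by simp
    qed
    ultimately show ?thesis using forms.mult[OF b(2) vY] by (metis diff_Suc_1 nat.distinct(1))
  qed
qed

text \<open>Induct on the generators and, for one generator \<open>y\<close>, on an exponent \<open>s\<close> with \<open>y\<^sup>s \<in> \<bb>\<close>: the quotient ideal
\<open>(\<bb> : y)\<close> contains \<open>y\<^sup>s\<^sup>-\<^sup>1\<close>.\<close>

lemma nilpotent_generators:
  assumes "finite Y" "Y \<subseteq> carrier R" "submod (carrier R) \<bb>" "\<And>y. y \<in> Y \<Longrightarrow> \<exists>s::nat. y [^] s \<in> \<bb>"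
  shows "\<exists>N. \<forall>a. (N, a) \<in> rforms Y \<longrightarrow> a \<in> \<bb>"
  using assms
proof (induction Y arbitrary: \<bb> rule: finite_induct)
  case empty
  have "a = \<zero>" if "(Suc 0, a) \<in> rforms {}" for a
    using that by (induction rule: forms_Suc_induct) auto
  then show ?case using submodD(2)[OF empty(2)] by blast
next
  case (insert y Y)
  have Y: "Y \<subseteq> carrier R" and y: "y \<in> carrier R" using insert.prems(1) by auto
  obtain s :: nat where s: "y [^] s \<in> \<bb>" using insert.prems(3) by blast
  have "submod (carrier R) \<bb> \<Longrightarrow> (\<And>x. x \<in> Y \<Longrightarrow> \<exists>s::nat. x [^] s \<in> \<bb>) \<Longrightarrow> y [^] s \<in> \<bb> \<Longrightarrow>
      \<exists>N. \<forall>a. (N, a) \<in> rforms (insert y Y) \<longrightarrow> a \<in> \<bb>" for \<bb>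
  proof (induction s arbitrary: \<bb>)
    case 0
    have "a \<in> \<bb>" if "(0, a) \<in> rforms (insert y Y)" for a
    proof -
      have a: "a \<in> carrier R" using forms_closed[OF _ insert.prems(1) that] by simp
      then show ?thesis using submodD(4)[OF 0(1) a 0(3)] by simp
    qed
    then show ?case by blast
  next
    case (Suc s)
    note \<bb> = Suc.prems(1)
    let ?c = "{z \<in> carrier R. z \<otimes> y \<in> \<bb>}"
    have c: "submod (carrier R) ?c"
      by (rule submodI) (use submodD[OF \<bb>] y in \<open>auto simp: l_distr m_assoc\<close>)
    have "\<exists>s::nat. x [^] s \<in> ?c" if x: "x \<in> Y" for x
    proof -
      obtain t :: nat where t: "x [^] t \<in> \<bb>" using Suc.prems(2)[OF x] by blast
      have xt: "x [^] t \<in> carrier R" using x Y by auto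
      have "x [^] t \<otimes> y \<in> \<bb>" using submodD(4)[OF \<bb> y t] m_comm[OF y xt] by simp
      then show ?thesis using xt by blast
    qed
    moreover have "y [^] s \<in> ?c" using Suc.prems(3) y by simp
    ultimately obtain N where N: "\<And>a. (N, a) \<in> rforms (insert y Y) \<Longrightarrow> a \<in> ?c"
      using Suc.IH[OF c] by blast
    obtain N' where N': "\<And>a. (N', a) \<in> rforms Y \<Longrightarrow> a \<in> \<bb>"
      using insert.IH[OF Y \<bb>] Suc.prems(2) by blast
    have "a \<in> \<bb>" if a: "(Suc (N + N'), a) \<in> rforms (insert y Y)" for a
    proof -
      obtain b c where b: "a = b \<oplus> y \<otimes> c" "(Suc (N + N'), b) \<in> rforms Y" "(N + N', c) \<in> rforms (insert y Y)"
        using forms_split_var[OF insert.prems(1) a] by auto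
      have "(N', b) \<in> rforms Y" by (rule forms_decreasing[OF Y b(2)]) simp
      then have bb: "b \<in> \<bb>" by (rule N')
      have "(N, c) \<in> rforms (insert y Y)" by (rule forms_decreasing[OF insert.prems(1) b(3)]) simp
      then have "c \<in> ?c" by (rule N)
      then have "y \<otimes> c \<in> \<bb>" using y by (simp add: m_comm)
      then show ?thesis unfolding b(1) by (rule submodD(3)[OF \<bb> bb])
    qed
    then show ?case by blast
  qed
  from this[OF insert.prems(2) _ s] show ?case using insert.prems(3) by blast
qed

lemma carrier_submod: "submod (carrier R) (carrier R)" by (rule submodI) auto

lemma submod_multiples:
  assumes A: "submod (carrier R) \<aa>" and C: "submod (carrier R) \<cc>" and w: "w \<in> carrier R"
  shows "submod (carrier R) {a \<oplus> c \<otimes> w | a c. a \<in> \<aa> \<and> c \<in> \<cc>}" (is "submod _ ?L")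
proof (rule submodI)
  have ac: "a \<in> \<aa> \<Longrightarrow> a \<in> carrier R" and cc: "c \<in> \<cc> \<Longrightarrow> c \<in> carrier R" for a c
    using submodD(1)[OF A] submodD(1)[OF C] by blast+
  show "?L \<subseteq> carrier R" using ac cc w by auto
  have "\<zero> = \<zero> \<oplus> \<zero> \<otimes> w" using w by simp
  then show "\<zero> \<in> ?L" using submodD(2)[OF A] submodD(2)[OF C] by blast
  fix v assume "v \<in> ?L"
  then obtain a c where v: "a \<in> \<aa>" "c \<in> \<cc>" "v = a \<oplus> c \<otimes> w" by blast
  show "d \<otimes> v \<in> ?L" if d: "d \<in> carrier R" for d
  proof -
    have "d \<otimes> v = d \<otimes> a \<oplus> (d \<otimes> c) \<otimes> w" unfolding v(3) using v ac cc d w by (simp add: r_distr m_assoc)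
    then show ?thesis using submodD(4)[OF A d v(1)] submodD(4)[OF C d v(2)] by blast
  qed
  fix u assume "u \<in> ?L"
  then obtain a' c' where u: "a' \<in> \<aa>" "c' \<in> \<cc>" "u = a' \<oplus> c' \<otimes> w" by blast
  have "v \<oplus> u = (a \<oplus> a') \<oplus> (c \<oplus> c') \<otimes> w" unfolding v(3) u(3) using v u ac cc w by (simp add: l_distr a_ac)
  then show "v \<oplus> u \<in> ?L" using submodD(3)[OF A v(1) u(1)] submodD(3)[OF C v(2) u(2)] by blast
qed

text \<open>Suppose that \<open>x\<close> is not in \<open>\<aa>\<close>. Since \<open>1 - z\<close> is a unit for \<open>z\<close> in \<open>\<mm>\<close>, neither is it in \<open>\<aa> + \<mm> x\<close>. Let \<open>\<bb>\<close> be maximal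
among the ideals containing \<open>\<aa> + \<mm> x\<close> but not \<open>x\<close>. For \<open>y\<close> in \<open>\<mm>\<close> the chain \<open>(\<bb> : y\<^sup>s)\<close> becomes stationary; if \<open>y\<^sup>s\<close>
were not in \<open>\<bb>\<close>, maximality would give \<open>x = b + c y\<^sup>s\<close>, then \<open>c y\<^sup>s\<^sup>+\<^sup>1 \<in> \<bb>\<close> because \<open>y x \<in> \<bb>\<close>, hence \<open>c y\<^sup>s \<in> \<bb>\<close> and
\<open>x \<in> \<bb>\<close>. So a power of \<open>\<mm>\<close> lies in \<open>\<bb>\<close>, and \<open>x \<in> \<aa> + \<mm>\<^sup>N \<subseteq> \<bb>\<close>, a contradiction.\<close>

theorem Krull_intersection:
  assumes N: "noeth (carrier R)" and m: "ideal \<mm> R" and loc: "\<And>z. z \<in> \<mm> \<Longrightarrow> \<one> \<ominus> z \<in> Units R"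
    and a: "ideal \<aa> R" and x: "x \<in> carrier R"
    and all: "\<And>n. \<exists>u\<in>\<aa>. \<exists>z. (n, z) \<in> rforms \<mm> \<and> x = u \<oplus> z"
  shows "x \<in> \<aa>"
proof (rule ccontr)
  assume xa: "x \<notin> \<aa>"
  have aS: "submod (carrier R) \<aa>" and mS: "submod (carrier R) \<mm>" using submod_ideal a m by blast+
  have mc: "z \<in> \<mm> \<Longrightarrow> z \<in> carrier R" for z using submodD(1)[OF mS] by blast
  have ac: "z \<in> \<aa> \<Longrightarrow> z \<in> carrier R" for z using submodD(1)[OF aS] by blast
  let ?L = "{u \<oplus> z \<otimes> x | u z. u \<in> \<aa> \<and> z \<in> \<mm>}"
  have L: "submod (carrier R) ?L"
    by (rule submod_multiples[OF aS mS x])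
  have "x \<notin> ?L"
  proof
    assume "x \<in> ?L"
    then obtain u z where u: "u \<in> \<aa>" "z \<in> \<mm>" "x = u \<oplus> z \<otimes> x" by blast
    have zx: "z \<otimes> x \<in> carrier R" using mc[OF u(2)] x by simp
    have "(\<one> \<ominus> z) \<otimes> x = x \<ominus> z \<otimes> x" using mc[OF u(2)] x by (simp add: a_minus_def l_distr l_minus)
    also have "\<dots> = (u \<oplus> z \<otimes> x) \<ominus> z \<otimes> x" using u(3) by simp
    also have "\<dots> = u" using zx ac[OF u(1)] by (simp add: a_minus_def a_assoc r_neg)
    finally have e: "(\<one> \<ominus> z) \<otimes> x = u" .
    have U: "\<one> \<ominus> z \<in> Units R" by (rule loc[OF u(2)])
    have "inv (\<one> \<ominus> z) \<otimes> ((\<one> \<ominus> z) \<otimes> x) = (inv (\<one> \<ominus> z) \<otimes> (\<one> \<ominus> z)) \<otimes> x"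
      by (rule m_assoc[OF Units_inv_closed[OF U] Units_closed[OF U] x, symmetric])
    then have "x = inv (\<one> \<ominus> z) \<otimes> u" unfolding e using U x by simp
    then show False using submodD(4)[OF aS Units_inv_closed[OF U] u(1)] xa by simp
  qed
  (* Zorn; maximality replaces primary decomposition *)
  then obtain \<bb> where \<bb>: "submod (carrier R) \<bb>" "?L \<subseteq> \<bb>" "x \<notin> \<bb>"
    and max: "\<And>M. submod (carrier R) M \<Longrightarrow> \<bb> \<subseteq> M \<Longrightarrow> x \<notin> M \<Longrightarrow> M = \<bb>"
    using submod_maximal_avoiding[OF L] by blast
  have bc: "z \<in> \<bb> \<Longrightarrow> z \<in> carrier R" for z using submodD(1)[OF \<bb>(1)] by blast
  have mx: "z \<otimes> x \<in> \<bb>" if z: "z \<in> \<mm>" for z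
  proof -
    have "z \<otimes> x = \<zero> \<oplus> z \<otimes> x" using mc[OF z] x by simp
    then show ?thesis using \<bb>(2) submodD(2)[OF aS] z by blast
  qed
  have ab: "u \<in> \<bb>" if u: "u \<in> \<aa>" for u
  proof -
    have "u = u \<oplus> \<zero> \<otimes> x" using ac[OF u] x by simp
    then show ?thesis using \<bb>(2) submodD(2)[OF mS] u by blast
  qed
  have pow: "\<exists>s::nat. y [^] s \<in> \<bb>" if y: "y \<in> \<mm>" for y
  proof -
    have yc: "y \<in> carrier R" by (rule mc[OF y])
    let ?Q = "\<lambda>s::nat. {z \<in> carrier R. z \<otimes> y [^] s \<in> \<bb>}"
    have Q: "submod (carrier R) (?Q s)" for s
      by (rule submodI) (use submodD[OF \<bb>(1)] yc in \<open>auto simp: l_distr m_assoc\<close>)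
    have "?Q s \<subseteq> ?Q (Suc s)" for s
    proof
      fix z assume z: "z \<in> ?Q s"
      then have "y \<otimes> (z \<otimes> y [^] s) \<in> \<bb>" using submodD(4)[OF \<bb>(1) yc] by blast
      moreover have "y \<otimes> (z \<otimes> y [^] s) = z \<otimes> y [^] Suc s" using z yc by (simp add: m_ac)
      ultimately show "z \<in> ?Q (Suc s)" using z by simp
    qed
    then obtain s where s: "?Q (Suc s) \<subseteq> ?Q s" using noeth_chain[of ?Q, OF N Q] by blast
    have ys: "y [^] s \<in> carrier R" using yc by simp
    have "y [^] s \<in> \<bb>"
    proof (rule ccontr)
      assume n: "y [^] s \<notin> \<bb>"
      let ?M = "{b \<oplus> c \<otimes> y [^] s | b c. b \<in> \<bb> \<and> c \<in> carrier R}"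
      have M: "submod (carrier R) ?M"
        by (rule submod_multiples[OF \<bb>(1) carrier_submod ys])
      have "b \<in> ?M" if b: "b \<in> \<bb>" for b
      proof -
        have "b = b \<oplus> \<zero> \<otimes> y [^] s" using bc[OF b] ys by simp
        then show ?thesis using b zero_closed by blast
      qed
      moreover have "y [^] s \<in> ?M"
      proof -
        have "y [^] s = \<zero> \<oplus> \<one> \<otimes> y [^] s" using ys by simp
        then show ?thesis using submodD(2)[OF \<bb>(1)] one_closed by blast
      qed
      ultimately have "x \<in> ?M" using max[OF M] n by blast
      then obtain b c where bx: "b \<in> \<bb>" "c \<in> carrier R" "x = b \<oplus> c \<otimes> y [^] s" by blast
      have yb: "y \<otimes> b \<in> \<bb>" by (rule submodD(4)[OF \<bb>(1) yc bx(1)])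
      have "y \<otimes> x \<ominus> y \<otimes> b \<in> \<bb>"
        by (rule submod_minus[OF carrier_is_subring \<bb>(1) mx[OF y] yb])
      moreover have "y \<otimes> x \<ominus> y \<otimes> b = c \<otimes> y [^] Suc s"
        unfolding bx(3) a_minus_def using bc[OF bx(1)] bx(2) yc ys by (simp add: r_distr m_ac a_ac r_neg1 r_neg2)
      ultimately have "c \<in> ?Q (Suc s)" using bx(2) by simp
      then have "c \<otimes> y [^] s \<in> \<bb>" using s by blast
      then have "x \<in> \<bb>" unfolding bx(3) by (rule submodD(3)[OF \<bb>(1) bx(1)])
      then show False using \<bb>(3) by simp
    qed
    then show ?thesis by blast
  qed
  obtain Y where Y: "finite Y" "Y \<subseteq> \<mm>" "\<And>M. submod (carrier R) M \<Longrightarrow> Y \<subseteq> M \<Longrightarrow> \<mm> \<subseteq> M"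
    by (rule noethE[OF N mS]) blast
  have Yc: "Y \<subseteq> carrier R" using Y(2) mc by blast
  obtain n where n: "\<And>a. (n, a) \<in> rforms Y \<Longrightarrow> a \<in> \<bb>"
    using nilpotent_generators[OF Y(1) Yc \<bb>(1)] pow Y(2) by blast
  let ?V = "{v \<in> carrier R. \<forall>d a. (d, a) \<in> rforms Y \<longrightarrow> (Suc d, a \<otimes> v) \<in> rforms Y}"
  have fc: "(d, a) \<in> rforms Y \<Longrightarrow> a \<in> carrier R" for d a by (rule forms_closed[OF subset_refl Yc])
  have "submod (carrier R) ?V"
  proof (rule submodI)
    show "\<zero> \<in> ?V" using fc forms.zero[of _ R "carrier R" Y] by simp
    show "v \<oplus> w \<in> ?V" if "v \<in> ?V" "w \<in> ?V" for v w
      using that fc forms.add[of _ _ R "carrier R" Y] by (simp add: r_distr)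
    show "c \<otimes> v \<in> ?V" if c: "c \<in> carrier R" and v: "v \<in> ?V" for c v
    proof -
      have "a \<otimes> (c \<otimes> v) = (a \<otimes> v) \<otimes> c" if "a \<in> carrier R" for a using that c v by (simp add: m_ac)
      then show ?thesis using c v fc forms_carrier_mult[OF Yc _ c] by simp
    qed
  qed blast
  moreover have "Y \<subseteq> ?V" using Yc forms.mult[of _ _ R "carrier R" Y] by blast
  ultimately have V: "\<mm> \<subseteq> ?V" by (rule Y(3))
  have "(d, a) \<in> rforms \<mm> \<Longrightarrow> (d, a) \<in> rforms Y" for d a
  proof (induction d a rule: forms.induct)
    case (mult d a v)
    then show ?case using V by blast
  qed (rule forms.const forms.zero forms.add; assumption)+
  then have "z \<in> \<bb>" if "(n, z) \<in> rforms \<mm>" for z using n that by blast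
  then have "x \<in> \<bb>" using all[of n] ab submodD(3)[OF \<bb>(1)] by blast
  then show False using \<bb>(3) by simp
qed

end

subsection \<open>Local rings\<close>

lemma (in cring) maximal_ideal_containing:
  assumes L: "ideal L R" and 1: "\<one> \<notin> L"
  shows "\<exists>\<mm>. maximalideal \<mm> R \<and> L \<subseteq> \<mm>"
proof -
  have ideal: "ideal M R" if M: "submod (carrier R) M" for M
    by (rule ideal_closedI) (use submodD[OF M] in blast)+
  obtain M where M: "submod (carrier R) M" "L \<subseteq> M" "\<one> \<notin> M"
    and max: "\<And>M'. submod (carrier R) M' \<Longrightarrow> M \<subseteq> M' \<Longrightarrow> \<one> \<notin> M' \<Longrightarrow> M' = M"
    using submod_maximal_avoiding[OF submod_ideal[OF L] 1] by blast
  have "maximalideal M R"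
  proof (rule maximalidealI[OF ideal[OF M(1)]])
    show "carrier R \<noteq> M" using M(3) by blast
    fix M' assume M': "ideal M' R" "M \<subseteq> M'" "M' \<subseteq> carrier R"
    show "M' = M \<or> M' = carrier R"
    proof (cases "\<one> \<in> M'")
      case True then show ?thesis using ideal.one_imp_carrier[OF M'(1)] by blast
    next
      case False then show ?thesis using max[OF submod_ideal[OF M'(1)] M'(2)] by blast
    qed
  qed
  then show ?thesis using M(2) by blast
qed

lemma (in cring) ideal_no_units: "ideal L R \<Longrightarrow> u \<in> L \<Longrightarrow> u \<in> Units R \<Longrightarrow> \<one> \<in> L"
  using ideal.I_l_closed[of L R u "inv u"] by simp

lemma local_ring_nonunits:
  fixes R (structure)
  assumes "is_local_ring R"
  shows "ideal (carrier R - Units R) R" "\<one>\<^bsub>R\<^esub> \<noteq> \<zero>\<^bsub>R\<^esub>"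
proof -
  interpret cring R using assms by (simp add: is_local_ring_def)
  obtain \<mm> where m: "maximalideal \<mm> R" and u: "\<And>\<mm>'. maximalideal \<mm>' R \<Longrightarrow> \<mm>' = \<mm>"
    using assms unfolding is_local_ring_def by blast
  interpret m: maximalideal \<mm> R by (rule m)
  have one: "\<one> \<notin> \<mm>" using m.one_imp_carrier m.I_notcarr by blast
  have "carrier R - Units R = \<mm>"
  proof
    show "\<mm> \<subseteq> carrier R - Units R"
      using m.Icarr ideal_no_units[OF m.is_ideal] one by blast
    show "carrier R - Units R \<subseteq> \<mm>"
    proof
      fix x assume x: "x \<in> carrier R - Units R"
      have P: "ideal (PIdl x) R" using x by (intro cgenideal_ideal) simp
      have "\<one> \<notin> PIdl x"
      proof
        assume "\<one> \<in> PIdl x"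
        then obtain y where y: "y \<in> carrier R" "y \<otimes> x = \<one>" by (auto simp: cgenideal_def)
        then have "x \<otimes> y = \<one>" using m_comm[of x y] x by simp
        then have "x \<in> Units R" using y x unfolding Units_def by blast
        then show False using x by simp
      qed
      then show "x \<in> \<mm>" using maximal_ideal_containing[OF P] u cgenideal_self[of x] x by blast
    qed
  qed
  then show "ideal (carrier R - Units R) R" using m.is_ideal by simp
  show "\<one> \<noteq> \<zero>" using one additive_subgroup.zero_closed[OF m.additive_subgroup_axioms] by metis
qed

lemma local_ringI:
  fixes R (structure)
  assumes R: "cring R" and I: "ideal (carrier R - Units R) R"
  shows "is_local_ring R"
proof -
  interpret cring R by fact
  let ?m = "carrier R - Units R"
  have 1: "\<one> \<notin> ?m" by simp
  have big: "L \<subseteq> ?m" if L: "ideal L R" "\<one> \<notin> L" for L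
    using ideal.Icarr[OF L(1)] ideal_no_units[OF L(1)] L(2) by blast
  have m: "maximalideal ?m R"
  proof (rule maximalidealI[OF I])
    show "carrier R \<noteq> ?m" using 1 one_closed by blast
    fix L assume L: "ideal L R" "?m \<subseteq> L" "L \<subseteq> carrier R"
    show "L = ?m \<or> L = carrier R"
      using big[OF L(1)] ideal.one_imp_carrier[OF L(1)] L(2) by blast
  qed
  have "\<mm> = ?m" if "maximalideal \<mm> R" for \<mm>
  proof -
    interpret mm: maximalideal \<mm> R by fact
    have "\<one> \<notin> \<mm>" using mm.one_imp_carrier mm.I_notcarr by blast
    then have "\<mm> \<subseteq> ?m" using big[OF mm.is_ideal] by blast
    then show ?thesis using mm.I_maximal[OF I] 1 one_closed by blast
  qed
  then show ?thesis unfolding is_local_ring_def using m R by blast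
qed

section \<open>Taylor expansion into another embedding\<close>

lemma base_field_simps:
  "carrier (base_field :: 'k::field ring) = UNIV" "monoid.mult (base_field :: 'k ring) = (*)"
  "ring.add (base_field :: 'k ring) = (+)" "monoid.one (base_field :: 'k ring) = 1" "ring.zero (base_field :: 'k ring) = 0"
  by (simp_all add: base_field_def ring_of_type_algebra_def)

lemma base_field_cring: "cring (base_field :: 'k::field ring)"
  unfolding base_field_def by (rule cring_from_type_algebra)

text \<open>A local algebra with residue field \<open>'k\<close> whose maximal ideal has generators \<open>x\<^sub>1, \<dots>, x\<^sub>n\<close> that admit dual
derivations.\<close>

locale regular_point = cring A for A :: "'a ring" (structure) +
  fixes \<iota> :: "'k::{field, field_char_0} \<Rightarrow> 'a" and n :: nat and x :: "nat \<Rightarrow> 'a" and D :: "nat \<Rightarrow> 'a \<Rightarrow> 'a" and \<mm>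
  assumes \<iota>: "\<iota> \<in> ring_hom base_field A" and x: "x \<in> {1..n} \<rightarrow> carrier A"
    and m_gen: "\<mm> = Idl (x ` {1..n})"
    and const: "\<And>a. a \<in> carrier A \<Longrightarrow> \<exists>c. a \<ominus> \<iota> c \<in> \<mm>" and const0: "\<And>c. \<iota> c \<in> \<mm> \<Longrightarrow> c = 0"
    and D: "\<And>j. j \<in> {1..n} \<Longrightarrow> k_derivation A \<iota> (D j)"
    and Dx: "\<And>i j. i \<in> {1..n} \<Longrightarrow> j \<in> {1..n} \<Longrightarrow> D j (x i) = (if i = j then \<one> else \<zero>)"
begin

abbreviation "mp d \<equiv> {a. (d, a) \<in> forms A (carrier A) \<mm>}"

lemma m_ideal: "ideal \<mm> A"
  unfolding m_gen by (rule genideal_ideal) (use x in auto)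

lemma ringideal: "ring_with_ideal A \<mm>"
  by (rule ring_with_ideal.intro[OF cring_axioms m_ideal])

lemma m_sub: "\<mm> \<subseteq> carrier A" using ideal.Icarr[OF m_ideal] by blast

lemma xc: "j \<in> {1..n} \<Longrightarrow> x j \<in> carrier A" by (rule Pi_mem[OF x])

lemma xm: "j \<in> {1..n} \<Longrightarrow> x j \<in> \<mm>"
  unfolding m_gen by (rule subsetD[OF genideal_self]) (use x in auto)

lemma \<iota>c: "\<iota> c \<in> carrier A" by (rule ring_hom_closed[OF \<iota>]) (simp add: base_field_simps)

lemma mp_carrier: "a \<in> mp d \<Longrightarrow> a \<in> carrier A"
  using forms_closed[OF subset_refl m_sub] by blast

lemma mp_ideal: "ideal (mp d) A"
  by (rule ring_with_ideal.JP_ideal[OF ringideal])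

lemma mp_add: "a \<in> mp d \<Longrightarrow> b \<in> mp d \<Longrightarrow> a \<oplus> b \<in> mp d"
  by (rule ideal_add[OF mp_ideal])

lemma mp_mult: "a \<in> mp d \<Longrightarrow> b \<in> mp e \<Longrightarrow> a \<otimes> b \<in> mp (d + e)"
  by (rule ring_with_ideal.JP_mult[OF ringideal])

lemma mp1: "a \<in> \<mm> \<Longrightarrow> a \<in> mp 1"
  using ring_with_ideal.J_JP1[OF ringideal] by blast

lemma mp_le: "a \<in> mp e \<Longrightarrow> d \<le> e \<Longrightarrow> a \<in> mp d"
  using forms_decreasing[OF m_sub] by blast

lemma derivD:
  assumes "k_derivation A \<iota> E"
  shows "a \<in> carrier A \<Longrightarrow> E a \<in> carrier A"
    "a \<in> carrier A \<Longrightarrow> b \<in> carrier A \<Longrightarrow> E (a \<oplus> b) = E a \<oplus> E b"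
    "a \<in> carrier A \<Longrightarrow> b \<in> carrier A \<Longrightarrow> E (a \<otimes> b) = a \<otimes> E b \<oplus> b \<otimes> E a"
    "E (\<iota> c) = \<zero>"
  using assms unfolding k_derivation_def by blast+

lemma deriv_mp: "k_derivation A \<iota> E \<Longrightarrow> a \<in> mp d \<Longrightarrow> E a \<in> mp (d - 1)"
proof -
  assume E: "k_derivation A \<iota> E" and a: "a \<in> mp d"
  have E0: "E \<zero> = \<zero>"
    using derivD(2)[OF E zero_closed zero_closed] derivD(1)[OF E zero_closed] by (simp add: add.r_cancel_one')
  have "(d, a) \<in> forms A (carrier A) \<mm> \<Longrightarrow> (d - 1, E a) \<in> forms A (carrier A) \<mm>" for d a
  proof (induction d a rule: forms.induct)
    case (const c) then show ?case using derivD(1)[OF E] by (simp add: forms.const)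
  next
    case (zero d) then show ?case by (simp add: E0 forms.zero)
  next
    case (add d a b)
    have "a \<in> carrier A" "b \<in> carrier A" using mp_carrier add by blast+
    then show ?case using add derivD(2)[OF E] by (simp add: forms.add)
  next
    case (mult d a v)
    have c: "a \<in> carrier A" "v \<in> carrier A" using mp_carrier mult m_sub by blast+
    have 1: "a \<otimes> E v \<in> mp d" using ideal.I_r_closed[OF mp_ideal, of a d] mult derivD(1)[OF E c(2)] by blast
    have 2: "v \<otimes> E a \<in> mp d"
    proof (cases d)
      case 0 then show ?thesis using c derivD(1)[OF E c(1)] by (simp add: forms.const)
    next
      case (Suc e)
      have "v \<otimes> E a \<in> mp (1 + (d - 1))" by (rule mp_mult[OF mp1[OF mult(2)]]) (use mult in blast)
      then show ?thesis using Suc by simp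
    qed
    show ?case using mp_add[OF 1 2] derivD(3)[OF E c] by simp
  qed
  then show ?thesis using a by blast
qed

text \<open>Modulo constants an element is a combination \<open>\<Sum> r\<^sub>i x\<^sub>i\<close>, and \<open>E (r\<^sub>i x\<^sub>i) = x\<^sub>i E r\<^sub>i\<close> gains one power of the maximal
ideal over \<open>E r\<^sub>i\<close>; induct on the power.\<close>

lemma deriv_zero_on_parameters:
  assumes E: "k_derivation A \<iota> E" and E0: "\<And>i. i \<in> {1..n} \<Longrightarrow> E (x i) = \<zero>" and a: "a \<in> carrier A"
  shows "E a \<in> mp N"
  using a
proof (induction N arbitrary: a)
  case 0 then show ?case using derivD(1)[OF E] by (simp add: forms.const)
next
  case (Suc N)
  have z: "E \<zero> = \<zero>"
    using derivD(2)[OF E zero_closed zero_closed] derivD(1)[OF E zero_closed] by (simp add: add.r_cancel_one')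
  have *: "E \<mu> \<in> mp (Suc N)" if "\<mu> \<in> \<mm>" for \<mu>
  proof -
    have "\<mu> \<in> Idl (x ` {1..n})" using that m_gen by simp
    moreover have "x ` {1..n} \<subseteq> carrier A" using x by blast
    ultimately show ?thesis
    proof (induction rule: genideal_induct)
      case (gen g) then show ?case using E0 by (auto simp: forms.zero)
    next
      case zero then show ?case by (simp add: z forms.zero)
    next
      case (add a b) then show ?case using mp_add[of "E a" "Suc N" "E b"] derivD(2)[OF E] by simp
    next
      case (mult r a)
      have am: "a \<in> \<mm>" using mult(2) m_gen by simp
      then have ac: "a \<in> carrier A" using m_sub by blast
      have 1: "r \<otimes> E a \<in> mp (Suc N)" by (rule ideal.I_l_closed[OF mp_ideal mult(3,1)])
      have "a \<otimes> E r \<in> mp (1 + N)" by (rule mp_mult[OF mp1[OF am] Suc.IH[OF mult(1)]])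
      then show ?case using mp_add[OF 1] derivD(3)[OF E mult(1) ac] by simp
    qed
  qed
  obtain c where c: "a \<ominus> \<iota> c \<in> \<mm>" using const[OF Suc.prems] by blast
  have "a = (a \<ominus> \<iota> c) \<oplus> \<iota> c" using Suc.prems \<iota>c by (simp add: a_minus_def a_assoc l_neg)
  then have "E a = E (a \<ominus> \<iota> c) \<oplus> E (\<iota> c)" using derivD(2)[OF E, of "a \<ominus> \<iota> c" "\<iota> c"] Suc.prems \<iota>c by simp
  then have "E a = E (a \<ominus> \<iota> c)" using derivD(4)[OF E, of c] derivD(1)[OF E, of "a \<ominus> \<iota> c"] Suc.prems \<iota>c by simp
  then show ?case using *[OF c] by simp
qed

end

text \<open>The elements \<open>x'\<^sub>1, \<dots>, x'\<^sub>n\<close> of \<open>A'\<close> are the counterparts of the parameters.\<close>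

locale taylor = regular_point A \<iota> n x D \<mm> + A': cring A'
  for A :: "'a ring" (structure) and \<iota> :: "'k::{field, field_char_0} \<Rightarrow> 'a" and n x D \<mm>
    and A' :: "'c ring" (structure) +
  fixes \<iota>' :: "'k \<Rightarrow> 'c" and x' :: "nat \<Rightarrow> 'c" and \<mm>'
  assumes \<iota>': "\<iota>' \<in> ring_hom base_field A'" and m': "ideal \<mm>' A'"
    and x': "x' \<in> {1..n} \<rightarrow> \<mm>'"
begin

abbreviation "AA \<equiv> RDirProd A A'"
abbreviation ptimes (infixl "\<star>" 70) where "u \<star> w \<equiv> u \<otimes>\<^bsub>AA\<^esub> w"
abbreviation pplus (infixl "\<uplus>" 65) where "u \<uplus> w \<equiv> u \<oplus>\<^bsub>AA\<^esub> w"
definition "cc c = (\<iota> c, \<iota>' c)"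
definition "xx j = (x j, x' j)"
abbreviation "mp' d \<equiv> {a. (d, a) \<in> forms A' (carrier A') \<mm>'}"

inductive_set lin :: "('a \<times> 'c) set \<Rightarrow> ('a \<times> 'c) set" for T where
  zero: "\<zero>\<^bsub>AA\<^esub> \<in> lin T"
| add: "u \<in> lin T \<Longrightarrow> w \<in> lin T \<Longrightarrow> u \<uplus> w \<in> lin T"
| mult: "j \<in> {1..n} \<Longrightarrow> p \<in> T \<Longrightarrow> xx j \<star> p \<in> lin T"

text \<open>The pairs \<open>(c + \<Sum> x\<^sub>j a\<^sub>j, c + \<Sum> x'\<^sub>j a'\<^sub>j)\<close> with \<open>(a\<^sub>j, a'\<^sub>j)\<close> in the relation of order \<open>N\<close>: both components have an
expansion in the parameters with the same coefficients up to order \<open>N\<close>.\<close>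

fun tay :: "nat \<Rightarrow> ('a \<times> 'c) set" where
  "tay 0 = carrier AA"
| "tay (Suc N) = {cc c \<uplus> u | c u. u \<in> lin (tay N)}"

lemma AA_cring: "cring AA" by (rule RDirProd_cring[OF cring_axioms A'.cring_axioms])

sublocale AA: cring AA by (rule AA_cring)

lemma \<iota>'c: "\<iota>' c \<in> carrier A'" by (rule ring_hom_closed[OF \<iota>']) (simp add: base_field_simps)

lemma cc_hom: "cc \<in> ring_hom base_field AA"
  by (rule ring_hom_memI)
    (simp_all add: cc_def RDirProd_simps \<iota>c \<iota>'c ring_hom_mult[OF \<iota>] ring_hom_mult[OF \<iota>'] ring_hom_add[OF \<iota>]
      ring_hom_add[OF \<iota>'] ring_hom_one[OF \<iota>] ring_hom_one[OF \<iota>'])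

lemma ccc: "cc c \<in> carrier AA" by (rule ring_hom_closed[OF cc_hom]) (simp add: base_field_simps)

lemma cc_add: "cc (c + d) = cc c \<uplus> cc d" and cc_mult: "cc (c * d) = cc c \<star> cc d"
  and cc_one: "cc 1 = \<one>\<^bsub>AA\<^esub>" and cc_zero: "cc 0 = \<zero>\<^bsub>AA\<^esub>"
  using ring_hom_add[OF cc_hom, of c d] ring_hom_mult[OF cc_hom, of c d] ring_hom_one[OF cc_hom]
    ring_hom_zero'[OF cc_hom base_field_cring AA_cring] by (simp_all add: base_field_simps)

lemma x'c: "j \<in> {1..n} \<Longrightarrow> x' j \<in> carrier A'" using Pi_mem[OF x'] ideal.Icarr[OF m'] by blast

lemma xxc: "j \<in> {1..n} \<Longrightarrow> xx j \<in> carrier AA" by (simp add: xx_def RDirProd_simps xc x'c)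

lemma lin_carrier: "T \<subseteq> carrier AA \<Longrightarrow> u \<in> lin T \<Longrightarrow> u \<in> carrier AA"
  by (erule lin.induct) (use xxc in auto)

lemma tay_carrier: "p \<in> tay N \<Longrightarrow> p \<in> carrier AA"
proof (induction N arbitrary: p)
  case (Suc N)
  then obtain c u where "u \<in> lin (tay N)" "p = cc c \<uplus> u" by auto
  then show ?case using lin_carrier[of "tay N" u] Suc.IH ccc by blast
qed simp

lemma tay_sub: "tay N \<subseteq> carrier AA" using tay_carrier by blast

lemma lin_mono: "T \<subseteq> T' \<Longrightarrow> u \<in> lin T \<Longrightarrow> u \<in> lin T'"
  by (erule lin.induct) (auto intro: lin.intros)

lemma tay_SucI: "u \<in> lin (tay N) \<Longrightarrow> cc c \<uplus> u \<in> tay (Suc N)"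
  unfolding tay.simps(2) by blast

lemma tay_decreasing: "tay (Suc N) \<subseteq> tay N"
proof (induction N)
  case 0 then show ?case using tay_sub[of "Suc 0"] by simp
next
  case (Suc N)
  show ?case
  proof
    fix p assume "p \<in> tay (Suc (Suc N))"
    then obtain c u where "u \<in> lin (tay (Suc N))" "p = cc c \<uplus> u" by (auto simp del: tay.simps(2) simp: tay.simps(2)[of "Suc N"])
    then show "p \<in> tay (Suc N)" using lin_mono[OF Suc.IH] tay_SucI by blast
  qed
qed

lemma cc_tay: "cc c \<in> tay N"
proof (cases N)
  case 0 then show ?thesis using ccc by (simp only: tay.simps)
next
  case (Suc M)
  show ?thesis using tay_SucI[OF lin.zero, where c = c and N = M] unfolding Suc by (simp only: AA.r_zero[OF ccc])
qed

lemma tay_add: "p \<in> tay N \<Longrightarrow> q \<in> tay N \<Longrightarrow> p \<uplus> q \<in> tay N"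
proof (cases N)
  case (Suc M)
  assume "p \<in> tay N" "q \<in> tay N"
  then obtain c u d w where u: "u \<in> lin (tay M)" "p = cc c \<uplus> u" and w: "w \<in> lin (tay M)" "q = cc d \<uplus> w"
    using Suc by auto
  have uw: "u \<in> carrier AA" "w \<in> carrier AA" using lin_carrier[OF tay_sub] u(1) w(1) by blast+
  have "p \<uplus> q = cc (c + d) \<uplus> (u \<uplus> w)"
    unfolding u(2) w(2) cc_add using uw ccc by (simp add: AA.a_ac)
  then show ?thesis unfolding Suc using tay_SucI[OF lin.add[OF u(1) w(1)]] by (simp only:)
qed simp

lemma tay_mult: "p \<in> tay N \<Longrightarrow> q \<in> tay N \<Longrightarrow> p \<star> q \<in> tay N"
proof (induction N arbitrary: p q)
  case (Suc N)
  have scale: "r \<star> u \<in> lin (tay N)" if r: "r \<in> tay N" and u: "u \<in> lin (tay N)" for r u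
    using u
  proof induction
    case zero then show ?case using tay_carrier[OF r] by (simp add: lin.zero)
  next
    case (add u w)
    have "u \<in> carrier AA" "w \<in> carrier AA" using lin_carrier[OF tay_sub] add(1,2) by blast+
    then have "r \<star> (u \<uplus> w) = r \<star> u \<uplus> r \<star> w" using tay_carrier[OF r] by (simp add: AA.r_distr)
    then show ?case using lin.add[OF add.IH] by simp
  next
    case (mult j p)
    have "r \<star> (xx j \<star> p) = xx j \<star> (r \<star> p)"
      using tay_carrier[OF r] tay_carrier[OF mult(2)] xxc[OF mult(1)] by (simp add: AA.m_lcomm)
    then show ?case using lin.mult[OF mult(1) Suc.IH[OF r mult(2)]] by simp
  qed
  obtain c u where u: "u \<in> lin (tay N)" "p = cc c \<uplus> u" using Suc.prems(1) by auto
  obtain d w where w: "w \<in> lin (tay N)" "q = cc d \<uplus> w" using Suc.prems(2) by auto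
  have uw: "u \<in> carrier AA" "w \<in> carrier AA" using lin_carrier[OF tay_sub] u(1) w(1) by blast+
  have "p \<star> q = cc (c * d) \<uplus> (cc d \<star> u \<uplus> p \<star> w)"
    unfolding u(2) w(2) cc_mult using uw ccc[of c] ccc[of d] by (simp add: AA.l_distr AA.r_distr AA.m_ac AA.a_ac)
  moreover have "p \<in> tay N" using Suc.prems(1) tay_decreasing by blast
  ultimately show ?case
    using tay_SucI[OF lin.add[OF scale[OF cc_tay u(1)] scale[OF _ w(1)]]] by metis
qed simp

text \<open>Write \<open>a = c + \<Sum> x\<^sub>j a\<^sub>j\<close> and lift the \<open>a\<^sub>j\<close> to the next lower order. The image in \<open>B\<close> is respected because it is for
\<open>c\<close>, for the parameters and for the \<open>a\<^sub>j\<close>.\<close>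

lemma tay_lift:
  assumes B: "cring B" and \<pi>: "\<pi> \<in> ring_hom A B" and \<pi>': "\<pi>' \<in> ring_hom A' B" "\<pi>' ` carrier A' = carrier B"
    and k: "\<And>c. \<pi>' (\<iota>' c) = \<pi> (\<iota> c)" and xe: "\<And>j. j \<in> {1..n} \<Longrightarrow> \<pi>' (x' j) = \<pi> (x j)" and a: "a \<in> carrier A"
  shows "\<exists>a'. (a, a') \<in> tay N \<and> \<pi>' a' = \<pi> a"
  using a
proof (induction N arbitrary: a)
  case 0
  have "\<pi> a \<in> \<pi>' ` carrier A'" using ring_hom_closed[OF \<pi> 0] \<pi>'(2) by simp
  then show ?case using 0 by (force simp: RDirProd_simps)
next
  case (Suc N)
  interpret B: cring B by (rule B)
  have *: "\<exists>\<mu>'. (\<mu>, \<mu>') \<in> lin (tay N) \<and> \<pi>' \<mu>' = \<pi> \<mu>" if "\<mu> \<in> \<mm>" for \<mu>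
  proof -
    have "\<mu> \<in> Idl (x ` {1..n})" using that m_gen by simp
    moreover have "x ` {1..n} \<subseteq> carrier A" using x by blast
    ultimately show ?thesis
    proof (induction rule: genideal_induct)
      case (gen g)
      then obtain j where j: "j \<in> {1..n}" "g = x j" by blast
      have "xx j \<star> cc 1 = (x j, x' j)" using xxc[OF j(1)] by (simp add: cc_one xx_def)
      then show ?case using lin.mult[OF j(1) cc_tay[of 1 N]] xe[OF j(1)] j(2) by metis
    next
      case zero
      have "\<zero>\<^bsub>AA\<^esub> = (\<zero>, \<zero>\<^bsub>A'\<^esub>)" by (simp add: RDirProd_simps)
      then show ?case using lin.zero[of "tay N"] ring_hom_zero'[OF \<pi> cring_axioms B] ring_hom_zero'[OF \<pi>'(1) A'.cring_axioms B] by metis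
    next
      case (add a b)
      obtain a' where a': "(a, a') \<in> lin (tay N)" "\<pi>' a' = \<pi> a" using add(3) by blast
      obtain b' where b': "(b, b') \<in> lin (tay N)" "\<pi>' b' = \<pi> b" using add(4) by blast
      have c: "a' \<in> carrier A'" "b' \<in> carrier A'"
        using lin_carrier[OF tay_sub a'(1)] lin_carrier[OF tay_sub b'(1)] by (simp_all add: RDirProd_simps)
      have "(a \<oplus> b, a' \<oplus>\<^bsub>A'\<^esub> b') \<in> lin (tay N)" using lin.add[OF a'(1) b'(1)] by (simp add: RDirProd_simps)
      moreover have "\<pi>' (a' \<oplus>\<^bsub>A'\<^esub> b') = \<pi> (a \<oplus> b)" using a' b' by (simp add: ring_hom_add[OF \<pi>'(1) c] ring_hom_add[OF \<pi> add(1,2)])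
      ultimately show ?case by blast
    next
      case (mult r a)
      have ac: "a \<in> carrier A" using mult(2) m_gen m_sub by blast
      obtain a' where a': "(a, a') \<in> lin (tay N)" "\<pi>' a' = \<pi> a" using mult(3) by blast
      obtain r' where r': "(r, r') \<in> tay N" "\<pi>' r' = \<pi> r" using Suc.IH[OF mult(1)] by blast
      have c: "a' \<in> carrier A'" "r' \<in> carrier A'"
        using lin_carrier[OF tay_sub a'(1)] tay_carrier[OF r'(1)] by (simp_all add: RDirProd_simps)
      have "(r, r') \<star> u \<in> lin (tay N)" if "u \<in> lin (tay N)" for u
        using that
      proof induction
        case zero then show ?case using tay_carrier[OF r'(1)] by (simp add: lin.zero)
      next
        case (add u w)
        have "u \<in> carrier AA" "w \<in> carrier AA" using lin_carrier[OF tay_sub] add(1,2) by blast+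
        then show ?case using lin.add[OF add.IH] tay_carrier[OF r'(1)] by (simp add: AA.r_distr)
      next
        case (mult j p)
        have "(r, r') \<star> (xx j \<star> p) = xx j \<star> ((r, r') \<star> p)"
          using tay_carrier[OF r'(1)] tay_carrier[OF mult(2)] xxc[OF mult(1)] by (simp add: AA.m_lcomm)
        then show ?case using lin.mult[OF mult(1) tay_mult[OF r'(1) mult(2)]] by simp
      qed
      from this[OF a'(1)] have "(r \<otimes> a, r' \<otimes>\<^bsub>A'\<^esub> a') \<in> lin (tay N)" by (simp add: RDirProd_simps)
      moreover have "\<pi>' (r' \<otimes>\<^bsub>A'\<^esub> a') = \<pi> (r \<otimes> a)" using a' r' by (simp add: ring_hom_mult[OF \<pi>'(1) c(2,1)] ring_hom_mult[OF \<pi> mult(1) ac])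
      ultimately show ?case by blast
    qed
  qed
  obtain c where c: "a \<ominus> \<iota> c \<in> \<mm>" using const[OF Suc.prems] by blast
  have ac: "a = \<iota> c \<oplus> (a \<ominus> \<iota> c)" using Suc.prems \<iota>c[of c] by (simp add: a_minus_def a_ac r_neg r_neg1 r_neg2)
  have acc: "a \<ominus> \<iota> c \<in> carrier A" using c m_sub by blast
  obtain \<mu>' where \<mu>': "(a \<ominus> \<iota> c, \<mu>') \<in> lin (tay N)" "\<pi>' \<mu>' = \<pi> (a \<ominus> \<iota> c)" using *[OF c] by blast
  have \<mu>c: "\<mu>' \<in> carrier A'" using lin_carrier[OF tay_sub \<mu>'(1)] by (simp add: RDirProd_simps)
  have "(\<iota> c \<oplus> (a \<ominus> \<iota> c), \<iota>' c \<oplus>\<^bsub>A'\<^esub> \<mu>') \<in> tay (Suc N)"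
    using tay_SucI[OF \<mu>'(1), of c] by (simp add: RDirProd_simps cc_def del: tay.simps(2))
  moreover have "\<pi>' (\<iota>' c \<oplus>\<^bsub>A'\<^esub> \<mu>') = \<pi> (\<iota> c \<oplus> (a \<ominus> \<iota> c))"
    unfolding ring_hom_add[OF \<pi>'(1) \<iota>'c \<mu>c] ring_hom_add[OF \<pi> \<iota>c acc] by (simp only: k \<mu>'(2))
  ultimately show ?case using ac by metis
qed

subsection \<open>Uniqueness of Taylor polynomials\<close>

abbreviation "HF \<equiv> forms AA (range cc) (xx ` {1..n})"

lemma HF_sub: "range cc \<subseteq> carrier AA" "xx ` {1..n} \<subseteq> carrier AA"
  using ccc xxc by blast+

lemma HF_carrier: "(d, q) \<in> HF \<Longrightarrow> q \<in> carrier AA"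
  by (rule AA.forms_closed[OF HF_sub])

lemma HF_fst: "(d, q) \<in> HF \<Longrightarrow> fst q \<in> mp d"
proof (induction d q rule: forms.induct)
  case (const c) then show ?case using \<iota>c by (auto simp: cc_def forms.const)
next
  case (zero d) then show ?case by (simp add: RDirProd_simps forms.zero)
next
  case (add d a b) then show ?case by (simp add: RDirProd_simps forms.add)
next
  case (mult d a v)
  then obtain j where "j \<in> {1..n}" "v = xx j" by blast
  then show ?case using mult xm by (simp add: RDirProd_simps xx_def forms.mult)
qed

text \<open>Euler's identity: on forms of degree \<open>d\<close> in the parameters the partial derivatives determine
  \<open>d\<close> times the form; they have formal counterparts in the second component.\<close>

lemma Euler:
  "(d, q) \<in> HF \<Longrightarrow> \<exists>p. (\<forall>i\<in>{1..n}. (d - 1, p i) \<in> HF \<and> fst (p i) = D i (fst q) \<and> (d = 0 \<longrightarrow> p i = \<zero>\<^bsub>AA\<^esub>)) \<and>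
     cc (of_nat d) \<star> q = (\<Oplus>\<^bsub>AA\<^esub>i\<in>{1..n}. xx i \<star> p i)"
proof (induction d q rule: forms.induct)
  have z: "(\<Oplus>\<^bsub>AA\<^esub>i\<in>{1..n}. xx i \<star> \<zero>\<^bsub>AA\<^esub>) = \<zero>\<^bsub>AA\<^esub>"
    by (rule AA.add.finprod_one_eqI) (rule AA.r_null[OF xxc])
  have D0: "D i \<zero> = \<zero>" if "i \<in> {1..n}" for i
    using derivD(2)[OF D[OF that] zero_closed zero_closed] derivD(1)[OF D[OF that] zero_closed] by (simp add: add.r_cancel_one')
  {
    case (const c)
    then obtain e where e: "c = cc e" by blast
    have "\<forall>i\<in>{1..n}. (0 - 1, \<zero>\<^bsub>AA\<^esub>) \<in> HF \<and> fst \<zero>\<^bsub>AA\<^esub> = D i (fst c) \<and> (0 = (0::nat) \<longrightarrow> \<zero>\<^bsub>AA\<^esub> = \<zero>\<^bsub>AA\<^esub>)"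
    proof (intro ballI conjI impI refl)
      fix i assume "i \<in> {1..n}"
      then show "fst \<zero>\<^bsub>AA\<^esub> = D i (fst c)" using derivD(4)[OF D] by (simp add: e cc_def RDirProd_simps)
    qed (rule forms.zero)
    moreover have "cc (of_nat 0) \<star> c = (\<Oplus>\<^bsub>AA\<^esub>i\<in>{1..n}. xx i \<star> \<zero>\<^bsub>AA\<^esub>)"
      unfolding z e using ccc[of e] by (simp add: cc_zero)
    ultimately show ?case by (intro exI[of _ "\<lambda>_. \<zero>\<^bsub>AA\<^esub>"] conjI)
  next
    case (zero d)
    have "\<forall>i\<in>{1..n}. (d - 1, \<zero>\<^bsub>AA\<^esub>) \<in> HF \<and> fst \<zero>\<^bsub>AA\<^esub> = D i (fst \<zero>\<^bsub>AA\<^esub>) \<and> (d = 0 \<longrightarrow> \<zero>\<^bsub>AA\<^esub> = \<zero>\<^bsub>AA\<^esub>)"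
      using D0 by (simp add: forms.zero) (simp add: RDirProd_simps)
    moreover have "cc (of_nat d) \<star> \<zero>\<^bsub>AA\<^esub> = (\<Oplus>\<^bsub>AA\<^esub>i\<in>{1..n}. xx i \<star> \<zero>\<^bsub>AA\<^esub>)"
      unfolding z using ccc by simp
    ultimately show ?case by (intro exI[of _ "\<lambda>_. \<zero>\<^bsub>AA\<^esub>"] conjI)
  next
    case (add d a b)
    obtain p where p: "\<And>i. i \<in> {1..n} \<Longrightarrow> (d - 1, p i) \<in> HF \<and> fst (p i) = D i (fst a) \<and> (d = 0 \<longrightarrow> p i = \<zero>\<^bsub>AA\<^esub>)"
      "cc (of_nat d) \<star> a = (\<Oplus>\<^bsub>AA\<^esub>i\<in>{1..n}. xx i \<star> p i)" using add.IH(1) by blast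
    obtain q where q: "\<And>i. i \<in> {1..n} \<Longrightarrow> (d - 1, q i) \<in> HF \<and> fst (q i) = D i (fst b) \<and> (d = 0 \<longrightarrow> q i = \<zero>\<^bsub>AA\<^esub>)"
      "cc (of_nat d) \<star> b = (\<Oplus>\<^bsub>AA\<^esub>i\<in>{1..n}. xx i \<star> q i)" using add.IH(2) by blast
    have ab: "a \<in> carrier AA" "b \<in> carrier AA" using HF_carrier add(1,2) by blast+
    have pc: "p i \<in> carrier AA" "q i \<in> carrier AA" if "i \<in> {1..n}" for i using HF_carrier p(1)[OF that] q(1)[OF that] by blast+
    have main: "(d - 1, p i \<uplus> q i) \<in> HF \<and> fst (p i \<uplus> q i) = D i (fst (a \<uplus> b)) \<and> (d = 0 \<longrightarrow> p i \<uplus> q i = \<zero>\<^bsub>AA\<^esub>)"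
      if i: "i \<in> {1..n}" for i
    proof -
      have 1: "(d - 1, p i \<uplus> q i) \<in> HF" by (rule forms.add[OF conjunct1[OF p(1)[OF i]] conjunct1[OF q(1)[OF i]]])
      have "fst a \<in> carrier A" "fst b \<in> carrier A" using ab by (auto simp: RDirProd_simps)
      then have 2: "fst (p i \<uplus> q i) = D i (fst (a \<uplus> b))"
        using p(1)[OF i] q(1)[OF i] derivD(2)[OF D[OF i]] by (simp add: RDirProd_simps)
      have "d = 0 \<longrightarrow> p i \<uplus> q i = \<zero>\<^bsub>AA\<^esub>" using p(1)[OF i] q(1)[OF i] AA.l_zero[OF AA.zero_closed] by metis
      then show ?thesis using 1 2 by blast
    qed
    have euler: "cc (of_nat d) \<star> (a \<uplus> b) = (\<Oplus>\<^bsub>AA\<^esub>i\<in>{1..n}. xx i \<star> (p i \<uplus> q i))"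
    proof -
      have "(\<Oplus>\<^bsub>AA\<^esub>i\<in>{1..n}. xx i \<star> (p i \<uplus> q i)) = (\<Oplus>\<^bsub>AA\<^esub>i\<in>{1..n}. xx i \<star> p i \<uplus> xx i \<star> q i)"
        by (rule AA.finsum_cong'[OF refl]) (simp_all add: pc xxc AA.r_distr Pi_def del: One_nat_def)
      also have "\<dots> = (\<Oplus>\<^bsub>AA\<^esub>i\<in>{1..n}. xx i \<star> p i) \<uplus> (\<Oplus>\<^bsub>AA\<^esub>i\<in>{1..n}. xx i \<star> q i)"
        by (rule AA.finsum_addf) (simp_all add: pc xxc Pi_def del: One_nat_def)
      finally show ?thesis using p(2) q(2) AA.r_distr[OF ab ccc] by simp
    qed
    show ?case by (rule exI[of _ "\<lambda>i. p i \<uplus> q i"], rule conjI[OF ballI euler], rule main)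
  next
    case (mult d a v)
    obtain p where p: "\<And>i. i \<in> {1..n} \<Longrightarrow> (d - 1, p i) \<in> HF \<and> fst (p i) = D i (fst a) \<and> (d = 0 \<longrightarrow> p i = \<zero>\<^bsub>AA\<^esub>)"
      "cc (of_nat d) \<star> a = (\<Oplus>\<^bsub>AA\<^esub>i\<in>{1..n}. xx i \<star> p i)" using mult.IH by blast
    obtain j where j: "j \<in> {1..n}" "v = xx j" using mult(2) by blast
    have ac: "a \<in> carrier AA" using HF_carrier mult(1) by blast
    have xj: "xx j \<in> carrier AA" by (rule xxc[OF j(1)])
    have pc: "p i \<in> carrier AA" if "i \<in> {1..n}" for i using HF_carrier p(1)[OF that] by blast
    define r where "r i = p i \<star> xx j \<uplus> (if j = i then a else \<zero>\<^bsub>AA\<^esub>)" for i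
    have main: "(Suc d - 1, r i) \<in> HF \<and> fst (r i) = D i (fst (a \<star> v)) \<and> (Suc d = 0 \<longrightarrow> r i = \<zero>\<^bsub>AA\<^esub>)" if i: "i \<in> {1..n}" for i
    proof -
      have 1: "(d, p i \<star> xx j) \<in> HF"
      proof (cases d)
        case 0
        then have "p i \<star> xx j = \<zero>\<^bsub>AA\<^esub>" using p(1)[OF i] AA.l_null[OF xj] by simp
        then show ?thesis by (simp only: forms.zero)
      next
        case (Suc e) then show ?thesis using forms.mult[of e "p i" AA "range cc" "xx ` {1..n}" "xx j"] p(1)[OF i] j(1) by simp
      qed
      have 2: "(d, if j = i then a else \<zero>\<^bsub>AA\<^esub>) \<in> HF" using mult(1) forms.zero by (cases "j = i") simp_all
      have fa: "fst a \<in> carrier A" using ac by (auto simp: RDirProd_simps)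
      have dd: "D i (fst a) \<in> carrier A" by (rule derivD(1)[OF D[OF i] fa])
      have "D i (fst a \<otimes> x j) = fst a \<otimes> D i (x j) \<oplus> x j \<otimes> D i (fst a)" by (rule derivD(3)[OF D[OF i] fa xc[OF j(1)]])
      also have "\<dots> = fst (r i)"
        unfolding r_def using p(1)[OF i] Dx[OF j(1) i] fa dd xc[OF j(1)] by (auto simp: RDirProd_simps xx_def m_comm a_comm)
      finally have "fst (r i) = D i (fst (a \<star> v))" by (simp add: RDirProd_simps j(2) xx_def)
      then show ?thesis using forms.add[OF 1 2] unfolding r_def by simp
    qed
    have euler: "cc (of_nat (Suc d)) \<star> (a \<star> v) = (\<Oplus>\<^bsub>AA\<^esub>i\<in>{1..n}. xx i \<star> r i)"
    proof -
      have "(\<Oplus>\<^bsub>AA\<^esub>i\<in>{1..n}. xx i \<star> r i) =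
          (\<Oplus>\<^bsub>AA\<^esub>i\<in>{1..n}. (xx i \<star> p i) \<star> xx j \<uplus> (if j = i then xx i \<star> a else \<zero>\<^bsub>AA\<^esub>))"
        unfolding r_def
        by (rule AA.finsum_cong'[OF refl]) (simp_all add: pc xxc xj ac AA.r_distr AA.m_assoc Pi_def del: One_nat_def)
      also have "\<dots> = (\<Oplus>\<^bsub>AA\<^esub>i\<in>{1..n}. (xx i \<star> p i) \<star> xx j) \<uplus> (\<Oplus>\<^bsub>AA\<^esub>i\<in>{1..n}. if j = i then xx i \<star> a else \<zero>\<^bsub>AA\<^esub>)"
        by (rule AA.finsum_addf) (simp_all add: pc xxc xj ac Pi_def del: One_nat_def)
      also have "(\<Oplus>\<^bsub>AA\<^esub>i\<in>{1..n}. (xx i \<star> p i) \<star> xx j) = (cc (of_nat d) \<star> a) \<star> xx j"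
        unfolding p(2) by (rule AA.finsum_ldistr[symmetric]) (simp_all add: pc xxc xj Pi_def del: One_nat_def)
      also have "(\<Oplus>\<^bsub>AA\<^esub>i\<in>{1..n}. if j = i then xx i \<star> a else \<zero>\<^bsub>AA\<^esub>) = xx j \<star> a"
        by (rule AA.finsum_singleton[OF j(1)]) (simp_all add: xxc ac Pi_def del: One_nat_def)
      also have "(cc (of_nat d) \<star> a) \<star> xx j \<uplus> xx j \<star> a = (cc (of_nat d) \<uplus> cc 1) \<star> (a \<star> xx j)"
      proof -
        have "a \<star> xx j \<in> carrier AA" using ac xj by simp
        then show ?thesis
          unfolding AA.l_distr[OF ccc AA.one_closed \<open>a \<star> xx j \<in> carrier AA\<close>] cc_one AA.m_assoc[OF ccc ac xj] AA.m_comm[OF xj ac]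
          by (simp only: AA.l_one)
      qed
      also have "cc (of_nat d) \<uplus> cc 1 = cc (of_nat (Suc d))" by (simp add: cc_add[symmetric] add.commute)
      finally show ?thesis using j(2) by simp
    qed
    show ?case by (rule exI[of _ r], rule conjI[OF ballI euler], rule main)
  }
qed

text \<open>By Euler's identity and induction: if the form in the \<open>x\<^sub>j\<close> lies in \<open>\<mm>\<^sup>d\<^sup>+\<^sup>1\<close>, its partial derivatives lie in \<open>\<mm>\<^sup>d\<close>, so
their counterparts vanish, and therefore so does \<open>d\<close> times the form in both components. Characteristic \<open>0\<close>
allows division by \<open>d\<close>.\<close>

lemma form_zero: "(d, q) \<in> HF \<Longrightarrow> fst q \<in> mp (Suc d) \<Longrightarrow> q = \<zero>\<^bsub>AA\<^esub>"
proof (induction d arbitrary: q)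
  case 0
  have "(d, q) \<in> HF \<Longrightarrow> d = 0 \<Longrightarrow> q \<in> range cc" for d q
  proof (induction d q rule: forms.induct)
    case (zero d) then show ?case using cc_zero by (metis rangeI)
  next
    case (add d a b)
    then obtain c e where "a = cc c" "b = cc e" by blast
    then show ?case using cc_add by (metis rangeI)
  qed auto
  then obtain c where c: "q = cc c" using 0(1) by blast
  have "\<mm> \<supseteq> mp (Suc 0)"
  proof
    fix a assume "a \<in> mp (Suc 0)"
    then have "(Suc 0, a) \<in> forms A (carrier A) \<mm>" by simp
    then show "a \<in> \<mm>"
    proof (induction rule: forms_Suc_induct)
      case zero show ?case by (rule ideal_zero[OF m_ideal])
    next
      case (add a b) show ?case by (rule ideal_add[OF m_ideal add.IH])
    next
      case (mult a v)
      have "a \<in> carrier A" using mp_carrier mult(1) by blast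
      then show ?case by (rule ideal.I_l_closed[OF m_ideal mult(2)])
    qed
  qed
  then have "\<iota> c \<in> \<mm>" using 0(2) c by (auto simp: cc_def)
  then show ?case using const0[of c] c cc_zero by simp
next
  case (Suc d)
  obtain p where p: "\<And>i. i \<in> {1..n} \<Longrightarrow> (Suc d - 1, p i) \<in> HF \<and> fst (p i) = D i (fst q) \<and> (Suc d = 0 \<longrightarrow> p i = \<zero>\<^bsub>AA\<^esub>)"
    "cc (of_nat (Suc d)) \<star> q = (\<Oplus>\<^bsub>AA\<^esub>i\<in>{1..n}. xx i \<star> p i)" using Euler[OF Suc.prems(1)] by blast
  have "p i = \<zero>\<^bsub>AA\<^esub>" if i: "i \<in> {1..n}" for i
  proof (rule Suc.IH)
    show "(d, p i) \<in> HF" using p(1)[OF i] by simp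
    show "fst (p i) \<in> mp (Suc d)" using p(1)[OF i] deriv_mp[OF D[OF i] Suc.prems(2)] by simp
  qed
  then have "(\<Oplus>\<^bsub>AA\<^esub>i\<in>{1..n}. xx i \<star> p i) = \<zero>\<^bsub>AA\<^esub>"
    by (intro AA.add.finprod_one_eqI) (simp add: xxc del: One_nat_def)
  then have "cc (of_nat (Suc d)) \<star> q = \<zero>\<^bsub>AA\<^esub>" using p(2) by simp
  moreover have qc: "q \<in> carrier AA" by (rule HF_carrier[OF Suc.prems(1)])
  moreover have "q = cc (inverse (of_nat (Suc d))) \<star> (cc (of_nat (Suc d)) \<star> q)"
  proof -
    have "inverse (of_nat (Suc d)) * of_nat (Suc d) = (1 :: 'k)" by (simp del: of_nat_Suc)
    then have "cc (inverse (of_nat (Suc d))) \<star> cc (of_nat (Suc d)) = \<one>\<^bsub>AA\<^esub>" using cc_mult cc_one by metis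
    then show ?thesis using AA.m_assoc[OF ccc ccc qc, of "inverse (of_nat (Suc d))" "of_nat (Suc d)"] qc by simp
  qed
  ultimately show ?case using AA.r_null[OF ccc] by metis
qed

text \<open>Polynomial expressions of degree less than \<open>N\<close> with constant coefficients, evaluated in both rings.\<close>

fun polys :: "nat \<Rightarrow> ('a \<times> 'c) set" where
  "polys 0 = {\<zero>\<^bsub>AA\<^esub>}"
| "polys (Suc N) = {s \<uplus> q | s q. s \<in> polys N \<and> (N, q) \<in> HF}"

lemma polys_carrier: "s \<in> polys N \<Longrightarrow> s \<in> carrier AA"
  by (induction N arbitrary: s) (use HF_carrier in auto)

lemma polys_SucI: "s \<in> polys N \<Longrightarrow> (N, q) \<in> HF \<Longrightarrow> s \<uplus> q \<in> polys (Suc N)"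
  unfolding polys.simps(2) by blast

lemma polys_zero: "\<zero>\<^bsub>AA\<^esub> \<in> polys N"
proof (induction N)
  case (Suc N)
  show ?case using polys_SucI[OF Suc forms.zero] by (simp only: AA.l_zero[OF AA.zero_closed])
qed (simp only: polys.simps singletonI)

lemma polys_const: "cc c \<in> polys (Suc N)"
proof (induction N)
  case 0
  have "(0, cc c) \<in> HF" by (rule forms.const) simp
  from polys_SucI[OF polys_zero this] show ?case using ccc by (simp del: polys.simps(2))
next
  case (Suc N)
  from polys_SucI[OF Suc forms.zero] show ?case using ccc by (simp del: polys.simps(2))
qed

lemma polys_add: "s \<in> polys N \<Longrightarrow> t \<in> polys N \<Longrightarrow> s \<uplus> t \<in> polys N"
proof (induction N arbitrary: s t)
  case (Suc N)
  obtain s' q where s: "s' \<in> polys N" "(N, q) \<in> HF" "s = s' \<uplus> q" using Suc.prems(1) by auto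
  obtain t' r where t: "t' \<in> polys N" "(N, r) \<in> HF" "t = t' \<uplus> r" using Suc.prems(2) by auto
  have "s \<uplus> t = (s' \<uplus> t') \<uplus> (q \<uplus> r)"
    unfolding s(3) t(3) using polys_carrier[OF s(1)] polys_carrier[OF t(1)] HF_carrier[OF s(2)] HF_carrier[OF t(2)] by (simp add: AA.a_ac)
  then show ?case using polys_SucI[OF Suc.IH[OF s(1) t(1)] forms.add[OF s(2) t(2)]] by simp
qed simp

lemma polys_shift: "s \<in> polys N \<Longrightarrow> j \<in> {1..n} \<Longrightarrow> xx j \<star> s \<in> polys (Suc N)"
proof (induction N arbitrary: s)
  case 0
  then have "xx j \<star> s = \<zero>\<^bsub>AA\<^esub>" using AA.r_null[OF xxc] by simp
  then show ?case using polys_zero by (simp only:)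
next
  case (Suc N)
  obtain s' q where s: "s' \<in> polys N" "(N, q) \<in> HF" "s = s' \<uplus> q" using Suc.prems(1) by auto
  note c = polys_carrier[OF s(1)] HF_carrier[OF s(2)] xxc[OF Suc.prems(2)]
  have "xx j \<star> s = xx j \<star> s' \<uplus> q \<star> xx j" unfolding s(3) using c by (simp add: AA.r_distr AA.m_comm)
  moreover have "(Suc N, q \<star> xx j) \<in> HF" by (rule forms.mult[OF s(2)]) (use Suc.prems(2) in blast)
  ultimately show ?case using polys_SucI[OF Suc.IH[OF s(1) Suc.prems(2)]] by simp
qed

lemma polys_unique: "s \<in> polys N \<Longrightarrow> fst s \<in> mp N \<Longrightarrow> s = \<zero>\<^bsub>AA\<^esub>"
proof (induction N arbitrary: s)
  case (Suc N)
  obtain s' q where s: "s' \<in> polys N" "(N, q) \<in> HF" "s = s' \<uplus> q" using Suc.prems(1) by auto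
  have c: "fst s' \<in> carrier A" "fst q \<in> carrier A"
    using polys_carrier[OF s(1)] HF_carrier[OF s(2)] by (auto simp: RDirProd_simps)
  have fs: "fst s = fst s' \<oplus> fst q" by (simp add: s(3) RDirProd_simps)
  have "fst s \<in> mp N" by (rule mp_le[OF Suc.prems(2)]) simp
  moreover have "\<ominus> fst q \<in> mp N"
    by (rule ideal_uminus[OF mp_ideal HF_fst[OF s(2)]])
  ultimately have "fst s \<oplus> \<ominus> fst q \<in> mp N" by (rule mp_add)
  moreover have "fst s \<oplus> \<ominus> fst q = fst s'" unfolding fs using c by (simp add: a_assoc r_neg)
  ultimately have "s' = \<zero>\<^bsub>AA\<^esub>" using Suc.IH[OF s(1)] by simp
  then have sq: "s = q" using s(3) HF_carrier[OF s(2)] by simp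
  then show ?case using form_zero[OF s(2)] Suc.prems(2) by simp
qed simp

lemma ringideal': "ring_with_ideal A' \<mm>'" by (rule ring_with_ideal.intro[OF A'.cring_axioms m'])

lemma tay_polys: "p \<in> tay N \<Longrightarrow> \<exists>s \<mu>. s \<in> polys N \<and> fst \<mu> \<in> mp N \<and> snd \<mu> \<in> mp' N \<and> p = s \<uplus> \<mu>"
proof (induction N arbitrary: p)
  case 0
  then have "p = \<zero>\<^bsub>AA\<^esub> \<uplus> p" "fst p \<in> mp 0" "snd p \<in> mp' 0" by (auto simp: RDirProd_simps forms.const)
  then show ?case by (intro exI[of _ "\<zero>\<^bsub>AA\<^esub>"] exI[of _ p]) simp
next
  case (Suc N)
  have MM_c: "\<mu> \<in> carrier AA" if "fst \<mu> \<in> mp N" "snd \<mu> \<in> mp' N" for \<mu> N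
    using that mp_carrier[of "fst \<mu>" N] ring_with_ideal.JP_carrier[OF ringideal', of N "snd \<mu>"] by (cases \<mu>) (simp add: RDirProd_simps)
  have m'add: "a \<oplus>\<^bsub>A'\<^esub> b \<in> mp' N" if "a \<in> mp' N" "b \<in> mp' N" for a b N using that by (simp add: forms.add)
  have lin: "\<exists>s \<mu>. s \<in> polys (Suc N) \<and> fst \<mu> \<in> mp (Suc N) \<and> snd \<mu> \<in> mp' (Suc N) \<and> u = s \<uplus> \<mu>" if "u \<in> lin (tay N)" for u
    using that
  proof induction
    case zero
    have "\<zero>\<^bsub>AA\<^esub> = \<zero>\<^bsub>AA\<^esub> \<uplus> \<zero>\<^bsub>AA\<^esub>" by simp
    moreover have "fst \<zero>\<^bsub>AA\<^esub> \<in> mp (Suc N)" "snd \<zero>\<^bsub>AA\<^esub> \<in> mp' (Suc N)" by (simp_all add: RDirProd_simps forms.zero)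
    ultimately show ?case using polys_zero by blast
  next
    case (add u w)
    obtain s \<mu> where s: "s \<in> polys (Suc N)" "fst \<mu> \<in> mp (Suc N)" "snd \<mu> \<in> mp' (Suc N)" "u = s \<uplus> \<mu>" using add.IH(1) by blast
    obtain t \<nu> where t: "t \<in> polys (Suc N)" "fst \<nu> \<in> mp (Suc N)" "snd \<nu> \<in> mp' (Suc N)" "w = t \<uplus> \<nu>" using add.IH(2) by blast
    have "u \<uplus> w = (s \<uplus> t) \<uplus> (\<mu> \<uplus> \<nu>)"
      unfolding s(4) t(4) using polys_carrier[OF s(1)] polys_carrier[OF t(1)] MM_c[OF s(2,3)] MM_c[OF t(2,3)] by (simp add: AA.a_ac)
    moreover have "fst (\<mu> \<uplus> \<nu>) \<in> mp (Suc N)" "snd (\<mu> \<uplus> \<nu>) \<in> mp' (Suc N)"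
      using mp_add[OF s(2) t(2)] m'add[OF s(3) t(3)] by (simp_all only: RDirProd_simps fst_conv snd_conv)
    ultimately show ?case using polys_add[OF s(1) t(1)] by blast
  next
    case (mult j p)
    obtain s \<mu> where s: "s \<in> polys N" "fst \<mu> \<in> mp N" "snd \<mu> \<in> mp' N" "p = s \<uplus> \<mu>" using Suc.IH[OF mult(2)] by blast
    have "xx j \<star> p = xx j \<star> s \<uplus> xx j \<star> \<mu>"
      unfolding s(4) by (rule AA.r_distr[OF polys_carrier[OF s(1)] MM_c[OF s(2,3)] xxc[OF mult(1)]])
    moreover have "x j \<otimes> fst \<mu> \<in> mp (1 + N)" by (rule mp_mult[OF mp1[OF xm[OF mult(1)]] s(2)])
    moreover have "x' j \<otimes>\<^bsub>A'\<^esub> snd \<mu> \<in> mp' (1 + N)"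
      by (rule ring_with_ideal.JP_mult[OF ringideal' _ s(3)])
        (use ring_with_ideal.J_JP1[OF ringideal'] Pi_mem[OF x' mult(1)] in blast)
    ultimately show ?case using polys_shift[OF s(1) mult(1)]
      by (intro exI[of _ "xx j \<star> s"] exI[of _ "xx j \<star> \<mu>"]) (simp add: RDirProd_simps xx_def del: polys.simps)
  qed
  obtain c u where u: "u \<in> lin (tay N)" "p = cc c \<uplus> u" using Suc.prems by auto
  obtain s \<mu> where s: "s \<in> polys (Suc N)" "fst \<mu> \<in> mp (Suc N)" "snd \<mu> \<in> mp' (Suc N)" "u = s \<uplus> \<mu>" using lin[OF u(1)] by blast
  have "p = (cc c \<uplus> s) \<uplus> \<mu>"
    unfolding u(2) s(4) by (rule AA.a_assoc[OF ccc polys_carrier[OF s(1)] MM_c[OF s(2,3)], symmetric])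
  then show ?case using polys_add[OF polys_const s(1), of c] s(2,3) by blast
qed

text \<open>The first component \<open>0\<close> has Taylor polynomial \<open>0\<close> by uniqueness, so the second component is all remainder.\<close>

lemma tay_zero:
  assumes "(\<zero>, a') \<in> tay N" shows "a' \<in> mp' N"
proof -
  obtain s \<mu> where s: "s \<in> polys N" "fst \<mu> \<in> mp N" "snd \<mu> \<in> mp' N" "(\<zero>, a') = s \<uplus> \<mu>"
    using tay_polys[OF assms] by blast
  have c: "fst s \<in> carrier A" using polys_carrier[OF s(1)] by (auto simp: RDirProd_simps)
  have "fst s \<oplus> fst \<mu> = \<zero>" using s(4) by (simp add: RDirProd_simps)
  then have "\<ominus> fst \<mu> = fst s" using minus_equality[OF _ mp_carrier[OF s(2)] c] by simp
  then have "fst s \<in> mp N" using ideal_uminus[OF mp_ideal s(2)] by simp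
  then have "s = \<zero>\<^bsub>AA\<^esub>" by (rule polys_unique[OF s(1)])
  then have "a' = snd \<mu>" using s(4) ring_with_ideal.JP_carrier[OF ringideal', of N "snd \<mu>"] s(3) by (simp add: RDirProd_simps)
  then show ?thesis using s(3) by simp
qed

end

text \<open>Copy the form with class \<open>s\<close> and value \<open>0\<close> to \<open>A'\<close>, coefficient by coefficient and factor by factor, up to order \<open>N\<close>.
The copy has the same class, and a value in \<open>\<mm>'\<^sup>N\<close> by \<open>tay_zero\<close>. As the value of \<open>s\<close> in \<open>A'\<close> is determined modulo
\<open>K' I'\<^sup>d\<^sup>-\<^sup>1\<close>, Krull's theorem applies to that ideal.\<close>

theorem graph_regular_transfer:
  fixes \<iota> :: "'k::{field, field_char_0} \<Rightarrow> 'a" and A :: "'a ring" and A' :: "'c ring"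
  assumes E: "embedded A I B J \<pi>" and E': "embedded A' I' B J \<pi>'"
    and R: "regular_point A \<iota> n x D \<mm>"
    and \<iota>': "\<iota>' \<in> ring_hom base_field A'" and k: "\<And>c. \<pi>' (\<iota>' c) = \<pi> (\<iota> c)"
    and N: "cring.noeth A' (carrier A')" and m': "ideal \<mm>' A'" and loc: "\<And>z. z \<in> \<mm>' \<Longrightarrow> \<one>\<^bsub>A'\<^esub> \<ominus>\<^bsub>A'\<^esub> z \<in> Units A'"
    and mm: "\<And>a a'. a \<in> \<mm> \<Longrightarrow> a' \<in> carrier A' \<Longrightarrow> \<pi>' a' = \<pi> a \<Longrightarrow> a' \<in> \<mm>'"
    and d: "0 < d" and s: "(\<zero>\<^bsub>A\<^esub>, s) \<in> embedded.graph A I B J \<pi> d"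
  shows "(\<zero>\<^bsub>A'\<^esub>, s) \<in> embedded.graph A' I' B J \<pi>' d"
proof -
  interpret E: embedded A I B J \<pi> by (rule E)
  interpret E': embedded A' I' B J \<pi>' by (rule E')
  interpret R: regular_point A \<iota> n x D \<mm> by (rule R)
  have "\<exists>a'. a' \<in> carrier A' \<and> \<pi>' a' = \<pi> (x j)" if "j \<in> {1..n}" for j
    using E'.B_lift[OF E.\<pi>_closed[OF R.xc[OF that]]] by metis
  then obtain x' where x': "\<And>j. j \<in> {1..n} \<Longrightarrow> x' j \<in> carrier A' \<and> \<pi>' (x' j) = \<pi> (x j)" by metis
  interpret T: taylor A \<iota> n x D \<mm> A' \<iota>' x' \<mm>'
  proof (intro taylor.intro taylor_axioms.intro R E'.A.cring_axioms \<iota>' m')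
    show "x' \<in> {1..n} \<rightarrow> \<mm>'" using x' mm R.xm by blast
  qed
  have lift: "\<exists>c'. (c, c') \<in> T.tay N \<and> \<pi>' c' = \<pi> c" if "c \<in> carrier A" for c N
    by (rule T.tay_lift[OF E.B.cring_axioms E.\<pi> E'.\<pi> E'.surj k _ that]) (use x' in blast)
  have lc: "c' \<in> carrier A'" if "(c, c') \<in> T.tay N" for c c' N
    using T.tay_carrier[OF that] by (simp add: RDirProd_simps)
  have trans: "(a, s) \<in> E.graph d \<Longrightarrow> \<exists>a'. (a', s) \<in> E'.graph d \<and> (a, a') \<in> T.tay N" for a s d N
  proof (induction rule: E.graph_induct)
    case (const c)
    obtain c' where c': "(c, c') \<in> T.tay N" "\<pi>' c' = \<pi> c" using lift[OF const] by blast
    show ?case using E'.graph_const[OF lc[OF c'(1)]] c' by auto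
  next
    case (zero d)
    have "(\<zero>\<^bsub>A\<^esub>, \<zero>\<^bsub>A'\<^esub>) \<in> T.tay N" using T.cc_tay[of 0 N] by (simp add: T.cc_zero RDirProd_simps)
    then show ?case using E'.graph_zero by blast
  next
    case (add d a s b t)
    obtain a' where a': "(a', s) \<in> E'.graph d" "(a, a') \<in> T.tay N" using add(3) by blast
    obtain b' where b': "(b', t) \<in> E'.graph d" "(b, b') \<in> T.tay N" using add(4) by blast
    have "(a \<oplus>\<^bsub>A\<^esub> b, a' \<oplus>\<^bsub>A'\<^esub> b') \<in> T.tay N" using T.tay_add[OF a'(2) b'(2)] by (simp add: RDirProd_simps)
    then show ?case using E'.graph_add[OF a'(1) b'(1)] by blast
  next
    case (mult d a s b)
    obtain a' where a': "(a', s) \<in> E'.graph d" "(a, a') \<in> T.tay N" using mult(3) by blast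
    have bA: "b \<in> carrier A" using mult(2) E.I_sub by blast
    obtain b' where b': "(b, b') \<in> T.tay N" "\<pi>' b' = \<pi> b" using lift[OF bA] by blast
    have bI: "b' \<in> I'" by (rule E'.in_I[OF lc[OF b'(1)]]) (use b'(2) E.\<pi>I[OF mult(2)] in simp)
    have "(a \<otimes>\<^bsub>A\<^esub> b, a' \<otimes>\<^bsub>A'\<^esub> b') \<in> T.tay N" using T.tay_mult[OF a'(2) b'(1)] by (simp add: RDirProd_simps)
    moreover have "(a' \<otimes>\<^bsub>A'\<^esub> b', s \<otimes>\<^bsub>E.SB\<^esub> Sym_gen B J (\<pi> b)) \<in> E'.graph (Suc d)"
      using E'.graph_mult_gen[OF a'(1) bI] b'(2) by simp
    ultimately show ?case by blast
  qed
  (* a0 is any value of s; the difference to the copies below shows that it is negligible *)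
  obtain a0 where a0: "(a0, s) \<in> E'.graph d" using E'.graph_total_snd[OF E.graph_snd[OF s]] by blast
  have a0c: "a0 \<in> carrier A'" using E'.graph_carrier[OF a0] by blast
  have "a0 \<in> ideal_prod A' E'.K (E'.A.JP (d - 1))"
  proof (rule E'.A.Krull_intersection[OF N m' loc E'.A.KJ_ideal[OF E'.K_ideal] a0c])
    fix N
    obtain a' where a': "(a', s) \<in> E'.graph d" "(\<zero>\<^bsub>A\<^esub>, a') \<in> T.tay N" using trans[OF s] by blast
    have ac: "a' \<in> carrier A'" using E'.graph_carrier[OF a'(1)] by blast
    have "a0 \<ominus>\<^bsub>A'\<^esub> a' \<in> ideal_prod A' E'.K (E'.A.JP (d - 1))" by (rule E'.graph_unique[OF a0 a'(1)])
    moreover have "(N, a') \<in> forms A' (carrier A') \<mm>'" using T.tay_zero[OF a'(2)] by blast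
    moreover have "a0 = (a0 \<ominus>\<^bsub>A'\<^esub> a') \<oplus>\<^bsub>A'\<^esub> a'"
      using a0c ac by (simp add: a_minus_def E'.A.a_assoc E'.A.l_neg)
    ultimately show "\<exists>u\<in>ideal_prod A' E'.K (E'.A.JP (d - 1)). \<exists>z. (N, z) \<in> forms A' (carrier A') \<mm>' \<and> a0 = u \<oplus>\<^bsub>A'\<^esub> z"
      by blast
  qed
  then have "(a0, \<zero>\<^bsub>E.SB\<^esub>) \<in> E'.graph d" using E'.graph_kernel[of a0 "d - 1"] d by simp
  from E'.graph_minus[OF a0 this] show ?thesis
    using E'.graph_carrier[OF a0] a0c by (simp add: a_minus_def E'.A.r_neg)
qed

section \<open>A common refinement of two embeddings\<close>

lemma generate_ring_hom_image:
  assumes h: "h \<in> ring_hom R S" and R: "cring R" and S: "cring S" and H: "H \<subseteq> carrier R"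
    and x: "x \<in> generate_ring S (h ` H)"
  shows "\<exists>y\<in>generate_ring R H. h y = x"
proof -
  interpret R: cring R by (rule R)
  interpret h: ring_hom_ring R S h by (rule ring_hom_ringI2[OF cring.axioms(1)[OF R] cring.axioms(1)[OF S] h])
  have c: "y \<in> generate_ring R H \<Longrightarrow> y \<in> carrier R" for y using R.generate_ring_in_carrier[OF H] .
  show ?thesis using x
  proof induction
    case one show ?case by (rule bexI[where x = "\<one>\<^bsub>R\<^esub>"]) (simp_all add: generate_ring.one)
  next
    case (incl k)
    then obtain y where y: "y \<in> H" "k = h y" by blast
    show ?case by (rule bexI[where x = y]) (simp_all add: y generate_ring.incl)
  next
    case (a_inv k)
    then obtain y where y: "y \<in> generate_ring R H" "h y = k" by blast
    show ?case by (rule bexI[OF _ generate_ring.a_inv[OF y(1)]]) (use c[OF y(1)] y(2) in simp)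
  next
    case (eng_add k l)
    obtain y where y: "y \<in> generate_ring R H" "h y = k" using eng_add.IH(1) by blast
    obtain z where z: "z \<in> generate_ring R H" "h z = l" using eng_add.IH(2) by blast
    show ?case by (rule bexI[OF _ generate_ring.eng_add[OF y(1) z(1)]]) (use c[OF y(1)] c[OF z(1)] y(2) z(2) in simp)
  next
    case (eng_mult k l)
    obtain y where y: "y \<in> generate_ring R H" "h y = k" using eng_mult.IH(1) by blast
    obtain z where z: "z \<in> generate_ring R H" "h z = l" using eng_mult.IH(2) by blast
    show ?case by (rule bexI[OF _ generate_ring.eng_mult[OF y(1) z(1)]]) (use c[OF y(1)] c[OF z(1)] y(2) z(2) in simp)
  qed
qed

lemma generate_ring_image_hom:
  assumes h: "h \<in> ring_hom R S" and R: "cring R" and S: "cring S" and H: "H \<subseteq> carrier R"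
    and y: "y \<in> generate_ring R H"
  shows "h y \<in> generate_ring S (h ` H)"
proof -
  interpret R: cring R by (rule R)
  interpret h: ring_hom_ring R S h by (rule ring_hom_ringI2[OF cring.axioms(1)[OF R] cring.axioms(1)[OF S] h])
  have c: "y \<in> generate_ring R H \<Longrightarrow> y \<in> carrier R" for y using R.generate_ring_in_carrier[OF H] .
  show ?thesis using y
  proof induction
    case one show ?case using generate_ring.one[of S] by simp
  next
    case (incl k) then show ?case by (intro generate_ring.incl imageI)
  next
    case (a_inv k) then show ?case using c[OF a_inv(1)] generate_ring.a_inv[OF a_inv(2)] by simp
  next
    case (eng_add k l) then show ?case using c[OF eng_add(1)] c[OF eng_add(2)] generate_ring.eng_add[OF eng_add.IH] by simp
  next
    case (eng_mult k l) then show ?case using c[OF eng_mult(1)] c[OF eng_mult(2)] generate_ring.eng_mult[OF eng_mult.IH] by simp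
  qed
qed

lemma ring_hom_Units:
  assumes h: "h \<in> ring_hom R S" and R: "cring R" and S: "cring S" and u: "u \<in> Units R"
  shows "h u \<in> Units S"
proof -
  interpret R: cring R by (rule R)
  interpret S: cring S by (rule S)
  obtain v where v: "v \<in> carrier R" "v \<otimes>\<^bsub>R\<^esub> u = \<one>\<^bsub>R\<^esub>" using u unfolding Units_def by blast
  have uc: "u \<in> carrier R" using u by (rule R.Units_closed)
  have "h v \<otimes>\<^bsub>S\<^esub> h u = \<one>\<^bsub>S\<^esub>" using ring_hom_mult[OF h v(1) uc] v(2) ring_hom_one[OF h] by simp
  moreover have c: "h v \<in> carrier S" "h u \<in> carrier S" using ring_hom_closed[OF h] v(1) uc by blast+
  ultimately show ?thesis unfolding Units_def using S.m_comm[OF c] by auto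
qed

lemma embeddingD:
  assumes "(A, \<iota>, \<pi>) \<in> embeddings B \<kappa>"
  shows "cring A" "\<iota> \<in> ring_hom base_field A" "is_local_ring A" "ess_finite_type A \<iota>"
    "\<pi> \<in> ring_hom A B" "\<pi> ` carrier A = carrier B" "\<pi> (\<iota> c) = \<kappa> c"
  using assms by (simp_all add: embeddings_def k_algebra_def)

text \<open>If \<open>w\<close> lifts the inverse of \<open>\<pi> v\<close>, then \<open>1 - w v\<close> lies in the kernel, which contains no unit as \<open>B\<close> is not zero.
In a local ring \<open>w v\<close> is then a unit.\<close>

lemma embedding_unit:
  assumes B: "cring B" and B1: "\<one>\<^bsub>B\<^esub> \<noteq> \<zero>\<^bsub>B\<^esub>" and N: "(A, \<iota>, \<pi>) \<in> embeddings B \<kappa>"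
    and v: "v \<in> carrier A" and u: "\<pi> v \<in> Units B"
  shows "v \<in> Units A"
proof (rule ccontr)
  note N = embeddingD[OF N]
  interpret A: cring A by (rule N(1))
  interpret B: cring B by (rule B)
  note \<pi> = N(5)
  have I: "ideal (carrier A - Units A) A" by (rule local_ring_nonunits(1)[OF N(3)])
  assume nv: "v \<notin> Units A"
  have "inv\<^bsub>B\<^esub> (\<pi> v) \<in> \<pi> ` carrier A" using N(6) u by simp
  then obtain w where w: "w \<in> carrier A" "\<pi> w = inv\<^bsub>B\<^esub> (\<pi> v)" by force
  let ?k = "\<one>\<^bsub>A\<^esub> \<ominus>\<^bsub>A\<^esub> w \<otimes>\<^bsub>A\<^esub> v"
  have wv: "w \<otimes>\<^bsub>A\<^esub> v \<in> carrier A" using w v by simp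
  have "\<pi> ?k = \<pi> \<one>\<^bsub>A\<^esub> \<ominus>\<^bsub>B\<^esub> \<pi> (w \<otimes>\<^bsub>A\<^esub> v)"
    by (rule ring_hom_minus[OF A.ring_axioms B.ring_axioms \<pi> A.one_closed wv])
  then have "\<pi> ?k = \<zero>\<^bsub>B\<^esub>" using ring_hom_mult[OF \<pi> w(1) v] ring_hom_one[OF \<pi>] u w(2) by (simp add: B.r_neg a_minus_def)
  then have "?k \<notin> Units A" using ring_hom_Units[OF \<pi> N(1) B, of ?k] B1 unfolding Units_def by auto
  moreover have "?k \<in> carrier A" using wv by simp
  ultimately have k: "?k \<in> carrier A - Units A" by blast
  have m: "w \<otimes>\<^bsub>A\<^esub> v \<in> carrier A - Units A" by (rule ideal.I_l_closed[OF I]) (use v nv w in auto)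
  have "?k \<oplus>\<^bsub>A\<^esub> w \<otimes>\<^bsub>A\<^esub> v \<in> carrier A - Units A"
    by (rule ideal_add[OF I k m])
  moreover have "?k \<oplus>\<^bsub>A\<^esub> w \<otimes>\<^bsub>A\<^esub> v = \<one>\<^bsub>A\<^esub>" using wv by (simp add: a_minus_def A.a_assoc A.l_neg)
  ultimately show False by simp
qed

locale two_embeddings =
  fixes B :: "'b ring" and \<kappa> :: "'k::field \<Rightarrow> 'b" and A A' :: "'r ring" and \<iota> \<iota>' \<pi> \<pi>'
  assumes B: "cring B" and B1: "\<one>\<^bsub>B\<^esub> \<noteq> \<zero>\<^bsub>B\<^esub>"
    and N: "(A, \<iota>, \<pi>) \<in> embeddings B \<kappa>" and N': "(A', \<iota>', \<pi>') \<in> embeddings B \<kappa>"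
begin

sublocale A: cring A by (rule embeddingD[OF N])
sublocale A': cring A' by (rule embeddingD[OF N'])
sublocale B: cring B by (rule B)

abbreviation "P \<equiv> RDirProd A A'"
definition "cc k = (\<iota> k, \<iota>' k)"
abbreviation "fibre \<equiv> {p \<in> carrier P. \<pi> (fst p) = \<pi>' (snd p)}"

sublocale P: cring P by (rule RDirProd_cring[OF A.cring_axioms A'.cring_axioms])

lemmas \<iota> = embeddingD(2)[OF N] and \<iota>' = embeddingD(2)[OF N'] and \<pi> = embeddingD(5)[OF N] and \<pi>' = embeddingD(5)[OF N']
lemmas \<pi>_surj = embeddingD(6)[OF N] and \<pi>'_surj = embeddingD(6)[OF N']

lemma cc_hom: "cc \<in> ring_hom base_field P"
  using \<iota> \<iota>' by (auto simp: ring_hom_def cc_def RDirProd_simps)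

lemma cc_closed: "cc k \<in> carrier P"
  by (rule ring_hom_closed[OF cc_hom]) (simp add: base_field_simps)

lemma cc_fibre: "cc k \<in> fibre"
  using cc_closed embeddingD(7)[OF N, of k] embeddingD(7)[OF N', of k] by (simp add: cc_def)

lemma fibre_subring: "subring fibre P"
proof (rule P.subringI)
  show "fibre \<subseteq> carrier P" by blast
  show "\<one>\<^bsub>P\<^esub> \<in> fibre" using ring_hom_one[OF \<pi>] ring_hom_one[OF \<pi>'] P.one_closed by (simp add: RDirProd_simps)
  fix p q assume p: "p \<in> fibre" and q: "q \<in> fibre"
  note c = P.m_closed[of p q] P.a_closed[of p q]
  show "p \<otimes>\<^bsub>P\<^esub> q \<in> fibre" "p \<oplus>\<^bsub>P\<^esub> q \<in> fibre"
    using p q by (auto simp: RDirProd_simps ring_hom_mult[OF \<pi>] ring_hom_mult[OF \<pi>'] ring_hom_add[OF \<pi>] ring_hom_add[OF \<pi>'])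
next
  fix p assume p: "p \<in> fibre"
  have pc: "p \<in> carrier P" using p by blast
  interpret f: ring_hom_ring P A fst by (rule ring_hom_ringI2[OF P.ring_axioms A.ring_axioms fst_hom])
  interpret s: ring_hom_ring P A' snd by (rule ring_hom_ringI2[OF P.ring_axioms A'.ring_axioms snd_hom])
  interpret h: ring_hom_ring A B \<pi> by (rule ring_hom_ringI2[OF A.ring_axioms B.ring_axioms \<pi>])
  interpret h': ring_hom_ring A' B \<pi>' by (rule ring_hom_ringI2[OF A'.ring_axioms B.ring_axioms \<pi>'])
  have "\<pi> (fst (\<ominus>\<^bsub>P\<^esub> p)) = \<pi>' (snd (\<ominus>\<^bsub>P\<^esub> p))"
    using p f.hom_closed[OF pc] s.hom_closed[OF pc] f.hom_a_inv[OF pc] s.hom_a_inv[OF pc]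
      h.hom_a_inv[OF f.hom_closed[OF pc]] h'.hom_a_inv[OF s.hom_closed[OF pc]] by (metis (mono_tags, lifting) mem_Collect_eq)
  then show "\<ominus>\<^bsub>P\<^esub> p \<in> fibre" using P.a_inv_closed[OF pc] by blast
qed

lemma fibre_lift: "a \<in> carrier A \<Longrightarrow> \<exists>p\<in>fibre. fst p = a"
proof -
  assume a: "a \<in> carrier A"
  have "\<pi> a \<in> \<pi>' ` carrier A'" using ring_hom_closed[OF \<pi> a] \<pi>'_surj by simp
  then obtain a' where "a' \<in> carrier A'" "\<pi>' a' = \<pi> a" by force
  then have "(a, a') \<in> fibre" using a by (simp add: RDirProd_simps)
  then show ?thesis by (rule bexI[rotated]) simp
qed

lemma fibre_lift': "a' \<in> carrier A' \<Longrightarrow> \<exists>p\<in>fibre. snd p = a'"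
proof -
  assume a: "a' \<in> carrier A'"
  have "\<pi>' a' \<in> \<pi> ` carrier A" using ring_hom_closed[OF \<pi>' a] \<pi>_surj by simp
  then obtain a where "a \<in> carrier A" "\<pi> a = \<pi>' a'" by force
  then have "(a, a') \<in> fibre" using a by (simp add: RDirProd_simps)
  then show ?thesis by (rule bexI[rotated]) simp
qed

lemma P_Units: "p \<in> carrier P \<Longrightarrow> fst p \<in> Units A \<Longrightarrow> snd p \<in> Units A' \<Longrightarrow> p \<in> Units P"
proof -
  assume p: "p \<in> carrier P" and u: "fst p \<in> Units A" "snd p \<in> Units A'"
  let ?q = "(inv\<^bsub>A\<^esub> (fst p), inv\<^bsub>A'\<^esub> (snd p))"
  have "?q \<in> carrier P" "?q \<otimes>\<^bsub>P\<^esub> p = \<one>\<^bsub>P\<^esub>" "p \<otimes>\<^bsub>P\<^esub> ?q = \<one>\<^bsub>P\<^esub>"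
    using u by (simp_all add: RDirProd_simps)
  then show ?thesis using p unfolding Units_def by blast
qed

lemma fibre_Units:
  assumes p: "p \<in> fibre" and u: "fst p \<in> Units A \<or> snd p \<in> Units A'"
  shows "p \<in> Units P"
proof -
  have c: "fst p \<in> carrier A" "snd p \<in> carrier A'" "\<pi> (fst p) = \<pi>' (snd p)" using p by (auto simp: RDirProd_simps)
  have uB: "\<pi> (fst p) \<in> Units B"
    using u ring_hom_Units[OF \<pi> A.cring_axioms B] ring_hom_Units[OF \<pi>' A'.cring_axioms B] c(3) by metis
  have "fst p \<in> Units A" by (rule embedding_unit[OF B B1 N c(1) uB])
  moreover have "snd p \<in> Units A'" by (rule embedding_unit[OF B B1 N' c(2)]) (use uB c(3) in simp)
  ultimately show ?thesis using p P_Units by blast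
qed

end

text \<open>The germ of a closed embedding dominating both: the fibre product \<open>A \<times>\<^sub>B A'\<close> need not be essentially
  of finite type, but a localization of a finitely generated subalgebra surjects onto both factors.\<close>

locale refinement = two_embeddings +
  fixes G :: "('c \<times> 'c) set" and S S' :: "'c set"
  assumes G: "finite G" "G \<subseteq> fibre" "S \<subseteq> fst ` G" "S' \<subseteq> snd ` G"
    and S: "\<And>a. a \<in> carrier A \<Longrightarrow> \<exists>u\<in>generate_ring A (range \<iota> \<union> S). \<exists>v\<in>generate_ring A (range \<iota> \<union> S). v \<in> Units A \<and> a \<otimes>\<^bsub>A\<^esub> v = u"
    and S': "\<And>a. a \<in> carrier A' \<Longrightarrow> \<exists>u\<in>generate_ring A' (range \<iota>' \<union> S'). \<exists>v\<in>generate_ring A' (range \<iota>' \<union> S'). v \<in> Units A' \<and> a \<otimes>\<^bsub>A'\<^esub> v = u"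
begin

abbreviation "H \<equiv> range cc \<union> G"
abbreviation "C0 \<equiv> generate_ring P H"
definition "C = {p \<in> carrier P. \<exists>u\<in>C0. \<exists>v\<in>C0. v \<in> Units P \<and> p \<otimes>\<^bsub>P\<^esub> v = u}"

lemma H_sub: "H \<subseteq> fibre" "H \<subseteq> carrier P" using G(2) cc_fibre by auto

lemma C0_fibre: "C0 \<subseteq> fibre" by (rule P.generate_ring_min_subring1[OF H_sub(2) fibre_subring H_sub(1)])

lemma C0c: "u \<in> C0 \<Longrightarrow> u \<in> carrier P" using C0_fibre by blast

lemma CI: "p \<in> carrier P \<Longrightarrow> v \<in> C0 \<Longrightarrow> v \<in> Units P \<Longrightarrow> p \<otimes>\<^bsub>P\<^esub> v \<in> C0 \<Longrightarrow> p \<in> C"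
  unfolding C_def by (intro CollectI conjI bexI[of _ "p \<otimes>\<^bsub>P\<^esub> v"] bexI[of _ v] refl)

lemma CE: assumes "p \<in> C" obtains v where "p \<in> carrier P" "v \<in> C0" "v \<in> Units P" "p \<otimes>\<^bsub>P\<^esub> v \<in> C0"
  using assms unfolding C_def by blast

lemma C0_C: "u \<in> C0 \<Longrightarrow> u \<in> C"
  by (rule CI[OF C0c generate_ring.one P.Units_one_closed]) (use C0c in simp_all)

lemma C_subring: "subring C P"
proof (rule P.subringI)
  show "C \<subseteq> carrier P" using CE by blast
  show "\<one>\<^bsub>P\<^esub> \<in> C" by (rule C0_C[OF generate_ring.one])
  fix p assume "p \<in> C"
  then obtain v where p: "p \<in> carrier P" "v \<in> C0" "v \<in> Units P" "p \<otimes>\<^bsub>P\<^esub> v \<in> C0" by (rule CE)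
  note vc = C0c[OF p(2)]
  show "\<ominus>\<^bsub>P\<^esub> p \<in> C" by (rule CI[OF _ p(2,3)]) (use p vc generate_ring.a_inv[OF p(4)] in \<open>simp_all add: P.l_minus\<close>)
  fix q assume "q \<in> C"
  then obtain w where q: "q \<in> carrier P" "w \<in> C0" "w \<in> Units P" "q \<otimes>\<^bsub>P\<^esub> w \<in> C0" by (rule CE)
  note wc = C0c[OF q(2)]
  have vw: "v \<otimes>\<^bsub>P\<^esub> w \<in> C0" "v \<otimes>\<^bsub>P\<^esub> w \<in> Units P" by (rule generate_ring.eng_mult[OF p(2) q(2)]) (rule P.Units_m_closed[OF p(3) q(3)])
  have "p \<otimes>\<^bsub>P\<^esub> q \<otimes>\<^bsub>P\<^esub> (v \<otimes>\<^bsub>P\<^esub> w) = (p \<otimes>\<^bsub>P\<^esub> v) \<otimes>\<^bsub>P\<^esub> (q \<otimes>\<^bsub>P\<^esub> w)" using p(1) q(1) vc wc by (simp add: P.m_ac)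
  then show "p \<otimes>\<^bsub>P\<^esub> q \<in> C" using generate_ring.eng_mult[OF p(4) q(4)] P.m_closed[OF p(1) q(1)] by (intro CI[OF _ vw]) simp_all
  have "(p \<oplus>\<^bsub>P\<^esub> q) \<otimes>\<^bsub>P\<^esub> (v \<otimes>\<^bsub>P\<^esub> w) = (p \<otimes>\<^bsub>P\<^esub> v) \<otimes>\<^bsub>P\<^esub> w \<oplus>\<^bsub>P\<^esub> (q \<otimes>\<^bsub>P\<^esub> w) \<otimes>\<^bsub>P\<^esub> v"
    unfolding P.l_distr[OF p(1) q(1) P.m_closed[OF vc wc]] using p(1) q(1) vc wc by (simp add: P.m_ac)
  then show "p \<oplus>\<^bsub>P\<^esub> q \<in> C"
    using generate_ring.eng_add[OF generate_ring.eng_mult[OF p(4) q(2)] generate_ring.eng_mult[OF q(4) p(2)]] P.a_closed[OF p(1) q(1)]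
    by (intro CI[OF _ vw]) simp_all
qed

lemma C_fibre: "p \<in> C \<Longrightarrow> p \<in> fibre"
proof -
  assume "p \<in> C"
  then obtain v where p: "p \<in> carrier P" "v \<in> C0" "v \<in> Units P" "p \<otimes>\<^bsub>P\<^esub> v \<in> C0" by (rule CE)
  have v: "v \<in> fibre" "p \<otimes>\<^bsub>P\<^esub> v \<in> fibre" using C0_fibre p by blast+
  have c: "fst p \<in> carrier A" "snd p \<in> carrier A'" "fst v \<in> carrier A" "snd v \<in> carrier A'"
    using p(1) v(1) by (auto simp: RDirProd_simps)
  have c2: "\<pi> (fst p) \<in> carrier B" "\<pi>' (snd p) \<in> carrier B" using ring_hom_closed[OF \<pi> c(1)] ring_hom_closed[OF \<pi>' c(2)] .
  have e: "\<pi> (fst p) \<otimes>\<^bsub>B\<^esub> \<pi> (fst v) = \<pi>' (snd p) \<otimes>\<^bsub>B\<^esub> \<pi> (fst v)"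
    using v(2) v(1) c by (simp add: RDirProd_simps ring_hom_mult[OF \<pi>] ring_hom_mult[OF \<pi>'])
  have u: "\<pi> (fst v) \<in> Units B"
    by (rule ring_hom_Units[OF \<pi> A.cring_axioms B ring_hom_Units[OF fst_hom P.cring_axioms A.cring_axioms p(3)]])
  have "\<pi> (fst p) = \<pi>' (snd p)"
  proof -
    have "\<pi> (fst v) \<otimes>\<^bsub>B\<^esub> \<pi> (fst p) = \<pi> (fst v) \<otimes>\<^bsub>B\<^esub> \<pi>' (snd p)" using e B.m_comm[OF _ B.Units_closed[OF u]] c2 by metis
    then show ?thesis using B.Units_l_cancel[OF u c2] by simp
  qed
  then show ?thesis using p(1) by blast
qed

abbreviation "R \<equiv> P\<lparr>carrier := C\<rparr>"

lemma R_cring: "cring R"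
  using P.subcring_iff[OF subringE(1)[OF C_subring]] P.subcringI'[OF C_subring] by blast

lemma C_surj_aux:
  assumes h: "h \<in> ring_hom P A1" and A1: "cring A1" and gen: "S1 \<subseteq> h ` H"
    and S1: "\<exists>u\<in>generate_ring A1 S1. \<exists>v\<in>generate_ring A1 S1. v \<in> Units A1 \<and> a \<otimes>\<^bsub>A1\<^esub> v = u"
    and units: "\<And>q. q \<in> fibre \<Longrightarrow> h q \<in> Units A1 \<Longrightarrow> q \<in> Units P" and a: "a \<in> carrier A1"
  shows "\<exists>p\<in>C. h p = a"
proof -
  interpret A1: cring A1 by (rule A1)
  have "generate_ring A1 S1 \<subseteq> generate_ring A1 (h ` H)"
    by (rule A1.mono_generate_ring[OF gen]) (use H_sub(2) ring_hom_closed[OF h] in blast)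
  then obtain u v where uv: "u \<in> generate_ring A1 (h ` H)" "v \<in> generate_ring A1 (h ` H)" "v \<in> Units A1" "a \<otimes>\<^bsub>A1\<^esub> v = u"
    using S1 by blast
  obtain p where p: "p \<in> C0" "h p = u" using generate_ring_hom_image[OF h P.cring_axioms A1 H_sub(2) uv(1)] by blast
  obtain q where q: "q \<in> C0" "h q = v" using generate_ring_hom_image[OF h P.cring_axioms A1 H_sub(2) uv(2)] by blast
  have qu: "q \<in> Units P" using units[of q] C0_fibre q uv(3) by blast
  let ?r = "p \<otimes>\<^bsub>P\<^esub> inv\<^bsub>P\<^esub> q"
  have rc: "?r \<in> carrier P" using C0c[OF p(1)] qu by simp
  have rq: "?r \<otimes>\<^bsub>P\<^esub> q = p" using C0c[OF p(1)] qu P.Units_closed[OF qu] by (simp add: P.m_assoc)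
  have "?r \<in> C" by (rule CI[OF rc q(1) qu]) (simp only: rq p(1))
  moreover have "h ?r = a"
  proof -
    note f = ring_hom_closed[OF h rc]
    have "h ?r \<otimes>\<^bsub>A1\<^esub> v = a \<otimes>\<^bsub>A1\<^esub> v" using ring_hom_mult[OF h rc P.Units_closed[OF qu]] rq p(2) q(2) uv(4) by simp
    then have "v \<otimes>\<^bsub>A1\<^esub> h ?r = v \<otimes>\<^bsub>A1\<^esub> a" using A1.m_comm[OF _ A1.Units_closed[OF uv(3)]] f a by metis
    then show ?thesis using A1.Units_l_cancel[OF uv(3) f a] by simp
  qed
  ultimately show ?thesis by blast
qed

lemma C_surj: "fst ` C = carrier A"
proof (intro subset_antisym subsetI)
  fix a assume a: "a \<in> carrier A"
  have "range \<iota> \<union> S \<subseteq> fst ` H" using G(3) by (force simp: cc_def)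
  from C_surj_aux[OF fst_hom A.cring_axioms this S[OF a] _ a] fibre_Units show "a \<in> fst ` C" by blast
qed (use C_fibre in \<open>force simp: RDirProd_simps\<close>)

lemma C_surj': "snd ` C = carrier A'"
proof (intro subset_antisym subsetI)
  fix a assume a: "a \<in> carrier A'"
  have "range \<iota>' \<union> S' \<subseteq> snd ` H" using G(4) by (force simp: cc_def)
  from C_surj_aux[OF snd_hom A'.cring_axioms this S'[OF a] _ a] fibre_Units show "a \<in> snd ` C" by blast
qed (use C_fibre in \<open>force simp: RDirProd_simps\<close>)

lemma R_Units: "p \<in> C \<Longrightarrow> p \<in> Units P \<Longrightarrow> p \<in> Units R"
proof -
  assume pC: "p \<in> C" and u: "p \<in> Units P"
  obtain v where p: "p \<in> carrier P" "v \<in> C0" "v \<in> Units P" "p \<otimes>\<^bsub>P\<^esub> v \<in> C0" using pC by (rule CE)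
  have ic: "inv\<^bsub>P\<^esub> p \<in> carrier P" using u by simp
  have pv: "p \<otimes>\<^bsub>P\<^esub> v \<in> Units P" by (rule P.Units_m_closed[OF u p(3)])
  have "inv\<^bsub>P\<^esub> p \<otimes>\<^bsub>P\<^esub> (p \<otimes>\<^bsub>P\<^esub> v) = v" using P.m_assoc[OF ic p(1) C0c[OF p(2)]] u C0c[OF p(2)] by simp
  then have "inv\<^bsub>P\<^esub> p \<in> C" using p(2) by (intro CI[OF ic p(4) pv]) simp
  then show ?thesis using pC P.Units_l_inv[OF u] P.Units_r_inv[OF u] unfolding Units_def by (intro CollectI conjI bexI[of _ "inv\<^bsub>P\<^esub> p"]) simp_all
qed

lemma R_fst: "fst \<in> ring_hom R A" and R_snd: "snd \<in> ring_hom R A'"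
  using subringE(1)[OF C_subring] by (auto simp: ring_hom_def RDirProd_simps)

lemma R_local_unit: "p \<in> C \<Longrightarrow> fst p \<in> Units A \<Longrightarrow> p \<in> Units R"
  using R_Units fibre_Units C_fibre by blast

lemma R_cc: "cc \<in> ring_hom base_field R"
proof -
  have "cc k \<in> C" for k using C0_C[of "cc k"] generate_ring.incl[of "cc k" H P] by blast
  then show ?thesis using cc_hom by (auto simp: ring_hom_def)
qed

lemma R_generated: "p \<in> C \<Longrightarrow> \<exists>u\<in>generate_ring R H. \<exists>v\<in>generate_ring R H. v \<in> Units R \<and> p \<otimes>\<^bsub>R\<^esub> v = u"
proof -
  assume "p \<in> C"
  then obtain v where p: "p \<in> carrier P" "v \<in> C0" "v \<in> Units P" "p \<otimes>\<^bsub>P\<^esub> v \<in> C0" by (rule CE)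
  have HC: "H \<subseteq> C" using C0_C generate_ring.incl[of _ H P] by blast
  have sub: "C0 \<subseteq> generate_ring R H"
    using P.subring_gen_incl[OF C_subring P.carrier_is_subring HC H_sub(2)] by simp
  have "v \<in> Units R" by (rule R_Units[OF C0_C[OF p(2)] p(3)])
  then show ?thesis using sub p by auto
qed

text \<open>The ring just constructed consists of pairs; the injection \<open>e\<close> moves it to the element type of \<open>A\<close> and \<open>A'\<close>. It is
local because, by \<open>embedding_unit\<close>, its nonunits are the preimage of the nonunits of \<open>A\<close>.\<close>

lemma dominates:
  fixes e :: "'c \<times> 'c \<Rightarrow> 'c"
  assumes e: "inj e"
  shows "\<exists>E\<in>embeddings B \<kappa>. embedding_maps (A, \<iota>, \<pi>) E \<noteq> {} \<and> embedding_maps (A', \<iota>', \<pi>') E \<noteq> {}"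
proof -
  interpret R: cring R by (rule R_cring)
  let ?T = "image_ring e R"
  let ?g = "inv_into (carrier R) e"
  have inj: "inj_on e (carrier R)" using e by (rule inj_on_subset) simp
  have iso: "e \<in> ring_iso R ?T" by (rule inj_imp_image_ring_iso[OF inj])
  have eh: "e \<in> ring_hom R ?T" using iso by (simp add: ring_iso_def)
  have T: "cring ?T" using R.ring_iso_imp_img_cring[OF iso] by (simp add: image_ring_def image_group_def monoid.defs)
  interpret T: cring ?T by (rule T)
  have gh: "?g \<in> ring_hom ?T R" using ring_iso_set_sym[OF R.ring_axioms iso] by (simp add: ring_iso_def)
  have ge: "?g (e p) = p" if "p \<in> C" for p using inv_into_f_f[OF inj, of p] that by simp
  have eg: "e (?g t) = t" "?g t \<in> C" if "t \<in> carrier ?T" for t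
    using that f_inv_into_f[of t e "carrier R"] inv_into_into[of t e "carrier R"] by (simp_all add: image_ring_carrier)
  have h1: "fst \<circ> ?g \<in> ring_hom ?T A" by (rule ring_hom_trans[OF gh R_fst])
  have h2: "snd \<circ> ?g \<in> ring_hom ?T A'" by (rule ring_hom_trans[OF gh R_snd])
  have ih: "e \<circ> cc \<in> ring_hom base_field ?T" by (rule ring_hom_trans[OF R_cc eh])
  have ccC: "cc k \<in> C" for k using C0_C[of "cc k"] generate_ring.incl[of "cc k" H P] by blast
  have gT: "?g ` carrier ?T = C"
  proof (intro subset_antisym subsetI)
    fix p assume p: "p \<in> C"
    then have "e p \<in> carrier ?T" by (simp add: image_ring_carrier)
    then show "p \<in> ?g ` carrier ?T" using ge[OF p] by (metis imageI)
  qed (use eg(2) in blast)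
  have s1: "(fst \<circ> ?g) ` carrier ?T = carrier A" and s2: "(snd \<circ> ?g) ` carrier ?T = carrier A'"
    unfolding image_comp[symmetric] gT by (rule C_surj, rule C_surj')
  have loc: "is_local_ring ?T"
  proof (rule local_ringI[OF T])
    have "carrier ?T - Units ?T = {t \<in> carrier ?T. (fst \<circ> ?g) t \<in> carrier A - Units A}"
    proof -
      have "t \<in> Units ?T" if t: "t \<in> carrier ?T" and u: "(fst \<circ> ?g) t \<in> Units A" for t
      proof -
        have "?g t \<in> Units R" by (rule R_local_unit) (use eg[OF t] u in simp_all)
        then have "e (?g t) \<in> Units ?T" by (rule ring_hom_Units[OF eh R_cring T])
        then show ?thesis using eg[OF t] by simp
      qed
      moreover have "(fst \<circ> ?g) t \<in> Units A" if "t \<in> Units ?T" for t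
        by (rule ring_hom_Units[OF h1 T A.cring_axioms that])
      ultimately show ?thesis using ring_hom_closed[OF h1] by blast
    qed
    moreover have "ideal {t \<in> carrier ?T. (fst \<circ> ?g) t \<in> carrier A - Units A} ?T"
      by (rule ring_hom_ring.ideal_vimage[OF ring_hom_ringI2[OF T.ring_axioms A.ring_axioms h1] local_ring_nonunits(1)[OF embeddingD(3)[OF N]]])
    ultimately show "ideal (carrier ?T - Units ?T) ?T" by simp
  qed
  have ess: "ess_finite_type ?T (e \<circ> cc)"
    unfolding ess_finite_type_def
  proof (intro exI[of _ "e ` G"] conjI ballI)
    have HC: "H \<subseteq> C" using C0_C generate_ring.incl[of _ H P] by blast
    show "e ` G \<subseteq> carrier ?T" using HC by (auto simp: image_ring_carrier)
    show "finite (e ` G)" using G(1) by simp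
    fix t assume t: "t \<in> carrier ?T"
    obtain u v where uv: "u \<in> generate_ring R H" "v \<in> generate_ring R H" "v \<in> Units R" "?g t \<otimes>\<^bsub>R\<^esub> v = u"
      using R_generated[OF eg(2)[OF t]] by blast
    have HR: "H \<subseteq> carrier R" using HC by simp
    have eH: "e ` H = range (e \<circ> cc) \<union> e ` G" by (simp add: image_Un image_comp)
    note gen = generate_ring_image_hom[OF eh R_cring T HR, unfolded eH]
    have "t \<otimes>\<^bsub>?T\<^esub> e v = e u"
      using ring_hom_mult[OF eh, of "?g t" v] eg[OF t] R.Units_closed[OF uv(3)] uv(4) by simp
    then show "\<exists>u\<in>generate_ring ?T (range (e \<circ> cc) \<union> e ` G). \<exists>v\<in>generate_ring ?T (range (e \<circ> cc) \<union> e ` G).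
        v \<in> Units ?T \<and> t \<otimes>\<^bsub>?T\<^esub> v = u"
      using gen[OF uv(1)] gen[OF uv(2)] ring_hom_Units[OF eh R_cring T uv(3)] by blast
  qed
  have \<pi>eq: "\<pi> (fst (?g t)) = \<pi>' (snd (?g t))" if "t \<in> carrier ?T" for t using C_fibre[OF eg(2)[OF that]] by blast
  let ?E = "(?T, e \<circ> cc, \<pi> \<circ> (fst \<circ> ?g))"
  have E: "?E \<in> embeddings B \<kappa>"
  proof -
    have "\<pi> \<circ> (fst \<circ> ?g) \<in> ring_hom ?T B" by (rule ring_hom_trans[OF h1 \<pi>])
    moreover have "(\<pi> \<circ> (fst \<circ> ?g)) ` carrier ?T = carrier B" unfolding image_comp[symmetric] using s1 \<pi>_surj by (simp only: image_comp)
    moreover have "(\<pi> \<circ> (fst \<circ> ?g)) ((e \<circ> cc) k) = \<kappa> k" for k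
      using ge[OF ccC[of k]] embeddingD(7)[OF N, of k] by (simp add: cc_def)
    ultimately show ?thesis using T ih loc ess by (simp add: embeddings_def k_algebra_def)
  qed
  moreover have "fst \<circ> ?g \<in> embedding_maps (A, \<iota>, \<pi>) ?E"
  proof -
    have "(fst \<circ> ?g) ((e \<circ> cc) k) = \<iota> k" for k using ge[OF ccC[of k]] by (simp add: cc_def)
    then show ?thesis using h1 s1 by (simp add: embedding_maps_def)
  qed
  moreover have "snd \<circ> ?g \<in> embedding_maps (A', \<iota>', \<pi>') ?E"
  proof -
    have "(snd \<circ> ?g) ((e \<circ> cc) k) = \<iota>' k" for k using ge[OF ccC[of k]] by (simp add: cc_def)
    then show ?thesis using h2 s2 \<pi>eq by (simp add: embedding_maps_def)
  qed
  ultimately show ?thesis by blast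
qed

end

text \<open>Adjoin lifts of the generators of both rings to the common field of constants inside \<open>A \<times>\<^sub>B A'\<close>, and localize.\<close>

theorem embeddings_directed:
  fixes N N' :: "('k::field, 'r, 'b) embedding"
  assumes B: "cring B" and B1: "\<one>\<^bsub>B\<^esub> \<noteq> \<zero>\<^bsub>B\<^esub>" and inf: "infinite (UNIV :: 'r set)"
    and N: "N \<in> embeddings B \<kappa>" and N': "N' \<in> embeddings B \<kappa>"
  shows "\<exists>E\<in>embeddings B \<kappa>. embedding_maps N E \<noteq> {} \<and> embedding_maps N' E \<noteq> {}"
proof -
  obtain A \<iota> \<pi> where NA: "N = (A, \<iota>, \<pi>)" by (cases N)
  obtain A' \<iota>' \<pi>' where NA': "N' = (A', \<iota>', \<pi>')" by (cases N')
  note N = N[unfolded NA] and N' = N'[unfolded NA']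
  interpret two_embeddings B \<kappa> A A' \<iota> \<iota>' \<pi> \<pi>' by (rule two_embeddings.intro[OF B B1 N N'])
  obtain S where S: "S \<subseteq> carrier A" "finite S"
    "\<And>a. a \<in> carrier A \<Longrightarrow> \<exists>u\<in>generate_ring A (range \<iota> \<union> S). \<exists>v\<in>generate_ring A (range \<iota> \<union> S). v \<in> Units A \<and> a \<otimes>\<^bsub>A\<^esub> v = u"
    using embeddingD(4)[OF N] unfolding ess_finite_type_def by metis
  obtain S' where S': "S' \<subseteq> carrier A'" "finite S'"
    "\<And>a. a \<in> carrier A' \<Longrightarrow> \<exists>u\<in>generate_ring A' (range \<iota>' \<union> S'). \<exists>v\<in>generate_ring A' (range \<iota>' \<union> S'). v \<in> Units A' \<and> a \<otimes>\<^bsub>A'\<^esub> v = u"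
    using embeddingD(4)[OF N'] unfolding ess_finite_type_def by metis
  have "\<forall>a\<in>S. \<exists>p. p \<in> fibre \<and> fst p = a" using fibre_lift S(1) by blast
  then obtain l where l: "\<And>a. a \<in> S \<Longrightarrow> l a \<in> fibre \<and> fst (l a) = a" by (rule bchoice[THEN exE]) blast
  have "\<forall>a\<in>S'. \<exists>p. p \<in> fibre \<and> snd p = a" using fibre_lift' S'(1) by blast
  then obtain l' where l': "\<And>a. a \<in> S' \<Longrightarrow> l' a \<in> fibre \<and> snd (l' a) = a" by (rule bchoice[THEN exE]) blast
  have "refinement B \<kappa> A A' \<iota> \<iota>' \<pi> \<pi>' (l ` S \<union> l' ` S') S S'"
  proof (intro refinement.intro refinement_axioms.intro two_embeddings_axioms)
    show "finite (l ` S \<union> l' ` S')" using S(2) S'(2) by simp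
    show "l ` S \<union> l' ` S' \<subseteq> fibre" using l l' by blast
    show "S \<subseteq> fst ` (l ` S \<union> l' ` S')"
    proof
      fix a assume a: "a \<in> S"
      show "a \<in> fst ` (l ` S \<union> l' ` S')" by (rule image_eqI[of _ _ "l a"]) (use l[OF a] a in auto)
    qed
    show "S' \<subseteq> snd ` (l ` S \<union> l' ` S')"
    proof
      fix a assume a: "a \<in> S'"
      show "a \<in> snd ` (l ` S \<union> l' ` S')" by (rule image_eqI[of _ _ "l' a"]) (use l'[OF a] a in auto)
    qed
  qed (fact S(3), fact S'(3))
  (* an infinite type has as many elements as its square *)
  moreover obtain e :: "'r \<times> 'r \<Rightarrow> 'r" where "inj e"
  proof -
    have "|(UNIV :: 'r set) \<times> (UNIV :: 'r set)| =o |UNIV :: 'r set|" by (rule card_of_Times_same_infinite[OF inf])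
    then obtain f :: "'r \<times> 'r \<Rightarrow> 'r" where "bij_betw f (UNIV \<times> UNIV) UNIV" using card_of_ordIso by blast
    then have "inj f" by (simp add: bij_betw_def)
    then show thesis by (rule that)
  qed
  ultimately show ?thesis unfolding NA NA' by (rule refinement.dominates)
qed

text \<open>Hilbert's basis theorem over the image of the field, followed by localization.\<close>

lemma embedding_noeth:
  fixes A :: "'r ring" and \<iota> :: "'k::field \<Rightarrow> 'r"
  assumes A: "cring A" and \<iota>: "\<iota> \<in> ring_hom base_field A" and ess: "ess_finite_type A \<iota>"
  shows "cring.noeth A (carrier A)"
proof -
  interpret A: cring A by (rule A)
  interpret h: ring_hom_ring "base_field :: 'k ring" A \<iota>
    by (rule ring_hom_ringI2[OF cring.axioms(1)[OF base_field_cring] A.ring_axioms \<iota>])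
  have rng: "range \<iota> \<subseteq> carrier A" using ring_hom_closed[OF \<iota>] by (auto simp: base_field_simps)
  have hadd: "\<iota> (a + b) = \<iota> a \<oplus>\<^bsub>A\<^esub> \<iota> b" and hmul: "\<iota> (a * b) = \<iota> a \<otimes>\<^bsub>A\<^esub> \<iota> b" and h1: "\<iota> 1 = \<one>\<^bsub>A\<^esub>" for a b
    using ring_hom_add[OF \<iota>, of a b] ring_hom_mult[OF \<iota>, of a b] ring_hom_one[OF \<iota>] by (simp_all add: base_field_simps)
  have h0: "\<iota> 0 = \<zero>\<^bsub>A\<^esub>" using h.hom_zero by (simp add: base_field_simps)
  have sub: "subring (range \<iota>) A"
  proof (rule A.subringI[OF rng])
    show "\<one>\<^bsub>A\<^esub> \<in> range \<iota>" using h1 by (metis rangeI)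
    fix a assume a: "a \<in> range \<iota>"
    then obtain k where k: "a = \<iota> k" by blast
    have "\<iota> (- k) \<oplus>\<^bsub>A\<^esub> \<iota> k = \<zero>\<^bsub>A\<^esub>" using hadd[of "- k" k] h0 by simp
    then have "\<ominus>\<^bsub>A\<^esub> a = \<iota> (- k)" unfolding k using A.minus_equality[of "\<iota> (- k)" "\<iota> k"] rng by blast
    then show "\<ominus>\<^bsub>A\<^esub> a \<in> range \<iota>" by blast
    fix b assume "b \<in> range \<iota>"
    then obtain j where j: "b = \<iota> j" by blast
    show "a \<otimes>\<^bsub>A\<^esub> b \<in> range \<iota>" unfolding k j hmul[symmetric] by blast
    show "a \<oplus>\<^bsub>A\<^esub> b \<in> range \<iota>" unfolding k j hadd[symmetric] by blast
  qed
  have N: "A.noeth (range \<iota>)"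
    unfolding A.noeth_def
  proof (intro allI impI)
    fix L assume L: "A.submod (range \<iota>) L"
    show "\<exists>G. finite G \<and> G \<subseteq> L \<and> (\<forall>M. A.submod (range \<iota>) M \<longrightarrow> G \<subseteq> M \<longrightarrow> L \<subseteq> M)"
    proof (cases "L \<subseteq> {\<zero>\<^bsub>A\<^esub>}")
      case True
      then show ?thesis using A.submodD(2) by (intro exI[of _ "{}"]) blast
    next
      case False
      then obtain k where k: "\<iota> k \<in> L" "\<iota> k \<noteq> \<zero>\<^bsub>A\<^esub>" using A.submodD(1)[OF L] by blast
      then have k0: "k \<noteq> 0" using h0 by blast
      have "L \<subseteq> M" if M: "A.submod (range \<iota>) M" "{\<iota> k} \<subseteq> M" for M
      proof
        fix y assume "y \<in> L"
        then obtain j where j: "y = \<iota> j" using A.submodD(1)[OF L] by blast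
        have "\<iota> (j / k) \<otimes>\<^bsub>A\<^esub> \<iota> k \<in> M" using A.submodD(4)[OF M(1)] M(2) by blast
        then show "y \<in> M" unfolding j hmul[symmetric] using k0 by simp
      qed
      then show ?thesis using k(1) by (intro exI[of _ "{\<iota> k}"]) blast
    qed
  qed
  obtain S where S: "S \<subseteq> carrier A" "finite S"
    "\<And>a. a \<in> carrier A \<Longrightarrow> \<exists>u\<in>generate_ring A (range \<iota> \<union> S). \<exists>v\<in>generate_ring A (range \<iota> \<union> S). v \<in> Units A \<and> a \<otimes>\<^bsub>A\<^esub> v = u"
    using ess unfolding ess_finite_type_def by metis
  show ?thesis
    by (rule A.localization_noeth[OF A.generate_ring_is_subring A.generate_ring_noeth[OF S(2,1) sub N] S(3)]) (use rng S(1) in blast)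
qed

lemma embedding_one_minus:
  fixes A (structure)
  assumes A: "is_local_ring A" and z: "z \<in> carrier A - Units A"
  shows "\<one> \<ominus> z \<in> Units A"
proof (rule ccontr)
  interpret cring A using A by (simp add: is_local_ring_def)
  assume nu: "\<one> \<ominus> z \<notin> Units A"
  note I = local_ring_nonunits(1)[OF A]
  have zc: "z \<in> carrier A" using z by blast
  then have "\<one> \<ominus> z \<in> carrier A - Units A" using nu by simp
  then have "(\<one> \<ominus> z) \<oplus> z \<in> carrier A - Units A" using ideal_add[OF I] z by blast
  moreover have "(\<one> \<ominus> z) \<oplus> z = \<one>" using zc by (simp add: a_minus_def a_assoc l_neg)
  ultimately show False by simp
qed

section \<open>Germs of regular functions\<close>

text \<open>A point with an affine neighbourhood \<open>U0\<close>, embedded by the coordinates \<open>\<phi>\<close>. All germs at \<open>p\<close> can be represented on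
smaller neighbourhoods as quotients of polynomials in the coordinates, so the local ring is handled through
the functions \<open>rational\<close> at \<open>p\<close> modulo equality near \<open>p\<close>.\<close>

locale stalk_at =
  fixes M :: "('a, 'k::field) fun_space" and p :: 'a and U0 :: "'a set" and n :: nat and \<phi> :: "'a \<Rightarrow> nat \<Rightarrow> 'k"
  assumes restr: "\<And>U V f. openin (zariski M) U \<Longrightarrow> f \<in> regular M U \<Longrightarrow> V \<subseteq> U \<Longrightarrow> openin (zariski M) V \<Longrightarrow> restrict f V \<in> regular M V"
    and U0: "openin (zariski M) U0" "p \<in> U0"
    and topo: "\<And>W. W \<subseteq> U0 \<Longrightarrow> openin (zariski M) W \<longleftrightarrow> (\<exists>S'\<subseteq>poly_fun n. W = {q \<in> U0. \<exists>s\<in>S'. s (\<phi> q) \<noteq> 0})"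
    and reg: "\<And>W. W \<subseteq> U0 \<Longrightarrow> openin (zariski M) W \<Longrightarrow> regular M W = {f \<in> extensional W. \<forall>p\<in>W.
        \<exists>g\<in>poly_fun n. \<exists>h\<in>poly_fun n. \<exists>V\<subseteq>W. openin (zariski M) V \<and> p \<in> V \<and>
          (\<forall>q\<in>V. h (\<phi> q) \<noteq> 0 \<and> f q = g (\<phi> q) / h (\<phi> q))}"
begin

abbreviation "op U \<equiv> openin (zariski M) U"

definition rational :: "('a \<Rightarrow> 'k) \<Rightarrow> bool" where
  "rational f \<longleftrightarrow> (\<exists>g\<in>poly_fun n. \<exists>h\<in>poly_fun n. \<exists>V\<subseteq>U0. op V \<and> p \<in> V \<and> (\<forall>q\<in>V. h (\<phi> q) \<noteq> 0 \<and> f q = g (\<phi> q) / h (\<phi> q)))"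

definition near :: "('a \<Rightarrow> 'k) \<Rightarrow> ('a \<Rightarrow> 'k) \<Rightarrow> bool" where
  "near f g \<longleftrightarrow> (\<exists>W. op W \<and> p \<in> W \<and> (\<forall>q\<in>W. f q = g q))"

text \<open>The germ of a function, not tied to a domain on which it is regular; see \<open>germ_gm\<close>.\<close>

definition gm :: "('a \<Rightarrow> 'k) \<Rightarrow> ('a, 'k) germ" where
  "gm f = {(V, g). op V \<and> p \<in> V \<and> g \<in> regular M V \<and> near f g}"

lemma nearI: "op W \<Longrightarrow> p \<in> W \<Longrightarrow> (\<And>q. q \<in> W \<Longrightarrow> f q = g q) \<Longrightarrow> near f g"
  unfolding near_def by blast

lemma near_sym: "near f g \<Longrightarrow> near g f" unfolding near_def by metis

lemma near_op: "near f f' \<Longrightarrow> near g g' \<Longrightarrow> near (\<lambda>q. c (f q) (g q)) (\<lambda>q. c (f' q) (g' q))"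
proof -
  assume "near f f'" "near g g'"
  then obtain W V where W: "op W" "p \<in> W" "\<And>q. q \<in> W \<Longrightarrow> f q = f' q" and V: "op V" "p \<in> V" "\<And>q. q \<in> V \<Longrightarrow> g q = g' q"
    unfolding near_def by metis
  show ?thesis by (rule nearI[of "W \<inter> V"]) (use W V in auto)
qed

lemma near_trans: "near f g \<Longrightarrow> near g h \<Longrightarrow> near f h"
proof -
  assume "near f g" "near g h"
  then obtain W V where W: "op W" "p \<in> W" "\<And>q. q \<in> W \<Longrightarrow> f q = g q" and V: "op V" "p \<in> V" "\<And>q. q \<in> V \<Longrightarrow> g q = h q"
    unfolding near_def by metis
  show ?thesis by (rule nearI[of "W \<inter> V"]) (use W V in auto)
qed

lemma near_at: "near f g \<Longrightarrow> f p = g p" unfolding near_def by blast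

lemma near_restrict: "op V \<Longrightarrow> p \<in> V \<Longrightarrow> near f (restrict f V)"
  by (rule nearI[of V]) simp_all

lemma rationalI:
  "g \<in> poly_fun n \<Longrightarrow> h \<in> poly_fun n \<Longrightarrow> V \<subseteq> U0 \<Longrightarrow> op V \<Longrightarrow> p \<in> V \<Longrightarrow>
    (\<And>q. q \<in> V \<Longrightarrow> h (\<phi> q) \<noteq> 0 \<and> f q = g (\<phi> q) / h (\<phi> q)) \<Longrightarrow> rational f"
  unfolding rational_def by blast

lemma rationalE:
  assumes "rational f"
  obtains g h V where "g \<in> poly_fun n" "h \<in> poly_fun n" "V \<subseteq> U0" "op V" "p \<in> V"
    "\<forall>q\<in>V. h (\<phi> q) \<noteq> 0" "\<forall>q\<in>V. f q = g (\<phi> q) / h (\<phi> q)"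
  using assms unfolding rational_def by metis

lemma regular_rational: "op U \<Longrightarrow> p \<in> U \<Longrightarrow> f \<in> regular M U \<Longrightarrow> rational f"
proof -
  assume U: "op U" "p \<in> U" and f: "f \<in> regular M U"
  let ?W = "U \<inter> U0"
  have W: "op ?W" "?W \<subseteq> U0" "p \<in> ?W" using U U0 by auto
  have "restrict f ?W \<in> regular M ?W" using restr[OF U(1) f _ W(1)] by blast
  then obtain g h V where V: "g \<in> poly_fun n" "h \<in> poly_fun n" "V \<subseteq> ?W" "op V" "p \<in> V"
      "\<And>q. q \<in> V \<Longrightarrow> h (\<phi> q) \<noteq> 0 \<and> restrict f ?W q = g (\<phi> q) / h (\<phi> q)"
    unfolding reg[OF W(2,1)] using W(3) by blast
  show ?thesis
  proof (rule rationalI[OF V(1,2) _ V(4,5)])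
    show "V \<subseteq> U0" using V(3) by blast
    fix q assume q: "q \<in> V"
    have "restrict f ?W q = f q" using q V(3) by (intro restrict_apply') blast
    then show "h (\<phi> q) \<noteq> 0 \<and> f q = g (\<phi> q) / h (\<phi> q)" using V(6)[OF q] by simp
  qed
qed

lemma rational_regular: "rational f \<Longrightarrow> \<exists>V. op V \<and> p \<in> V \<and> restrict f V \<in> regular M V"
proof -
  assume "rational f"
  then obtain g h V where V: "g \<in> poly_fun n" "h \<in> poly_fun n" "V \<subseteq> U0" "op V" "p \<in> V"
    "\<forall>q\<in>V. h (\<phi> q) \<noteq> 0" "\<forall>q\<in>V. f q = g (\<phi> q) / h (\<phi> q)" by (rule rationalE)
  have "restrict f V \<in> regular M V" unfolding reg[OF V(3,4)]
  proof (intro CollectI conjI ballI)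
    fix r assume r: "r \<in> V"
    show "\<exists>g\<in>poly_fun n. \<exists>h\<in>poly_fun n. \<exists>V'\<subseteq>V. op V' \<and> r \<in> V' \<and> (\<forall>q\<in>V'. h (\<phi> q) \<noteq> 0 \<and> restrict f V q = g (\<phi> q) / h (\<phi> q))"
      by (intro bexI[OF _ V(1)] bexI[OF _ V(2)] exI[of _ V] conjI ballI subset_refl) (use V r in simp_all)
  qed simp
  then show ?thesis using V by blast
qed

lemma gm_member: "rational f \<Longrightarrow> \<exists>V g. (V, g) \<in> gm f"
proof -
  assume "rational f"
  then obtain V where V: "op V" "p \<in> V" "restrict f V \<in> regular M V" using rational_regular by blast
  then have "(V, restrict f V) \<in> gm f" using near_restrict[OF V(1,2)] by (simp add: gm_def)
  then show ?thesis by blast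
qed

lemma gm_cong: "near f g \<Longrightarrow> gm f = gm g"
  unfolding gm_def using near_trans near_sym by blast

lemma gm_eq_iff: "rational f \<Longrightarrow> gm f = gm g \<longleftrightarrow> near f g"
proof
  assume f: "rational f" and e: "gm f = gm g"
  obtain V h where "(V, h) \<in> gm f" using gm_member[OF f] by blast
  then have "near f h" "near g h" using e by (auto simp: gm_def)
  then show "near f g" using near_trans near_sym by blast
qed (rule gm_cong)

lemma germ_gm: "op U \<Longrightarrow> p \<in> U \<Longrightarrow> germ M p U f = gm f"
proof -
  assume U: "op U" "p \<in> U"
  have "(\<exists>W. op W \<and> p \<in> W \<and> W \<subseteq> U \<inter> V \<and> (\<forall>q\<in>W. f q = g q)) \<longleftrightarrow> near f g" if V: "op V" "p \<in> V" for V g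
  proof
    assume "near f g"
    then obtain W where W: "op W" "p \<in> W" "\<forall>q\<in>W. f q = g q" unfolding near_def by blast
    show "\<exists>W. op W \<and> p \<in> W \<and> W \<subseteq> U \<inter> V \<and> (\<forall>q\<in>W. f q = g q)"
      by (rule exI[of _ "W \<inter> (U \<inter> V)"]) (use W U V in auto)
  qed (auto simp: near_def)
  then show ?thesis unfolding germ_def gm_def by blast
qed

lemma germ_op_gm:
  assumes f: "rational f" and g: "rational g"
  shows "germ_op M p c (gm f) (gm g) = gm (\<lambda>q. c (f q) (g q))"
proof -
  have *: "germ M p (U \<inter> V) (\<lambda>q\<in>U \<inter> V. c (f' q) (g' q)) = gm (\<lambda>q. c (f q) (g q))"
    if U: "(U, f') \<in> gm f" and V: "(V, g') \<in> gm g" for U V f' g'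
  proof -
    have o: "op (U \<inter> V)" "p \<in> U \<inter> V" using U V by (auto simp: gm_def)
    have n: "near f f'" "near g g'" using U V by (auto simp: gm_def)
    have "near (\<lambda>q. c (f q) (g q)) (\<lambda>q\<in>U \<inter> V. c (f' q) (g' q))"
      by (rule near_trans[OF near_op[OF n] near_restrict[OF o]])
    then show ?thesis unfolding germ_gm[OF o] by (rule gm_cong[symmetric])
  qed
  obtain U f' where U: "(U, f') \<in> gm f" using gm_member[OF f] by blast
  obtain V g' where V: "(V, g') \<in> gm g" using gm_member[OF g] by blast
  show ?thesis
  proof
    show "germ_op M p c (gm f) (gm g) \<subseteq> gm (\<lambda>q. c (f q) (g q))"
    proof
      fix z assume "z \<in> germ_op M p c (gm f) (gm g)"
      then obtain U f' V g' where z: "(U, f') \<in> gm f" "(V, g') \<in> gm g" "z \<in> germ M p (U \<inter> V) (\<lambda>q\<in>U \<inter> V. c (f' q) (g' q))"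
        unfolding germ_op_def by auto
      then show "z \<in> gm (\<lambda>q. c (f q) (g q))" using *[OF z(1,2)] by simp
    qed
    show "gm (\<lambda>q. c (f q) (g q)) \<subseteq> germ_op M p c (gm f) (gm g)"
      unfolding germ_op_def *[OF U V, symmetric] using U V by blast
  qed
qed

subsection \<open>The ring of germs\<close>

abbreviation "A \<equiv> stalk M p"
abbreviation "\<iota> \<equiv> stalk_const M p"

lemma points_open: "op (points M)" "p \<in> points M"
  using U0 openin_subset by auto

lemma rational_const: "rational (\<lambda>_. c)"
  by (rule rationalI[OF poly_fun.const[of c] poly_fun.const[of 1] subset_refl U0]) simp

lemma rational_add: "rational f \<Longrightarrow> rational g \<Longrightarrow> rational (\<lambda>q. f q + g q)"
proof -
  assume "rational f" "rational g"
  obtain a b V where V: "a \<in> poly_fun n" "b \<in> poly_fun n" "V \<subseteq> U0" "op V" "p \<in> V"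
    "\<forall>q\<in>V. b (\<phi> q) \<noteq> 0" "\<forall>q\<in>V. f q = a (\<phi> q) / b (\<phi> q)" using \<open>rational f\<close> by (rule rationalE)
  obtain c d W where W: "c \<in> poly_fun n" "d \<in> poly_fun n" "W \<subseteq> U0" "op W" "p \<in> W"
    "\<forall>q\<in>W. d (\<phi> q) \<noteq> 0" "\<forall>q\<in>W. g q = c (\<phi> q) / d (\<phi> q)" using \<open>rational g\<close> by (rule rationalE)
  show ?thesis
  proof (rule rationalI[OF poly_fun.add[OF poly_fun.mult[OF V(1) W(2)] poly_fun.mult[OF W(1) V(2)]] poly_fun.mult[OF V(2) W(2)], of "V \<inter> W"])
    fix q assume "q \<in> V \<inter> W"
    then have "b (\<phi> q) \<noteq> 0" "f q = a (\<phi> q) / b (\<phi> q)" "d (\<phi> q) \<noteq> 0" "g q = c (\<phi> q) / d (\<phi> q)" using V W by blast+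
    then show "b (\<phi> q) * d (\<phi> q) \<noteq> 0 \<and> f q + g q = (a (\<phi> q) * d (\<phi> q) + c (\<phi> q) * b (\<phi> q)) / (b (\<phi> q) * d (\<phi> q))"
      by (simp add: add_frac_eq)
  qed (use V W in auto)
qed

lemma rational_mult: "rational f \<Longrightarrow> rational g \<Longrightarrow> rational (\<lambda>q. f q * g q)"
proof -
  assume "rational f" "rational g"
  obtain a b V where V: "a \<in> poly_fun n" "b \<in> poly_fun n" "V \<subseteq> U0" "op V" "p \<in> V"
    "\<forall>q\<in>V. b (\<phi> q) \<noteq> 0" "\<forall>q\<in>V. f q = a (\<phi> q) / b (\<phi> q)" using \<open>rational f\<close> by (rule rationalE)
  obtain c d W where W: "c \<in> poly_fun n" "d \<in> poly_fun n" "W \<subseteq> U0" "op W" "p \<in> W"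
    "\<forall>q\<in>W. d (\<phi> q) \<noteq> 0" "\<forall>q\<in>W. g q = c (\<phi> q) / d (\<phi> q)" using \<open>rational g\<close> by (rule rationalE)
  show ?thesis
  proof (rule rationalI[OF poly_fun.mult[OF V(1) W(1)] poly_fun.mult[OF V(2) W(2)], of "V \<inter> W"])
    fix q assume "q \<in> V \<inter> W"
    then have "b (\<phi> q) \<noteq> 0" "f q = a (\<phi> q) / b (\<phi> q)" "d (\<phi> q) \<noteq> 0" "g q = c (\<phi> q) / d (\<phi> q)" using V W by blast+
    then show "b (\<phi> q) * d (\<phi> q) \<noteq> 0 \<and> f q * g q = (a (\<phi> q) * c (\<phi> q)) / (b (\<phi> q) * d (\<phi> q))" by simp
  qed (use V W in auto)
qed

lemma rational_inverse:
  assumes f: "rational f" and p: "f p \<noteq> 0"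
  shows "rational (\<lambda>q. inverse (f q))" "near (\<lambda>q. inverse (f q) * f q) (\<lambda>_. 1)"
proof -
  obtain a b V where V: "a \<in> poly_fun n" "b \<in> poly_fun n" "V \<subseteq> U0" "op V" "p \<in> V"
    "\<forall>q\<in>V. b (\<phi> q) \<noteq> 0" "\<forall>q\<in>V. f q = a (\<phi> q) / b (\<phi> q)" using f by (rule rationalE)
  let ?D = "{q \<in> U0. \<exists>s\<in>{a}. s (\<phi> q) \<noteq> 0}"
  have "{a} \<subseteq> poly_fun n" using V(1) by simp
  then have D: "op ?D" using topo[of ?D] by blast
  have pD: "p \<in> ?D" using p V(5) bspec[OF V(7) V(5)] U0 by auto
  let ?W = "V \<inter> ?D"
  have W: "op ?W" "p \<in> ?W" "?W \<subseteq> U0" using V D pD by auto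
  show "rational (\<lambda>q. inverse (f q))"
    by (rule rationalI[OF V(2,1) W(3,1,2)]) (use V in auto)
  show "near (\<lambda>q. inverse (f q) * f q) (\<lambda>_. 1)"
    by (rule nearI[OF W(1,2)]) (use V in auto)
qed

lemma carrier_gm: "carrier A = {gm f | f. rational f}"
proof (intro subset_antisym subsetI)
  fix z assume "z \<in> carrier A"
  then obtain U f where "z = germ M p U f" "op U" "p \<in> U" "f \<in> regular M U" unfolding stalk_def by auto
  then show "z \<in> {gm f | f. rational f}" using germ_gm regular_rational by blast
next
  fix z assume "z \<in> {gm f | f. rational f}"
  then obtain f where f: "z = gm f" "rational f" by blast
  then obtain V where V: "op V" "p \<in> V" "restrict f V \<in> regular M V" using rational_regular by blast
  have "z = germ M p V (restrict f V)" unfolding germ_gm[OF V(1,2)] f(1) by (rule gm_cong[OF near_restrict[OF V(1,2)]])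
  then show "z \<in> carrier A" unfolding stalk_def using V by auto
qed

lemma gm_carrier: "rational f \<Longrightarrow> gm f \<in> carrier A" unfolding carrier_gm by blast

lemma carrierE: assumes "z \<in> carrier A" obtains f where "rational f" "z = gm f"
  using assms unfolding carrier_gm by blast

lemma const_gm: "\<iota> c = gm (\<lambda>_. c)"
  unfolding stalk_const_def germ_gm[OF points_open] by (rule gm_cong[OF near_sym[OF near_restrict[OF points_open]]])

lemma stalk_ops:
  "rational f \<Longrightarrow> rational g \<Longrightarrow> gm f \<otimes>\<^bsub>A\<^esub> gm g = gm (\<lambda>q. f q * g q)"
  "rational f \<Longrightarrow> rational g \<Longrightarrow> gm f \<oplus>\<^bsub>A\<^esub> gm g = gm (\<lambda>q. f q + g q)"
  "\<one>\<^bsub>A\<^esub> = gm (\<lambda>_. 1)" "\<zero>\<^bsub>A\<^esub> = gm (\<lambda>_. 0)"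
  by (simp_all add: stalk_def germ_op_gm const_gm)

lemmas rational_intros = rational_const rational_add rational_mult

lemma stalk_cring: "cring A"
proof (rule cringI)
  show "abelian_group A"
  proof (rule abelian_groupI)
    fix x y assume "x \<in> carrier A" "y \<in> carrier A"
    then obtain f g where f: "rational f" "x = gm f" and g: "rational g" "y = gm g" by (elim carrierE)
    show "x \<oplus>\<^bsub>A\<^esub> y \<in> carrier A" using f g by (simp add: stalk_ops rational_intros gm_carrier)
    show "x \<oplus>\<^bsub>A\<^esub> y = y \<oplus>\<^bsub>A\<^esub> x" using f g by (simp add: stalk_ops add.commute)
    fix z assume "z \<in> carrier A"
    then obtain h where h: "rational h" "z = gm h" by (elim carrierE)
    show "x \<oplus>\<^bsub>A\<^esub> y \<oplus>\<^bsub>A\<^esub> z = x \<oplus>\<^bsub>A\<^esub> (y \<oplus>\<^bsub>A\<^esub> z)" using f g h by (simp add: stalk_ops rational_intros add.assoc)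
  next
    show "\<zero>\<^bsub>A\<^esub> \<in> carrier A" by (simp add: stalk_ops gm_carrier rational_const)
    fix x assume "x \<in> carrier A"
    then obtain f where f: "rational f" "x = gm f" by (elim carrierE)
    show "\<zero>\<^bsub>A\<^esub> \<oplus>\<^bsub>A\<^esub> x = x" using f by (simp add: stalk_ops rational_const)
    have "rational (\<lambda>q. (- 1) * f q)" using f by (intro rational_intros)
    moreover have "gm (\<lambda>q. (- 1) * f q) \<oplus>\<^bsub>A\<^esub> x = \<zero>\<^bsub>A\<^esub>"
      unfolding f(2) stalk_ops(2)[OF rational_mult[OF rational_const f(1)] f(1)] by (simp add: stalk_ops)
    ultimately show "\<exists>y\<in>carrier A. y \<oplus>\<^bsub>A\<^esub> x = \<zero>\<^bsub>A\<^esub>" using gm_carrier by blast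
  qed
  show "Group.comm_monoid A"
  proof (rule comm_monoidI)
    fix x y assume "x \<in> carrier A" "y \<in> carrier A"
    then obtain f g where f: "rational f" "x = gm f" and g: "rational g" "y = gm g" by (elim carrierE)
    show "x \<otimes>\<^bsub>A\<^esub> y \<in> carrier A" using f g by (simp add: stalk_ops rational_intros gm_carrier)
    show "x \<otimes>\<^bsub>A\<^esub> y = y \<otimes>\<^bsub>A\<^esub> x" using f g by (simp add: stalk_ops mult.commute)
    fix z assume "z \<in> carrier A"
    then obtain h where h: "rational h" "z = gm h" by (elim carrierE)
    show "x \<otimes>\<^bsub>A\<^esub> y \<otimes>\<^bsub>A\<^esub> z = x \<otimes>\<^bsub>A\<^esub> (y \<otimes>\<^bsub>A\<^esub> z)" using f g h by (simp add: stalk_ops rational_intros mult.assoc)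
  next
    show "\<one>\<^bsub>A\<^esub> \<in> carrier A" by (simp add: stalk_ops gm_carrier rational_const)
    fix x assume "x \<in> carrier A"
    then obtain f where f: "rational f" "x = gm f" by (elim carrierE)
    show "\<one>\<^bsub>A\<^esub> \<otimes>\<^bsub>A\<^esub> x = x" using f by (simp add: stalk_ops rational_const)
  qed
  fix x y z assume "x \<in> carrier A" "y \<in> carrier A" "z \<in> carrier A"
  then obtain f g h where f: "rational f" "x = gm f" and g: "rational g" "y = gm g" and h: "rational h" "z = gm h" by (elim carrierE)
  show "(x \<oplus>\<^bsub>A\<^esub> y) \<otimes>\<^bsub>A\<^esub> z = x \<otimes>\<^bsub>A\<^esub> z \<oplus>\<^bsub>A\<^esub> y \<otimes>\<^bsub>A\<^esub> z"
    using f g h by (simp add: stalk_ops rational_intros distrib_right)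
qed

sublocale A: cring A by (rule stalk_cring)

lemma const_hom: "\<iota> \<in> ring_hom base_field A"
  by (rule ring_hom_memI) (simp_all add: base_field_simps const_gm stalk_ops gm_carrier rational_const)

lemma const_closed: "\<iota> c \<in> carrier A" by (simp add: const_gm gm_carrier rational_const)

text \<open>The choice does not matter: functions that agree near \<open>p\<close> agree at \<open>p\<close>.\<close>

definition ev :: "('a, 'k) germ \<Rightarrow> 'k" where "ev z = (SOME f. rational f \<and> z = gm f) p"

lemma ev_gm: "rational f \<Longrightarrow> ev (gm f) = f p"
proof -
  assume f: "rational f"
  let ?g = "SOME g. rational g \<and> gm f = gm g"
  have "rational ?g \<and> gm f = gm ?g" by (rule someI[of _ f]) (simp add: f)
  then have "near f ?g" using gm_eq_iff[OF f] by blast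
  then show ?thesis unfolding ev_def using near_at by metis
qed

lemma ev_hom: "ev \<in> ring_hom A base_field"
proof (rule ring_hom_memI)
  fix x y assume "x \<in> carrier A" "y \<in> carrier A"
  then obtain f g where f: "rational f" "x = gm f" and g: "rational g" "y = gm g" by (elim carrierE)
  show "ev (x \<otimes>\<^bsub>A\<^esub> y) = ev x \<otimes>\<^bsub>base_field\<^esub> ev y" "ev (x \<oplus>\<^bsub>A\<^esub> y) = ev x \<oplus>\<^bsub>base_field\<^esub> ev y"
    using f g by (simp_all add: stalk_ops ev_gm rational_intros base_field_simps)
qed (simp_all add: base_field_simps stalk_ops ev_gm rational_const)

lemma ev_const: "ev (\<iota> c) = c" by (simp add: const_gm ev_gm rational_const)

lemma Units_iff: "z \<in> carrier A \<Longrightarrow> z \<in> Units A \<longleftrightarrow> ev z \<noteq> 0"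
proof
  assume z: "z \<in> carrier A" and u: "z \<in> Units A"
  have "ev z \<in> Units base_field" by (rule ring_hom_Units[OF ev_hom stalk_cring base_field_cring u])
  then show "ev z \<noteq> 0" by (auto simp: Units_def base_field_simps)
next
  assume z: "z \<in> carrier A" and nz: "ev z \<noteq> 0"
  obtain f where f: "rational f" "z = gm f" using z by (rule carrierE)
  have fp: "f p \<noteq> 0" using nz f by (simp add: ev_gm)
  let ?w = "gm (\<lambda>q. inverse (f q))"
  have w: "?w \<in> carrier A" by (rule gm_carrier[OF rational_inverse(1)[OF f(1) fp]])
  have "?w \<otimes>\<^bsub>A\<^esub> z = \<one>\<^bsub>A\<^esub>"
    unfolding f(2) stalk_ops(1)[OF rational_inverse(1)[OF f(1) fp] f(1)] stalk_ops(3) by (rule gm_cong[OF rational_inverse(2)[OF f(1) fp]])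
  then show "z \<in> Units A" unfolding Units_def using z w A.m_comm[OF w z] by auto
qed

lemma stalk_max_eq: "stalk_max M p = {z \<in> carrier A. ev z = 0}"
proof (intro subset_antisym subsetI)
  fix z assume "z \<in> stalk_max M p"
  then obtain U f where z: "z = germ M p U f" "op U" "p \<in> U" "f \<in> regular M U" "f p = 0" unfolding stalk_max_def by blast
  have f: "rational f" by (rule regular_rational[OF z(2-4)])
  show "z \<in> {z \<in> carrier A. ev z = 0}" using z f by (simp add: germ_gm gm_carrier ev_gm)
next
  fix z assume "z \<in> {z \<in> carrier A. ev z = 0}"
  then have zc: "z \<in> carrier A" and e: "ev z = 0" by auto
  obtain f where f: "rational f" "z = gm f" using zc by (rule carrierE)
  obtain V where V: "op V" "p \<in> V" "restrict f V \<in> regular M V" using rational_regular[OF f(1)] by blast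
  have "z = germ M p V (restrict f V)" unfolding germ_gm[OF V(1,2)] f(2) by (rule gm_cong[OF near_restrict[OF V(1,2)]])
  moreover have "restrict f V p = 0" using e f V(2) by (simp add: ev_gm)
  ultimately show "z \<in> stalk_max M p" unfolding stalk_max_def using V by blast
qed

lemma max_nonunits: "carrier A - Units A = stalk_max M p"
  unfolding stalk_max_eq using Units_iff by blast

lemma max_ideal: "ideal (stalk_max M p) A"
proof -
  have "ideal {z \<in> carrier A. ev z \<in> {\<zero>\<^bsub>(base_field :: 'k ring)\<^esub>}} A"
    by (rule ring_hom_ring.ideal_vimage[OF ring_hom_ringI2[OF A.ring_axioms cring.axioms(1)[OF base_field_cring] ev_hom]
        ring.zeroideal[OF cring.axioms(1)[OF base_field_cring]]])
  then show ?thesis unfolding stalk_max_eq by (simp add: base_field_simps)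
qed

lemma stalk_local: "is_local_ring A"
  by (rule local_ringI[OF stalk_cring]) (simp only: max_nonunits max_ideal)

lemma minus_const_max: "z \<in> carrier A \<Longrightarrow> \<exists>c. z \<ominus>\<^bsub>A\<^esub> \<iota> c \<in> stalk_max M p"
proof -
  assume z: "z \<in> carrier A"
  have "ev (z \<ominus>\<^bsub>A\<^esub> \<iota> (ev z)) = ev z \<ominus>\<^bsub>base_field\<^esub> ev (\<iota> (ev z))"
    by (rule ring_hom_minus[OF A.ring_axioms cring.axioms(1)[OF base_field_cring] ev_hom z const_closed])
  also have "\<dots> = 0"
    using ring.ring_simprules(16)[OF cring.axioms(1)[OF base_field_cring], of "ev z"]
    by (simp add: ev_const a_minus_def base_field_simps)
  finally show ?thesis unfolding stalk_max_eq using z const_closed by (intro exI[of _ "ev z"]) simp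
qed

lemma const_max: "\<iota> c \<in> stalk_max M p \<Longrightarrow> c = 0"
  unfolding stalk_max_eq by (simp add: ev_const)

lemma coord_rational: "g \<in> poly_fun n \<Longrightarrow> rational (\<lambda>q. g (\<phi> q))"
  by (rule rationalI[OF _ poly_fun.const[of 1] subset_refl U0]) simp_all

lemma coord_generated:
  "g \<in> poly_fun n \<Longrightarrow> gm (\<lambda>q. g (\<phi> q)) \<in> generate_ring A (range \<iota> \<union> (\<lambda>i. gm (\<lambda>q. \<phi> q i)) ` {..<n})"
proof (induction rule: poly_fun.induct)
  case (const c) show ?case unfolding const_gm[symmetric] by (rule generate_ring.incl) simp
next
  case (coord i) then show ?case by (intro generate_ring.incl) simp
next
  case (add f g)
  then show ?case using generate_ring.eng_add[OF add.IH] by (simp add: stalk_ops coord_rational)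
next
  case (mult f g)
  then show ?case using generate_ring.eng_mult[OF mult.IH] by (simp add: stalk_ops coord_rational)
qed

lemma stalk_ess_finite: "ess_finite_type A \<iota>"
  unfolding ess_finite_type_def
proof (intro exI[of _ "(\<lambda>i. gm (\<lambda>q. \<phi> q i)) ` {..<n}"] conjI ballI)
  show "(\<lambda>i. gm (\<lambda>q. \<phi> q i)) ` {..<n} \<subseteq> carrier A"
    using coord_rational[OF poly_fun.coord] gm_carrier by blast
  show "finite ((\<lambda>i. gm (\<lambda>q. \<phi> q i)) ` {..<n})" by simp
  fix z assume "z \<in> carrier A"
  then obtain f where f: "rational f" "z = gm f" by (rule carrierE)
  obtain a b V where V: "a \<in> poly_fun n" "b \<in> poly_fun n" "V \<subseteq> U0" "op V" "p \<in> V"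
    "\<forall>q\<in>V. b (\<phi> q) \<noteq> 0" "\<forall>q\<in>V. f q = a (\<phi> q) / b (\<phi> q)" using f(1) by (rule rationalE)
  have "gm (\<lambda>q. f q * b (\<phi> q)) = gm (\<lambda>q. a (\<phi> q))" by (rule gm_cong[OF nearI[OF V(4,5)]]) (use V(6,7) in simp)
  then have "z \<otimes>\<^bsub>A\<^esub> gm (\<lambda>q. b (\<phi> q)) = gm (\<lambda>q. a (\<phi> q))" unfolding f(2) stalk_ops(1)[OF f(1) coord_rational[OF V(2)]] .
  moreover have "gm (\<lambda>q. b (\<phi> q)) \<in> Units A"
    using Units_iff[OF gm_carrier[OF coord_rational[OF V(2)]]] ev_gm[OF coord_rational[OF V(2)]] V(5,6) by simp
  ultimately show "\<exists>u\<in>generate_ring A (range \<iota> \<union> (\<lambda>i. gm (\<lambda>q. \<phi> q i)) ` {..<n}).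
      \<exists>v\<in>generate_ring A (range \<iota> \<union> (\<lambda>i. gm (\<lambda>q. \<phi> q i)) ` {..<n}). v \<in> Units A \<and> z \<otimes>\<^bsub>A\<^esub> v = u"
    using coord_generated[OF V(1)] coord_generated[OF V(2)] by blast
qed

end

lemma variety_stalk:
  assumes V: "variety M" and p: "p \<in> points M"
  shows "\<exists>U0 n \<phi>. stalk_at M p U0 n \<phi>"
proof -
  obtain \<U> where "\<forall>U\<in>\<U>. affine_open M U" "\<Union>\<U> = points M" using V unfolding variety_def by blast
  then obtain U0 where U: "affine_open M U0" "p \<in> U0" using p by blast
  then obtain n \<phi> where *: "openin (zariski M) U0"
     "(\<forall>W\<subseteq>U0. openin (zariski M) W \<longleftrightarrow> (\<exists>S'\<subseteq>poly_fun n. W = {q \<in> U0. \<exists>s\<in>S'. s (\<phi> q) \<noteq> 0}))"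
     "(\<forall>W\<subseteq>U0. openin (zariski M) W \<longrightarrow> regular M W = {f \<in> extensional W. \<forall>p\<in>W.
        \<exists>g\<in>poly_fun n. \<exists>h\<in>poly_fun n. \<exists>V\<subseteq>W. openin (zariski M) V \<and> p \<in> V \<and>
          (\<forall>q\<in>V. h (\<phi> q) \<noteq> 0 \<and> f q = g (\<phi> q) / h (\<phi> q))})"
    unfolding affine_open_def by (elim conjE exE)
  have "sheaf_of_functions M" using V unfolding variety_def by blast
  then have r: "restrict f V \<in> regular M V"
    if "openin (zariski M) U" "f \<in> regular M U" "V \<subseteq> U" "openin (zariski M) V" for U V f
    unfolding sheaf_of_functions_def using that by blast
  have "stalk_at M p U0 n \<phi>"
    by (rule stalk_at.intro) (fact r, fact *(1), fact U(2), use *(2) in blast, use *(3) in blast)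
  then show ?thesis by blast
qed

text \<open>Distinct constants \<open>c\<close> give distinct sets of this type.\<close>

lemma infinite_germs: "infinite (UNIV :: ('a, 'k::field_char_0) germ set)"
proof
  assume "finite (UNIV :: ('a, 'k) germ set)"
  moreover have "inj (\<lambda>c :: 'k. {({}, \<lambda>_. c)} :: ('a, 'k) germ)" by (rule injI) (simp add: fun_eq_iff)
  ultimately have "finite (UNIV :: 'k set)" using finite_imageD[of "\<lambda>c :: 'k. {({}, \<lambda>_. c)} :: ('a, 'k) germ" UNIV] finite_subset[OF subset_UNIV] by blast
  then show False using infinite_UNIV_char_0 by blast
qed

section \<open>The two conditions at a point\<close>

lemma k_derivation_minus:
  fixes A (structure)
  assumes A: "cring A" and D: "k_derivation A \<iota> D" and E: "k_derivation A \<iota> E"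
  shows "k_derivation A \<iota> (\<lambda>a. D a \<ominus> E a)"
proof -
  interpret cring A by (rule A)
  have c: "D a \<in> carrier A" "E a \<in> carrier A" if "a \<in> carrier A" for a
    using D E that unfolding k_derivation_def by blast+
  have add: "D (a \<oplus> b) = D a \<oplus> D b" "E (a \<oplus> b) = E a \<oplus> E b"
    "D (a \<otimes> b) = (a \<otimes> D b) \<oplus> (b \<otimes> D a)" "E (a \<otimes> b) = (a \<otimes> E b) \<oplus> (b \<otimes> E a)"
    if "a \<in> carrier A" "b \<in> carrier A" for a b
    using D E that unfolding k_derivation_def by blast+
  have k: "D (\<iota> e) = \<zero>" "E (\<iota> e) = \<zero>" for e using D E unfolding k_derivation_def by blast+
  show ?thesis unfolding k_derivation_def
  proof (intro conjI ballI allI)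
    show "(\<lambda>a. D a \<ominus> E a) \<in> carrier A \<rightarrow> carrier A" using c by auto
    fix a b assume a: "a \<in> carrier A" and b: "b \<in> carrier A"
    note cc = c[OF a] c[OF b] a b
    show "D (a \<oplus> b) \<ominus> E (a \<oplus> b) = (D a \<ominus> E a) \<oplus> (D b \<ominus> E b)"
      unfolding add(1,2)[OF a b] using cc by (simp add: a_minus_def minus_add a_ac)
    show "D (a \<otimes> b) \<ominus> E (a \<otimes> b) = a \<otimes> (D b \<ominus> E b) \<oplus> b \<otimes> (D a \<ominus> E a)"
      unfolding add(3,4)[OF a b] using cc by (simp add: a_minus_def minus_add r_distr r_minus a_ac)
  next
    fix e show "D (\<iota> e) \<ominus> E (\<iota> e) = \<zero>" unfolding k by (simp add: a_minus_def)
  qed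
qed

lemma k_derivation_sum:
  fixes A (structure)
  assumes A: "cring A" and D: "\<And>i. i \<in> I \<Longrightarrow> k_derivation A \<iota> (D i)" and c: "\<And>i. i \<in> I \<Longrightarrow> c i \<in> carrier A"
    and fin: "finite I"
  shows "k_derivation A \<iota> (\<lambda>a. \<Oplus>i\<in>I. c i \<otimes> D i a)"
proof -
  interpret cring A by (rule A)
  have cl: "D i a \<in> carrier A" if "i \<in> I" "a \<in> carrier A" for i a
    using D[OF that(1)] that(2) unfolding k_derivation_def by blast
  have add: "D i (a \<oplus> b) = D i a \<oplus> D i b"
    "D i (a \<otimes> b) = (a \<otimes> D i b) \<oplus> (b \<otimes> D i a)" if "i \<in> I" "a \<in> carrier A" "b \<in> carrier A" for i a b
    using D[OF that(1)] that(2,3) unfolding k_derivation_def by blast+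
  have k: "D i (\<iota> e) = \<zero>" if "i \<in> I" for i e using D[OF that] unfolding k_derivation_def by blast
  show ?thesis unfolding k_derivation_def
  proof (intro conjI ballI allI)
    show "(\<lambda>a. \<Oplus>i\<in>I. c i \<otimes> D i a) \<in> carrier A \<rightarrow> carrier A"
      by (intro Pi_I finsum_closed m_closed c cl)
    fix a b assume a: "a \<in> carrier A" and b: "b \<in> carrier A"
    have "(\<Oplus>i\<in>I. c i \<otimes> D i (a \<oplus> b)) = (\<Oplus>i\<in>I. c i \<otimes> D i a \<oplus> c i \<otimes> D i b)"
      by (rule finsum_cong'[OF refl]) (use a b c cl add in \<open>auto simp: r_distr\<close>)
    also have "\<dots> = (\<Oplus>i\<in>I. c i \<otimes> D i a) \<oplus> (\<Oplus>i\<in>I. c i \<otimes> D i b)"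
      by (rule finsum_addf) (use a b c cl in auto)
    finally show "(\<Oplus>i\<in>I. c i \<otimes> D i (a \<oplus> b)) = \<dots>" .
    have "(\<Oplus>i\<in>I. c i \<otimes> D i (a \<otimes> b)) = (\<Oplus>i\<in>I. a \<otimes> (c i \<otimes> D i b) \<oplus> b \<otimes> (c i \<otimes> D i a))"
      by (rule finsum_cong'[OF refl]) (use a b c cl add in \<open>auto simp: r_distr m_lcomm\<close>)
    also have "\<dots> = (\<Oplus>i\<in>I. a \<otimes> (c i \<otimes> D i b)) \<oplus> (\<Oplus>i\<in>I. b \<otimes> (c i \<otimes> D i a))"
      by (rule finsum_addf) (use a b c cl in auto)
    also have "(\<Oplus>i\<in>I. a \<otimes> (c i \<otimes> D i b)) = a \<otimes> (\<Oplus>i\<in>I. c i \<otimes> D i b)"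
      by (rule finsum_rdistr[symmetric]) (use fin a b c cl in auto)
    also have "(\<Oplus>i\<in>I. b \<otimes> (c i \<otimes> D i a)) = b \<otimes> (\<Oplus>i\<in>I. c i \<otimes> D i a)"
      by (rule finsum_rdistr[symmetric]) (use fin a b c cl in auto)
    finally show "(\<Oplus>i\<in>I. c i \<otimes> D i (a \<otimes> b)) =
        a \<otimes> (\<Oplus>i\<in>I. c i \<otimes> D i b) \<oplus> b \<otimes> (\<Oplus>i\<in>I. c i \<otimes> D i a)" .
  next
    fix e show "(\<Oplus>i\<in>I. c i \<otimes> D i (\<iota> e)) = \<zero>"
      by (rule add.finprod_one_eqI) (use k c in simp)
  qed
qed

text \<open>The conclusion of the \<open>\<times>\<close>-condition for one operator.\<close>

definition decomposable :: "('r, 'm) ring_scheme \<Rightarrow> nat \<Rightarrow> (nat \<Rightarrow> 'r \<Rightarrow> 'r) \<Rightarrow> 'r \<Rightarrow> nat \<Rightarrow> (nat multiset \<Rightarrow> 'r) \<Rightarrow> bool" where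
  "decomposable R n D f d P \<longleftrightarrow> (let T = mpoly_ring R {0..n} in
    \<exists>Q. (\<forall>j\<in>{0..n}. Q j \<in> homogeneous R {0..n} (d - 1)) \<and>
      P = (\<Oplus>\<^bsub>T\<^esub>j\<in>{0..n}. Q j \<otimes>\<^bsub>T\<^esub> ring.indexed_var R j) \<and>
      (\<Oplus>\<^bsub>T\<^esub>j\<in>{1..n}. Q j \<otimes>\<^bsub>T\<^esub> ring.indexed_const R (D j f)) \<in> Idl\<^bsub>T\<^esub> {ring.indexed_const R f})"

locale section_at = stalk_at M p U0 m \<phi>
  for M :: "('a, 'k::field_char_0) fun_space" and p U0 m \<phi> +
  fixes L :: "('i, 'a, 'k) bundle_data" and F
  assumes L: "line_bundle M L" and F: "bundle_section M L F"
begin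

abbreviation "chart_at i \<equiv> i \<in> charts L \<and> p \<in> chart L i"
abbreviation "fi i \<equiv> germ M p (chart L i) (F i)"
abbreviation "IX \<equiv> ideal_X M L F p"
abbreviation "IY \<equiv> ideal_Y M L F p"
abbreviation "B \<equiv> stalk_X M L F p"
abbreviation "\<kappa> \<equiv> stalk_X_const M L F p"
abbreviation "J \<equiv> ideal_YX M L F p"
abbreviation "\<pi> \<equiv> a_r_coset A IX"
abbreviation "jet i D \<equiv> (\<lambda>j::nat. if j = 0 then fi i else D j (fi i))"

lemma fi_gm: "chart_at i \<Longrightarrow> rational (F i) \<and> fi i = gm (F i)"
proof -
  assume i: "chart_at i"
  have o: "op (chart L i)" "p \<in> chart L i" and r: "F i \<in> regular M (chart L i)"
    using L F i unfolding line_bundle_def bundle_section_def by blast+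
  show ?thesis using regular_rational[OF o r] germ_gm[OF o] by blast
qed

lemma fi_closed: "chart_at i \<Longrightarrow> fi i \<in> carrier A"
  using fi_gm gm_carrier by metis

lemma fi_ev: "chart_at i \<Longrightarrow> ev (fi i) = F i p"
  using fi_gm ev_gm by metis

lemma fi_transition:
  assumes i: "chart_at i" and j: "chart_at j" shows "\<exists>t\<in>carrier A. fi i = t \<otimes>\<^bsub>A\<^esub> fi j"
proof -
  let ?W = "chart L i \<inter> chart L j"
  let ?t = "transition L i j"
  have "op (chart L i)" "op (chart L j)" using L i j unfolding line_bundle_def by blast+
  then have o: "op ?W" "p \<in> ?W" using i j by auto
  have "?t \<in> regular M ?W" using L i j unfolding line_bundle_def by blast
  then have t: "rational ?t" by (rule regular_rational[OF o])
  have "F i q = ?t q * F j q" if "q \<in> ?W" for q using F i j that unfolding bundle_section_def by blast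
  then have "near (F i) (\<lambda>q. ?t q * F j q)" by (rule nearI[OF o])
  then have "gm (F i) = gm ?t \<otimes>\<^bsub>A\<^esub> gm (F j)" using fi_gm[OF j] t gm_cong by (simp add: stalk_ops)
  then show ?thesis using fi_gm[OF i] fi_gm[OF j] gm_carrier[OF t] by metis
qed

lemma ideal_X_eq: "chart_at i \<Longrightarrow> IX = Idl\<^bsub>A\<^esub> {fi i}"
proof -
  assume i: "chart_at i"
  let ?G = "{fi i | i. chart_at i}"
  have G: "?G \<subseteq> carrier A" using fi_closed by blast
  have f: "{fi i} \<subseteq> carrier A" using fi_closed[OF i] by simp
  have I: "ideal (Idl\<^bsub>A\<^esub> {fi i}) A" by (rule A.genideal_ideal[OF f])
  have "fi j \<in> Idl\<^bsub>A\<^esub> {fi i}" if "chart_at j" for j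
    using fi_transition[OF that i] ideal.I_l_closed[OF I subsetD[OF A.genideal_self[OF f]]] by force
  then have "Idl\<^bsub>A\<^esub> ?G \<subseteq> Idl\<^bsub>A\<^esub> {fi i}" by (intro A.genideal_minimal[OF I]) blast
  moreover have "Idl\<^bsub>A\<^esub> {fi i} \<subseteq> Idl\<^bsub>A\<^esub> ?G"
    by (rule A.genideal_minimal[OF A.genideal_ideal[OF G]]) (use i A.genideal_self[OF G] in blast)
  ultimately show ?thesis unfolding ideal_X_def by blast
qed

lemma ideal_X_multiples: "chart_at i \<Longrightarrow> IX = {fi i \<otimes>\<^bsub>A\<^esub> c | c. c \<in> carrier A}"
proof -
  assume i: "chart_at i"
  note f = fi_closed[OF i]
  show ?thesis
    unfolding ideal_X_eq[OF i] A.cgenideal_eq_genideal[OF f, symmetric] cgenideal_def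
  proof (intro Collect_cong iffI; elim exE conjE)
    fix a c assume a: "a = c \<otimes>\<^bsub>A\<^esub> fi i" and c: "c \<in> carrier A"
    show "\<exists>c. a = fi i \<otimes>\<^bsub>A\<^esub> c \<and> c \<in> carrier A" unfolding a A.m_comm[OF c f] using c by blast
  next
    fix a c assume a: "a = fi i \<otimes>\<^bsub>A\<^esub> c" and c: "c \<in> carrier A"
    show "\<exists>c. a = c \<otimes>\<^bsub>A\<^esub> fi i \<and> c \<in> carrier A" unfolding a A.m_comm[OF f c] using c by blast
  qed
qed

lemma chart_exists: "\<exists>i. chart_at i"
  using L points_open unfolding line_bundle_def by blast

lemma IX_ideal: "ideal IX A"
proof -
  obtain i where i: "chart_at i" using chart_exists by blast
  show ?thesis unfolding ideal_X_eq[OF i] by (rule A.genideal_ideal) (use fi_closed[OF i] in simp)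
qed

lemma regular_point:
  assumes P: "local_parameters M p n x D"
  shows "regular_point A \<iota> n x D (stalk_max M p)"
proof (intro regular_point.intro regular_point_axioms.intro stalk_cring const_hom)
  note R = P[unfolded local_parameters_def regular_parameters_def]
  show "x \<in> {1..n} \<rightarrow> carrier A" "stalk_max M p = Idl\<^bsub>A\<^esub> (x ` {1..n})" using R by blast+
  show "k_derivation A \<iota> (D j)" if "j \<in> {1..n}" for j using R that by blast
  show "D j (x i) = (if i = j then \<one>\<^bsub>A\<^esub> else \<zero>\<^bsub>A\<^esub>)" if "i \<in> {1..n}" "j \<in> {1..n}" for i j using R that by blast
qed (fact minus_const_max, fact const_max)

lemma stalk_noeth: "A.noeth (carrier A)"
  by (rule embedding_noeth[OF stalk_cring const_hom stalk_ess_finite])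

lemma one_minus_max: "z \<in> stalk_max M p \<Longrightarrow> \<one>\<^bsub>A\<^esub> \<ominus>\<^bsub>A\<^esub> z \<in> Units A"
  by (rule embedding_one_minus[OF stalk_local]) (simp only: max_nonunits)

text \<open>The difference of the two sides is a derivation that kills the parameters, so its values lie in every power
of the maximal ideal.\<close>

lemma derivation_expansion:
  assumes P: "local_parameters M p n x D" and E: "k_derivation A \<iota> E" and a: "a \<in> carrier A"
  shows "E a = (\<Oplus>\<^bsub>A\<^esub>i\<in>{1..n}. E (x i) \<otimes>\<^bsub>A\<^esub> D i a)"
proof -
  interpret R: regular_point A \<iota> n x D "stalk_max M p" by (rule regular_point[OF P])
  let ?S = "\<lambda>a. \<Oplus>\<^bsub>A\<^esub>i\<in>{1..n}. E (x i) \<otimes>\<^bsub>A\<^esub> D i a"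
  have Ec: "b \<in> carrier A \<Longrightarrow> E b \<in> carrier A" for b by (rule R.derivD(1)[OF E])
  have S: "k_derivation A \<iota> ?S" by (rule k_derivation_sum[OF stalk_cring R.D Ec[OF R.xc]]) simp_all
  have ES: "k_derivation A \<iota> (\<lambda>a. E a \<ominus>\<^bsub>A\<^esub> ?S a)" by (rule k_derivation_minus[OF stalk_cring E S])
  have z: "E (x j) \<ominus>\<^bsub>A\<^esub> ?S (x j) = \<zero>\<^bsub>A\<^esub>" if j: "j \<in> {1..n}" for j
  proof -
    have "?S (x j) = (\<Oplus>\<^bsub>A\<^esub>i\<in>{1..n}. if j = i then E (x i) else \<zero>\<^bsub>A\<^esub>)"
      by (rule A.finsum_cong'[OF refl]) (use R.Dx[OF j] Ec[OF R.xc] in auto)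
    also have "\<dots> = E (x j)" by (rule A.finsum_singleton[OF j]) (use Ec[OF R.xc] in auto)
    finally show ?thesis using Ec[OF R.xc[OF j]] by (simp add: a_minus_def A.r_neg)
  qed
  have Sc: "?S a \<in> carrier A" by (rule R.derivD(1)[OF S a])
  have "E a \<ominus>\<^bsub>A\<^esub> ?S a \<in> {\<zero>\<^bsub>A\<^esub>}"
  proof (rule A.Krull_intersection[OF stalk_noeth max_ideal one_minus_max A.zeroideal])
    show c: "E a \<ominus>\<^bsub>A\<^esub> ?S a \<in> carrier A" using Ec[OF a] Sc by simp
    fix N
    have "(N, E a \<ominus>\<^bsub>A\<^esub> ?S a) \<in> forms A (carrier A) (stalk_max M p)"
      using R.deriv_zero_on_parameters[OF ES z a, of N] by blast
    then show "\<exists>u\<in>{\<zero>\<^bsub>A\<^esub>}. \<exists>w. (N, w) \<in> forms A (carrier A) (stalk_max M p) \<and> E a \<ominus>\<^bsub>A\<^esub> ?S a = u \<oplus>\<^bsub>A\<^esub> w"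
      using A.l_zero[OF c] by (intro bexI[of _ "\<zero>\<^bsub>A\<^esub>"] exI[of _ "E a \<ominus>\<^bsub>A\<^esub> ?S a"]) simp_all
  qed
  then show ?thesis using Ec[OF a] Sc A.r_right_minus_eq by simp
qed

lemma jet_closed:
  assumes P: "local_parameters M p n x D" and i: "chart_at i"
  shows "jet i D \<in> {0..n} \<rightarrow> carrier A"
proof
  interpret R: regular_point A \<iota> n x D "stalk_max M p" by (rule regular_point[OF P])
  fix j assume "j \<in> {0..n}"
  then show "jet i D j \<in> carrier A" using fi_closed[OF i] R.derivD(1)[OF R.D fi_closed[OF i], of j] by (cases "j = 0") simp_all
qed

text \<open>Another local equation is \<open>t f\<close>, and \<open>D' (t f) = t D' f + f D' t\<close>; another partial derivative \<open>D'\<close> is a combination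
of the given ones by \<open>derivation_expansion\<close>.\<close>

lemma ideal_Y_eq:
  assumes P: "local_parameters M p n x D" and i: "chart_at i"
  shows "IY = Idl\<^bsub>A\<^esub> (jet i D ` {0..n})"
proof -
  interpret R: regular_point A \<iota> n x D "stalk_max M p" by (rule regular_point[OF P])
  let ?G1 = "{fi i | i. chart_at i}"
  let ?G2 = "{D j (fi i) | i n x D j. i \<in> charts L \<and> p \<in> chart L i \<and> local_parameters M p n x D \<and> j \<in> {1..n}}"
  let ?I = "Idl\<^bsub>A\<^esub> (jet i D ` {0..n})"
  have jc: "jet i D ` {0..n} \<subseteq> carrier A" using jet_closed[OF P i] by blast
  have I: "ideal ?I A" by (rule A.genideal_ideal[OF jc])
  have inI: "jet i D j \<in> ?I" if "j \<in> {0..n}" for j using A.genideal_self[OF jc] that by blast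
  have f: "fi i \<in> ?I" using inI[of 0] by simp
  have Df: "D j (fi i) \<in> ?I" if "j \<in> {1..n}" for j using inI[of j] that by simp
  have 1: "?G1 \<subseteq> ?I"
  proof
    fix z assume "z \<in> ?G1"
    then obtain k where k: "z = fi k" "chart_at k" by blast
    obtain t where t: "t \<in> carrier A" "fi k = t \<otimes>\<^bsub>A\<^esub> fi i" using fi_transition[OF k(2) i] by blast
    show "z \<in> ?I" unfolding k(1) t(2) by (rule ideal.I_l_closed[OF I f t(1)])
  qed
  have 2: "?G2 \<subseteq> ?I"
  proof
    fix z assume "z \<in> ?G2"
    then obtain i' n' x' D' j' where z: "z = D' j' (fi i')" and i': "chart_at i'" and P': "local_parameters M p n' x' D'" and j': "j' \<in> {1..n'}"
      by blast
    interpret R': regular_point A \<iota> n' x' D' "stalk_max M p" by (rule regular_point[OF P'])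
    obtain t where t: "t \<in> carrier A" "fi i' = t \<otimes>\<^bsub>A\<^esub> fi i" using fi_transition[OF i' i] by blast
    note E = R'.D[OF j']
    have "(\<Oplus>\<^bsub>A\<^esub>k\<in>{1..n}. D' j' (x k) \<otimes>\<^bsub>A\<^esub> D k (fi i)) \<in> ?I"
    proof -
      have "finite K \<Longrightarrow> K \<subseteq> {1..n} \<Longrightarrow> (\<Oplus>\<^bsub>A\<^esub>k\<in>K. D' j' (x k) \<otimes>\<^bsub>A\<^esub> D k (fi i)) \<in> ?I" for K
      proof (induction K rule: finite_induct)
        case empty show ?case using ideal_zero[OF I] by simp
      next
        case (insert k K)
        have k: "k \<in> {1..n}" and K: "K \<subseteq> {1..n}" using insert.prems by auto
        have c: "D' j' (x l) \<otimes>\<^bsub>A\<^esub> D l (fi i) \<in> ?I" if "l \<in> {1..n}" for l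
          by (rule ideal.I_l_closed[OF I Df[OF that] R'.derivD(1)[OF E R.xc[OF that]]])
        have "(\<Oplus>\<^bsub>A\<^esub>k\<in>insert k K. D' j' (x k) \<otimes>\<^bsub>A\<^esub> D k (fi i)) =
            D' j' (x k) \<otimes>\<^bsub>A\<^esub> D k (fi i) \<oplus>\<^bsub>A\<^esub> (\<Oplus>\<^bsub>A\<^esub>k\<in>K. D' j' (x k) \<otimes>\<^bsub>A\<^esub> D k (fi i))"
          by (rule A.finsum_insert[OF insert.hyps]) (use c K k ideal.Icarr[OF I] in blast)+
        then show ?case using ideal_add[OF I c[OF k] insert.IH[OF K]] by simp
      qed
      then show ?thesis by simp
    qed
    then have "D' j' (fi i) \<in> ?I" unfolding derivation_expansion[OF P E fi_closed[OF i], symmetric] .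
    then have a: "t \<otimes>\<^bsub>A\<^esub> D' j' (fi i) \<in> ?I" by (rule ideal.I_l_closed[OF I _ t(1)])
    have b: "fi i \<otimes>\<^bsub>A\<^esub> D' j' t \<in> ?I" by (rule ideal.I_r_closed[OF I f R'.derivD(1)[OF E t(1)]])
    show "z \<in> ?I" unfolding z t(2) R'.derivD(3)[OF E t(1) fi_closed[OF i]]
      by (rule ideal_add[OF I a b])
  qed
  have sub: "?G1 \<union> ?G2 \<subseteq> ?I" by (rule Un_least[OF 1 2])
  have G: "?G1 \<union> ?G2 \<subseteq> carrier A" by (rule subset_trans[OF sub]) (rule subsetI, rule ideal.Icarr[OF I])
  have "Idl\<^bsub>A\<^esub> (?G1 \<union> ?G2) \<subseteq> ?I" by (rule A.genideal_minimal[OF I sub])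
  moreover have "?I \<subseteq> Idl\<^bsub>A\<^esub> (?G1 \<union> ?G2)"
  proof (rule A.genideal_minimal[OF A.genideal_ideal[OF G]], rule image_subsetI)
    fix j assume j: "j \<in> {0..n}"
    have "jet i D j \<in> ?G1 \<union> ?G2"
    proof (cases "j = 0")
      case True then show ?thesis using i by auto
    next
      case False
      then have "j \<in> {1..n}" using j by simp
      then have "D j (fi i) \<in> ?G2" using P i by (intro CollectI exI[of _ i] exI[of _ n] exI[of _ x] exI[of _ D] exI[of _ j] conjI) simp_all
      then show ?thesis using False by simp
    qed
    then show "jet i D j \<in> Idl\<^bsub>A\<^esub> (?G1 \<union> ?G2)" by (rule subsetD[OF A.genideal_self[OF G]])
  qed
  ultimately show ?thesis unfolding ideal_Y_def by (rule subset_antisym)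
qed

lemma ideal_Y_no_parameters:
  assumes "\<And>n x D. \<not> local_parameters M p n x D"
  shows "IY = IX"
  unfolding ideal_Y_def ideal_X_def using assms by simp

lemma IY: "ideal IY A" "IX \<subseteq> IY"
proof -
  obtain i where i: "chart_at i" using chart_exists by blast
  have "ideal IY A \<and> IX \<subseteq> IY"
  proof (cases "\<exists>n x D. local_parameters M p n x D")
    case True
    then obtain n x D where P: "local_parameters M p n x D" by blast
    have jc: "jet i D ` {0..n} \<subseteq> carrier A" using jet_closed[OF P i] by blast
    have I: "ideal IY A" unfolding ideal_Y_eq[OF P i] by (rule A.genideal_ideal[OF jc])
    have "jet i D 0 \<in> IY" unfolding ideal_Y_eq[OF P i] by (rule subsetD[OF A.genideal_self[OF jc]]) simp
    then have "{fi i} \<subseteq> IY" by simp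
    then show ?thesis unfolding ideal_X_eq[OF i] using I A.genideal_minimal by blast
  next
    case False
    then have "IY = IX" by (intro ideal_Y_no_parameters) blast
    then show ?thesis using IX_ideal by simp
  qed
  then show "ideal IY A" "IX \<subseteq> IY" by blast+
qed

lemma B_cring: "cring B"
  unfolding stalk_X_def by (rule ideal.quotient_is_cring[OF IX_ideal stalk_cring])

lemma J_ideal: "ideal J B"
proof -
  have "J = \<pi> ` IY" unfolding ideal_YX_def by blast
  then show ?thesis unfolding stalk_X_def using A.ring_ideal_imp_quot_ideal[OF IX_ideal IY(1)] by simp
qed

lemma \<pi>_hom: "\<pi> \<in> ring_hom A B"
  unfolding stalk_X_def by (rule ideal.rcos_ring_hom[OF IX_ideal])

lemma \<pi>_surj: "\<pi> ` carrier A = carrier B"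
  by (auto simp: stalk_X_def FactRing_def A_RCOSETS_def')

lemma \<pi>_eq_iff: "a \<in> carrier A \<Longrightarrow> b \<in> carrier A \<Longrightarrow> \<pi> a = \<pi> b \<longleftrightarrow> a \<ominus>\<^bsub>A\<^esub> b \<in> IX"
  using A.quotient_eq_iff_same_a_r_cos[OF IX_ideal] by blast

lemma \<pi>_zero_iff: "a \<in> carrier A \<Longrightarrow> \<pi> a = \<zero>\<^bsub>B\<^esub> \<longleftrightarrow> a \<in> IX"
  using \<pi>_eq_iff[of a "\<zero>\<^bsub>A\<^esub>"] ring_hom_zero'[OF \<pi>_hom stalk_cring B_cring] by (simp add: a_minus_def)

abbreviation "NM \<equiv> (A, \<iota>, \<pi>)"

lemma NM: "NM \<in> embeddings B \<kappa>"
  unfolding embeddings_def k_algebra_def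
  using stalk_cring const_hom stalk_local stalk_ess_finite \<pi>_hom \<pi>_surj by (simp add: stalk_X_const_def)

lemma ideal_in_NM: "ideal_in J NM = IY"
proof -
  have "a \<in> IY" if a: "a \<in> carrier A" "\<pi> a \<in> J" for a
  proof -
    obtain b where b: "b \<in> IY" "\<pi> a = \<pi> b" using a(2) unfolding ideal_YX_def by blast
    have bc: "b \<in> carrier A" using ideal.Icarr[OF IY(1) b(1)] .
    have d: "a \<ominus>\<^bsub>A\<^esub> b \<in> IY" using \<pi>_eq_iff[OF a(1) bc] b(2) IY(2) by blast
    have "(a \<ominus>\<^bsub>A\<^esub> b) \<oplus>\<^bsub>A\<^esub> b \<in> IY" by (rule ideal_add[OF IY(1) d b(1)])
    then show ?thesis using a(1) bc by (simp add: a_minus_def A.a_assoc A.l_neg)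
  qed
  then show ?thesis unfolding ideal_in_def using ideal.Icarr[OF IY(1)] by (auto simp: ideal_YX_def)
qed

lemma embedded_NM: "embedded A IY B J \<pi>"
  using embedding_embedded[OF B_cring J_ideal NM] unfolding ideal_in_NM .

lemma jets:
  assumes P: "local_parameters M p n x D" and i: "chart_at i"
  shows "jets A IY B J \<pi> n (jet i D)"
proof (intro jets.intro jets_axioms.intro embedded_NM jet_closed[OF P i] ideal_Y_eq[OF P i])
  have "{a \<in> carrier A. \<pi> a = \<zero>\<^bsub>B\<^esub>} = IX" using \<pi>_zero_iff ideal.Icarr[OF IX_ideal] by blast
  then show "{a \<in> carrier A. \<pi> a = \<zero>\<^bsub>B\<^esub>} = {jet i D 0 \<otimes>\<^bsub>A\<^esub> c | c. c \<in> carrier A}"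
    using ideal_X_multiples[OF i] by simp
qed

lemma decomposable_iff:
  assumes P: "local_parameters M p n x D" and i: "chart_at i"
  shows "decomposable A n D (fi i) d = jets.decomposes A n (jet i D) d"
proof
  fix P'
  interpret R: regular_point A \<iota> n x D "stalk_max M p" by (rule regular_point[OF P])
  interpret jets A IY B J \<pi> n "jet i D" by (rule jets[OF P i])
  interpret T: cring TT by (rule TT_cring)
  have eq: "(\<Oplus>\<^bsub>TT\<^esub>j\<in>{1..n}. Q j \<otimes>\<^bsub>TT\<^esub> tc (jet i D j)) = (\<Oplus>\<^bsub>TT\<^esub>j\<in>{1..n}. Q j \<otimes>\<^bsub>TT\<^esub> tc (D j (fi i)))"
    if Q: "\<forall>j\<in>{0..n}. Q j \<in> homogeneous A {0..n} (d - 1)" for Q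
  proof (rule T.finsum_cong'[OF refl])
    show "(\<lambda>j. Q j \<otimes>\<^bsub>TT\<^esub> tc (D j (fi i))) \<in> {1..n} \<rightarrow> carrier TT"
    proof
      fix j assume j: "j \<in> {1..n}"
      have "Q j \<in> carrier TT" by (rule A.homogeneous_carrier[OF bspec[OF Q]]) (use j in simp)
      moreover have "tc (D j (fi i)) \<in> carrier TT" by (rule A.mpoly_closed(1)[OF R.derivD(1)[OF R.D[OF j] fi_closed[OF i]]])
      ultimately show "Q j \<otimes>\<^bsub>TT\<^esub> tc (D j (fi i)) \<in> carrier TT" by (rule T.m_closed)
    qed
  qed simp
  show "decomposable A n D (fi i) d P' = decomposes d P'"
    unfolding decomposable_def Let_def decomposes_def
    by (intro iff_exI conj_cong refl) (simp only: eq simp_thms if_True)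
qed

text \<open>This is \<open>decomposes_iff_graph\<close> for the jet of \<open>f\<close>.\<close>

lemma times_iff_graph:
  assumes P: "local_parameters M p n x D" and i: "chart_at i" and d: "0 < d"
  shows "(\<forall>P\<in>satisfied_operators M p n D (fi i) d. decomposable A n D (fi i) d P) \<longleftrightarrow>
    (\<forall>s. (\<zero>\<^bsub>A\<^esub>, s) \<in> embedded.graph A IY B J \<pi> d \<longrightarrow> s = \<zero>\<^bsub>Sym B J\<^esub>)"
  unfolding jets.decomposes_iff_graph[OF jets[OF P i] d, symmetric] decomposable_iff[OF P i]
  unfolding satisfied_operators_def by blast

text \<open>When \<open>f\<close> is a unit, the ideal generated by it in the polynomial ring is everything, so any way to write \<open>P\<close> as
\<open>\<Sum> Q\<^sub>j T\<^sub>j\<close> will do.\<close>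

lemma times_off_X:
  assumes u: "fi i \<in> Units A" and P: "local_parameters M p n x D" and i: "chart_at i" and d: "0 < d"
    and Pm: "P \<in> satisfied_operators M p n D (fi i) d"
  shows "decomposable A n D (fi i) d P"
proof -
  interpret R: regular_point A \<iota> n x D "stalk_max M p" by (rule regular_point[OF P])
  interpret jets A IY B J \<pi> n "jet i D" by (rule jets[OF P i])
  interpret T: cring TT by (rule TT_cring)
  obtain e where e: "d = Suc e" using d by (cases d) auto
  have "P \<in> homogeneous A {0..n} (Suc e)" using Pm e unfolding satisfied_operators_def by blast
  then obtain Q where Q: "\<forall>j\<in>{0..n}. Q j \<in> homogeneous A {0..n} e"
    "P = (\<Oplus>\<^bsub>TT\<^esub>j\<in>{0..n}. Q j \<otimes>\<^bsub>TT\<^esub> tv j)" using A.homogeneous_Suc_decomp[of P "{0..n}" e] by blast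
  have fc: "tc (fi i) \<in> carrier TT" by (rule A.mpoly_closed(1)[OF fi_closed[OF i]])
  have I: "ideal (Idl\<^bsub>TT\<^esub> {tc (fi i)}) TT" by (rule T.genideal_ideal) (use fc in simp)
  have "tc (fi i) \<in> Units TT" by (rule ring_hom_Units[OF A.indexed_const_hom stalk_cring TT_cring u])
  moreover have "tc (fi i) \<in> Idl\<^bsub>TT\<^esub> {tc (fi i)}" using T.genideal_self[of "{tc (fi i)}"] fc by blast
  ultimately have "\<one>\<^bsub>TT\<^esub> \<in> Idl\<^bsub>TT\<^esub> {tc (fi i)}" using T.ideal_no_units[OF I] by blast
  then have "Idl\<^bsub>TT\<^esub> {tc (fi i)} = carrier TT" by (rule ideal.one_imp_carrier[OF I])
  moreover have "(\<Oplus>\<^bsub>TT\<^esub>j\<in>{1..n}. Q j \<otimes>\<^bsub>TT\<^esub> tc (D j (fi i))) \<in> carrier TT"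
  proof (rule T.finsum_closed, rule)
    fix j assume j: "j \<in> {1..n}"
    have "Q j \<in> carrier TT" by (rule A.homogeneous_carrier[OF bspec[OF Q(1)]]) (use j in simp)
    moreover have "tc (D j (fi i)) \<in> carrier TT" by (rule A.mpoly_closed(1)[OF R.derivD(1)[OF R.D[OF j] fi_closed[OF i]]])
    ultimately show "Q j \<otimes>\<^bsub>TT\<^esub> tc (D j (fi i)) \<in> carrier TT" by (rule T.m_closed)
  qed
  ultimately show ?thesis unfolding decomposable_def Let_def using Q e by (intro exI[of _ Q]) simp
qed

subsection \<open>Points of the hypersurface\<close>

abbreviation "canonical_bij d \<equiv> bij_betw (Sym_to_qSym B \<kappa> J) (Sym_deg B J d)
  (qSym_deg B \<kappa> J d :: (('k, ('a, 'k) germ, ('a, 'k) germ set) embedding \<Rightarrow> _) set)"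

context
  fixes i0 assumes i0: "chart_at i0" and zero: "F i0 p = 0"
begin

lemma B_nonzero: "\<one>\<^bsub>B\<^esub> \<noteq> \<zero>\<^bsub>B\<^esub>"
proof
  assume "\<one>\<^bsub>B\<^esub> = \<zero>\<^bsub>B\<^esub>"
  then have "\<pi> \<one>\<^bsub>A\<^esub> = \<zero>\<^bsub>B\<^esub>" using ring_hom_one[OF \<pi>_hom] by simp
  then have "\<one>\<^bsub>A\<^esub> \<in> IX" using \<pi>_zero_iff by simp
  moreover have "IX \<subseteq> stalk_max M p"
    unfolding ideal_X_eq[OF i0]
    by (rule A.genideal_minimal[OF max_ideal]) (use fi_closed[OF i0] fi_ev[OF i0] zero in \<open>simp add: stalk_max_eq\<close>)
  ultimately have "\<one>\<^bsub>A\<^esub> \<in> carrier A - Units A" unfolding max_nonunits by blast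
  then show False by simp
qed

lemma bij_if_graph:
  assumes d: "0 < d" and W: "\<And>s. s \<in> Sym_deg B J d \<Longrightarrow> (\<zero>\<^bsub>A\<^esub>, s) \<in> embedded.graph A IY B J \<pi> d \<Longrightarrow> s = \<zero>\<^bsub>Sym B J\<^esub>"
  shows "canonical_bij d"
proof (rule limit_bij[OF B_cring J_ideal NM])
  fix N :: "('k, ('a, 'k) germ, ('a, 'k) germ set) embedding" assume "N \<in> embeddings B \<kappa>"
  then show "\<exists>N'\<in>embeddings B \<kappa>. embedding_maps NM N' \<noteq> {} \<and> embedding_maps N N' \<noteq> {}"
    by (rule embeddings_directed[OF B_cring B_nonzero infinite_germs NM])
next
  fix s assume s: "s \<in> Sym_deg B J d" "qclass B J NM s = qclass B J NM \<zero>\<^bsub>Sym B J\<^esub>"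
  then show "s = \<zero>\<^bsub>Sym B J\<^esub>"
    using qclass_zero_iff[OF B_cring J_ideal NM d s(1)] W[OF s(1)] unfolding ideal_in_NM by blast
qed

text \<open>Without parameters \<open>ideal_Y\<close> has no derivatives among its generators, \<open>Y\<close> coincides with \<open>X\<close> locally, and the
symmetric algebra of the zero ideal vanishes in positive degree.\<close>

lemma bij_no_parameters:
  assumes no: "\<And>n x D. \<not> local_parameters M p n x D" and d: "0 < d"
  shows "canonical_bij d"
proof (rule bij_if_graph[OF d])
  fix s assume s: "s \<in> Sym_deg B J d"
  interpret BJ: ring_with_ideal B J by (rule ring_with_ideal.intro[OF B_cring J_ideal])
  have "J = {\<zero>\<^bsub>B\<^esub>}"
  proof -
    have "b = \<zero>\<^bsub>B\<^esub>" if b: "b \<in> J" for b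
    proof -
      obtain a where a: "a \<in> IX" "b = \<pi> a" using b unfolding ideal_YX_def ideal_Y_no_parameters[OF no] by blast
      then show ?thesis using \<pi>_zero_iff[OF ideal.Icarr[OF IX_ideal a(1)]] by blast
    qed
    then show ?thesis using ideal_zero[OF J_ideal] by blast
  qed
  note J0 = this
  obtain e where e: "d = Suc e" using d by (cases d) auto
  have "(Suc e, s) \<in> forms (Sym B J) (Sym_const B J ` carrier B) (Sym_gen B J ` J)"
    using s unfolding BJ.Sym_deg_eq_forms e by blast
  then show "s = \<zero>\<^bsub>Sym B J\<^esub>"
  proof (induction rule: forms_Suc_induct)
    case (add a b) then show ?case by simp
  next
    case (mult a v)
    have "a \<in> Sym_deg B J e" using mult(1) unfolding BJ.Sym_deg_eq_forms by blast
    then have "a \<in> carrier (Sym B J)" by (rule embedded.Sym_deg_carrier[OF embedded_NM])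
    moreover have "v = \<zero>\<^bsub>Sym B J\<^esub>" using mult(2) BJ.Sym_gen_zero J0 by auto
    ultimately show ?case by simp
  qed simp
qed

text \<open>By \<open>graph_regular_transfer\<close> the element \<open>s\<close> dies in every term, hence in the limit. An element of \<open>A'\<close> that has the
same image in \<open>B\<close> as a nonunit of \<open>A\<close> is a nonunit.\<close>

lemma graph_if_bij:
  assumes P: "local_parameters M p n x D" and bij: "canonical_bij d" and d: "0 < d"
    and s: "(\<zero>\<^bsub>A\<^esub>, s) \<in> embedded.graph A IY B J \<pi> d"
  shows "s = \<zero>\<^bsub>Sym B J\<^esub>"
proof -
  interpret E: embedded A IY B J \<pi> by (rule embedded_NM)
  have sd: "s \<in> Sym_deg B J d" by (rule E.graph_snd[OF s])
  have zd: "\<zero>\<^bsub>Sym B J\<^esub> \<in> Sym_deg B J d" unfolding E.B.Sym_deg_eq_forms by (simp add: forms.zero)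
  show ?thesis
  proof (rule limit_inj[OF B_cring J_ideal bij sd zd])
    fix N :: "('k, ('a, 'k) germ, ('a, 'k) germ set) embedding" assume N: "N \<in> embeddings B \<kappa>"
    obtain A' \<iota>' \<pi>' where NA: "N = (A', \<iota>', \<pi>')" by (cases N)
    note N = N[unfolded NA]
    note D = embeddingD[OF N]
    have "(\<zero>\<^bsub>A'\<^esub>, s) \<in> embedded.graph A' (ideal_in J (A', \<iota>', \<pi>')) B J \<pi>' d"
    proof (rule graph_regular_transfer[OF embedded_NM embedding_embedded[OF B_cring J_ideal N] regular_point[OF P] D(2) _
          embedding_noeth[OF D(1,2,4)] local_ring_nonunits(1)[OF D(3)] embedding_one_minus[OF D(3)] _ d s])
      show "\<pi>' (\<iota>' c) = \<pi> (\<iota> c)" for c using D(7) by (simp add: stalk_X_const_def)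
      fix a a' assume a: "a \<in> stalk_max M p" "a' \<in> carrier A'" "\<pi>' a' = \<pi> a"
      have an: "a \<in> carrier A - Units A" using a(1) max_nonunits by blast
      have "a' \<notin> Units A'"
      proof
        assume "a' \<in> Units A'"
        then have "\<pi> a \<in> Units B" using ring_hom_Units[OF D(5,1) B_cring] a(3) by metis
        then have "a \<in> Units A" using embedding_unit[OF B_cring B_nonzero NM] an by blast
        then show False using an by blast
      qed
      then show "a' \<in> carrier A' - Units A'" using a(2) by blast
    qed
    then show "qclass B J N s = qclass B J N \<zero>\<^bsub>Sym B J\<^esub>"
      unfolding NA using qclass_zero_iff[OF B_cring J_ideal N d sd] by blast
  qed
qed

end

end

theorem proposition3p4:
  fixes M :: "('a, 'k::{alg_closed_field, field_char_0}) fun_space"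
    and L :: "('i, 'a, 'k) bundle_data"
    and F :: "'i \<Rightarrow> 'a \<Rightarrow> 'k"
  assumes "variety M" and "irreducible_space (zariski M)" and "nonsingular M"
    and "line_bundle M L" and "bundle_section M L F" and "nonzero_section L F"
    and "reduced_hypersurface M L F"
  shows "times_condition M L F \<longleftrightarrow> (\<exists>d0. \<forall>d\<ge>d0. Sym_iso_qSym M L F d)"
proof -
  have at: "\<exists>U0 m \<phi>. section_at M p U0 m \<phi> L F" if "p \<in> points M" for p
    using variety_stalk[OF assms(1) that] assms(4,5) by (auto intro!: section_at.intro section_at_axioms.intro)
  have X: "p \<in> points M" if "p \<in> hypersurface_points L F" for p
    using that assms(4) unfolding hypersurface_points_def line_bundle_def by blast
  have times: "times_condition M L F \<longleftrightarrow> (\<exists>d0. \<forall>d\<ge>d0. \<forall>p\<in>points M. \<forall>i\<in>charts L. \<forall>n x D.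
     p \<in> chart L i \<longrightarrow> local_parameters M p n x D \<longrightarrow>
     (\<forall>P\<in>satisfied_operators M p n D (germ M p (chart L i) (F i)) d. decomposable (stalk M p) n D (germ M p (chart L i) (F i)) d P))"
    unfolding times_condition_def decomposable_def Let_def ..
  show ?thesis
  proof
    assume "times_condition M L F"
    then obtain d0 where d0: "\<And>d p i n x D P. d \<ge> d0 \<Longrightarrow> p \<in> points M \<Longrightarrow> i \<in> charts L \<Longrightarrow> p \<in> chart L i \<Longrightarrow> local_parameters M p n x D \<Longrightarrow>
       P \<in> satisfied_operators M p n D (germ M p (chart L i) (F i)) d \<Longrightarrow> decomposable (stalk M p) n D (germ M p (chart L i) (F i)) d P"
      unfolding times by blast
    (* degree 0 is avoided, because decompositions exist in positive degree only *)
    have "Sym_iso_qSym M L F d" if d: "d \<ge> Suc d0" for d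
      unfolding Sym_iso_qSym_def Let_def
    proof
      fix p assume p: "p \<in> hypersurface_points L F"
      obtain U0 m \<phi> where "section_at M p U0 m \<phi> L F" using at[OF X[OF p]] by blast
      then interpret section_at M p U0 m \<phi> L F .
      obtain i where i: "chart_at i" "F i p = 0" using p unfolding hypersurface_points_def by blast
      have d': "0 < d" "d \<ge> d0" using d by auto
      show "canonical_bij d"
      proof (cases "\<exists>n x D. local_parameters M p n x D")
        case True
        then obtain n x D where P: "local_parameters M p n x D" by blast
        have "\<forall>P\<in>satisfied_operators M p n D (fi i) d. decomposable A n D (fi i) d P"
          using d0[OF d'(2) X[OF p] _ _ P] i(1) by blast
        then show ?thesis unfolding times_iff_graph[OF P i(1) d'(1)] using bij_if_graph[OF i d'(1)] by blast
      next
        case False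
        then show ?thesis using bij_no_parameters[OF i _ d'(1)] by blast
      qed
    qed
    then show "\<exists>d0. \<forall>d\<ge>d0. Sym_iso_qSym M L F d" by blast
  next
    assume "\<exists>d0. \<forall>d\<ge>d0. Sym_iso_qSym M L F d"
    then obtain d0 where d0: "\<And>d. d \<ge> d0 \<Longrightarrow> Sym_iso_qSym M L F d" by blast
    show "times_condition M L F"
      unfolding times
    proof (intro exI[of _ "Suc d0"] allI ballI impI)
      fix d p i n x D P
      assume d: "d \<ge> Suc d0" and p: "p \<in> points M" and i0: "i \<in> charts L" "p \<in> chart L i" and Par: "local_parameters M p n x D"
        and P: "P \<in> satisfied_operators M p n D (germ M p (chart L i) (F i)) d"
      obtain U0 m \<phi> where "section_at M p U0 m \<phi> L F" using at[OF p] by blast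
      then interpret section_at M p U0 m \<phi> L F .
      have i: "chart_at i" using i0 by blast
      have d': "0 < d" "d \<ge> d0" using d by auto
      show "decomposable A n D (fi i) d P"
      proof (cases "F i p = 0")
        case True
        then have "p \<in> hypersurface_points L F" using i unfolding hypersurface_points_def by blast
        then have "canonical_bij d" using d0[OF d'(2)] unfolding Sym_iso_qSym_def Let_def by blast
        then have "\<forall>s. (\<zero>\<^bsub>A\<^esub>, s) \<in> embedded.graph A IY B J \<pi> d \<longrightarrow> s = \<zero>\<^bsub>Sym B J\<^esub>"
          using graph_if_bij[OF i True Par _ d'(1)] by blast
        then show ?thesis using P unfolding times_iff_graph[OF Par i d'(1), symmetric] by blast
      next
        case False
        then have "fi i \<in> Units A" using Units_iff[OF fi_closed[OF i]] fi_ev[OF i] by simp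
        then show ?thesis by (rule times_off_X[OF _ Par i d'(1) P])
      qed
    qed
  qed
qed

end
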